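(* Let $u_0\in H^2(\mathbb{S}^1)$ with $u_0>0$, and let $$\left\|\arctan\left(\frac{\partial_x u_0}{u_0}\right)\right\|_{L^\infty(\mathbb{S}^1)}$$ be suitably small. Then solutions $u$ to the problem $$\partial_t u-\partial_x\arctan\left(\frac{\partial_x u}{u}\right)=0\ \text{ on }\mathbb{S}^1\times[0,T],\qquad u(x,0)=u_0(x),$$ verify $$\int_{\mathbb{S}^1}\frac{\left(u(t)\partial_x^2u(t)-(\partial_x u(t))^2\right)^2}{u(t)\left(u^2(t)+(\partial_x u(t))^2\right)}\,dx\le\left(\int_{\mathbb{S}^1}\frac{\left(u_0\partial_x^2u(0)-(\partial_x u(0))^2\right)^2}{u_0\left(u_0^2+(\partial_x u(0))^2\right)}\,dx\right)\exp\left(c\int_0^t\left(\int_{\mathbb{S}^1}\frac{\left(u(s)\partial_x^2u(s)-(\partial_x u(s))^2\right)^2}{\left(u^2(s)+(\partial_x u(s))^2\right)^2}\,dx+1\right)ds\right),$$ where $c$ is a constant. In particular, $$u\in L^\infty(0,T;H^2(\mathbb{S}^1)).$$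
   Context: $\mathbb{S}^1$ is the one-dimensional torus of length $2\pi$, identified with $[-\pi,\pi]$ with periodic boundary conditions. The result is presented as an existence result (through a Lyapunov functional) under lower regularity of the data than $H^3$, the approach being to prove suitable uniform bounds for the solutions $u_\kappa$ of the approximating problems $$\partial_t u_\kappa-\partial_x\arctan\left(\frac{\partial_x u_\kappa}{u_\kappa}\right)=0\ \text{ in }\mathbb{S}^1\times(0,T_\kappa),\qquad u_\kappa(x,0)=\mathscr{J}_\kappa*u_0(x)\ \text{ in }\mathbb{S}^1,$$ where $\mathscr{J}_\kappa$ is the periodic heat kernel at time $\kappa>0$; these solutions exist by the local well-posedness of the equation for positive $H^3(\mathbb{S}^1)$ data. *)

theory Defs
  imports
    "HOL-Analysis.Analysis"
    "HOL-Library.Periodic_Fun"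
    "HOL-Probability.Essential_Supremum"
begin

text \<open>
  The torus of length \<open>2\<pi>\<close> is the interval \<open>[-\<pi>, \<pi>]\<close> with Lebesgue measure; pointwise statements
  about functions on it refer to \<open>2\<pi>\<close>-periodic functions on the real line.
\<close>

abbreviation torus :: "real measure" where
  "torus \<equiv> lebesgue_on {-pi..pi}"

definition periodic :: "(real \<Rightarrow> real) \<Rightarrow> bool" where
  "periodic f \<longleftrightarrow> periodic_fun_simple f (2 * pi)"

definition test_fun :: "(real \<Rightarrow> real) \<Rightarrow> bool" where
  "test_fun \<phi> \<longleftrightarrow> periodic \<phi> \<and> (\<forall>n x. (deriv ^^ n) \<phi> field_differentiable (at x))"

definition L2_torus :: "(real \<Rightarrow> real) \<Rightarrow> bool" where
  "L2_torus f \<longleftrightarrow> f \<in> borel_measurable torus \<and> integrable torus (\<lambda>x. (f x)\<^sup>2)"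

definition has_weak_deriv :: "nat \<Rightarrow> (real \<Rightarrow> real) \<Rightarrow> (real \<Rightarrow> real) \<Rightarrow> bool" where
  "has_weak_deriv j f g \<longleftrightarrow>
     (\<forall>\<phi>. test_fun \<phi> \<longrightarrow>
        (LINT x|torus. f x * (deriv ^^ j) \<phi> x) = (-1) ^ j * (LINT x|torus. g x * \<phi> x))"

text \<open>
  The choice below is unique up to null sets, and the derivative is only used inside integrals
  and essential suprema over the torus.
\<close>

definition wderiv :: "nat \<Rightarrow> (real \<Rightarrow> real) \<Rightarrow> real \<Rightarrow> real" where
  "wderiv j f = (SOME g. L2_torus g \<and> has_weak_deriv j f g)"

definition H_torus :: "nat \<Rightarrow> (real \<Rightarrow> real) \<Rightarrow> bool" where
  "H_torus k f \<longleftrightarrow> L2_torus f \<and> (\<forall>j\<le>k. \<exists>g. L2_torus g \<and> has_weak_deriv j f g)"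

definition H_norm :: "nat \<Rightarrow> (real \<Rightarrow> real) \<Rightarrow> real" where
  "H_norm k f = sqrt (\<Sum>j\<le>k. LINT x|torus. (wderiv j f x)\<^sup>2)"

text \<open>
  Strong measurability in time: the spaces \<open>H\<^sup>k\<close> are separable Hilbert spaces and the pairings
  with test functions are dense in their duals, so by Pettis' theorem weak measurability against
  test functions is the same as Bochner measurability.
\<close>

definition time_measurable :: "real \<Rightarrow> (real \<Rightarrow> real \<Rightarrow> real) \<Rightarrow> bool" where
  "time_measurable T u \<longleftrightarrow>
     (\<forall>\<phi>. test_fun \<phi> \<longrightarrow>
        (\<lambda>t. LINT x|torus. u t x * \<phi> x) \<in> borel_measurable (lebesgue_on {0..T}))"

definition L2_time_H :: "real \<Rightarrow> nat \<Rightarrow> (real \<Rightarrow> real \<Rightarrow> real) \<Rightarrow> bool" where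
  "L2_time_H T k u \<longleftrightarrow> time_measurable T u \<and> (AE t in lebesgue_on {0..T}. H_torus k (u t)) \<and>
     integrable (lebesgue_on {0..T}) (\<lambda>t. (H_norm k (u t))\<^sup>2)"

definition Linf_time_H :: "real \<Rightarrow> nat \<Rightarrow> (real \<Rightarrow> real \<Rightarrow> real) \<Rightarrow> bool" where
  "Linf_time_H T k u \<longleftrightarrow> time_measurable T u \<and>
     (\<exists>M. AE t in lebesgue_on {0..T}. H_torus k (u t) \<and> H_norm k (u t) \<le> M)"

text \<open>
  Solutions \<open>u t x\<close> of \<open>u\<^sub>t = (arctan (u\<^sub>x / u))\<^sub>x\<close> on the torus times \<open>[0, T]\<close> with initial
  value \<open>u0\<close>, in the sense of distributions: continuous, positive, of class \<open>L\<^sup>2(0,T; H\<^sup>1)\<close>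
  (so that \<open>u\<^sub>x\<close> makes sense as a function). Second derivatives of the solution are not
  assumed to exist. Positivity is part of the meaning of the equation, because of the quotient.
\<close>

definition solution ::
  "real \<Rightarrow> (real \<Rightarrow> real) \<Rightarrow> (real \<Rightarrow> real \<Rightarrow> real) \<Rightarrow> bool" where
  "solution T u0 u \<longleftrightarrow>
     continuous_on ({0..T} \<times> UNIV) (\<lambda>(t, x). u t x) \<and>
     (\<forall>t\<in>{0..T}. periodic (u t) \<and> (\<forall>x. u t x > 0)) \<and>
     L2_time_H T 1 u \<and>
     (\<forall>x. u 0 x = u0 x) \<and>
     (\<forall>t\<in>{0..T}. \<forall>\<phi>. test_fun \<phi> \<longrightarrow>
        (LINT x|torus. u t x * \<phi> x) - (LINT x|torus. u0 x * \<phi> x) =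
          - (LINT s|lebesgue_on {0..t}.
               LINT x|torus. arctan (wderiv 1 (u s) x / u s x) * deriv \<phi> x))"

definition lyapunov :: "(real \<Rightarrow> real) \<Rightarrow> real" where
  "lyapunov f = (LINT x|torus.
     (f x * wderiv 2 f x - (wderiv 1 f x)\<^sup>2)\<^sup>2 / (f x * ((f x)\<^sup>2 + (wderiv 1 f x)\<^sup>2)))"

definition growth_rate :: "(real \<Rightarrow> real) \<Rightarrow> real" where
  "growth_rate f = (LINT x|torus.
     (f x * wderiv 2 f x - (wderiv 1 f x)\<^sup>2)\<^sup>2 / ((f x)\<^sup>2 + (wderiv 1 f x)\<^sup>2)\<^sup>2)"

end

theory Submission
  imports Defs "HOL-Complex_Analysis.Great_Picard"
begin

text \<open>
  Put \<open>v = ln u\<close>, \<open>p = v\<^sub>x\<close>, \<open>w = arctan p\<close> and \<open>q = w\<^sub>x / u\<close>. The equation becomes \<open>v\<^sub>t = q\<close>,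
  hence \<open>p\<^sub>t = q\<^sub>x\<close>, and the functional on both sides of the claim is \<open>E = \<integral> u (1 + p^2) w\<^sub>x^2\<close>, while the
  growth rate in the exponent is \<open>\<integral> w\<^sub>x^2\<close>. Differentiating \<open>E\<close> along a solution and integrating by
  parts gives \<open>- 2 \<integral> u^2 q\<^sub>x^2\<close> plus terms that are cubic in \<open>q, q\<^sub>x\<close> or carry a factor \<open>p\<close>. The
  interpolation inequality \<open>\<integral> w\<^sub>x^4 \<le> 9 sup w^2 \<integral> w\<^sub>x\<^sub>x^2\<close> and a Poincare inequality for \<open>q\<close> (whose product
  with \<open>u\<close> has mean zero) bound all of them by a small multiple of \<open>\<integral> u^2 q\<^sub>x^2\<close> as long as \<open>|p|\<close> stays
  below a small constant, and the maximum principle for \<open>p\<close> preserves that bound. So for data of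
  small slope \<open>E\<close> does not increase at all; as the integral in the exponent is nonnegative, the
  claimed inequality follows, with \<open>c = 1\<close>.

  A solution in the sense of distributions is only of class \<open>L\<^sup>2(0,T; H\<^sup>1)\<close>, where this computation
  makes no sense. It is therefore carried out for a discretisation, whose limit is shown to be the
  only solution.

  The discretisation is the explicit Euler scheme for \<open>v\<close> on dyadic grids, with a time step below a
  multiple of the square of the mesh. It obeys the maximum principles for \<open>v\<close> and for the
  slopes exactly (\<open>admissible_euler\<close>), and the discrete energy decreases
  (\<open>energy_decreases\<close>). The slope bound and the energy bound the increments in space and in time,
  so that by the theorem of Arzela and Ascoli a subsequence converges uniformly (\<open>compactness\<close>).
  For fixed time the energy makes the slopes Hoelder continuous, so they converge uniformly too, and
  the limit satisfies the weak equation (\<open>weak_equation\<close>). The angle \<open>w\<close> of the limit has a derivative in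
  \<open>L\<^sup>2\<close>, and the energy is lower semicontinuous, because dyadic difference quotients form a
  martingale (\<open>dyadic_limit\<close>). Sampling the initial datum does not increase its energy in the limit
  (\<open>energy_limsup\<close>), so that the energy of the limit is at most that of the datum at all times.

  Uniqueness (\<open>solution_unique\<close>) compares an arbitrary solution \<open>u\<close> with the constructed one \<open>U\<close>. For the
  difference \<open>z = u - U\<close> an energy inequality is available for its Fourier sums, as each Fourier
  coefficient of \<open>z\<close> is absolutely continuous in time, and passes to the limit
  (\<open>energy_inequality\<close>). The flux term is controlled by the monotonicity of the arctangent and the
  bound for \<open>U\<^sub>x / U\<close> (\<open>arctan_monotone_estimate\<close>), and Gronwall's inequality gives \<open>z = 0\<close>. Therefore all
  properties of the limit of the scheme hold for every solution.
\<close>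

section \<open>Primitives of integrable functions\<close>

text \<open>
  Absolute continuity in integrated form: the derivative \<open>g\<close> is an integrable
  function that matters only up to null sets.
\<close>

definition primitive_on :: "real => real => (real => real) => (real => real) => bool" where
  "primitive_on a b f g \<longleftrightarrow> integrable (lebesgue_on {a..b}) g \<and>
     (\<forall>x y. a \<le> x \<and> x \<le> y \<and> y \<le> b \<longrightarrow> f y - f x = (LINT s|lebesgue_on {x..y}. g s))"

lemma primitive_onD:
  "primitive_on a b f g ==> a \<le> x ==> x \<le> y ==> y \<le> b ==> f y - f x = (LINT s|lebesgue_on {x..y}. g s)"
  by (auto simp: primitive_on_def)

lemma primitive_on_integrable:
  "primitive_on a b f g ==> integrable (lebesgue_on {a..b}) g"
  by (auto simp: primitive_on_def)

lemma primitive_on_indefinite: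
  assumes "integrable (lebesgue_on {a..b}) g"
  shows "primitive_on a b (\<lambda>x. c + (LINT s|lebesgue_on {a..x}. g s)) g"
  unfolding primitive_on_def
proof (intro conjI allI impI)
  fix x y assume "a \<le> x \<and> x \<le> y \<and> y \<le> b"
  then show "c + integral\<^sup>L (lebesgue_on {a..y}) g - (c + integral\<^sup>L (lebesgue_on {a..x}) g) =
           integral\<^sup>L (lebesgue_on {x..y}) g"
    using integral_combine[OF integrable_subinterval[OF assms, of a y], of x] by auto
qed (fact assms)

lemma primitive_on_continuous:
  assumes "primitive_on a b f g"
  shows "continuous_on {a..b} f"
proof -
  have "continuous_on {a..b} (\<lambda>x. f a + (LINT s|lebesgue_on {a..x}. g s))"
    by (intro continuous_intros indefinite_integral_continuous_real primitive_on_integrable[OF assms])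
  moreover have "f a + (LINT s|lebesgue_on {a..x}. g s) = f x" if "x \<in> {a..b}" for x
    using primitive_onD[OF assms, of a x] that by auto
  ultimately show ?thesis by (metis (no_types, lifting) continuous_on_cong)
qed

lemma integrable_on_interval_continuous:
  fixes f :: "real => real"
  assumes "continuous_on {a..b} f"
  shows "integrable (lebesgue_on {a..b}) f"
  using absolutely_integrable_continuous_real[OF assms]
  by (simp add: integrable_restrict_space set_integrable_def)

lemma integrable_bounded_mult:
  fixes f g :: "real => real"
  assumes g: "integrable (lebesgue_on S) g" and f: "f \<in> borel_measurable (lebesgue_on S)"
    and S: "S \<in> sets lebesgue" and bd: "\<And>x. x \<in> S ==> \<bar>f x\<bar> \<le> B"
  shows "integrable (lebesgue_on S) (\<lambda>x. f x * g x)"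
proof (rule Bochner_Integration.integrable_bound[where f="\<lambda>x. B * g x"])
  show "AE x in lebesgue_on S. norm (f x * g x) \<le> norm (B * g x)"
  proof (rule AE_I2)
    fix x assume "x \<in> space (lebesgue_on S)"
    then have "\<bar>f x\<bar> \<le> B" using bd by simp
    then show "norm (f x * g x) \<le> norm (B * g x)" by (auto simp: abs_mult intro!: mult_right_mono)
  qed
qed (use f g in auto)

lemma integrable_continuous_mult:
  fixes f g :: "real => real"
  assumes g: "integrable (lebesgue_on {a..b}) g" and f: "continuous_on {a..b} f"
  shows "integrable (lebesgue_on {a..b}) (\<lambda>x. f x * g x)"
proof -
  obtain B where B: "\<And>x. x \<in> {a..b} ==> \<bar>f x\<bar> \<le> B"
    using compact_imp_bounded[OF compact_continuous_image[OF f compact_Icc]]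
    unfolding bounded_iff by (metis imageI real_norm_def)
  show ?thesis
    by (rule integrable_bounded_mult[OF g _ _ B])
       (auto intro: continuous_imp_measurable_on_sets_lebesgue[OF f])
qed

lemma lint_diff_bound:
  fixes f g h :: "real => real"
  assumes "integrable (lebesgue_on S) f" "integrable (lebesgue_on S) g" "integrable (lebesgue_on S) h"
   "S \<in> sets lebesgue" "\<And>x. x \<in> S ==> \<bar>f x - g x\<bar> \<le> h x"
  shows "\<bar>(LINT x|lebesgue_on S. f x) - (LINT x|lebesgue_on S. g x)\<bar> \<le> (LINT x|lebesgue_on S. h x)"
proof -
  have "\<bar>LINT x|lebesgue_on S. f x - g x\<bar> \<le> (LINT x|lebesgue_on S. \<bar>f x - g x\<bar>)"
    using integral_norm_bound[of "lebesgue_on S" "\<lambda>x. f x - g x"] by simp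
  also have "\<dots> \<le> (LINT x|lebesgue_on S. h x)"
    by (intro integral_mono integrable_abs Bochner_Integration.integrable_diff) (use assms in auto)
  finally show ?thesis using assms by (simp add: Bochner_Integration.integral_diff)
qed

lemma primitive_on_bound:
  assumes p: "primitive_on a b f g" and g: "\<And>x. x \<in> {a..b} ==> \<bar>g x - c\<bar> \<le> K" and x: "x \<in> {a..b}"
  shows "\<bar>f x - f a - (x - a) * c\<bar> \<le> (x - a) * K"
proof -
  have i: "integrable (lebesgue_on {a..x}) g"
    by (rule integrable_subinterval[OF primitive_on_integrable[OF p]]) (use x in auto)
  have const: "integrable (lebesgue_on {a..x}) (\<lambda>_. z)" "(LINT s|lebesgue_on {a..x}. z) = (x - a) * z" for z :: real
    using x by (auto simp: measure_restrict_space intro!: integrable_on_interval_continuous)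
  have "\<bar>(LINT s|lebesgue_on {a..x}. g s) - (LINT s|lebesgue_on {a..x}. c)\<bar> \<le> (LINT s|lebesgue_on {a..x}. K)"
    by (rule lint_diff_bound[OF i const(1) const(1)]) (use g x in auto)
  then show ?thesis using primitive_onD[OF p, of a x] x by (simp only: const(2) atLeastAtMost_iff order_refl)
qed

text \<open>
  Both sides are additive in the interval. An error on short intervals of at most
  \<open>e\<close> times the mass of one fixed integrable function therefore adds up, over a
  fine partition, to at most \<open>e\<close> times its total mass, and \<open>e\<close> is
  arbitrary.
\<close>

lemma primitive_onI_local:
  fixes F k G :: "real => real"
  assumes k: "integrable (lebesgue_on {a..b}) k" and G: "integrable (lebesgue_on {a..b}) G"
    and loc: "\<And>e. e > 0 ==> \<exists>d>0. \<forall>x y. a \<le> x \<and> x \<le> y \<and> y \<le> b \<and> y - x < d \<longrightarrow>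
          \<bar>F y - F x - (LINT s|lebesgue_on {x..y}. k s)\<bar> \<le> e * (LINT s|lebesgue_on {x..y}. G s)"
  shows "primitive_on a b F k"
  unfolding primitive_on_def
proof (intro conjI allI impI)
  fix x y assume xy: "a \<le> x \<and> x \<le> y \<and> y \<le> b"
  define K where "K = (\<lambda>x. LINT s|lebesgue_on {a..x}. k s)"
  define \<Gamma> where "\<Gamma> = (\<lambda>x. LINT s|lebesgue_on {a..x}. G s)"
  have K: "(LINT s|lebesgue_on {s..t}. k s) = K t - K s" if "a \<le> s" "s \<le> t" "t \<le> b" for s t
    using integral_combine[OF integrable_subinterval[OF k, of a t], of s] that by (auto simp: K_def)
  have \<Gamma>: "(LINT s|lebesgue_on {s..t}. G s) = \<Gamma> t - \<Gamma> s" if "a \<le> s" "s \<le> t" "t \<le> b" for s t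
    using integral_combine[OF integrable_subinterval[OF G, of a t], of s] that by (auto simp: \<Gamma>_def)
  have small: "\<bar>F y - F x - (K y - K x)\<bar> \<le> e * (\<Gamma> y - \<Gamma> x)" if e: "e > 0" for e
  proof -
    obtain d where d: "d > 0" and dd: "\<And>x y. a \<le> x ==> x \<le> y ==> y \<le> b ==> y - x < d ==>
          \<bar>F y - F x - (LINT s|lebesgue_on {x..y}. k s)\<bar> \<le> e * (LINT s|lebesgue_on {x..y}. G s)"
      using loc[OF e] by blast
    have dd': "\<bar>F t - F s - (K t - K s)\<bar> \<le> e * (\<Gamma> t - \<Gamma> s)" if "a \<le> s" "s \<le> t" "t \<le> b" "t - s < d" for s t
      using dd[OF that] K[OF that(1-3)] \<Gamma>[OF that(1-3)] by simp
    have "\<bar>F t - F x - (K t - K x)\<bar> \<le> e * (\<Gamma> t - \<Gamma> x)"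
      if "t - x \<le> real n * (d/2)" "x \<le> t" "t \<le> b" for n t
      using that
    proof (induction n arbitrary: t)
      case 0 then show ?case by simp
    next
      case (Suc n)
      define z where "z = max x (t - d/2)"
      have z: "x \<le> z" "z \<le> t" "t - z < d" "z - x \<le> real n * (d/2)"
        using Suc.prems d by (auto simp: z_def max_def algebra_simps)
      have "\<bar>F z - F x - (K z - K x)\<bar> \<le> e * (\<Gamma> z - \<Gamma> x)"
        using Suc.IH[of z] z Suc.prems by auto
      moreover have "\<bar>F t - F z - (K t - K z)\<bar> \<le> e * (\<Gamma> t - \<Gamma> z)"
        using dd'[of z t] z Suc.prems xy by auto
      moreover have "e * (\<Gamma> t - \<Gamma> x) = e * (\<Gamma> t - \<Gamma> z) + e * (\<Gamma> z - \<Gamma> x)" by (simp add: algebra_simps)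
      ultimately show ?case by linarith
    qed
    moreover obtain n :: nat where "(y - x) / (d/2) \<le> real n" using real_arch_simple by blast
    then have "y - x \<le> real n * (d/2)" using d by (simp add: field_simps)
    ultimately show ?thesis using xy by auto
  qed
  have "\<bar>F y - F x - (K y - K x)\<bar> \<le> 0"
  proof (rule field_le_epsilon)
    fix e :: real assume e: "e > 0"
    define c where "c = e / (1 + \<bar>\<Gamma> y - \<Gamma> x\<bar>)"
    have "c > 0" using e by (simp add: c_def add_pos_nonneg)
    then have "\<bar>F y - F x - (K y - K x)\<bar> \<le> c * (\<Gamma> y - \<Gamma> x)" by (rule small)
    also have "\<dots> \<le> c * (1 + \<bar>\<Gamma> y - \<Gamma> x\<bar>)" using \<open>c > 0\<close> by (intro mult_left_mono) auto
    also have "\<dots> = e" by (simp add: c_def)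
    finally show "\<bar>F y - F x - (K y - K x)\<bar> \<le> 0 + e" by simp
  qed
  then show "F y - F x = (LINT s|lebesgue_on {x..y}. k s)" using K[of x y] xy by auto
qed (fact k)

text \<open>
  By the mean value theorem the increment of \<open>\<Phi> (f x)\<close> over a short interval
  is that of \<open>f\<close> times a value of \<open>\<Phi>'\<close> on the range of
  \<open>f\<close> over that interval; uniform continuity turns this into the local criterion.
  So the chain rule holds although \<open>f\<close> need not be differentiable anywhere in
  particular.
\<close>

lemma primitive_on_compose:
  fixes f g \<Phi> \<Phi>' :: "real => real"
  assumes f: "primitive_on a b f g"
    and der: "\<And>z. z \<in> f ` {a..b} ==> (\<Phi> has_real_derivative \<Phi>' z) (at z)"
    and cont: "continuous_on (f ` {a..b}) \<Phi>'"
  shows "primitive_on a b (\<lambda>x. \<Phi> (f x)) (\<lambda>x. \<Phi>' (f x) * g x)"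
proof (rule primitive_onI_local[where G="\<lambda>x. \<bar>g x\<bar>"])
  note cf = primitive_on_continuous[OF f] and ig = primitive_on_integrable[OF f]
  have cc: "continuous_on {a..b} (\<lambda>x. \<Phi>' (f x))"
    using continuous_on_compose2[OF cont cf] by auto
  show ik: "integrable (lebesgue_on {a..b}) (\<lambda>x. \<Phi>' (f x) * g x)"
    by (rule integrable_continuous_mult[OF ig cc])
  show "integrable (lebesgue_on {a..b}) (\<lambda>x. \<bar>g x\<bar>)" using ig by auto
  fix e :: real assume e: "e > 0"
  obtain d where d: "d > 0" "\<And>x y. x \<in> {a..b} ==> y \<in> {a..b} ==> \<bar>y - x\<bar> < d ==> \<bar>\<Phi>' (f y) - \<Phi>' (f x)\<bar> < e"
    using compact_uniformly_continuous[OF cc compact_Icc] e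
    unfolding uniformly_continuous_on_def dist_real_def by metis
  show "\<exists>d>0. \<forall>x y. a \<le> x \<and> x \<le> y \<and> y \<le> b \<and> y - x < d \<longrightarrow>
          \<bar>\<Phi> (f y) - \<Phi> (f x) - (LINT s|lebesgue_on {x..y}. \<Phi>' (f s) * g s)\<bar> \<le> e * (LINT s|lebesgue_on {x..y}. \<bar>g s\<bar>)"
  proof (intro exI[of _ d] conjI allI impI d(1))
    fix x y assume xy: "a \<le> x \<and> x \<le> y \<and> y \<le> b \<and> y - x < d"
    have igx: "integrable (lebesgue_on {x..y}) g" by (rule integrable_subinterval[OF ig]) (use xy in auto)
    have ikx: "integrable (lebesgue_on {x..y}) (\<lambda>x. \<Phi>' (f x) * g x)" by (rule integrable_subinterval[OF ik]) (use xy in auto)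
    have ivt: "\<exists>z. x \<le> z \<and> z \<le> y \<and> f z = w" if "min (f x) (f y) \<le> w" "w \<le> max (f x) (f y)" for w
    proof -
      have c: "continuous_on {x..y} f" by (rule continuous_on_subset[OF cf]) (use xy in auto)
      show ?thesis
      proof (cases "f x \<le> f y")
        case True then show ?thesis using IVT'[of f x w y] c that xy by auto
      next
        case False then show ?thesis using IVT2'[of f y w x] c that xy by auto
      qed
    qed
    have "\<exists>z. x \<le> z \<and> z \<le> y \<and> \<Phi> (f y) - \<Phi> (f x) = \<Phi>' (f z) * (f y - f x)"
    proof -
      have inr: "w \<in> f ` {a..b}" if "min (f x) (f y) \<le> w" "w \<le> max (f x) (f y)" for w
        using ivt[OF that] xy by force
      consider "f x < f y" | "f x = f y" | "f y < f x" by linarith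
      then show ?thesis
      proof cases
        case 1
        then obtain w where "f x < w" "w < f y" "\<Phi> (f y) - \<Phi> (f x) = (f y - f x) * \<Phi>' w"
          using MVT2[of "f x" "f y" \<Phi> \<Phi>'] der inr by (auto simp: min_def max_def)
        then show ?thesis using ivt[of w] by (metis max.strict_coboundedI2 min.strict_coboundedI1 less_imp_le mult.commute)
      next
        case 2 then show ?thesis using xy by auto
      next
        case 3
        then obtain w where w: "f y < w" "w < f x" "\<Phi> (f x) - \<Phi> (f y) = (f x - f y) * \<Phi>' w"
          using MVT2[of "f y" "f x" \<Phi> \<Phi>'] der inr by (auto simp: min_def max_def)
        then have "\<Phi> (f y) - \<Phi> (f x) = \<Phi>' w * (f y - f x)" by (simp add: algebra_simps)
        then show ?thesis using ivt[of w] w by (metis max.strict_coboundedI1 min.strict_coboundedI2 less_imp_le)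
      qed
    qed
    then obtain z where z: "x \<le> z" "z \<le> y" "\<Phi> (f y) - \<Phi> (f x) = \<Phi>' (f z) * (f y - f x)" by blast
    have "\<Phi> (f y) - \<Phi> (f x) = (LINT s|lebesgue_on {x..y}. \<Phi>' (f z) * g s)"
      using z primitive_onD[OF f, of x y] xy by simp
    also have "\<bar>\<dots> - (LINT s|lebesgue_on {x..y}. \<Phi>' (f s) * g s)\<bar> \<le> (LINT s|lebesgue_on {x..y}. e * \<bar>g s\<bar>)"
    proof (rule lint_diff_bound)
      fix s assume s: "s \<in> {x..y}"
      have "\<bar>\<Phi>' (f z) - \<Phi>' (f s)\<bar> \<le> e"
        by (rule less_imp_le, rule d(2)) (use s z xy in auto)
      then have "\<bar>\<Phi>' (f z) - \<Phi>' (f s)\<bar> * \<bar>g s\<bar> \<le> e * \<bar>g s\<bar>" by (rule mult_right_mono) simp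
      then show "\<bar>\<Phi>' (f z) * g s - \<Phi>' (f s) * g s\<bar> \<le> e * \<bar>g s\<bar>"
        by (simp add: abs_mult flip: left_diff_distrib)
    qed (use igx ikx in auto)
    finally show "\<bar>\<Phi> (f y) - \<Phi> (f x) - (LINT s|lebesgue_on {x..y}. \<Phi>' (f s) * g s)\<bar> \<le> e * (LINT s|lebesgue_on {x..y}. \<bar>g s\<bar>)"
      by simp
  qed
qed

lemma primitive_on_linear:
  assumes f: "primitive_on a b f g" and f2: "primitive_on a b f2 g2"
  shows "primitive_on a b (\<lambda>x. c * f x + d * f2 x) (\<lambda>x. c * g x + d * g2 x)"
  unfolding primitive_on_def
proof (intro conjI allI impI)
  show "integrable (lebesgue_on {a..b}) (\<lambda>x. c * g x + d * g2 x)"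
    using primitive_on_integrable[OF f] primitive_on_integrable[OF f2] by auto
  fix x y assume xy: "a \<le> x \<and> x \<le> y \<and> y \<le> b"
  have "integrable (lebesgue_on {x..y}) g" "integrable (lebesgue_on {x..y}) g2"
    using xy by (auto intro: integrable_subinterval[OF primitive_on_integrable[OF f]] integrable_subinterval[OF primitive_on_integrable[OF f2]])
  then have "(LINT s|lebesgue_on {x..y}. c * g s + d * g2 s) = c * (f y - f x) + d * (f2 y - f2 x)"
    using primitive_onD[OF f, of x y] primitive_onD[OF f2, of x y] xy by simp
  then show "c * f y + d * f2 y - (c * f x + d * f2 x) = (LINT s|lebesgue_on {x..y}. c * g s + d * g2 s)"
    by (simp add: algebra_simps)
qed

text \<open>
  Polarisation reduces the product rule to the chain rule for the square.
\<close>

lemma primitive_on_mult: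
  fixes f g f2 g2 :: "real => real"
  assumes f: "primitive_on a b f g" and f2: "primitive_on a b f2 g2"
  shows "primitive_on a b (\<lambda>x. f x * f2 x) (\<lambda>x. f2 x * g x + f x * g2 x)"
proof -
  have sq: "primitive_on a b (\<lambda>x. (h x)^2) (\<lambda>x. 2 * h x * k x)" if "primitive_on a b h k" for h k
    by (rule primitive_on_compose[OF that]) (auto intro!: derivative_eq_intros continuous_intros)
  from primitive_on_linear[OF sq[OF primitive_on_linear[OF f f2, of 1 1]] sq[OF primitive_on_linear[OF f f2, of 1 "-1"]], of "1 / 4" "- 1 / 4"]
  show ?thesis by (simp add: power2_eq_square algebra_simps)
qed

lemma primitive_on_C1:
  fixes f f' :: "real => real"
  assumes "\<And>x. x \<in> {a..b} ==> (f has_real_derivative f' x) (at x within {a..b})"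
    and "continuous_on {a..b} f'"
  shows "primitive_on a b f f'"
  unfolding primitive_on_def
proof (intro conjI allI impI)
  show "integrable (lebesgue_on {a..b}) f'" by (rule integrable_on_interval_continuous[OF assms(2)])
  fix x y assume xy: "a \<le> x \<and> x \<le> y \<and> y \<le> b"
  have "(f' has_integral f y - f x) {x..y}"
  proof (rule fundamental_theorem_of_calculus)
    fix z assume "z \<in> {x..y}"
    then show "(f has_vector_derivative f' z) (at z within {x..y})"
      using assms(1)[of z] xy
      by (auto simp flip: has_real_derivative_iff_has_vector_derivative intro: DERIV_subset)
  qed (use xy in auto)
  moreover have "integrable (lebesgue_on {x..y}) f'"
    by (rule integrable_on_interval_continuous, rule continuous_on_subset[OF assms(2)]) (use xy in auto)
  ultimately show "f y - f x = integral\<^sup>L (lebesgue_on {x..y}) f'"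
    by (simp add: lebesgue_integral_eq_integral integral_unique)
qed

lemma integration_by_parts:
  assumes f: "primitive_on a b f g" and f2: "primitive_on a b f2 g2" and ab: "a \<le> b"
   and "f b * f2 b = f a * f2 a"
  shows "(LINT x|lebesgue_on {a..b}. f x * g2 x) = - (LINT x|lebesgue_on {a..b}. g x * f2 x)"
proof -
  have "f b * f2 b - f a * f2 a = (LINT x|lebesgue_on {a..b}. f2 x * g x + f x * g2 x)"
    using primitive_onD[OF primitive_on_mult[OF f f2], of a b] ab by simp
  also have "\<dots> = (LINT x|lebesgue_on {a..b}. f2 x * g x) + (LINT x|lebesgue_on {a..b}. f x * g2 x)"
    by (intro Bochner_Integration.integral_add integrable_continuous_mult
      primitive_on_continuous[OF f] primitive_on_integrable[OF f] primitive_on_continuous[OF f2] primitive_on_integrable[OF f2])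
  finally show ?thesis using assms(4) by (simp add: mult.commute)
qed

section \<open>Fourier coefficients and orthogonality\<close>

definition fourier_cos :: "(real => real) => nat => real" where
  "fourier_cos f k = (LINT x|torus. f x * cos (real k * x))"

definition fourier_sin :: "(real => real) => nat => real" where
  "fourier_sin f k = (LINT x|torus. f x * sin (real k * x))"

text \<open>
  The integral of \<open>cos (k x)^2\<close> over the torus, and for \<open>k > 0\<close> also
  that of \<open>sin (k x)^2\<close>.
\<close>

definition fourier_weight :: "nat => real" where
  "fourier_weight k = (if k = 0 then 2 * pi else pi)"

definition trig_sum :: "nat => (nat => real) => (nat => real) => real => real" where
  "trig_sum n a b x = (\<Sum>k\<le>n. a k * cos (real k * x) + b k * sin (real k * x))"

definition fourier_sum :: "nat => (real => real) => real => real" where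
  "fourier_sum n f = trig_sum n (\<lambda>k. fourier_cos f k / fourier_weight k) (\<lambda>k. fourier_sin f k / fourier_weight k)"

definition fourier_energy :: "nat => (real => real) => real" where
  "fourier_energy n f = (\<Sum>k\<le>n. ((fourier_cos f k)^2 + (fourier_sin f k)^2) / fourier_weight k)"

lemma finite_measure_torus: "finite_measure torus"
  by (intro finite_measure_lebesgue_on) simp

lemma integrable_const_torus [simp]: "integrable torus (\<lambda>_. c::real)"
  using finite_measure.integrable_const[OF finite_measure_torus] .

lemma measure_torus [simp]: "measure torus {-pi..pi} = 2 * pi"
  by (simp add: measure_restrict_space)

lemma lint_const_torus [simp]: "(LINT x|torus. c::real) = 2 * pi * c"
  by (simp add: measure_restrict_space)

lemma L2_torus_integrable: "L2_torus f ==> integrable torus f"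
  unfolding L2_torus_def
proof (elim conjE)
  assume m: "f \<in> borel_measurable torus" and i: "integrable torus (\<lambda>x. (f x)^2)"
  have "\<bar>f x\<bar> \<le> \<bar>1 + (f x)^2\<bar>" for x
  proof -
    have "0 \<le> (\<bar>f x\<bar> - 1)^2" by simp
    then have "2 * \<bar>f x\<bar> \<le> 1 + (f x)^2" by (simp add: power2_eq_square algebra_simps)
    then show ?thesis by (smt (verit) zero_le_power2)
  qed
  then show ?thesis
    by (intro Bochner_Integration.integrable_bound[OF Bochner_Integration.integrable_add[OF integrable_const_torus[of 1] i]])
       (use m in auto)
qed

lemma L2_torus_mult: "L2_torus f ==> L2_torus g ==> integrable torus (\<lambda>x. f x * g x)"
  unfolding L2_torus_def
proof (elim conjE)
  assume m: "f \<in> borel_measurable torus" "g \<in> borel_measurable torus"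
    and i: "integrable torus (\<lambda>x. (f x)^2)" "integrable torus (\<lambda>x. (g x)^2)"
  have "\<bar>f x * g x\<bar> \<le> \<bar>(f x)^2 + (g x)^2\<bar>" for x
  proof -
    have "0 \<le> (\<bar>f x\<bar> - \<bar>g x\<bar>)^2" by simp
    then have "2 * (\<bar>f x\<bar> * \<bar>g x\<bar>) \<le> (f x)^2 + (g x)^2" by (simp add: power2_eq_square algebra_simps)
    then show ?thesis by (simp add: abs_mult)
       (smt (verit) mult_nonneg_nonneg abs_ge_zero)
  qed
  then show ?thesis
    by (intro Bochner_Integration.integrable_bound[OF Bochner_Integration.integrable_add[OF i]])
       (use m in auto)
qed

lemma L2_torus_add: "L2_torus f ==> L2_torus g ==> L2_torus (\<lambda>x. f x + g x)"
  using L2_torus_mult[of f g] unfolding L2_torus_def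
  by (auto simp: power2_sum intro!: Bochner_Integration.integrable_add)
     (simp add: mult.assoc)

lemma L2_torus_cmult: "L2_torus f ==> L2_torus (\<lambda>x. c * f x)"
  unfolding L2_torus_def by (auto simp: power_mult_distrib)

lemma L2_torus_diff: "L2_torus f ==> L2_torus g ==> L2_torus (\<lambda>x. f x - g x)"
  using L2_torus_add[of f "\<lambda>x. (-1) * g x"] L2_torus_cmult[of g "-1"] by simp

lemma L2_torus_bounded:
  assumes "f \<in> borel_measurable torus" "\<And>x. x \<in> {-pi..pi} ==> \<bar>f x\<bar> \<le> B"
  shows "L2_torus f"
  unfolding L2_torus_def
proof
  show "integrable torus (\<lambda>x. (f x)^2)"
  proof (rule Bochner_Integration.integrable_bound[of torus "\<lambda>x. B^2"])
    show "AE x in torus. norm ((f x)^2) \<le> norm (B^2)"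
      using assms(2) by (intro AE_I2) (auto simp: abs_le_square_iff[symmetric] intro: order_trans[OF _ abs_ge_self])
  qed (use assms in auto)
qed (fact assms(1))

lemma bounded_on_Icc:
  fixes f :: "real => real"
  assumes "continuous_on {a..b} f"
  obtains B where "B \<ge> 0" "\<And>x. x \<in> {a..b} ==> \<bar>f x\<bar> \<le> B"
proof -
  obtain B where "\<And>x. x \<in> {a..b} ==> \<bar>f x\<bar> \<le> B"
    using compact_imp_bounded[OF compact_continuous_image[OF assms compact_Icc]]
    unfolding bounded_iff by (metis imageI real_norm_def)
  then show ?thesis using that[of "max B 0"] by (metis max.cobounded2 max.coboundedI1)
qed

lemma L2_torus_continuous: "continuous_on {-pi..pi} f ==> L2_torus f"
  by (metis L2_torus_bounded bounded_on_Icc continuous_imp_measurable_on_sets_lebesgue lmeasurable_cbox fmeasurableD cbox_interval)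

lemma L2_torus_mult_continuous:
  assumes "L2_torus g" "continuous_on {-pi..pi} f"
  shows "L2_torus (\<lambda>x. f x * g x)"
proof -
  have "continuous_on {-pi..pi} (\<lambda>x. (f x)^2)" by (intro continuous_intros assms)
  from integrable_continuous_mult[OF _ this, of "\<lambda>x. (g x)^2"] assms(1)
  show ?thesis using continuous_imp_measurable_on_sets_lebesgue[OF assms(2)]
    by (auto simp: L2_torus_def power_mult_distrib)
qed

lemma L2_torus_trig_sum: "L2_torus (trig_sum n a b)"
  unfolding trig_sum_def [abs_def] by (intro L2_torus_continuous continuous_intros)

lemma L2_torus_cos: "L2_torus (\<lambda>x. cos (c * x))" and L2_torus_sin: "L2_torus (\<lambda>x. sin (c * x))"
  by (intro L2_torus_continuous continuous_intros)+

lemma lint_Cauchy_Schwarz: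
  fixes f g :: "'a => real"
  assumes f: "integrable M (\<lambda>x. (f x)^2)" and g: "integrable M (\<lambda>x. (g x)^2)" and fg: "integrable M (\<lambda>x. f x * g x)"
  shows "(LINT x|M. f x * g x)^2 \<le> (LINT x|M. (f x)^2) * (LINT x|M. (g x)^2)"
proof -
  define A B C where "A = (LINT x|M. (f x)^2)" "B = (LINT x|M. f x * g x)" "C = (LINT x|M. (g x)^2)"
  have q: "0 \<le> s^2 * A + 2 * s * t * B + t^2 * C" for s t :: real
  proof -
    have "0 \<le> (LINT x|M. (s * f x + t * g x)^2)" by (intro Bochner_Integration.integral_nonneg) auto
    also have "\<dots> = (LINT x|M. s^2 * (f x)^2 + 2 * s * t * (f x * g x) + t^2 * (g x)^2)"
      by (intro Bochner_Integration.integral_cong) (auto simp: power2_eq_square algebra_simps)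
    also have "\<dots> = s^2 * A + 2 * s * t * B + t^2 * C"
      using assms by (simp add: A_B_C_def)
    finally show ?thesis .
  qed
  have A: "A \<ge> 0" and C: "C \<ge> 0" unfolding A_B_C_def by (auto intro!: Bochner_Integration.integral_nonneg)
  have "B^2 \<le> A * C"
  proof (cases "A = 0")
    case True
    have "B = 0"
    proof (rule ccontr)
      assume "B \<noteq> 0"
      have "0 \<le> 2 * (- (C + 1) / B) * 1 * B + 1^2 * C" using q[of "- (C + 1) / B" 1] True by simp
      then show False using \<open>B \<noteq> 0\<close> C by simp
    qed
    then show ?thesis using True by simp
  next
    case False
    then have "A > 0" using A by simp
    have "0 \<le> B^2 * A + 2 * B * (- A) * B + A^2 * C" using q[of B "- A"] by simp
    then have "A * B^2 \<le> A * (A * C)" by (simp add: power2_eq_square algebra_simps)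
    then show ?thesis using \<open>A > 0\<close> by simp
  qed
  then show ?thesis by (simp add: A_B_C_def)
qed

lemma lint_cos_int:
  "(LINT x|torus. cos (of_int m * x)) = (if m = 0 then 2 * pi else 0)"
proof (cases "m = 0")
  case False
  have "primitive_on (-pi) pi (\<lambda>x. sin (of_int m * x) / of_int m) (\<lambda>x. cos (of_int m * x))"
  proof (rule primitive_on_C1)
    fix x assume "x \<in> {-pi..pi}"
    show "((\<lambda>x. sin (of_int m * x) / of_int m) has_real_derivative cos (of_int m * x)) (at x within {-pi..pi})"
      using False by (auto intro!: derivative_eq_intros)
  qed (intro continuous_intros)
  from primitive_onD[OF this, of "-pi" pi] have "(LINT x|torus. cos (of_int m * x)) = 2 * sin (of_int m * pi) / of_int m"
    by (simp add: field_simps)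
  then show ?thesis using False sin_int_times_real[of m] sin_times_pi_eq_0[of "of_int m"] by simp
qed (simp_all add: measure_torus)

lemma lint_sin_int: "(LINT x|torus. sin (of_int m * x)) = 0"
proof (cases "m = 0")
  case False
  have "primitive_on (-pi) pi (\<lambda>x. - cos (of_int m * x) / of_int m) (\<lambda>x. sin (of_int m * x))"
  proof (rule primitive_on_C1)
    fix x assume "x \<in> {-pi..pi}"
    show "((\<lambda>x. - cos (of_int m * x) / of_int m) has_real_derivative sin (of_int m * x)) (at x within {-pi..pi})"
      using False by (auto intro!: derivative_eq_intros)
  qed (intro continuous_intros)
  from primitive_onD[OF this, of "-pi" pi] show ?thesis
    by simp
qed (simp_all add: measure_torus)

lemma integrable_torus_continuous: "continuous_on {-pi..pi} f ==> integrable torus (f :: real => real)"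
  by (rule integrable_on_interval_continuous)

lemma lint_cos_cos: "(LINT x|torus. cos (real j * x) * cos (real k * x)) = (if j = k then fourier_weight k else 0)"
proof -
  have "(LINT x|torus. cos (real j * x) * cos (real k * x)) =
     (LINT x|torus. (cos (of_int (int j - int k) * x) + cos (of_int (int j + int k) * x)) / 2)"
    by (intro Bochner_Integration.integral_cong) (auto simp: cos_times_cos algebra_simps)
  also have "\<dots> = ((LINT x|torus. cos (of_int (int j - int k) * x)) + (LINT x|torus. cos (of_int (int j + int k) * x))) / 2"
    by (subst Bochner_Integration.integral_add[symmetric]) (auto intro!: integrable_torus_continuous continuous_intros)
  finally show ?thesis unfolding lint_cos_int fourier_weight_def by auto
qed

lemma lint_sin_sin: "(LINT x|torus. sin (real j * x) * sin (real k * x)) = (if j = k \<and> k \<noteq> 0 then fourier_weight k else 0)"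
proof -
  have "(LINT x|torus. sin (real j * x) * sin (real k * x)) =
     (LINT x|torus. (cos (of_int (int j - int k) * x) - cos (of_int (int j + int k) * x)) / 2)"
    by (intro Bochner_Integration.integral_cong) (auto simp: sin_times_sin algebra_simps)
  also have "\<dots> = ((LINT x|torus. cos (of_int (int j - int k) * x)) - (LINT x|torus. cos (of_int (int j + int k) * x))) / 2"
    by (subst Bochner_Integration.integral_diff[symmetric]) (auto intro!: integrable_torus_continuous continuous_intros)
  finally show ?thesis unfolding lint_cos_int fourier_weight_def by auto
qed

lemma lint_sin_cos: "(LINT x|torus. sin (real j * x) * cos (real k * x)) = 0"
proof -
  have "(LINT x|torus. sin (real j * x) * cos (real k * x)) =
     (LINT x|torus. (sin (of_int (int j + int k) * x) + sin (of_int (int j - int k) * x)) / 2)"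
    by (intro Bochner_Integration.integral_cong) (auto simp: sin_times_cos left_diff_distrib distrib_right)
  also have "\<dots> = ((LINT x|torus. sin (of_int (int j + int k) * x)) + (LINT x|torus. sin (of_int (int j - int k) * x))) / 2"
    by (subst Bochner_Integration.integral_add[symmetric]) (auto intro!: integrable_torus_continuous continuous_intros)
  finally show ?thesis unfolding lint_sin_int by auto
qed

lemma lint_mult_trig_sum:
  assumes "L2_torus f"
  shows "(LINT x|torus. f x * trig_sum n a b x) = (\<Sum>k\<le>n. a k * fourier_cos f k + b k * fourier_sin f k)"
proof -
  have i: "integrable torus (\<lambda>x. f x * cos (real k * x))" "integrable torus (\<lambda>x. f x * sin (real k * x))" for k
    by (intro L2_torus_mult assms L2_torus_cos L2_torus_sin)+
  have "(LINT x|torus. f x * trig_sum n a b x) =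
     (LINT x|torus. (\<Sum>k\<le>n. a k * (f x * cos (real k * x)) + b k * (f x * sin (real k * x))))"
    by (intro Bochner_Integration.integral_cong) (auto simp: trig_sum_def sum_distrib_left algebra_simps)
  also have "\<dots> = (\<Sum>k\<le>n. LINT x|torus. a k * (f x * cos (real k * x)) + b k * (f x * sin (real k * x)))"
    using i by (intro Bochner_Integration.integral_sum) auto
  also have "\<dots> = (\<Sum>k\<le>n. a k * fourier_cos f k + b k * fourier_sin f k)"
    using i by (intro sum.cong) (auto simp: fourier_cos_def fourier_sin_def)
  finally show ?thesis .
qed

lemma fourier_cos_trig_sum: "k \<le> n ==> fourier_cos (trig_sum n a b) k = fourier_weight k * a k"
proof -
  assume k: "k \<le> n"
  have "fourier_cos (trig_sum n a b) k = (LINT x|torus. cos (real k * x) * trig_sum n a b x)"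
    by (simp add: fourier_cos_def mult.commute)
  also have "\<dots> = (\<Sum>j\<le>n. a j * fourier_cos (\<lambda>x. cos (real k * x)) j + b j * fourier_sin (\<lambda>x. cos (real k * x)) j)"
    by (rule lint_mult_trig_sum[OF L2_torus_cos])
  also have "\<dots> = (\<Sum>j\<le>n. if j = k then a k * fourier_weight k else 0)"
    by (intro sum.cong) (auto simp: fourier_cos_def fourier_sin_def lint_cos_cos lint_sin_cos mult.commute[of "cos _" "sin _"])
  also have "\<dots> = fourier_weight k * a k" using k by simp
  finally show ?thesis .
qed

lemma fourier_sin_trig_sum: "k \<le> n ==> k \<noteq> 0 ==> fourier_sin (trig_sum n a b) k = fourier_weight k * b k"
proof -
  assume k: "k \<le> n" "k \<noteq> 0"
  have "fourier_sin (trig_sum n a b) k = (LINT x|torus. sin (real k * x) * trig_sum n a b x)"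
    by (simp add: fourier_sin_def mult.commute)
  also have "\<dots> = (\<Sum>j\<le>n. a j * fourier_cos (\<lambda>x. sin (real k * x)) j + b j * fourier_sin (\<lambda>x. sin (real k * x)) j)"
    by (rule lint_mult_trig_sum[OF L2_torus_sin])
  also have "\<dots> = (\<Sum>j\<le>n. if j = k then b k * fourier_weight k else 0)"
    using k by (intro sum.cong) (auto simp: fourier_cos_def fourier_sin_def lint_sin_sin lint_sin_cos)
  also have "\<dots> = fourier_weight k * b k" using k by simp
  finally show ?thesis .
qed

lemma fourier_sin_0 [simp]: "fourier_sin f 0 = 0" by (simp add: fourier_sin_def)

lemma fourier_weight_pos: "fourier_weight k > 0" by (simp add: fourier_weight_def)

text \<open>
  Completing the square with the orthogonality relations. The choice of the Fourier coefficients
  makes the last sum vanish, which gives Bessel's inequality and the optimality of the Fourier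
  sums.
\<close>

lemma lint_diff_trig_sum:
  assumes f: "L2_torus f"
  shows "(LINT x|torus. (f x - trig_sum n a b x)^2) = (LINT x|torus. (f x)^2) - fourier_energy n f
     + (\<Sum>k\<le>n. fourier_weight k * (a k - fourier_cos f k / fourier_weight k)^2
              + (if k = 0 then 0 else fourier_weight k * (b k - fourier_sin f k / fourier_weight k)^2))"
proof -
  let ?T = "trig_sum n a b"
  have "(LINT x|torus. (f x - ?T x)^2) = (LINT x|torus. (f x)^2 - 2 * (f x * ?T x) + ?T x * ?T x)"
    by (intro Bochner_Integration.integral_cong) (auto simp: power2_eq_square algebra_simps)
  also have "\<dots> = (LINT x|torus. (f x)^2) - 2 * (LINT x|torus. f x * ?T x) + (LINT x|torus. ?T x * ?T x)"
    using f L2_torus_mult[OF f L2_torus_trig_sum[of n a b]] L2_torus_mult[OF L2_torus_trig_sum[of n a b] L2_torus_trig_sum[of n a b]]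
    by (simp add: L2_torus_def)
  also have "\<dots> = (LINT x|torus. (f x)^2) + (\<Sum>k\<le>n. - 2 * (a k * fourier_cos f k + b k * fourier_sin f k)
       + (a k * fourier_cos ?T k + b k * fourier_sin ?T k))"
    unfolding lint_mult_trig_sum[OF f] lint_mult_trig_sum[OF L2_torus_trig_sum]
    by (simp add: sum.distrib sum_distrib_left sum_negf sum_subtractf)
  also have "(\<Sum>k\<le>n. - 2 * (a k * fourier_cos f k + b k * fourier_sin f k) + (a k * fourier_cos ?T k + b k * fourier_sin ?T k)) =
     (\<Sum>k\<le>n. - (((fourier_cos f k)^2 + (fourier_sin f k)^2) / fourier_weight k)
        + (fourier_weight k * (a k - fourier_cos f k / fourier_weight k)^2
              + (if k = 0 then 0 else fourier_weight k * (b k - fourier_sin f k / fourier_weight k)^2)))"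
  proof (intro sum.cong refl)
    fix k assume "k \<in> {..n}"
    then have k: "k \<le> n" by simp
    have w: "fourier_weight k \<noteq> 0" using fourier_weight_pos[of k] by simp
    show "- 2 * (a k * fourier_cos f k + b k * fourier_sin f k) + (a k * fourier_cos ?T k + b k * fourier_sin ?T k) =
      - (((fourier_cos f k)^2 + (fourier_sin f k)^2) / fourier_weight k)
        + (fourier_weight k * (a k - fourier_cos f k / fourier_weight k)^2
              + (if k = 0 then 0 else fourier_weight k * (b k - fourier_sin f k / fourier_weight k)^2))"
      using w fourier_cos_trig_sum[OF k, of a b] fourier_sin_trig_sum[OF k, of a b]
      by (cases "k = 0") (auto simp: field_simps power2_eq_square)
  qed
  finally show ?thesis by (simp add: fourier_energy_def sum.distrib sum_negf sum_subtractf)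
qed

lemma lint_diff_fourier_sum:
  assumes f: "L2_torus f"
  shows "(LINT x|torus. (f x - fourier_sum n f x)^2) = (LINT x|torus. (f x)^2) - fourier_energy n f"
  unfolding fourier_sum_def lint_diff_trig_sum[OF f] by (auto intro!: sum.neutral)

lemma fourier_sum_best:
  assumes f: "L2_torus f" and "m \<le> n"
  shows "(LINT x|torus. (f x - fourier_sum n f x)^2) \<le> (LINT x|torus. (f x - trig_sum m a b x)^2)"
proof -
  have 1: "(LINT x|torus. (f x)^2) - fourier_energy m f \<le> (LINT x|torus. (f x - trig_sum m a b x)^2)"
    unfolding lint_diff_trig_sum[OF f] using fourier_weight_pos
    by (simp add: sum_nonneg less_imp_le)
  have "fourier_energy m f \<le> fourier_energy n f"
    unfolding fourier_energy_def using assms(2) fourier_weight_pos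
    by (intro sum_mono2) (auto simp: less_imp_le)
  then show ?thesis using 1 lint_diff_fourier_sum[OF f, of n] by linarith
qed

lemma fourier_energy_le: "L2_torus f ==> fourier_energy n f \<le> (LINT x|torus. (f x)^2)"
  using lint_diff_fourier_sum[of f n] Bochner_Integration.integral_nonneg[of torus "\<lambda>x. (f x - fourier_sum n f x)^2"]
  by simp

lemma abs_lint_torus_le:
  assumes "\<And>x. x \<in> {-pi..pi} ==> \<bar>f x\<bar> \<le> K"
  shows "\<bar>LINT x|torus. f x\<bar> \<le> 2 * pi * K"
proof (cases "integrable torus f")
  case True
  have "\<bar>(LINT x|torus. f x) - (LINT x|torus. 0)\<bar> \<le> (LINT x|torus. K)"
    by (rule lint_diff_bound[OF True]) (use assms in auto)
  then show ?thesis by simp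
next
  case False
  have "0 \<le> K" using assms[of 0] by simp
  then show ?thesis using False by (simp add: not_integrable_integral_eq)
qed

lemma lint_sq_diff_le:
  assumes "L2_torus f" "L2_torus h" "L2_torus g"
  shows "(LINT x|torus. (f x - g x)^2) \<le> 2 * (LINT x|torus. (f x - h x)^2) + 2 * (LINT x|torus. (h x - g x)^2)"
proof -
  note L = L2_torus_diff[OF assms(1,2)] L2_torus_diff[OF assms(2,3)] L2_torus_diff[OF assms(1,3)]
  have "(LINT x|torus. (f x - g x)^2) \<le> (LINT x|torus. 2 * (f x - h x)^2 + 2 * (h x - g x)^2)"
  proof (rule integral_mono)
    fix x show "(f x - g x)^2 \<le> 2 * (f x - h x)^2 + 2 * (h x - g x)^2"
      using zero_le_power2[of "(f x - h x) - (h x - g x)"] by (simp add: power2_eq_square algebra_simps)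
  qed (use L in \<open>auto simp: L2_torus_def\<close>)
  then show ?thesis using L by (simp add: L2_torus_def)
qed

section \<open>Completeness of the trigonometric system\<close>

definition trig_poly :: "(real => real) => bool" where
  "trig_poly f \<longleftrightarrow> (\<exists>n a b. f = trig_sum n a b)"

lemma trig_sum_extend:
  assumes "n \<le> m"
  shows "trig_sum n a b = trig_sum m (\<lambda>k. if k \<le> n then a k else 0) (\<lambda>k. if k \<le> n then b k else 0)"
proof
  fix x
  show "trig_sum n a b x = trig_sum m (\<lambda>k. if k \<le> n then a k else 0) (\<lambda>k. if k \<le> n then b k else 0) x"
    unfolding trig_sum_def using assms by (intro sum.mono_neutral_cong_left) auto
qed

lemma trig_poly_add: "trig_poly f ==> trig_poly g ==> trig_poly (\<lambda>x. f x + g x)"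
proof -
  assume "trig_poly f" "trig_poly g"
  then obtain n a b m c d where f: "f = trig_sum n a b" and g: "g = trig_sum m c d"
    unfolding trig_poly_def by blast
  define N where "N = max n m"
  have "trig_poly (\<lambda>x. trig_sum N a' b' x + trig_sum N c' d' x)" for a' b' c' d'
    unfolding trig_poly_def
    by (intro exI[of _ N] exI[of _ "\<lambda>k. a' k + c' k"] exI[of _ "\<lambda>k. b' k + d' k"])
       (auto simp: trig_sum_def fun_eq_iff sum.distrib[symmetric] algebra_simps intro!: sum.cong)
  then show ?thesis
    using trig_sum_extend[of n N a b] trig_sum_extend[of m N c d] by (simp add: f g N_def)
qed

lemma trig_poly_cmult: "trig_poly f ==> trig_poly (\<lambda>x. c * f x)"
proof -
  assume "trig_poly f"
  then obtain n a b where f: "f = trig_sum n a b"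
    unfolding trig_poly_def by blast
  then show ?thesis
    unfolding trig_poly_def
    by (intro exI[of _ n] exI[of _ "\<lambda>k. c * a k"] exI[of _ "\<lambda>k. c * b k"])
       (auto simp: trig_sum_def fun_eq_iff sum_distrib_left algebra_simps intro!: sum.cong)
qed

lemma trig_poly_sum: "(\<And>i. i \<in> I ==> trig_poly (f i)) ==> trig_poly (\<lambda>x. \<Sum>i\<in>I. f i x)"
proof (induction I rule: infinite_finite_induct)
  case (insert i I)
  then show ?case by (simp add: trig_poly_add)
qed (auto simp: trig_poly_def trig_sum_def fun_eq_iff intro!: exI[of _ 0] exI[of _ "\<lambda>_. 0::real"])

lemma trig_poly_cos: "trig_poly (\<lambda>x. cos (of_int k * x))"
proof -
  have "cos (of_int k * x) = trig_sum (nat \<bar>k\<bar>) (\<lambda>j. if j = nat \<bar>k\<bar> then 1 else 0) (\<lambda>_. 0) x" for x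
  proof -
    have "trig_sum (nat \<bar>k\<bar>) (\<lambda>j. if j = nat \<bar>k\<bar> then 1 else 0) (\<lambda>_. 0) x = cos (real (nat \<bar>k\<bar>) * x)"
      by (simp add: trig_sum_def if_distrib[of "\<lambda>c. c * _"] cong: if_cong)
    also have "\<dots> = cos (of_int k * x)" by (cases "k \<ge> 0") auto
    finally show ?thesis by simp
  qed
  then show ?thesis unfolding trig_poly_def fun_eq_iff by blast
qed

lemma trig_poly_sin: "trig_poly (\<lambda>x. sin (of_int k * x))"
proof -
  have "sin (of_int k * x) = trig_sum (nat \<bar>k\<bar>) (\<lambda>_. 0) (\<lambda>j. if j = nat \<bar>k\<bar> then of_int (sgn k) else 0) x" for x
  proof -
    have "trig_sum (nat \<bar>k\<bar>) (\<lambda>_. 0) (\<lambda>j. if j = nat \<bar>k\<bar> then of_int (sgn k) else 0) x = of_int (sgn k) * sin (real (nat \<bar>k\<bar>) * x)"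
      by (simp add: trig_sum_def if_distrib[of "\<lambda>c. c * _"] cong: if_cong)
    also have "\<dots> = sin (of_int k * x)" by (cases "k \<ge> 0") (auto simp: sgn_if)
    finally show ?thesis by simp
  qed
  then show ?thesis unfolding trig_poly_def fun_eq_iff by blast
qed

lemma trig_poly_mult_aux:
  assumes c: "\<And>k. trig_poly (\<lambda>x. g x * cos (real k * x))" and s: "\<And>k. trig_poly (\<lambda>x. g x * sin (real k * x))"
   and f: "trig_poly f"
  shows "trig_poly (\<lambda>x. g x * f x)"
proof -
  obtain n a b where f: "f = trig_sum n a b" using f unfolding trig_poly_def by blast
  have "trig_poly (\<lambda>x. \<Sum>k\<le>n. a k * (g x * cos (real k * x)) + b k * (g x * sin (real k * x)))"
    by (intro trig_poly_sum trig_poly_add trig_poly_cmult c s)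
  moreover have "(\<lambda>x. \<Sum>k\<le>n. a k * (g x * cos (real k * x)) + b k * (g x * sin (real k * x))) = (\<lambda>x. g x * f x)"
    by (auto simp: f trig_sum_def fun_eq_iff sum_distrib_left algebra_simps intro!: sum.cong)
  ultimately show ?thesis by simp
qed

lemma trig_poly_cos_mult: "trig_poly f ==> trig_poly (\<lambda>x. cos x * f x)"
proof (rule trig_poly_mult_aux)
  fix k
  have "trig_poly (\<lambda>x. (1/2) * (cos (of_int (1 - int k) * x) + cos (of_int (1 + int k) * x)))"
    by (intro trig_poly_cmult trig_poly_add trig_poly_cos)
  moreover have "(\<lambda>x. (1/2) * (cos (of_int (1 - int k) * x) + cos (of_int (1 + int k) * x))) = (\<lambda>x. cos x * cos (real k * x))"
    by (simp add: fun_eq_iff cos_times_cos left_diff_distrib distrib_right)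
  ultimately show "trig_poly (\<lambda>x. cos x * cos (real k * x))" by simp
  have "trig_poly (\<lambda>x. (1/2) * (sin (of_int (1 + int k) * x) + (-1) * sin (of_int (1 - int k) * x)))"
    by (intro trig_poly_cmult trig_poly_add trig_poly_sin)
  moreover have "(\<lambda>x. (1/2) * (sin (of_int (1 + int k) * x) + (-1) * sin (of_int (1 - int k) * x))) = (\<lambda>x. cos x * sin (real k * x))"
    by (simp add: fun_eq_iff cos_times_sin left_diff_distrib distrib_right)
  ultimately show "trig_poly (\<lambda>x. cos x * sin (real k * x))" by simp
qed

lemma trig_poly_sin_mult: "trig_poly f ==> trig_poly (\<lambda>x. sin x * f x)"
proof (rule trig_poly_mult_aux)
  fix k
  have "trig_poly (\<lambda>x. (1/2) * (sin (of_int (1 + int k) * x) + sin (of_int (1 - int k) * x)))"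
    by (intro trig_poly_cmult trig_poly_add trig_poly_sin)
  moreover have "(\<lambda>x. (1/2) * (sin (of_int (1 + int k) * x) + sin (of_int (1 - int k) * x))) = (\<lambda>x. sin x * cos (real k * x))"
    by (simp add: fun_eq_iff sin_times_cos left_diff_distrib distrib_right)
  ultimately show "trig_poly (\<lambda>x. sin x * cos (real k * x))" by simp
  have "trig_poly (\<lambda>x. (1/2) * (cos (of_int (1 - int k) * x) + (-1) * cos (of_int (1 + int k) * x)))"
    by (intro trig_poly_cmult trig_poly_add trig_poly_cos)
  moreover have "(\<lambda>x. (1/2) * (cos (of_int (1 - int k) * x) + (-1) * cos (of_int (1 + int k) * x))) = (\<lambda>x. sin x * sin (real k * x))"
    by (simp add: fun_eq_iff sin_times_sin left_diff_distrib distrib_right)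
  ultimately show "trig_poly (\<lambda>x. sin x * sin (real k * x))" by simp
qed

lemma trig_poly_polynomial_cos:
  assumes "real_polynomial_function p"
  shows "trig_poly (\<lambda>x. p (cos x))"
proof -
  obtain a n where p: "p = (\<lambda>x. \<Sum>i\<le>n. a i * x ^ i)"
    using assms unfolding real_polynomial_function_iff_sum by blast
  have "trig_poly (\<lambda>x. cos x ^ i)" for i
  proof (induction i)
    case 0 show ?case using trig_poly_cos[of 0] by simp
  next
    case (Suc i) from trig_poly_cos_mult[OF Suc] show ?case by simp
  qed
  then show ?thesis unfolding p by (intro trig_poly_sum trig_poly_cmult)
qed

text \<open>
  An even function of \<open>x\<close> is a continuous function of \<open>cos x\<close>, hence a
  uniform limit of polynomials in \<open>cos x\<close>. An odd function is \<open>sin x\<close>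
  times an even one; that quotient is continuous because \<open>g\<close> vanishes near the
  zeros of the sine.
\<close>

lemma trig_poly_approx_cutoff:
  fixes g :: "real => real"
  assumes g: "continuous_on {-pi..pi} g" and c: "c > 0" and e: "e > 0"
    and cut: "\<And>x. x \<in> {-pi..pi} ==> \<bar>sin x\<bar> \<le> c ==> g x = 0"
  shows "\<exists>T. trig_poly T \<and> (\<forall>x\<in>{-pi..pi}. \<bar>g x - T x\<bar> < e)"
proof -
  define ge where "ge = (\<lambda>x. (g x + g (- x)) / 2)"
  define go where "go = (\<lambda>x. ((g x - g (- x)) / 2) * (sin x / max (c^2) ((sin x)^2)))"
  have gm: "continuous_on {0..pi} (\<lambda>x. g (- x))" "continuous_on {0..pi} g"
    by (auto intro!: continuous_on_compose2[OF g] continuous_intros continuous_on_subset[OF g])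
  have ce: "continuous_on {0..pi} ge" unfolding ge_def by (intro continuous_intros gm) auto
  have co: "continuous_on {0..pi} go" unfolding go_def
  proof (intro continuous_intros gm)
    have "max (c^2) z > 0" for z using c by (simp add: less_max_iff_disj)
    then show "\<forall>x\<in>{0..pi}. max (c^2) ((sin x)^2) \<noteq> 0" by (metis less_irrefl)
  qed auto
  have ac: "continuous_on {-1..1} (\<lambda>y. ge (arccos y))" "continuous_on {-1..1} (\<lambda>y. go (arccos y))"
    by (auto intro!: continuous_on_compose2[OF ce] continuous_on_compose2[OF co] continuous_on_arccos' arccos_lbound arccos_ubound)
  obtain p1 where p1: "real_polynomial_function p1" "\<And>y. y \<in> {-1..1} ==> \<bar>ge (arccos y) - p1 y\<bar> < e/2"
    using Stone_Weierstrass_real_polynomial_function[OF compact_Icc ac(1), of "e/2"] e by auto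
  obtain p2 where p2: "real_polynomial_function p2" "\<And>y. y \<in> {-1..1} ==> \<bar>go (arccos y) - p2 y\<bar> < e/2"
    using Stone_Weierstrass_real_polynomial_function[OF compact_Icc ac(2), of "e/2"] e by auto
  define T where "T = (\<lambda>x. p1 (cos x) + sin x * p2 (cos x))"
  have "trig_poly T" unfolding T_def
    by (intro trig_poly_add trig_poly_sin_mult trig_poly_polynomial_cos p1 p2)
  moreover have "\<bar>g x - T x\<bar> < e" if x: "x \<in> {-pi..pi}" for x
  proof -
    have even: "ge \<bar>x\<bar> = ge x" unfolding ge_def by (auto simp: abs_if)
    have even': "go \<bar>x\<bar> = go x" unfolding go_def by (auto simp: abs_if algebra_simps diff_divide_distrib)
    have arc: "arccos (cos x) = \<bar>x\<bar>"
      using arccos_cos[of "\<bar>x\<bar>"] x by (auto simp: abs_if)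
    have dec: "g x = ge x + sin x * go x"
    proof (cases "\<bar>sin x\<bar> \<le> c")
      case True
      then show ?thesis using cut[of x] cut[of "-x"] x by (auto simp: ge_def go_def)
    next
      case False
      then have "c^2 \<le> (sin x)^2" using c by (metis abs_le_square_iff abs_of_pos linear)
      moreover have "sin x \<noteq> 0" using False c by auto
      ultimately show ?thesis by (simp add: ge_def go_def max_def power2_eq_square field_simps)
    qed
    have b1: "\<bar>ge x - p1 (cos x)\<bar> < e/2" using p1(2)[of "cos x"] arc even by simp
    have b2: "\<bar>go x - p2 (cos x)\<bar> < e/2" using p2(2)[of "cos x"] arc even' by simp
    have "g x - T x = (ge x - p1 (cos x)) + sin x * (go x - p2 (cos x))"
      using dec by (simp add: T_def algebra_simps)
    also have "\<bar>\<dots>\<bar> \<le> \<bar>ge x - p1 (cos x)\<bar> + \<bar>sin x\<bar> * \<bar>go x - p2 (cos x)\<bar>"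
      by (metis abs_mult abs_triangle_ineq)
    also have "\<dots> \<le> \<bar>ge x - p1 (cos x)\<bar> + 1 * \<bar>go x - p2 (cos x)\<bar>"
      by (intro add_left_mono mult_right_mono) auto
    also have "\<dots> < e" using b1 b2 by simp
    finally show ?thesis .
  qed
  ultimately show ?thesis by blast
qed

text \<open>
  A measurable function is almost everywhere a limit of continuous functions. Truncating the
  values at height \<open>K\<close> and cutting off near the zeros of the sine makes dominated
  convergence applicable.
\<close>

lemma L2_torus_cutoff_approx:
  assumes f: "L2_torus f" and e: "e > 0"
  shows "\<exists>g c. continuous_on UNIV g \<and> c > 0 \<and> (\<forall>x. \<bar>sin x\<bar> \<le> c \<longrightarrow> g x = 0) \<and>
    (LINT x|torus. (f x - g x)^2) < e"
proof -
  have fm: "f \<in> borel_measurable torus" and fi: "integrable torus (\<lambda>x. (f x)^2)" using f by (auto simp: L2_torus_def)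
  obtain Z h where Z: "negligible Z" and h: "\<And>n. continuous_on UNIV (h n)"
    and lim: "\<And>x. x \<notin> Z ==> (\<lambda>n. h n x) \<longlonglongrightarrow> (if x \<in> {-pi..pi} then f x else 0)"
    using fm measurable_on_iff_borel_measurable[of "{-pi..pi}" f] unfolding measurable_on_def by auto
  define clamp where "clamp = (\<lambda>K y :: real. max (- K) (min K y))"
  have cb: "\<bar>clamp K y\<bar> \<le> K" if "K \<ge> 0" for K y using that by (auto simp: clamp_def)
  have cc: "continuous_on UNIV (clamp K)" for K unfolding clamp_def by (intro continuous_intros)
  have clampm [measurable]: "clamp K \<in> borel_measurable borel" for K
    by (intro borel_measurable_continuous_onI cc)
  have AEs: "AE x in torus. sin x \<noteq> 0"
  proof -
    have "AE x in lebesgue. x \<notin> {-pi, 0, pi}"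
      by (rule AE_not_in) (simp flip: negligible_iff_null_sets)
    then have "AE x in torus. x \<notin> {-pi, 0, pi}"
      by (auto simp: AE_restrict_space_iff elim: eventually_mono)
    moreover have "AE x in torus. x \<in> {-pi..pi}" by (rule AE_I2) simp
    ultimately show ?thesis
    proof eventually_elim
      case (elim x)
      then show ?case using sin_gt_zero[of x] sin_gt_zero[of "-x"] by (cases "x > 0") auto
    qed
  qed
  have AEZ: "AE x in torus. x \<notin> Z"
  proof -
    have "AE x in lebesgue. x \<notin> Z" using Z AE_not_in negligible_iff_null_sets by blast
    then show ?thesis by (auto simp: AE_restrict_space_iff elim: eventually_mono)
  qed
  have "(\<lambda>K. LINT x|torus. (f x - clamp (real K) (f x))^2) \<longlonglongrightarrow> (LINT x|torus. 0)"
  proof (rule integral_dominated_convergence[where w="\<lambda>x. (f x)^2"])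
    show "(\<lambda>x. (f x - clamp (real K) (f x))^2) \<in> borel_measurable torus" for K using fm by measurable
    show "AE x in torus. (\<lambda>K. (f x - clamp (real K) (f x))^2) \<longlonglongrightarrow> 0"
    proof (rule AE_I2)
      fix x
      obtain n :: nat where n: "\<bar>f x\<bar> \<le> real n" using real_arch_simple by blast
      have "\<forall>\<^sub>F K in sequentially. (f x - clamp (real K) (f x))^2 = 0"
      proof (rule eventually_sequentiallyI)
        fix K assume "n \<le> K"
        then have "\<bar>f x\<bar> \<le> real K" using n by (meson of_nat_le_iff order_trans)
        then show "(f x - clamp (real K) (f x))^2 = 0" by (auto simp: clamp_def)
      qed
      then show "(\<lambda>K. (f x - clamp (real K) (f x))^2) \<longlonglongrightarrow> 0" by (rule tendsto_eventually)
    qed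
    show "AE x in torus. norm ((f x - clamp (real K) (f x))^2) \<le> (f x)^2" for K
      by (rule AE_I2) (auto simp: clamp_def abs_le_square_iff[symmetric])
  qed (use fi in auto)
  then have "\<forall>\<^sub>F K in sequentially. (LINT x|torus. (f x - clamp (real K) (f x))^2) < e/4"
    using e by (intro order_tendstoD(2)) auto
  then obtain K :: nat where K: "(LINT x|torus. (f x - clamp (real K) (f x))^2) < e/4"
    using eventually_happens'[OF sequentially_bot] by blast
  define \<psi> where "\<psi> = (\<lambda>n x. max 0 (min 1 (real n * \<bar>sin x\<bar> - 1)))"
  have chi: "0 \<le> \<psi> n x" "\<psi> n x \<le> 1" for n x by (auto simp: \<psi>_def)
  have chic: "continuous_on UNIV (\<psi> n)" for n unfolding \<psi>_def by (intro continuous_intros)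
  define G where "G = (\<lambda>n x. clamp (real K) (h n x) * \<psi> n x)"
  have Gc: "continuous_on UNIV (G n)" for n unfolding G_def
    by (intro continuous_intros chic continuous_on_compose2[OF cc h]) auto
  have Gm: "G n \<in> borel_measurable torus" for n
    by (intro continuous_imp_measurable_on_sets_lebesgue continuous_on_subset[OF Gc]) auto
  have "(\<lambda>n. LINT x|torus. (clamp (real K) (f x) - G n x)^2) \<longlonglongrightarrow> (LINT x|torus. 0)"
  proof (rule integral_dominated_convergence[where w="\<lambda>x. (2 * real K)^2"])
    show "(\<lambda>x. (clamp (real K) (f x) - G n x)^2) \<in> borel_measurable torus" for n using fm Gm by measurable
    show "AE x in torus. (\<lambda>n. (clamp (real K) (f x) - G n x)^2) \<longlonglongrightarrow> 0"
      using AEs AEZ AE_space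
    proof eventually_elim
      case (elim x)
      have "(\<lambda>n. h n x) \<longlonglongrightarrow> f x" using lim[of x] elim by simp
      then have 1: "(\<lambda>n. clamp (real K) (h n x)) \<longlonglongrightarrow> clamp (real K) (f x)"
        unfolding clamp_def by (intro tendsto_intros)
      obtain m :: nat where m: "2 / \<bar>sin x\<bar> \<le> real m" using real_arch_simple by blast
      have "\<forall>\<^sub>F n in sequentially. \<psi> n x = 1"
      proof (rule eventually_sequentiallyI)
        fix n assume "m \<le> n"
        then have "2 / \<bar>sin x\<bar> \<le> real n" using m by (meson of_nat_le_iff order_trans)
        then have "2 \<le> real n * \<bar>sin x\<bar>" using elim by (simp add: field_simps)
        then show "\<psi> n x = 1" by (auto simp: \<psi>_def)
      qed
      then have 2: "(\<lambda>n. \<psi> n x) \<longlonglongrightarrow> 1" by (rule tendsto_eventually)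
      have "(\<lambda>n. (clamp (real K) (f x) - G n x)^2) \<longlonglongrightarrow> (clamp (real K) (f x) - clamp (real K) (f x) * 1)^2"
        unfolding G_def by (intro tendsto_intros 1 2)
      then show ?case by simp
    qed
    show "AE x in torus. norm ((clamp (real K) (f x) - G n x)^2) \<le> (2 * real K)^2" for n
    proof (rule AE_I2)
      fix x
      have "\<bar>G n x\<bar> \<le> real K * 1" unfolding G_def abs_mult using chi[of n x] cb[of "real K"]
        by (intro mult_mono) auto
      then have "\<bar>clamp (real K) (f x) - G n x\<bar> \<le> \<bar>2 * real K\<bar>" using cb[of "real K" "f x"] by linarith
      then have "(clamp (real K) (f x) - G n x)^2 \<le> (2 * real K)^2" by (simp only: abs_le_square_iff)
      then show "norm ((clamp (real K) (f x) - G n x)^2) \<le> (2 * real K)^2" by simp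
    qed
  qed auto
  then have "\<forall>\<^sub>F n in sequentially. (LINT x|torus. (clamp (real K) (f x) - G n x)^2) < e/4"
    using e by (intro order_tendstoD(2)) auto
  then have "\<forall>\<^sub>F n in sequentially. n > 0 \<and> (LINT x|torus. (clamp (real K) (f x) - G n x)^2) < e/4"
    using eventually_gt_at_top[of "0::nat"] by eventually_elim auto
  then obtain n where n: "n > 0" "(LINT x|torus. (clamp (real K) (f x) - G n x)^2) < e/4"
    using eventually_happens'[OF sequentially_bot] by blast
  have LG: "L2_torus (G n)" by (intro L2_torus_continuous continuous_on_subset[OF Gc]) auto
  have Lc: "L2_torus (\<lambda>x. clamp (real K) (f x))"
    by (rule L2_torus_bounded[of _ "real K"]) (use fm cb in auto)
  have "(LINT x|torus. (f x - G n x)^2) \<le> 2 * (LINT x|torus. (f x - clamp (real K) (f x))^2) + 2 * (LINT x|torus. (clamp (real K) (f x) - G n x)^2)"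
    by (rule lint_sq_diff_le[OF f Lc LG])
  also have "\<dots> < e" using K n by simp
  finally have "(LINT x|torus. (f x - G n x)^2) < e" .
  moreover have "G n x = 0" if "\<bar>sin x\<bar> \<le> 1 / real n" for x
  proof -
    have "real n * \<bar>sin x\<bar> \<le> 1" using that n by (simp add: field_simps)
    then show ?thesis by (simp add: G_def \<psi>_def)
  qed
  ultimately show ?thesis using Gc n by (intro exI[of _ "G n"] exI[of _ "1 / real n"]) auto
qed

text \<open>
  Trigonometric polynomials are dense in the square integrable functions, and the Fourier sums
  are at least as close to \<open>f\<close> as any of them.
\<close>

theorem fourier_sum_tendsto:
  assumes f: "L2_torus f"
  shows "(\<lambda>n. LINT x|torus. (f x - fourier_sum n f x)^2) \<longlonglongrightarrow> 0"
proof (rule LIMSEQ_I)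
  fix e :: real assume e: "e > 0"
  obtain g c where g: "continuous_on UNIV g" "c > 0" "\<And>x. \<bar>sin x\<bar> \<le> c ==> g x = 0"
    "(LINT x|torus. (f x - g x)^2) < e / 4" using L2_torus_cutoff_approx[OF f, of "e/4"] e by auto
  define r where "r = sqrt (e / (16 * pi))"
  have r: "r > 0" "r^2 = e / (16 * pi)" using e by (auto simp: r_def)
  have gc: "continuous_on {-pi..pi} g" by (rule continuous_on_subset[OF g(1)]) auto
  obtain T where T: "trig_poly T" "\<And>x. x \<in> {-pi..pi} ==> \<bar>g x - T x\<bar> < r"
    using trig_poly_approx_cutoff[OF gc g(2) r(1)] g(3) by blast
  then obtain m a b where m: "T = trig_sum m a b" unfolding trig_poly_def by blast
  have LT: "L2_torus T" unfolding m by (rule L2_torus_trig_sum)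
  have Lg: "L2_torus g" by (rule L2_torus_continuous[OF gc])
  have "(LINT x|torus. (g x - T x)^2) \<le> (LINT x|torus. r^2)"
  proof (rule integral_mono)
    fix x assume "x \<in> space torus"
    then have "\<bar>g x - T x\<bar> \<le> \<bar>r\<bar>" using T(2)[of x] by simp
    then show "(g x - T x)^2 \<le> r^2" by (simp add: abs_le_square_iff)
  qed (use L2_torus_diff[OF Lg LT] in \<open>auto simp: L2_torus_def\<close>)
  then have "(LINT x|torus. (f x - T x)^2) \<le> 2 * (LINT x|torus. (f x - g x)^2) + 2 * (2 * pi * r^2)"
    using lint_sq_diff_le[OF f Lg LT] by simp
  also have "\<dots> < e" using g(4) r e by (simp add: field_simps)
  finally have lt: "(LINT x|torus. (f x - T x)^2) < e" .
  show "\<exists>no. \<forall>n\<ge>no. norm ((LINT x|torus. (f x - fourier_sum n f x)^2) - 0) < e"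
  proof (intro exI allI impI)
    fix n assume "m \<le> n"
    have "(LINT x|torus. (f x - fourier_sum n f x)^2) < e"
      using fourier_sum_best[OF f \<open>m \<le> n\<close>, of a b] lt by (simp add: m)
    then show "norm ((LINT x|torus. (f x - fourier_sum n f x)^2) - 0) < e"
      by (simp add: Bochner_Integration.integral_nonneg)
  qed
qed

corollary fourier_energy_tendsto:
  assumes f: "L2_torus f"
  shows "(\<lambda>n. fourier_energy n f) \<longlonglongrightarrow> (LINT x|torus. (f x)^2)"
  using tendsto_diff[OF tendsto_const[of "LINT x|torus. (f x)^2"] fourier_sum_tendsto[OF f]]
  by (simp add: lint_diff_fourier_sum[OF f])

lemma AE_zero_if_coeffs_zero:
  assumes f: "L2_torus f" and "\<And>k. fourier_cos f k = 0" "\<And>k. fourier_sin f k = 0"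
  shows "AE x in torus. f x = 0"
proof -
  have "fourier_energy n f = 0" for n by (simp add: fourier_energy_def assms)
  then have "(LINT x|torus. (f x)^2) = 0"
    using fourier_energy_tendsto[OF f] by (simp add: LIMSEQ_const_iff)
  then have "AE x in torus. (f x)^2 = 0"
    using f integral_nonneg_eq_0_iff_AE[of torus "\<lambda>x. (f x)^2"] by (auto simp: L2_torus_def)
  then show ?thesis by simp
qed

lemma primitive_on_cong:
  assumes "primitive_on a b f g" "\<And>x. x \<in> {a..b} ==> f x = f' x"
  shows "primitive_on a b f' g"
  using assms unfolding primitive_on_def by (metis atLeastAtMost_iff order_trans)

section \<open>Weak derivatives on the torus\<close>

lemma test_fun_has_derivative:
  assumes "test_fun \<phi>" shows "(\<phi> has_real_derivative deriv \<phi> x) (at x)"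
  using assms unfolding test_fun_def
  by (metis DERIV_deriv_iff_field_differentiable funpow_0)

lemma test_fun_periodic: "test_fun \<phi> ==> \<phi> (x + 2 * pi) = \<phi> x"
  by (auto simp: test_fun_def periodic_def periodic_fun_simple_def)

lemma test_fun_deriv:
  assumes "test_fun \<phi>" shows "test_fun (deriv \<phi>)"
  unfolding test_fun_def
proof (intro conjI allI)
  fix n x show "(deriv ^^ n) (deriv \<phi>) field_differentiable at x"
    using assms unfolding test_fun_def by (metis funpow_Suc_right comp_apply)
next
  have "deriv \<phi> (x + 2 * pi) = deriv \<phi> x" for x
  proof -
    have "((\<lambda>y. \<phi> (y + 2 * pi)) has_real_derivative deriv \<phi> (x + 2 * pi)) (at x)"
      using test_fun_has_derivative[OF assms, of "x + 2 * pi"] DERIV_shift[of \<phi> _ x "2 * pi"] by simp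
    then have "(\<phi> has_real_derivative deriv \<phi> (x + 2 * pi)) (at x)"
      by (simp add: test_fun_periodic[OF assms])
    then show ?thesis by (metis DERIV_imp_deriv)
  qed
  then show "periodic (deriv \<phi>)" by (simp add: periodic_def periodic_fun_simple_def)
qed

lemma test_fun_continuous: "test_fun \<phi> ==> continuous_on S \<phi>"
  by (meson DERIV_continuous_on has_field_derivative_at_within test_fun_has_derivative)

lemma test_fun_ends: "test_fun \<phi> ==> \<phi> pi = \<phi> (-pi)"
  using test_fun_periodic[of \<phi> "-pi"] by simp

lemma test_fun_trig: "test_fun (\<lambda>x. a * cos (real k * x) + b * sin (real k * x))"
  unfolding test_fun_def
proof (intro conjI allI)
  show "periodic (\<lambda>x. a * cos (real k * x) + b * sin (real k * x))"
    unfolding periodic_def periodic_fun_simple_def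
  proof
    fix x
    have "real k * (x + 2 * pi) = real k * x + real k * (2 * of_real pi)" by (simp add: algebra_simps)
    then have "cos (real k * (x + 2 * pi)) = cos (real k * x)" "sin (real k * (x + 2 * pi)) = sin (real k * x)"
      using cos.plus_of_nat[of "real k * x" k] sin.plus_of_nat[of "real k * x" k] by simp_all
    then show "a * cos (real k * (x + 2 * pi)) + b * sin (real k * (x + 2 * pi)) = a * cos (real k * x) + b * sin (real k * x)" by simp
  qed
  have der: "((\<lambda>x. a * cos (real k * x) + b * sin (real k * x)) has_real_derivative
      (real k * b) * cos (real k * x) + (- real k * a) * sin (real k * x)) (at x)" for a b x
    by (auto intro!: derivative_eq_intros simp: algebra_simps)
  have "\<exists>a' b'. (deriv ^^ n) (\<lambda>x. a * cos (real k * x) + b * sin (real k * x)) = (\<lambda>x. a' * cos (real k * x) + b' * sin (real k * x))" for n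
  proof (induction n)
    case (Suc n)
    then obtain a' b' where e: "(deriv ^^ n) (\<lambda>x. a * cos (real k * x) + b * sin (real k * x)) = (\<lambda>x. a' * cos (real k * x) + b' * sin (real k * x))" by blast
    have "deriv (\<lambda>x. a' * cos (real k * x) + b' * sin (real k * x)) = (\<lambda>x. (real k * b') * cos (real k * x) + (- real k * a') * sin (real k * x))"
      using DERIV_imp_deriv[OF der[of a' b']] by blast
    then have "(deriv ^^ Suc n) (\<lambda>x. a * cos (real k * x) + b * sin (real k * x)) = (\<lambda>x. (real k * b') * cos (real k * x) + (- real k * a') * sin (real k * x))"
      by (simp only: funpow.simps comp_apply e)
    then show ?case by blast
  qed auto
  note derivs = this
  show "(deriv ^^ n) (\<lambda>x. a * cos (real k * x) + b * sin (real k * x)) field_differentiable at x" for n x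
  proof -
    obtain a' b' where "(deriv ^^ n) (\<lambda>x. a * cos (real k * x) + b * sin (real k * x)) = (\<lambda>x. a' * cos (real k * x) + b' * sin (real k * x))"
      using derivs[of n] by blast
    then show ?thesis using der[of a' b' x] by (auto simp only: field_differentiable_def)
  qed
qed

lemma test_fun_cos: "test_fun (\<lambda>x. cos (real k * x))" and test_fun_sin: "test_fun (\<lambda>x. sin (real k * x))"
  using test_fun_trig[of 1 k 0] test_fun_trig[of 0 k 1] by simp_all

lemma deriv_cos_mult: "deriv (\<lambda>x. cos (real k * x)) = (\<lambda>x. - real k * sin (real k * x))"
  by (intro ext DERIV_imp_deriv) (auto intro!: derivative_eq_intros)

lemma deriv_sin_mult: "deriv (\<lambda>x. sin (real k * x)) = (\<lambda>x. real k * cos (real k * x))"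
  by (intro ext DERIV_imp_deriv) (auto intro!: derivative_eq_intros)

lemma has_weak_deriv_1:
  "has_weak_deriv 1 f g \<longleftrightarrow> (\<forall>\<phi>. test_fun \<phi> \<longrightarrow> (LINT x|torus. f x * deriv \<phi> x) = - (LINT x|torus. g x * \<phi> x))"
  by (simp add: has_weak_deriv_def)

lemma has_weak_deriv_0: "has_weak_deriv 0 f f"
  by (simp add: has_weak_deriv_def)

lemma fourier_cos_weak_deriv: "has_weak_deriv 1 f g ==> fourier_cos g k = real k * fourier_sin f k"
proof -
  assume "has_weak_deriv 1 f g"
  then have "(LINT x|torus. f x * deriv (\<lambda>x. cos (real k * x)) x) = - (LINT x|torus. g x * cos (real k * x))"
    using test_fun_cos[of k] unfolding has_weak_deriv_1 by blast
  then have "(LINT x|torus. f x * (- real k * sin (real k * x))) = - (LINT x|torus. g x * cos (real k * x))"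
    by (simp only: deriv_cos_mult)
  moreover have "(\<lambda>x. f x * (- real k * sin (real k * x))) = (\<lambda>x. (- real k) * (f x * sin (real k * x)))" by auto
  ultimately have "(LINT x|torus. (- real k) * (f x * sin (real k * x))) = - fourier_cos g k" by (simp only: fourier_cos_def)
  then show ?thesis by (simp add: fourier_sin_def)
qed

lemma fourier_sin_weak_deriv: "has_weak_deriv 1 f g ==> fourier_sin g k = - real k * fourier_cos f k"
proof -
  assume "has_weak_deriv 1 f g"
  then have "(LINT x|torus. f x * deriv (\<lambda>x. sin (real k * x)) x) = - (LINT x|torus. g x * sin (real k * x))"
    using test_fun_sin[of k] unfolding has_weak_deriv_1 by blast
  then have "(LINT x|torus. f x * (real k * cos (real k * x))) = - (LINT x|torus. g x * sin (real k * x))"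
    by (simp only: deriv_sin_mult)
  moreover have "(\<lambda>x. f x * (real k * cos (real k * x))) = (\<lambda>x. real k * (f x * cos (real k * x)))" by auto
  ultimately have "(LINT x|torus. real k * (f x * cos (real k * x))) = - fourier_sin g k" by (simp only: fourier_sin_def)
  then show ?thesis by (simp add: fourier_cos_def)
qed

lemma primitive_has_weak_deriv:
  assumes "primitive_on (-pi) pi f g" "f pi = f (-pi)"
  shows "has_weak_deriv 1 f g"
  unfolding has_weak_deriv_1
proof (intro allI impI)
  fix \<phi> assume t: "test_fun \<phi>"
  have "primitive_on (-pi) pi \<phi> (deriv \<phi>)"
    by (rule primitive_on_C1)
       (auto intro: has_field_derivative_at_within test_fun_has_derivative[OF t] test_fun_continuous[OF test_fun_deriv[OF t]])
  from integration_by_parts[OF assms(1) this]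
  show "(LINT x|torus. f x * deriv \<phi> x) = - (LINT x|torus. g x * \<phi> x)"
    using assms(2) test_fun_ends[OF t] by simp
qed

lemma fourier_diff:
  assumes "L2_torus f" "L2_torus g"
  shows "fourier_cos (\<lambda>x. f x - g x) k = fourier_cos f k - fourier_cos g k"
    "fourier_sin (\<lambda>x. f x - g x) k = fourier_sin f k - fourier_sin g k"
  using L2_torus_mult[OF assms(1) L2_torus_cos] L2_torus_mult[OF assms(2) L2_torus_cos]
   L2_torus_mult[OF assms(1) L2_torus_sin] L2_torus_mult[OF assms(2) L2_torus_sin]
  by (simp_all add: fourier_cos_def fourier_sin_def left_diff_distrib)

text \<open>
  Cosines and sines are test functions, so two weak derivatives have the same Fourier
  coefficients.
\<close>

lemma weak_deriv_unique:
  assumes "L2_torus g" "L2_torus g'" "has_weak_deriv j f g" "has_weak_deriv j f g'"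
  shows "AE x in torus. g x = g' x"
proof -
  have eq: "(LINT x|torus. g x * \<phi> x) = (LINT x|torus. g' x * \<phi> x)" if "test_fun \<phi>" for \<phi>
  proof -
    have "(-1) ^ j * (LINT x|torus. g x * \<phi> x) = (-1) ^ j * (LINT x|torus. g' x * \<phi> x)"
      using assms(3)[unfolded has_weak_deriv_def, rule_format, OF that]
        assms(4)[unfolded has_weak_deriv_def, rule_format, OF that] by simp
    then show ?thesis by simp
  qed
  have "AE x in torus. g x - g' x = 0"
    using eq[OF test_fun_cos] eq[OF test_fun_sin]
    by (intro AE_zero_if_coeffs_zero L2_torus_diff assms)
       (simp_all add: fourier_diff[OF assms(1,2)] fourier_cos_def fourier_sin_def)
  then show ?thesis by simp
qed

lemma wderiv_AE_eq:
  assumes "L2_torus g" "has_weak_deriv j f g"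
  shows "AE x in torus. wderiv j f x = g x"
proof -
  have "L2_torus (wderiv j f) \<and> has_weak_deriv j f (wderiv j f)"
    unfolding wderiv_def by (rule someI[of _ g]) (use assms in auto)
  then show ?thesis using weak_deriv_unique assms by blast
qed

lemma wderiv_props:
  assumes "\<exists>g. L2_torus g \<and> has_weak_deriv j f g"
  shows "L2_torus (wderiv j f)" "has_weak_deriv j f (wderiv j f)"
  using someI_ex[OF assms] unfolding wderiv_def by auto

lemma H_torus_wderiv:
  assumes "H_torus k f" "j \<le> k"
  shows "L2_torus (wderiv j f)" "has_weak_deriv j f (wderiv j f)"
  using wderiv_props[of j f] assms by (auto simp: H_torus_def)

text \<open>
  The weak derivative has mean zero, so its primitive is periodic; the difference between
  \<open>f\<close> and that primitive has vanishing Fourier coefficients, once the means are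
  adjusted.
\<close>

lemma weak_deriv_primitive:
  assumes f: "L2_torus f" and g: "L2_torus g" and w: "has_weak_deriv 1 f g"
  obtains F where "primitive_on (-pi) pi F g" "F pi = F (-pi)" "AE x in torus. f x = F x"
proof -
  define F0 where "F0 = (\<lambda>x. 0 + (LINT s|lebesgue_on {-pi..x}. g s))"
  have p0: "primitive_on (-pi) pi F0 g" unfolding F0_def
    by (intro primitive_on_indefinite L2_torus_integrable g)
  have "(LINT x|torus. g x) = 0" using fourier_cos_weak_deriv[OF w, of 0] by (simp add: fourier_cos_def)
  then have ends0: "F0 pi = F0 (-pi)" using primitive_onD[OF p0, of "-pi" pi] by simp
  have L0: "L2_torus F0" by (rule L2_torus_continuous[OF primitive_on_continuous[OF p0]])
  define c where "c = (fourier_cos f 0 - fourier_cos F0 0) / (2 * pi)"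
  define F where "F = (\<lambda>x. c + (LINT s|lebesgue_on {-pi..x}. g s))"
  have p: "primitive_on (-pi) pi F g" unfolding F_def
    by (intro primitive_on_indefinite L2_torus_integrable g)
  have FF: "F x = c + F0 x" for x by (simp add: F_def F0_def)
  have ends: "F pi = F (-pi)" using ends0 FF by simp
  have L: "L2_torus F" by (rule L2_torus_continuous[OF primitive_on_continuous[OF p]])
  have wF: "has_weak_deriv 1 F g" by (rule primitive_has_weak_deriv[OF p ends])
  have "fourier_cos F 0 = fourier_cos f 0"
  proof -
    have "fourier_cos F 0 = (LINT x|torus. c + F0 x)" by (simp add: fourier_cos_def FF)
    also have "\<dots> = 2 * pi * c + (LINT x|torus. F0 x)"
      using L2_torus_integrable[OF L0] by simp
    also have "\<dots> = fourier_cos f 0" by (simp add: c_def) (simp add: fourier_cos_def)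
    finally show ?thesis .
  qed
  then have "fourier_cos F k = fourier_cos f k" for k
    using fourier_sin_weak_deriv[OF w, of k] fourier_sin_weak_deriv[OF wF, of k] by (cases "k = 0") auto
  moreover have "fourier_sin F k = fourier_sin f k" for k
    using fourier_cos_weak_deriv[OF w, of k] fourier_cos_weak_deriv[OF wF, of k] by (cases "k = 0") auto
  ultimately have "AE x in torus. f x - F x = 0"
    by (intro AE_zero_if_coeffs_zero L2_torus_diff f L) (simp_all add: fourier_diff[OF f L])
  then have "AE x in torus. f x = F x" by simp
  then show ?thesis using that p ends by blast
qed

lemma AE_torus_eq_continuous:
  assumes f: "continuous_on {-pi..pi} f" and g: "continuous_on {-pi..pi} g" and ae: "AE x in torus. f x = (g x :: real)"
    and x: "x \<in> {-pi..pi}"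
  shows "f x = g x"
proof -
  have c: "continuous_on {-pi..pi} (\<lambda>x. \<bar>f x - g x\<bar>)" by (intro continuous_intros f g)
  have "((\<lambda>x. \<bar>f x - g x\<bar>) has_integral 0) {-pi..pi}"
  proof -
    have "integral {-pi..pi} (\<lambda>x. \<bar>f x - g x\<bar>) = (LINT x|torus. \<bar>f x - g x\<bar>)"
      by (intro lebesgue_integral_eq_integral[symmetric] integrable_torus_continuous c) auto
    also have "\<dots> = (LINT x|torus. 0)" using ae
      continuous_imp_measurable_on_sets_lebesgue[OF c]
      by (intro Bochner_Integration.integral_cong_AE) auto
    finally show ?thesis using integrable_continuous_real[OF c] by (simp add: has_integral_iff)
  qed
  then have "\<bar>f x - g x\<bar> = 0"
    using has_integral_0_cbox_imp_0[of "-pi" pi "\<lambda>x. \<bar>f x - g x\<bar>" x] c x pi_gt_zero by (auto simp: not_le)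
  then show ?thesis by simp
qed

lemma lint_subinterval_cong_AE:
  fixes a b c d :: real and f g :: "real => real"
  assumes "AE x in lebesgue_on {a..b}. f x = (g x :: real)" "{c..d} \<subseteq> {a..b}"
    "f \<in> borel_measurable (lebesgue_on {a..b})" "g \<in> borel_measurable (lebesgue_on {a..b})"
  shows "(LINT x|lebesgue_on {c..d}. f x) = (LINT x|lebesgue_on {c..d}. g x)"
proof (rule Bochner_Integration.integral_cong_AE)
  show "f \<in> borel_measurable (lebesgue_on {c..d})" "g \<in> borel_measurable (lebesgue_on {c..d})"
    using assms(2-4) measurable_restrict_mono by blast+
  show "AE x in lebesgue_on {c..d}. f x = g x"
  proof -
    have "AE x in lebesgue. x \<in> {a..b} \<longrightarrow> f x = g x"
      using assms(1) by (subst (asm) AE_restrict_space_iff) auto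
    then have "AE x in lebesgue. x \<in> {c..d} \<longrightarrow> f x = g x"
      by eventually_elim (use assms(2) in blast)
    then show ?thesis by (subst AE_restrict_space_iff) auto
  qed
qed

lemma primitive_on_cong_AE:
  assumes p: "primitive_on a b f g" and ae: "AE x in lebesgue_on {a..b}. g x = g' x"
    and m: "g' \<in> borel_measurable (lebesgue_on {a..b})"
  shows "primitive_on a b f g'"
  unfolding primitive_on_def
proof (intro conjI allI impI)
  have mg: "g \<in> borel_measurable (lebesgue_on {a..b})" using primitive_on_integrable[OF p] by auto
  show "integrable (lebesgue_on {a..b}) g'"
    using Bochner_Integration.integrable_cong_AE[OF mg m ae] primitive_on_integrable[OF p] by simp
  fix x y assume "a \<le> x \<and> x \<le> y \<and> y \<le> b"
  then show "f y - f x = integral\<^sup>L (lebesgue_on {x..y}) g'"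
    using primitive_onD[OF p, of x y] lint_subinterval_cong_AE[OF ae _ mg m, of x y] by auto
qed

text \<open>
  A function of class \<open>H\<^sup>2\<close> on the circle, given by its continuous
  representative, the continuous representative of its derivative and a second derivative. The
  conditions at the end points make both continuous representatives periodic.
\<close>

definition H2_chain :: "(real => real) => (real => real) => (real => real) => bool" where
  "H2_chain f f' f'' \<longleftrightarrow> primitive_on (-pi) pi f f' \<and> primitive_on (-pi) pi f' f'' \<and>
     f pi = f (-pi) \<and> f' pi = f' (-pi) \<and> L2_torus f''"

lemma has_weak_deriv_2:
  assumes "has_weak_deriv 1 f f'"
  shows "has_weak_deriv 2 f f'' \<longleftrightarrow> has_weak_deriv 1 f' f''"
proof -
  have "(LINT x|torus. f' x * deriv \<phi> x) = - (LINT x|torus. f x * deriv (deriv \<phi>) x)" if "test_fun \<phi>" for \<phi>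
    using has_weak_deriv_1[THEN iffD1, OF assms, rule_format, OF test_fun_deriv[OF that]] by simp
  then show ?thesis
    unfolding has_weak_deriv_1 by (auto simp: has_weak_deriv_def numeral_2_eq_2)
qed

text \<open>
  Transfers the arbitrary choice made in the definition of the weak derivatives to the members
  of the chain.
\<close>

lemma H2_chain_weak:
  assumes "H2_chain f f' f''"
  shows "H_torus 2 f" "AE x in torus. wderiv 0 f x = f x" "AE x in torus. wderiv 1 f x = f' x" "AE x in torus. wderiv 2 f x = f'' x"
proof -
  have p: "primitive_on (-pi) pi f f'" "primitive_on (-pi) pi f' f''" "f pi = f (-pi)" "f' pi = f' (-pi)" "L2_torus f''"
    using assms by (auto simp: H2_chain_def)
  have L: "L2_torus f" "L2_torus f'" using p(1,2) by (auto intro: L2_torus_continuous primitive_on_continuous)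
  have w1: "has_weak_deriv 1 f f'" and w2': "has_weak_deriv 1 f' f''" using p primitive_has_weak_deriv by auto
  then have w2: "has_weak_deriv 2 f f''" using has_weak_deriv_2[OF w1] by simp
  have "j = 0 \<or> j = 1 \<or> j = 2" if "j \<le> 2" for j :: nat using that by auto
  then show "H_torus 2 f" unfolding H_torus_def using L p(5) w1 w2 has_weak_deriv_0 by blast
  show "AE x in torus. wderiv 0 f x = f x" "AE x in torus. wderiv 1 f x = f' x" "AE x in torus. wderiv 2 f x = f'' x"
    by (intro wderiv_AE_eq L p w1 w2 has_weak_deriv_0)+
qed

lemma H2_chain_exists:
  assumes H: "H_torus 2 f" and c: "continuous_on {-pi..pi} f"
  obtains f' f'' where "H2_chain f f' f''"
proof -
  have L: "L2_torus f" using H by (simp add: H_torus_def)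
  define g1 g2 where "g1 = wderiv 1 f" "g2 = wderiv 2 f"
  have g: "L2_torus g1" "L2_torus g2" "has_weak_deriv 1 f g1" "has_weak_deriv 2 f g2"
    unfolding g1_g2_def by (intro H_torus_wderiv[OF H]; simp)+
  then have w12: "has_weak_deriv 1 g1 g2" using has_weak_deriv_2 by blast
  obtain f' where f': "primitive_on (-pi) pi f' g2" "f' pi = f' (-pi)" "AE x in torus. g1 x = f' x"
    using weak_deriv_primitive[OF g(1,2) w12] .
  obtain F where F: "primitive_on (-pi) pi F g1" "F pi = F (-pi)" "AE x in torus. f x = F x"
    using weak_deriv_primitive[OF L g(1,3)] .
  have eq: "f x = F x" if "x \<in> {-pi..pi}" for x
    by (rule AE_torus_eq_continuous[OF c primitive_on_continuous[OF F(1)] F(3) that])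
  have "primitive_on (-pi) pi f g1" by (rule primitive_on_cong[OF F(1)]) (simp add: eq)
  then have "primitive_on (-pi) pi f f'"
    by (rule primitive_on_cong_AE[OF _ f'(3)])
       (intro continuous_imp_measurable_on_sets_lebesgue primitive_on_continuous[OF f'(1)], simp)
  then show ?thesis using that f' eq F(2) g(2) by (auto simp: H2_chain_def)
qed

lemma lyapunov_chain:
  assumes "H2_chain f f' f''" and fp: "\<And>x. x \<in> {-pi..pi} ==> f x > 0"
  shows "lyapunov f = (LINT x|torus. (f x * f'' x - (f' x)^2)^2 / (f x * ((f x)^2 + (f' x)^2)))"
    "growth_rate f = (LINT x|torus. (f x * f'' x - (f' x)^2)^2 / ((f x)^2 + (f' x)^2)^2)"
proof -
  have p: "primitive_on (-pi) pi f f'" "primitive_on (-pi) pi f' f''" "f pi = f (-pi)" "f' pi = f' (-pi)" "L2_torus f''"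
    using assms(1) by (auto simp: H2_chain_def)
  have [measurable]: "f \<in> borel_measurable torus" "f' \<in> borel_measurable torus" "f'' \<in> borel_measurable torus"
    using p by (auto intro!: continuous_imp_measurable_on_sets_lebesgue primitive_on_continuous simp: L2_torus_def)
  note H = H2_chain_weak[OF assms(1)]
  have [measurable]: "wderiv 1 f \<in> borel_measurable torus" "wderiv 2 f \<in> borel_measurable torus"
    using H_torus_wderiv[OF H(1), of 1] H_torus_wderiv[OF H(1), of 2] by (auto simp: L2_torus_def)
  show "lyapunov f = (LINT x|torus. (f x * f'' x - (f' x)^2)^2 / (f x * ((f x)^2 + (f' x)^2)))"
    unfolding lyapunov_def
    by (rule Bochner_Integration.integral_cong_AE; (measurable)?; use H(3,4) in eventually_elim; simp)
  show "growth_rate f = (LINT x|torus. (f x * f'' x - (f' x)^2)^2 / ((f x)^2 + (f' x)^2)^2)"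
    unfolding growth_rate_def
    by (rule Bochner_Integration.integral_cong_AE; (measurable)?; use H(3,4) in eventually_elim; simp)
qed

section \<open>Dyadic difference quotients\<close>

lemma fatou_real:
  fixes F :: "nat => 'a => real"
  assumes i: "\<And>n. integrable M (F n)" and pos: "\<And>n x. x \<in> space M ==> 0 \<le> F n x" and m: "f \<in> borel_measurable M"
    and lim: "AE x in M. (\<lambda>n. F n x) \<longlonglongrightarrow> f x" and le: "\<forall>\<^sub>F n in sequentially. (LINT x|M. F n x) \<le> C"
  shows "integrable M f" "(LINT x|M. f x) \<le> C"
proof -
  have fpos: "AE x in M. 0 \<le> f x"
    using lim AE_space
  proof eventually_elim
    case (elim x)
    show ?case by (rule LIMSEQ_le_const[OF elim(1)]) (use pos elim in auto)
  qed
  have C: "C \<ge> 0"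
  proof -
    obtain n where "(LINT x|M. F n x) \<le> C" using eventually_happens'[OF sequentially_bot le] by blast
    moreover have "0 \<le> (LINT x|M. F n x)" by (intro Bochner_Integration.integral_nonneg pos)
    ultimately show ?thesis by linarith
  qed
  have "(\<integral>\<^sup>+x. ennreal (f x) \<partial>M) = (\<integral>\<^sup>+x. liminf (\<lambda>n. ennreal (F n x)) \<partial>M)"
  proof (rule nn_integral_cong_AE, use lim in eventually_elim)
    case (elim x)
    have "(\<lambda>n. ennreal (F n x)) \<longlonglongrightarrow> ennreal (f x)" by (intro tendsto_ennrealI elim)
    then show ?case by (simp add: lim_imp_Liminf)
  qed
  also have "\<dots> \<le> liminf (\<lambda>n. \<integral>\<^sup>+x. ennreal (F n x) \<partial>M)"
    by (rule nn_integral_liminf) (use i in auto)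
  also have "\<dots> = liminf (\<lambda>n. ennreal (LINT x|M. F n x))"
    by (intro arg_cong[where f=liminf] ext nn_integral_eq_integral i AE_I2 pos)
  also have "\<dots> \<le> liminf (\<lambda>n. ennreal C)"
    by (rule Liminf_mono) (use le in \<open>eventually_elim, auto intro: ennreal_leI\<close>)
  also have "\<dots> = ennreal C" by (simp add: Liminf_const)
  finally have fin: "(\<integral>\<^sup>+x. ennreal (f x) \<partial>M) \<le> ennreal C" .
  then show int: "integrable M f"
    by (intro integrableI_nonneg m fpos) (auto simp: top_unique intro: le_less_trans)
  have "ennreal (LINT x|M. f x) \<le> ennreal C"
    using nn_integral_eq_integral[OF int fpos] fin by simp
  then show "(LINT x|M. f x) \<le> C" using C by (simp add: ennreal_le_iff)
qed

definition mesh :: "nat => real" where "mesh n = 2 * pi / 2 ^ n"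

definition node :: "nat => int => real" where "node n j = - pi + real_of_int j * mesh n"

definition cell :: "nat => real => int" where "cell n x = \<lfloor>(x + pi) / mesh n\<rfloor>"

text \<open>
  As \<open>n\<close> grows these functions form a martingale with respect to the dyadic
  partitions: the mean of a finer quotient over a coarser cell is the coarser quotient.
\<close>

definition dyadic_quotient :: "(real => real) => nat => real => real" where
  "dyadic_quotient W n x = (W (node n (cell n x + 1)) - W (node n (cell n x))) / mesh n"

definition dyadic_energy :: "(real => real) => nat => real" where
  "dyadic_energy W n = (\<Sum>j=0..<2 ^ n. (W (node n (j + 1)) - W (node n j))^2 / mesh n)"

lemma mesh_pos: "mesh n > 0" by (simp add: mesh_def)

lemma node_0 [simp]: "node n 0 = - pi" by (simp add: node_def)

lemma node_last [simp]: "node n (2 ^ n) = pi" by (simp add: node_def mesh_def)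

lemma node_Suc: "node n (j + 1) = node n j + mesh n" by (simp add: node_def algebra_simps)

lemma node_mono: "i \<le> j ==> node n i \<le> node n j"
  using mesh_pos[of n] by (simp add: node_def)

lemma node_refine: "n \<le> m ==> node n j = node m (j * 2 ^ (m - n))"
  by (auto simp: node_def mesh_def power_add dest!: le_Suc_ex)

lemma cell_eq:
  assumes "node n j \<le> x" "x < node n (j + 1)"
  shows "cell n x = j"
  unfolding cell_def
  using assms mesh_pos[of n] by (intro floor_unique) (auto simp: node_def field_simps)

lemma node_cell: "node n (cell n x) \<le> x" "x < node n (cell n x) + mesh n"
proof -
  have "real_of_int (cell n x) \<le> (x + pi) / mesh n" "(x + pi) / mesh n < real_of_int (cell n x) + 1"
    unfolding cell_def by linarith+
  then show "node n (cell n x) \<le> x" "x < node n (cell n x) + mesh n"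
    using mesh_pos[of n] by (auto simp: node_def field_simps)
qed

lemma cell_range:
  assumes "x \<in> {-pi..pi}"
  shows "0 \<le> cell n x" "cell n x \<le> 2 ^ n"
proof -
  show "0 \<le> cell n x" unfolding cell_def using assms mesh_pos[of n] by simp
  have "(x + pi) / mesh n \<le> 2 ^ n" using assms mesh_pos[of n] by (simp add: mesh_def field_simps)
  then have "real_of_int (cell n x) \<le> real_of_int (2 ^ n)" unfolding cell_def
    by (metis of_int_floor_le of_int_numeral of_int_power order_trans)
  then show "cell n x \<le> 2 ^ n" by (simp only: of_int_le_iff)
qed

lemma node_cell_in:
  assumes "x \<in> {-pi..pi}"
  shows "node n (cell n x) \<in> {-pi..pi}"
  using node_mono[of 0 "cell n x" n] node_mono[of "cell n x" "2 ^ n" n] cell_range[OF assms, of n] by auto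

lemma mesh_tendsto: "mesh \<longlonglongrightarrow> 0"
proof -
  have "(\<lambda>n. 2 * pi * (1 / 2) ^ n) \<longlonglongrightarrow> 2 * pi * 0" by (intro tendsto_intros LIMSEQ_power_zero) auto
  then show ?thesis by (simp add: mesh_def[abs_def] power_one_over)
qed

lemma node_cell_tendsto: "(\<lambda>n. node n (cell n x)) \<longlonglongrightarrow> x"
proof (rule tendsto_sandwich[where f="\<lambda>n. x - mesh n" and h="\<lambda>_. x"])
  show "\<forall>\<^sub>F n in sequentially. x - mesh n \<le> node n (cell n x)"
    using node_cell(2)[of x] by (intro always_eventually allI) (smt (verit))
  show "\<forall>\<^sub>F n in sequentially. node n (cell n x) \<le> x" using node_cell(1) by simp
  show "(\<lambda>n. x - mesh n) \<longlonglongrightarrow> x" using tendsto_diff[OF tendsto_const[of x] mesh_tendsto] by simp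
qed simp

lemma AE_cell: "AE x in lebesgue_on {node n j..node n (j + 1)}. cell n x = j"
proof -
  have "AE x in lebesgue. x \<notin> {node n (j + 1)}"
    by (rule AE_not_in) (simp flip: negligible_iff_null_sets)
  then have "AE x in lebesgue. x \<in> {node n j..node n (j + 1)} \<longrightarrow> cell n x = j"
    by eventually_elim (auto intro!: cell_eq)
  then show ?thesis by (subst AE_restrict_space_iff) auto
qed

lemma measurable_cell: "(\<lambda>x. f (cell n x)) \<in> borel_measurable (lebesgue_on S)" for f :: "int => real"
proof -
  have "(\<lambda>x. f (cell n x)) \<in> borel_measurable borel" unfolding cell_def by measurable
  then have "(\<lambda>x. f (cell n x)) \<in> borel_measurable lebesgue" by (intro measurable_completion) auto
  then show ?thesis by (rule measurable_restrict_space1)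
qed

lemma lint_cell:
  fixes f :: "int => real" and g :: "real => real"
  assumes "g \<in> borel_measurable (lebesgue_on {node n j..node n (j + 1)})"
  shows "(LINT x|lebesgue_on {node n j..node n (j + 1)}. f (cell n x) * g x) = f j * (LINT x|lebesgue_on {node n j..node n (j + 1)}. g x)"
proof -
  have "(LINT x|lebesgue_on {node n j..node n (j + 1)}. f (cell n x) * g x) = (LINT x|lebesgue_on {node n j..node n (j + 1)}. f j * g x)"
  proof (rule Bochner_Integration.integral_cong_AE)
    show "AE x in lebesgue_on {node n j..node n (j + 1)}. f (cell n x) * g x = f j * g x"
      using AE_cell[of n j] by eventually_elim simp
  qed (use assms measurable_cell[of f n] in auto)
  then show ?thesis by simp
qed

lemma measure_cell: "measure (lebesgue_on {node n j..node n (j + 1)}) {node n j..node n (j + 1)} = mesh n"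
  using mesh_pos[of n] by (simp add: measure_restrict_space node_Suc)

lemma lint_cell_const:
  fixes f :: "int => real"
  shows "(LINT x|lebesgue_on {node n j..node n (j + 1)}. f (cell n x)) = f j * mesh n"
  using lint_cell[of "\<lambda>_. 1" n j f] measure_cell[of n j] by simp

lemma lint_split_nodes:
  fixes F :: "real => real"
  assumes i: "integrable (lebesgue_on {node n a..node n b}) F" and "a \<le> b"
  shows "(LINT x|lebesgue_on {node n a..node n b}. F x) = (\<Sum>j=a..<b. LINT x|lebesgue_on {node n j..node n (j + 1)}. F x)"
  using assms(2,1)
proof (induction b rule: int_ge_induct)
  case base
  have "(LINT x|lebesgue_on {node n a..node n a}. F x) = (LINT x|lebesgue_on {node n a..node n a}. 0)"
  proof -
    have "AE x in lebesgue. x \<notin> {node n a}"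
      by (rule AE_not_in) (simp flip: negligible_iff_null_sets)
    then have "AE x in lebesgue. x \<in> {node n a..node n a} \<longrightarrow> F x = 0"
      by eventually_elim auto
    then have "AE x in lebesgue_on {node n a..node n a}. F x = 0"
      by (subst AE_restrict_space_iff) auto
    then show ?thesis using base by (intro Bochner_Integration.integral_cong_AE) auto
  qed
  then show ?case by simp
next
  case (step b)
  have s: "{a..<b + 1} = insert b {a..<b}" using step by auto
  have i': "integrable (lebesgue_on {node n a..node n b}) F"
    by (rule integrable_subinterval[OF step.prems]) (use node_mono[of b "b+1" n] in auto)
  show ?case
    using integral_combine[OF step.prems, of "node n b"] node_mono[of a b n] node_mono[of b "b+1" n] step.IH[OF i'] step.hyps
    by (simp add: s)
qed

context
  fixes W :: "real => real" and K :: real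
  assumes W: "continuous_on UNIV W" and K: "\<And>x. \<bar>W x\<bar> \<le> K"
begin

private abbreviation "g \<equiv> dyadic_quotient W"

lemma g_measurable: "g n \<in> borel_measurable (lebesgue_on S)"
  using measurable_cell[of "\<lambda>j. (W (node n (j + 1)) - W (node n j)) / mesh n" n S]
  by (simp add: dyadic_quotient_def[abs_def])

lemma g_bounded: "\<bar>g n x\<bar> \<le> 2 * K / mesh n"
proof -
  have "\<bar>W (node n (cell n x + 1)) - W (node n (cell n x))\<bar> \<le> 2 * K"
    using K[of "node n (cell n x + 1)"] K[of "node n (cell n x)"] by linarith
  from divide_right_mono[OF this, of "mesh n"] show ?thesis
    using mesh_pos[of n] by (simp add: dyadic_quotient_def abs_divide)
qed

lemma g_L2: "L2_torus (g n)"
  by (rule L2_torus_bounded[OF g_measurable g_bounded])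

lemma g_integrable: "integrable (lebesgue_on {a..b}) (g n)"
proof -
  have "integrable (lebesgue_on {a..b}) (\<lambda>x. g n x * 1)"
    by (rule integrable_bounded_mult[OF integrable_on_interval_continuous g_measurable _ g_bounded]) auto
  then show ?thesis by simp
qed

lemma lint_g_nodes:
  assumes "a \<le> b"
  shows "(LINT x|lebesgue_on {node n a..node n b}. g n x) = W (node n b) - W (node n a)"
proof -
  have "(LINT x|lebesgue_on {node n a..node n b}. g n x) = (\<Sum>j=a..<b. LINT x|lebesgue_on {node n j..node n (j + 1)}. g n x)"
    by (rule lint_split_nodes[OF g_integrable assms])
  also have "\<dots> = (\<Sum>j=a..<b. W (node n (j + 1)) - W (node n j))"
    using lint_cell_const[of n _ "\<lambda>j. (W (node n (j + 1)) - W (node n j)) / mesh n"] mesh_pos[of n]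
    by (simp add: dyadic_quotient_def[abs_def])
  also have "\<dots> = W (node n b) - W (node n a)"
    using assms
  proof (induction b rule: int_ge_induct)
    case (step b)
    have "{a..<b + 1} = insert b {a..<b}" using step by auto
    then show ?case using step by simp
  qed simp
  finally show ?thesis .
qed

lemma lint_g_nodes_refined:
  assumes "a \<le> b" "n \<le> m"
  shows "(LINT x|lebesgue_on {node n a..node n b}. g m x) = W (node n b) - W (node n a)"
  using lint_g_nodes[of "a * 2 ^ (m - n)" "b * 2 ^ (m - n)" m] assms by (simp add: node_refine)

text \<open>
  The martingale property: a finer quotient, integrated against a function that is constant on
  the coarser cells, telescopes.
\<close>

lemma lint_weighted:
  fixes f :: "int => real"
  assumes "n \<le> m"
  shows "(LINT x|torus. f (cell n x) * g m x) = (\<Sum>j=0..<2 ^ n. f j * (W (node n (j + 1)) - W (node n j)))"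
proof -
  have tor: "torus = lebesgue_on {node n 0..node n (2 ^ n)}" by simp
  have i: "integrable torus (\<lambda>x. f (cell n x) * g m x)"
  proof (rule integrable_bounded_mult[OF g_integrable measurable_cell])
    fix x :: real assume x: "x \<in> {-pi..pi}"
    show "\<bar>f (cell n x)\<bar> \<le> (\<Sum>j=0..2 ^ n. \<bar>f j\<bar>)"
      using cell_range[OF x, of n] by (intro member_le_sum[of "cell n x" _ "\<lambda>j. \<bar>f j\<bar>"]) auto
  qed auto
  have "(LINT x|torus. f (cell n x) * g m x) = (\<Sum>j=0..<2 ^ n. LINT x|lebesgue_on {node n j..node n (j + 1)}. f (cell n x) * g m x)"
    unfolding tor by (rule lint_split_nodes) (use i in auto)
  also have "\<dots> = (\<Sum>j=0..<2 ^ n. f j * (W (node n (j + 1)) - W (node n j)))"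
    using assms by (intro sum.cong) (simp_all add: lint_cell[OF g_measurable] lint_g_nodes_refined)
  finally show ?thesis .
qed

lemma lint_g_g: "n \<le> m ==> (LINT x|torus. g n x * g m x) = dyadic_energy W n"
  using lint_weighted[of n m "\<lambda>j. (W (node n (j + 1)) - W (node n j)) / mesh n"]
  by (simp add: dyadic_quotient_def[of W n] dyadic_energy_def power2_eq_square)

lemma lint_s_g2: "(LINT x|torus. s (node n (cell n x)) * (g n x)^2) = (\<Sum>j=0..<2 ^ n. s (node n j) * ((W (node n (j + 1)) - W (node n j))^2 / mesh n))"
  using lint_weighted[of n n "\<lambda>j. s (node n j) * ((W (node n (j + 1)) - W (node n j)) / mesh n)"]
  by (simp add: dyadic_quotient_def[of W n] power2_eq_square mult_ac)

lemma lint_g_diff: "n \<le> m ==> (LINT x|torus. (g m x - g n x)^2) = dyadic_energy W m - dyadic_energy W n"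
proof -
  assume nm: "n \<le> m"
  have "(LINT x|torus. (g m x - g n x)^2) = (LINT x|torus. g m x * g m x - 2 * (g n x * g m x) + g n x * g n x)"
    by (intro Bochner_Integration.integral_cong) (auto simp: power2_eq_square algebra_simps)
  also have "\<dots> = (LINT x|torus. g m x * g m x) - 2 * (LINT x|torus. g n x * g m x) + (LINT x|torus. g n x * g n x)"
    using L2_torus_mult[OF g_L2 g_L2] by simp
  finally show ?thesis using lint_g_g[OF nm] lint_g_g[of n n] lint_g_g[of m m] by simp
qed

text \<open>
  The martingale property makes the increments of the dyadic quotients orthogonal, so that the
  energies increase to a limit and the quotients form a Cauchy sequence in
  \<open>L\<^sup>2\<close>. A subsequence converges almost everywhere. Its limit is the
  derivative of \<open>W\<close>, since the quotients integrate to the increments of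
  \<open>W\<close> between dyadic points; Fatou's lemma yields the bound for the weighted
  integral.
\<close>

theorem dyadic_limit:
  assumes B: "\<And>n. dyadic_energy W n \<le> B"
    and s: "continuous_on {-pi..pi} s" "\<And>x. x \<in> {-pi..pi} ==> s x \<ge> 0"
    and E: "\<And>e. e > 0 ==> \<forall>\<^sub>F n in sequentially. (\<Sum>j=0..<2 ^ n. s (node n j) * ((W (node n (j + 1)) - W (node n j))^2 / mesh n)) \<le> E + e"
  obtains \<omega> where "L2_torus \<omega>" "primitive_on (-pi) pi W \<omega>" "(LINT x|torus. s x * (\<omega> x)^2) \<le> E"
proof -
  have mono: "dyadic_energy W n \<le> dyadic_energy W m" if "n \<le> m" for n m
    using lint_g_diff[OF that] Bochner_Integration.integral_nonneg[of torus "\<lambda>x. (g m x - g n x)^2"] by simp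
  then have "incseq (dyadic_energy W)" by (simp add: incseq_def)
  then obtain A where A: "dyadic_energy W \<longlonglongrightarrow> A" and Ale: "\<And>n. dyadic_energy W n \<le> A"
    using incseq_convergent[of "dyadic_energy W" B] B by blast
  have L1: "(LINT x|torus. \<bar>f x\<bar>) \<le> sqrt (2 * pi * (LINT x|torus. (f x)^2))" if "L2_torus f" for f
  proof (rule real_le_rsqrt)
    have "(LINT x|torus. \<bar>f x\<bar> * 1)^2 \<le> (LINT x|torus. \<bar>f x\<bar>^2) * (LINT x|torus. 1^2)"
      by (rule lint_Cauchy_Schwarz) (use that L2_torus_integrable[OF that] in \<open>auto simp: L2_torus_def\<close>)
    then show "(LINT x|torus. \<bar>f x\<bar>)^2 \<le> 2 * pi * (LINT x|torus. (f x)^2)" by (simp add: mult.commute)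
  qed
  have gap: "(\<lambda>n. sqrt (2 * pi * (A - dyadic_energy W n))) \<longlonglongrightarrow> 0"
    using tendsto_real_sqrt[OF tendsto_mult[OF tendsto_const[of "2 * pi"] tendsto_diff[OF tendsto_const[of A] A]]] by simp
  have L1g: "(LINT x|torus. \<bar>g m x - g n x\<bar>) \<le> sqrt (2 * pi * (A - dyadic_energy W n))" if "n \<le> m" for n m
  proof -
    have "(LINT x|torus. \<bar>g m x - g n x\<bar>) \<le> sqrt (2 * pi * (dyadic_energy W m - dyadic_energy W n))"
      using L1[OF L2_torus_diff[OF g_L2[of m] g_L2[of n]]] lint_g_diff[OF that] by simp
    also have "\<dots> \<le> sqrt (2 * pi * (A - dyadic_energy W n))" using Ale by simp
    finally show ?thesis .
  qed
  obtain r where r: "strict_mono r" "AE x in torus. Cauchy (\<lambda>i. g (r i) x)"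
  proof (rule cauchy_L1_AE_cauchy_subseq[of torus g])
    show "integrable torus (g n)" for n by (rule g_integrable)
    fix e :: real assume e: "0 < e"
    then obtain N where N: "\<And>n. n \<ge> N ==> sqrt (2 * pi * (A - dyadic_energy W n)) < e"
      using order_tendstoD(2)[OF gap e] unfolding eventually_sequentially by blast
    show "\<exists>N. \<forall>i\<ge>N. \<forall>j\<ge>N. (LINT x|torus. norm (g i x - g j x)) < e"
    proof (intro exI[of _ N] allI impI)
      fix i j assume "N \<le> i" "N \<le> j"
      then show "(LINT x|torus. norm (g i x - g j x)) < e"
        using L1g[of i j] L1g[of j i] N[of i] N[of j] by (cases "i \<le> j") (auto simp: abs_minus_commute)
    qed
  qed
  define \<omega> where "\<omega> x = lim (\<lambda>i. g (r i) x)" for x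
  have wm: "\<omega> \<in> borel_measurable torus"
    unfolding \<omega>_def by (rule borel_measurable_lim_metric) (rule g_measurable)
  have conv: "AE x in torus. (\<lambda>i. g (r i) x) \<longlonglongrightarrow> \<omega> x"
    using r(2) unfolding \<omega>_def by eventually_elim (simp add: Cauchy_convergent_iff convergent_LIMSEQ_iff)
  have rge: "n \<le> r i" if "n \<le> i" for i n using seq_suble[OF r(1), of i] that by linarith
  have fat: "integrable torus (\<lambda>x. (\<omega> x - g n x)^2)" "(LINT x|torus. (\<omega> x - g n x)^2) \<le> A - dyadic_energy W n" for n
  proof -
    have 1: "integrable torus (\<lambda>x. (g (r i) x - g n x)^2)" for i using L2_torus_diff[OF g_L2 g_L2] by (simp add: L2_torus_def)
    have 2: "AE x in torus. (\<lambda>i. (g (r i) x - g n x)^2) \<longlonglongrightarrow> (\<omega> x - g n x)^2"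
      using conv by eventually_elim (intro tendsto_intros)
    have 3: "\<forall>\<^sub>F i in sequentially. (LINT x|torus. (g (r i) x - g n x)^2) \<le> A - dyadic_energy W n"
      using eventually_ge_at_top[of n]
    proof eventually_elim
      case (elim i)
      show ?case using lint_g_diff[OF rge[OF elim]] Ale[of "r i"] by simp
    qed
    have 4: "(\<lambda>x. (\<omega> x - g n x)^2) \<in> borel_measurable torus" using wm g_measurable by measurable
    show "integrable torus (\<lambda>x. (\<omega> x - g n x)^2)" "(LINT x|torus. (\<omega> x - g n x)^2) \<le> A - dyadic_energy W n"
      using fatou_real[OF 1 _ 4 2 3] by auto
  qed
  have Ld: "L2_torus (\<lambda>x. \<omega> x - g n x)" for n
    unfolding L2_torus_def using fat wm g_measurable by auto
  have Lw: "L2_torus \<omega>" using L2_torus_add[OF Ld[of 0] g_L2[of 0]] by simp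
  define \<Omega> where "\<Omega> = (\<lambda>x. W (-pi) + (LINT t|lebesgue_on {-pi..x}. \<omega> t))"
  have pO: "primitive_on (-pi) pi \<Omega> \<omega>" unfolding \<Omega>_def
    by (intro primitive_on_indefinite L2_torus_integrable Lw)
  have eqn: "\<Omega> (node n j) = W (node n j)" if j: "0 \<le> j" "j \<le> 2 ^ n" for n j
  proof -
    have nd: "-pi \<le> node n j" "node n j \<le> pi" using node_mono[OF j(1), of n] node_mono[OF j(2), of n] by simp_all
    have "\<bar>\<Omega> (node n j) - W (node n j)\<bar> \<le> sqrt (2 * pi * (A - dyadic_energy W m))" if m: "n \<le> m" for m
    proof -
      have iw: "integrable (lebesgue_on {-pi..node n j}) \<omega>"
        by (rule integrable_subinterval[OF L2_torus_integrable[OF Lw]]) (use nd in auto)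
      have "\<Omega> (node n j) - W (node n j) = (LINT t|lebesgue_on {-pi..node n j}. \<omega> t) - (LINT t|lebesgue_on {-pi..node n j}. g m t)"
        using lint_g_nodes_refined[OF j(1) m] by (simp add: \<Omega>_def)
      also have "\<dots> = (LINT t|lebesgue_on {-pi..node n j}. \<omega> t - g m t)"
        using iw g_integrable by simp
      also have "\<bar>\<dots>\<bar> \<le> (LINT t|lebesgue_on {-pi..node n j}. \<bar>\<omega> t - g m t\<bar>)"
        using integral_norm_bound[of "lebesgue_on {-pi..node n j}" "\<lambda>t. \<omega> t - g m t"] by simp
      also have "\<dots> \<le> (LINT t|torus. \<bar>\<omega> t - g m t\<bar>)"
      proof -
        have i: "integrable torus (\<lambda>t. \<bar>\<omega> t - g m t\<bar>)" using L2_torus_integrable[OF Ld] by auto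
        have "0 \<le> (LINT t|lebesgue_on {node n j..pi}. \<bar>\<omega> t - g m t\<bar>)" by (intro Bochner_Integration.integral_nonneg) auto
        then show ?thesis using integral_combine[OF i nd] by linarith
      qed
      also have "\<dots> \<le> sqrt (2 * pi * (LINT x|torus. (\<omega> x - g m x)^2))" by (rule L1[OF Ld])
      also have "\<dots> \<le> sqrt (2 * pi * (A - dyadic_energy W m))" using fat(2)[of m] by simp
      finally show ?thesis .
    qed
    then have "\<bar>\<Omega> (node n j) - W (node n j)\<bar> \<le> 0"
      by (intro LIMSEQ_le_const[OF gap]) blast
    then show ?thesis by simp
  qed
  have eq: "\<Omega> x = W x" if x: "x \<in> {-pi..pi}" for x
  proof (rule LIMSEQ_unique)
    show "(\<lambda>n. \<Omega> (node n (cell n x))) \<longlonglongrightarrow> \<Omega> x"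
      using continuous_on_tendsto_compose[OF primitive_on_continuous[OF pO] node_cell_tendsto x] node_cell_in[OF x] by auto
    show "(\<lambda>n. \<Omega> (node n (cell n x))) \<longlonglongrightarrow> W x"
      using continuous_on_tendsto_compose[OF W node_cell_tendsto, of x] cell_range[OF x] by (simp add: eqn)
  qed
  have pW: "primitive_on (-pi) pi W \<omega>" by (rule primitive_on_cong[OF pO eq])
  have "(LINT x|torus. s x * (\<omega> x)^2) \<le> E + e" if e: "e > 0" for e
  proof -
    obtain S where S: "\<And>x. x \<in> {-pi..pi} ==> \<bar>s x\<bar> \<le> S" using bounded_on_Icc[OF s(1)] by blast
    note cin = node_cell_in
    define F where "F i x = s (node (r i) (cell (r i) x)) * (g (r i) x)^2" for i x
    have 1: "integrable torus (F i)" for i unfolding F_def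
    proof (rule integrable_bounded_mult[OF _ measurable_cell])
      show "integrable torus (\<lambda>x. (g (r i) x)^2)" using g_L2 by (simp add: L2_torus_def)
    qed (use S cin in auto)
    have 2: "AE x in torus. (\<lambda>i. F i x) \<longlonglongrightarrow> s x * (\<omega> x)^2"
      using conv AE_space
    proof eventually_elim
      case (elim x)
      then have x: "x \<in> {-pi..pi}" by simp
      have "(\<lambda>n. s (node n (cell n x))) \<longlonglongrightarrow> s x"
        using continuous_on_tendsto_compose[OF s(1) node_cell_tendsto x] cin[OF x] by auto
      then have "(\<lambda>i. s (node (r i) (cell (r i) x))) \<longlonglongrightarrow> s x"
        using LIMSEQ_subseq_LIMSEQ[OF _ r(1)] by (auto simp: o_def)
      then show ?case unfolding F_def by (intro tendsto_intros elim(1))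
    qed
    have 3: "\<forall>\<^sub>F i in sequentially. (LINT x|torus. F i x) \<le> E + e"
      using eventually_subseq[OF r(1) E[OF e]] unfolding F_def by (simp add: lint_s_g2)
    have 4: "(\<lambda>x. s x * (\<omega> x)^2) \<in> borel_measurable torus"
      using wm continuous_imp_measurable_on_sets_lebesgue[OF s(1)] by auto
    show ?thesis by (rule fatou_real(2)[OF 1 _ 4 2 3]) (use cin s(2) in \<open>auto simp: F_def\<close>)
  qed
  then have "(LINT x|torus. s x * (\<omega> x)^2) \<le> E" by (rule field_le_epsilon)
  then show ?thesis using that Lw pW by blast
qed

end

section \<open>The explicit scheme and its maximum principles\<close>

lemma period_sum_shift:
  fixes f :: "int => real"
  assumes per: "\<And>i. f (i + int N) = f i"
  shows "(\<Sum>i=0..<int N. f (i + 1)) = (\<Sum>i=0..<int N. f i)"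
proof (cases "N = 0")
  case False
  have "(\<Sum>i=0..<int N. f (i + 1)) = (\<Sum>i=1..<int N + 1. f i)"
    by (rule sum.reindex_bij_witness[of _ "\<lambda>i. i - 1" "\<lambda>i. i + 1"]) auto
  also have "{1..<int N + 1} = insert (int N) {1..<int N}" using False by auto
  also have "sum f (insert (int N) {1..<int N}) = f (int N) + (\<Sum>i=1..<int N. f i)" by simp
  also have "f (int N) = f 0" using per[of 0] by simp
  also have "f 0 + (\<Sum>i=1..<int N. f i) = sum f (insert 0 {1..<int N})" by simp
  also have "insert 0 {1..<int N} = {0..<int N}" using False by auto
  finally show ?thesis .
qed simp

lemma period_sum_shift_back:
  fixes f :: "int => real"
  assumes per: "\<And>i. f (i + int N) = f i"
  shows "(\<Sum>i=0..<int N. f (i - 1)) = (\<Sum>i=0..<int N. f i)"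
proof -
  have "f (i + int N - 1) = f (i - 1)" for i using per[of "i - 1"] by (simp add: algebra_simps)
  then show ?thesis using period_sum_shift[of "\<lambda>i. f (i - 1)" N] by simp
qed

lemma summation_by_parts_period:
  fixes X Y :: "int => real"
  assumes X: "\<And>i. X (i + int N) = X i" and Y: "\<And>i. Y (i + int N) = Y i"
  shows "(\<Sum>i=0..<int N. Y i * (X i - X (i - 1))) = - (\<Sum>i=0..<int N. X i * (Y (i + 1) - Y i))"
proof -
  have "(i + int N) - 1 = (i - 1) + int N" for i by simp
  then have "(\<Sum>i=0..<int N. Y (i + 1) * X (i + 1 - 1)) = (\<Sum>i=0..<int N. Y i * X (i - 1))"
    by (intro period_sum_shift) (metis X Y)
  then show ?thesis by (simp add: algebra_simps sum_subtractf sum_negf)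
qed

lemma telescope_abs:
  fixes f :: "int => real"
  assumes "i \<le> j"
  shows "\<bar>f j - f i\<bar> \<le> (\<Sum>l=i..<j. \<bar>f (l + 1) - f l\<bar>)"
  using assms
proof (induction j rule: int_ge_induct)
  case (step j)
  have "{i..<j + 1} = insert j {i..<j}" using step by auto
  then have "(\<Sum>l=i..<j + 1. \<bar>f (l + 1) - f l\<bar>) = \<bar>f (j + 1) - f j\<bar> + (\<Sum>l=i..<j. \<bar>f (l + 1) - f l\<bar>)" by simp
  then show ?case using step by linarith
qed simp

lemma telescope_period:
  fixes f :: "int => real"
  assumes "i \<in> {0..<int N}" "j \<in> {0..<int N}"
  shows "\<bar>f j - f i\<bar> \<le> (\<Sum>l=0..<int N. \<bar>f (l + 1) - f l\<bar>)"
proof -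
  have *: "\<bar>f j - f i\<bar> \<le> (\<Sum>l=0..<int N. \<bar>f (l + 1) - f l\<bar>)" if "i \<le> j" "0 \<le> i" "j < int N" for i j
    using telescope_abs[OF that(1), of f] that
    by (elim order_trans) (intro sum_mono2, auto)
  show ?thesis
  proof (cases "i \<le> j")
    case True then show ?thesis using * assms by auto
  next
    case False then show ?thesis using *[of j i] assms by (auto simp: abs_minus_commute)
  qed
qed

lemma arctan_mvt:
  fixes x y :: real
  obtains \<xi> where "min x y \<le> \<xi>" "\<xi> \<le> max x y" "arctan x - arctan y = (x - y) / (1 + \<xi>^2)"
proof -
  consider "y < x" | "x = y" | "x < y" by linarith
  then show ?thesis
  proof cases
    case 1
    obtain z where "y < z" "z < x" "arctan x - arctan y = (x - y) * inverse (1 + z^2)"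
      using MVT2[OF 1, of arctan "\<lambda>z. inverse (1 + z^2)"] DERIV_arctan by blast
    then show ?thesis using that[of z] by (simp add: divide_inverse)
  next
    case 2 then show ?thesis using that[of x] by simp
  next
    case 3
    obtain z where z: "x < z" "z < y" "arctan y - arctan x = (y - x) * inverse (1 + z^2)"
      using MVT2[OF 3, of arctan "\<lambda>z. inverse (1 + z^2)"] DERIV_arctan by blast
    have "arctan x - arctan y = - ((y - x) * inverse (1 + z^2))" using z(3) by simp
    also have "\<dots> = (x - y) / (1 + z^2)" by (simp add: divide_inverse algebra_simps)
    finally show ?thesis using that[of z] z by simp
  qed
qed

lemma arctan_diff_factor:
  fixes x y :: real
  assumes "\<bar>x\<bar> \<le> 1" "\<bar>y\<bar> \<le> 1"
  shows "\<exists>c. 1/2 \<le> c \<and> c \<le> 1 \<and> arctan x - arctan y = c * (x - y)"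
proof -
  obtain z where z: "min x y \<le> z" "z \<le> max x y" "arctan x - arctan y = (x - y) / (1 + z^2)" by (rule arctan_mvt)
  then have "z^2 \<le> 1" using assms by (auto simp: abs_square_le_1)
  moreover have "1 + z^2 > 0" by (simp add: add_pos_nonneg)
  ultimately show ?thesis using z(3) by (intro exI[of _ "1 / (1 + z^2)"]) (simp add: field_simps)
qed

lemma arctan_1_lipschitz: "\<bar>arctan x - arctan y\<bar> \<le> \<bar>x - y\<bar>" for x y :: real
proof -
  obtain z where z: "arctan x - arctan y = (x - y) / (1 + z^2)" by (rule arctan_mvt)
  have "\<bar>x - y\<bar> / (1 + z^2) \<le> \<bar>x - y\<bar> / 1" by (intro divide_left_mono) (auto simp: add_pos_nonneg)
  then show ?thesis unfolding z by (simp add: abs_divide)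
qed

lemma exp_diff_bound:
  fixes x y :: real
  assumes "exp x \<le> M" "exp y \<le> M"
  shows "\<bar>exp x - exp y\<bar> \<le> M * \<bar>x - y\<bar>"
proof -
  have main: "\<bar>exp x - exp y\<bar> \<le> M * \<bar>x - y\<bar>" if xy: "exp x \<le> M" "y < x" for x y :: real
  proof -
    obtain z where z: "y < z" "z < x" "exp x - exp y = (x - y) * exp z"
      using MVT2[OF xy(2), of exp exp] DERIV_exp by blast
    have "exp z \<le> M" using z xy by (meson exp_le_cancel_iff less_imp_le order_trans)
    then have "(x - y) * exp z \<le> (x - y) * M" using xy by (intro mult_left_mono) auto
    then show ?thesis using z xy by (simp add: mult.commute)
  qed
  consider "y < x" | "x = y" | "x < y" by linarith
  then show ?thesis using main[of x y] main[of y x] assms by cases (auto simp: abs_minus_commute)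
qed

definition slope :: "real => (int => real) => int => real" where
  "slope h v i = (v (i + 1) - v i) / h"

definition angle :: "real => (int => real) => int => real" where
  "angle h v i = arctan (slope h v i)"

definition angle_diff :: "real => (int => real) => int => real" where
  "angle_diff h v i = (angle h v i - angle h v (i - 1)) / h"

text \<open>
  The discrete time derivative of \<open>v\<close>: since \<open>v = ln u\<close>, the equation
  reads \<open>v\<^sub>t = w\<^sub>x / exp v\<close>.
\<close>

definition speed :: "real => (int => real) => int => real" where
  "speed h v i = angle_diff h v i / exp (v i)"

definition euler :: "real => real => (int => real) => int => real" where
  "euler \<tau> h v i = v i + \<tau> * speed h v i"

text \<open>
  Discrete form of the Lyapunov functional: with \<open>u = exp v\<close> and \<open>p =
  u\<^sub>x / u\<close> the integrand of the latter is \<open>u (1 + p^2) ((arctan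
  p)\<^sub>x)^2\<close>, because \<open>p\<^sub>x = (u u\<^sub>x\<^sub>x - u\<^sub>x^2) /
  u^2\<close>.
\<close>

definition energy :: "nat => real => (int => real) => real" where
  "energy N h v = h * (\<Sum>i=0..<int N. exp (v i) * (1 + (slope h v i)^2) * (angle_diff h v i)^2)"

text \<open>
  The bound for the slopes. It only has to be so small that the error terms in
  \<open>energy_decreases\<close> are absorbed by the dissipation.
\<close>

abbreviation kappa :: real where "kappa \<equiv> 1 / 10000"

text \<open>
  The invariant region of the scheme. The factor 2 between the bounds costs nothing, as small
  slopes keep the oscillation of \<open>v\<close> over a period small.
\<close>

definition admissible :: "nat => real => real => (int => real) => bool" where
  "admissible N h m v \<longleftrightarrow> (\<forall>i. v (i + int N) = v i) \<and> (\<forall>i. \<bar>slope h v i\<bar> \<le> kappa) \<and>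
     (\<forall>i. m \<le> exp (v i) \<and> exp (v i) \<le> 2 * m)"

text \<open>
  If \<open>v i\<close> lies below the bound by \<open>V - v i\<close>, its neighbours exceed
  \<open>v i\<close> by no more than that, so the increment is at most a multiple of \<open>V -
  v i\<close>, which the restriction on the time step makes smaller than one. With a general
  weight \<open>a\<close> in place of \<open>exp (v i)\<close> the lower bound follows by
  changing the sign of \<open>v\<close>.
\<close>

lemma euler_step_upper:
  assumes h: "h > 0" and m: "m > 0" and tau: "0 < \<tau>" "\<tau> \<le> m * h^2 / 100" and a: "m \<le> a" and V: "\<And>i. v i \<le> V"
  shows "v i + \<tau> * (angle_diff h v i / a) \<le> V"
proof -
  have at: "arctan x \<le> y" if "x \<le> y" "0 \<le> y" for x y :: real
    using arctan_le_self[OF that(2)] arctan_monotone'[OF that(1)] by linarith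
  define D where "D = (V - v i) / h"
  have D: "D \<ge> 0" using V[of i] h by (simp add: D_def)
  have 1: "angle h v i \<le> D" unfolding angle_def
    by (rule at[OF _ D]) (use V[of "i+1"] h in \<open>simp add: slope_def D_def divide_right_mono\<close>)
  have "arctan (- slope h v (i - 1)) \<le> D"
    by (rule at[OF _ D]) (use V[of "i-1"] h in \<open>simp add: slope_def D_def field_simps\<close>)
  then have 2: "- angle h v (i - 1) \<le> D" by (simp add: angle_def arctan_minus)
  have "angle_diff h v i \<le> 2 * D / h" unfolding angle_diff_def using 1 2 h by (intro divide_right_mono) auto
  then have "angle_diff h v i / a \<le> (2 * D / h) / a" using a m by (intro divide_right_mono) auto
  also have "\<dots> \<le> (2 * D / h) / m" using D h m a by (intro divide_left_mono) auto
  finally have "\<tau> * (angle_diff h v i / a) \<le> (m * h^2 / 100) * ((2 * D / h) / m)"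
    using tau D h m by (meson divide_nonneg_nonneg less_imp_le mult_mono mult_nonneg_nonneg order_trans mult_left_mono mult_right_mono zero_le_numeral)
  also have "\<dots> = (V - v i) / 50" using h m by (simp add: D_def field_simps power2_eq_square)
  also have "\<dots> \<le> V - v i" using V[of i] by simp
  finally show ?thesis by simp
qed

lemma euler_max_principle:
  assumes h: "h > 0" and m: "m > 0" and tau: "0 < \<tau>" "\<tau> \<le> m * h^2 / 100" and lo: "\<And>i. m \<le> exp (v i)"
  shows "(\<And>i. v i \<le> V) ==> euler \<tau> h v i \<le> V" "(\<And>i. V \<le> v i) ==> V \<le> euler \<tau> h v i"
proof -
  show "euler \<tau> h v i \<le> V" if "\<And>i. v i \<le> V"
    using euler_step_upper[OF h m tau lo that] by (simp add: euler_def speed_def)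
  have "slope h (\<lambda>i. - v i) j = - slope h v j" for j by (simp add: slope_def minus_divide_left)
  then have "angle_diff h (\<lambda>i. - v i) i = - angle_diff h v i"
    by (simp add: angle_diff_def angle_def arctan_minus minus_divide_left)
  then show "V \<le> euler \<tau> h v i" if "\<And>i. V \<le> v i"
    using euler_step_upper[OF h m tau lo, of "\<lambda>i. - v i" "- V" i i] that by (simp add: euler_def speed_def)
qed

lemma slope_euler: "h \<noteq> 0 ==> slope h (euler \<tau> h v) i = slope h v i + \<tau> * ((speed h v (i + 1) - speed h v i) / h)"
  by (simp add: slope_def euler_def field_simps)

lemma speed_bound_one_sided:
  fixes h m \<tau> x y :: real and v :: "int => real"
  assumes h: "h > 0" and m: "m > 0" and tau: "0 < \<tau>" "\<tau> \<le> m * h^2 / 100"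
    and lo: "\<And>i. m \<le> exp (v i)" and d: "x \<le> y" "0 \<le> y"
  shows "\<tau> * (x / h / exp (v i)) / h \<le> y / 100"
proof -
  have "x / h / exp (v i) \<le> y / h / exp (v i)" using d h by (intro divide_right_mono) auto
  also have "\<dots> \<le> y / h / m" using d h m lo[of i] by (intro divide_left_mono) auto
  finally have "\<tau> * (x / h / exp (v i)) \<le> \<tau> * (y / h / m)" using tau by (intro mult_left_mono) auto
  also have "\<dots> \<le> (m * h^2 / 100) * (y / h / m)" using tau d h m by (intro mult_right_mono) auto
  finally have "\<tau> * (x / h / exp (v i)) / h \<le> (m * h^2 / 100) * (y / h / m) / h" using h by (intro divide_right_mono) auto
  also have "\<dots> = y / 100" using h m by (simp add: field_simps power2_eq_square)
  finally show ?thesis .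
qed

text \<open>
  The slopes solve a discrete parabolic equation \<open>p\<^sub>t = (w\<^sub>x /
  u)\<^sub>x\<close>. As the arctangent is 1-Lipschitz, a slope at distance \<open>D\<close>
  from the bound \<open>P\<close> has an angle at distance at most \<open>D\<close> from
  \<open>arctan P\<close>, and one step covers at most a fiftieth of it.
\<close>

lemma slope_max_principle:
  assumes h: "h > 0" and m: "m > 0" and tau: "0 < \<tau>" "\<tau> \<le> m * h^2 / 100"
    and lo: "\<And>i. m \<le> exp (v i)" and P: "\<And>i. \<bar>slope h v i\<bar> \<le> P"
  shows "\<bar>slope h (euler \<tau> h v) i\<bar> \<le> P"
proof -
  note b = speed_bound_one_sided[OF h m tau lo]
  let ?w = "angle h v"
  have wle: "?w j \<le> arctan P" "- arctan P \<le> ?w j" for j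
    using P[of j] arctan_monotone'[of "slope h v j" P] arctan_monotone'[of "-P" "slope h v j"]
    by (auto simp: angle_def arctan_minus)
  have up: "arctan P - ?w i \<le> P - slope h v i"
    using arctan_1_lipschitz[of P "slope h v i"] P[of i] by (simp add: angle_def)
  have dn: "?w i + arctan P \<le> slope h v i + P"
    using arctan_1_lipschitz[of "slope h v i" "-P"] P[of i] by (simp add: angle_def arctan_minus)
  have e: "\<tau> * ((speed h v (i + 1) - speed h v i) / h) =
     \<tau> * ((?w (i+1) - ?w i) / h / exp (v (i+1))) / h + \<tau> * ((?w (i-1) - ?w i) / h / exp (v i)) / h"
    by (simp add: speed_def angle_diff_def diff_divide_distrib right_diff_distrib)
  have e': "- (\<tau> * ((speed h v (i + 1) - speed h v i) / h)) =
     \<tau> * ((?w i - ?w (i+1)) / h / exp (v (i+1))) / h + \<tau> * ((?w i - ?w (i-1)) / h / exp (v i)) / h"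
    by (simp add: speed_def angle_diff_def diff_divide_distrib right_diff_distrib)
  define X where "X = \<tau> * ((speed h v (i + 1) - speed h v i) / h)"
  have "X \<le> (P - slope h v i) / 100 + (P - slope h v i) / 100"
    unfolding X_def e by (intro add_mono b) (use wle[of "i+1"] wle[of "i-1"] up P[of i] in auto)
  moreover have "- X \<le> (slope h v i + P) / 100 + (slope h v i + P) / 100"
    unfolding X_def e' by (intro add_mono b) (use wle[of "i+1"] wle[of "i-1"] dn P[of i] in auto)
  moreover have "\<bar>slope h v i\<bar> \<le> P" by (rule P)
  moreover have "slope h (euler \<tau> h v) i = slope h v i + X"
    unfolding X_def by (rule slope_euler) (use h in simp)
  ultimately show ?thesis unfolding abs_le_iff by (auto simp: field_simps)
qed

lemma admissible_euler:
  assumes h: "h > 0" and m: "m > 0" and tau: "0 < \<tau>" "\<tau> \<le> m * h^2 / 100" and adm: "admissible N h m v"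
  shows "admissible N h m (euler \<tau> h v)"
proof -
  have lo: "m \<le> exp (v i)" and hi: "exp (v i) \<le> 2 * m" and per: "v (i + int N) = v i" for i
    using adm by (auto simp: admissible_def)
  have "ln m \<le> v i" "v i \<le> ln (2 * m)" for i
    using lo[of i] hi[of i] m ln_ge_iff[of "2 * m" "v i"] ln_le_cancel_iff[of m "exp (v i)"] by auto
  note ln_bounds = this
  have "ln m \<le> euler \<tau> h v i" for i
    by (rule euler_max_principle(2)[OF h m tau lo]) (rule ln_bounds)
  moreover have "euler \<tau> h v i \<le> ln (2 * m)" for i
    by (rule euler_max_principle(1)[OF h m tau lo]) (rule ln_bounds)
  ultimately have "m \<le> exp (euler \<tau> h v i) \<and> exp (euler \<tau> h v i) \<le> 2 * m" for i
    using m by (metis exp_le_cancel_iff exp_ln mult_pos_pos zero_less_numeral)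
  moreover have "\<bar>slope h (euler \<tau> h v) i\<bar> \<le> kappa" for i
    by (rule slope_max_principle[OF h m tau lo]) (use adm in \<open>auto simp: admissible_def\<close>)
  moreover have "euler \<tau> h v (i + int N) = euler \<tau> h v i" for i
  proof -
    have "v (i + int N + 1) = v (i + 1)" "v (i + int N - 1) = v (i - 1)" "v (i + int N) = v i"
      using per[of "i + 1"] per[of "i - 1"] per[of i] by (simp_all add: algebra_simps)
    then show ?thesis
      unfolding euler_def speed_def angle_diff_def angle_def slope_def by simp
  qed
  ultimately show ?thesis by (auto simp: admissible_def)
qed

section \<open>Decay of the discrete energy\<close>

lemma young_weighted:
  fixes a b t :: real
  assumes "t > 0"
  shows "\<bar>a\<bar> * \<bar>b\<bar> \<le> (t * a^2 + b^2 / t) / 2"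
proof -
  have "0 \<le> (t * \<bar>a\<bar> - \<bar>b\<bar>)^2 / t" using assms by simp
  also have "\<dots> = t * a^2 - 2 * (\<bar>a\<bar> * \<bar>b\<bar>) + b^2 / t"
    using assms by (simp add: power2_eq_square field_simps flip: abs_mult)
  finally show ?thesis by simp
qed

text \<open>
  Discrete form of \<open>\<integral> w\<^sub>x^4 \<le> 9 sup w^2 \<integral>
  w\<^sub>x\<^sub>x^2\<close>: one factor \<open>w\<^sub>x\<close> is summed by parts and the
  Cauchy-Schwarz inequality is applied. This is where the smallness of the angles enters the
  energy estimate.
\<close>

lemma discrete_interpolation:
  fixes w d :: "int => real"
  assumes h: "h > 0" and per: "\<And>i. w (i + int N) = w i" and w: "\<And>i. \<bar>w i\<bar> \<le> k"
    and d: "\<And>i. d i = (w i - w (i - 1)) / h"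
  shows "(\<Sum>i=0..<int N. d i ^ 4) \<le> 9 * k^2 * (\<Sum>i=0..<int N. ((d (i + 1) - d i) / h)^2)"
proof -
  have perd: "d (i + int N) = d i" for i
  proof -
    have "i + int N - 1 = (i - 1) + int N" by simp
    then show ?thesis unfolding d by (metis per)
  qed
  have k: "k \<ge> 0" using w[of 0] by linarith
  define A where "A = (\<Sum>i=0..<int N. d i ^ 4)"
  define B where "B = (\<Sum>i=0..<int N. ((d (i + 1) - d i) / h)^2)"
  define S where "S = (\<Sum>i=0..<int N. \<bar>d (i + 1) - d i\<bar> * (3/2 * ((d (i + 1))^2 + (d i)^2)))"
  have A0: "A \<ge> 0" unfolding A_def by (intro sum_nonneg) auto
  have S0: "S \<ge> 0" unfolding S_def by (intro sum_nonneg mult_nonneg_nonneg) auto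
  have B0: "B \<ge> 0" unfolding B_def by (intro sum_nonneg) auto
  have "h * A = (\<Sum>i=0..<int N. d i ^ 3 * (w i - w (i - 1)))"
    unfolding A_def sum_distrib_left
    by (intro sum.cong) (use h in \<open>auto simp: d power4_eq_xxxx power3_eq_cube\<close>)
  also have "\<dots> = - (\<Sum>i=0..<int N. w i * (d (i + 1) ^ 3 - d i ^ 3))"
    by (rule summation_by_parts_period) (simp_all add: per perd)
  also have "\<dots> \<le> (\<Sum>i=0..<int N. \<bar>w i * (d (i + 1) ^ 3 - d i ^ 3)\<bar>)"
    using sum_abs[of "\<lambda>i. w i * (d (i + 1) ^ 3 - d i ^ 3)" "{0..<int N}"] by linarith
  also have "\<dots> \<le> (\<Sum>i=0..<int N. k * (\<bar>d (i + 1) - d i\<bar> * (3/2 * ((d (i + 1))^2 + (d i)^2))))"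
  proof (intro sum_mono)
    fix i
    have c: "\<bar>x ^ 3 - y ^ 3\<bar> \<le> \<bar>x - y\<bar> * (3/2 * (x^2 + y^2))" for x y :: real
    proof -
      have "x ^ 3 - y ^ 3 = (x - y) * (x^2 + x * y + y^2)" by (simp add: power2_eq_square power3_eq_cube algebra_simps)
      then have "\<bar>x ^ 3 - y ^ 3\<bar> = \<bar>x - y\<bar> * \<bar>x^2 + x * y + y^2\<bar>" by (simp add: abs_mult)
      moreover have "\<bar>x^2 + x * y + y^2\<bar> \<le> 3/2 * (x^2 + y^2)"
        using zero_le_power2[of "x - y"] zero_le_power2[of "x + y"]
        by (simp add: power2_eq_square algebra_simps abs_le_iff)
      ultimately show ?thesis using mult_left_mono[of "\<bar>x^2 + x * y + y^2\<bar>" "3/2 * (x^2 + y^2)" "\<bar>x - y\<bar>"] by simp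
    qed
    show "\<bar>w i * (d (i + 1) ^ 3 - d i ^ 3)\<bar> \<le> k * (\<bar>d (i + 1) - d i\<bar> * (3/2 * ((d (i + 1))^2 + (d i)^2)))"
      unfolding abs_mult by (intro mult_mono w c k) auto
  qed
  also have "\<dots> = k * S" by (simp add: S_def sum_distrib_left)
  finally have hA: "h * A \<le> k * S" .
  have "S^2 \<le> (\<Sum>i=0..<int N. \<bar>d (i + 1) - d i\<bar>^2) * (\<Sum>i=0..<int N. (3/2 * ((d (i + 1))^2 + (d i)^2))^2)"
    unfolding S_def by (rule Cauchy_Schwarz_ineq_sum)
  also have "(\<Sum>i=0..<int N. \<bar>d (i + 1) - d i\<bar>^2) = h^2 * B"
    unfolding B_def sum_distrib_left using h by (intro sum.cong) (auto simp: power_divide)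
  also have "(\<Sum>i=0..<int N. (3/2 * ((d (i + 1))^2 + (d i)^2))^2) \<le> (\<Sum>i=0..<int N. 9/2 * (d (i + 1) ^ 4 + d i ^ 4))"
  proof (intro sum_mono)
    fix i
    have "(3/2 * (x^2 + y^2))^2 \<le> 9/2 * (x ^ 4 + y ^ 4)" for x y :: real
      using zero_le_power2[of "x^2 - y^2"] by (simp add: power2_eq_square power4_eq_xxxx algebra_simps)
    then show "(3/2 * ((d (i + 1))^2 + (d i)^2))^2 \<le> 9/2 * (d (i + 1) ^ 4 + d i ^ 4)" .
  qed
  also have "(\<Sum>i=0..<int N. 9/2 * (d (i + 1) ^ 4 + d i ^ 4)) =
      9/2 * ((\<Sum>i=0..<int N. d (i + 1) ^ 4) + (\<Sum>i=0..<int N. d i ^ 4))"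
    by (simp only: sum.distrib flip: sum_distrib_left)
  also have "\<dots> = 9 * A"
    using period_sum_shift[of "\<lambda>i. d i ^ 4" N] perd by (simp add: A_def)
  finally have S2: "S^2 \<le> h^2 * B * (9 * A)" using B0 by (simp add: mult_left_mono)
  have "(h * A)^2 \<le> (k * S)^2" using hA h A0 by (intro power_mono) auto
  also have "\<dots> \<le> k^2 * (h^2 * B * (9 * A))" unfolding power_mult_distrib using S2 by (intro mult_left_mono) auto
  finally have "h^2 * A * A \<le> h^2 * A * (9 * k^2 * B)" by (simp add: power2_eq_square algebra_simps)
  then have "A \<le> 9 * k^2 * B"
  proof (cases "A = 0")
    case False
    then have "h^2 * A > 0" using A0 h by simp
    then show ?thesis using \<open>h^2 * A * A \<le> h^2 * A * (9 * k^2 * B)\<close> by (metis mult_le_cancel_left_pos)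
  qed (use B0 in auto)
  then show ?thesis by (simp add: A_def B_def)
qed

text \<open>
  One step of the scheme. In the continuous notation \<open>p = v\<^sub>x\<close>, \<open>w =
  arctan p\<close>, \<open>d = w\<^sub>x\<close>, \<open>q = v\<^sub>t\<close>, \<open>R =
  q\<^sub>x\<close>, and \<open>Q\<close> is the dissipation \<open>\<integral>
  q\<^sub>x^2\<close>.
\<close>

locale admissible_step =
  fixes N :: nat and h m \<tau> :: real and v :: "int => real"
  assumes N: "N > 0" and h_eq: "h = 2 * pi / real N" and m: "m > 0"
    and tau: "0 < \<tau>" "\<tau> \<le> m * h^2 / 100" and adm: "admissible N h m v"
begin

abbreviation "I \<equiv> {0..<int N}"
abbreviation "p \<equiv> slope h v"
abbreviation "w \<equiv> angle h v"
abbreviation "d \<equiv> angle_diff h v"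
abbreviation "q \<equiv> speed h v"

definition R :: "int => real" where "R i = (q (i + 1) - q i) / h"
definition Q :: real where "Q = h * (\<Sum>i\<in>I. (R i)^2)"

lemma h: "h > 0" using N by (simp add: h_eq)
lemma hN: "h * real N = 2 * pi" using N by (simp add: h_eq)

lemma per: "v (i + int N) = v i" and p_le: "\<bar>p i\<bar> \<le> kappa" and lo: "m \<le> exp (v i)" and hi: "exp (v i) \<le> 2 * m"
  using adm by (auto simp: admissible_def)

lemma per_p: "p (i + int N) = p i"
  unfolding slope_def using per[of i] per[of "i + 1"] by (simp add: algebra_simps)

lemma per_w: "w (i + int N) = w i" by (simp add: angle_def per_p)

lemma per_d: "d (i + int N) = d i"
  unfolding angle_diff_def using per_w[of i] per_w[of "i - 1"] by (simp add: algebra_simps)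

lemma per_q: "q (i + int N) = q i"
  unfolding speed_def by (simp add: per_d per)

lemma per_R: "R (i + int N) = R i"
  unfolding R_def using per_q[of i] per_q[of "i + 1"] by (simp add: algebra_simps)

lemma Q_nonneg: "Q \<ge> 0" unfolding Q_def using h by (intro mult_nonneg_nonneg sum_nonneg) auto

lemma d_eq: "d i = exp (v i) * q i" by (simp add: speed_def)

lemma w_le: "\<bar>w i\<bar> \<le> kappa"
  using arctan_1_lipschitz[of "p i" 0] p_le[of i] by (simp add: angle_def)

lemma sum_Q: "(\<Sum>i\<in>I. (R i)^2) = Q / h" using h by (simp add: Q_def)

text \<open>
  The sum of \<open>exp (v i) q i\<close> over a period telescopes to zero, so \<open>q\<close>
  changes sign and is bounded by its total variation over a period.
\<close>

lemma poincare_sup: "(q i)^2 \<le> 2 * pi * Q"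
proof -
  have zero: "(\<Sum>i\<in>I. exp (v i) * q i) = 0"
  proof -
    have "(\<Sum>i\<in>I. exp (v i) * q i) = ((\<Sum>i\<in>I. w i) - (\<Sum>i\<in>I. w (i - 1))) / h"
      by (simp add: d_eq[symmetric] angle_diff_def sum_subtractf flip: sum_divide_distrib)
    then show ?thesis using period_sum_shift_back[of w N] per_w by simp
  qed
  have neg: "\<exists>j\<in>I. q j \<le> 0"
  proof (rule ccontr)
    assume "\<not> ?thesis"
    then have "(\<Sum>i\<in>I. exp (v i) * q i) > 0" using N by (intro sum_pos) (auto intro!: mult_pos_pos simp: not_le)
    then show False using zero by simp
  qed
  have pos: "\<exists>j\<in>I. q j \<ge> 0"
  proof (rule ccontr)
    assume "\<not> ?thesis"
    then have "(\<Sum>i\<in>I. - (exp (v i) * q i)) > 0" using N by (intro sum_pos) (auto simp: not_le mult_pos_neg)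
    then show False using zero by (simp add: sum_negf)
  qed
  define V where "V = (\<Sum>l\<in>I. \<bar>q (l + 1) - q l\<bar>)"
  have V0: "V \<ge> 0" unfolding V_def by (intro sum_nonneg) auto
  have V2: "V^2 \<le> 2 * pi * Q"
  proof -
    have "V^2 \<le> (\<Sum>l\<in>I. 1^2) * (\<Sum>l\<in>I. \<bar>q (l + 1) - q l\<bar>^2)"
      unfolding V_def using Cauchy_Schwarz_ineq_sum[of "\<lambda>_. 1" "\<lambda>l. \<bar>q (l + 1) - q l\<bar>" I] by simp
    also have "(\<Sum>l\<in>I. \<bar>q (l + 1) - q l\<bar>^2) = h^2 * (\<Sum>l\<in>I. (R l)^2)"
      unfolding sum_distrib_left R_def using h by (intro sum.cong) (auto simp: power_divide)
    also have "(\<Sum>l\<in>I. (1::real)^2) * (h^2 * (\<Sum>l\<in>I. (R l)^2)) = (h * real N) * Q"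
      by (simp add: Q_def power2_eq_square)
    finally show ?thesis by (simp add: hN)
  qed
  have bd: "\<bar>q i\<bar> \<le> V" if i: "i \<in> I" for i
  proof (cases "q i \<ge> 0")
    case True
    obtain j where "j \<in> I" "q j \<le> 0" using neg by blast
    then show ?thesis using telescope_period[of j N i q] i True by (auto simp: V_def)
  next
    case False
    obtain j where "j \<in> I" "q j \<ge> 0" using pos by blast
    then show ?thesis using telescope_period[of j N i q] i False by (auto simp: V_def)
  qed
  have pm: "q (i mod int N) = q i"
  proof -
    interpret pf: periodic_fun_simple q "int N" by standard (rule per_q)
    have "q (i mod int N + (i div int N) * int N) = q (i mod int N)" using pf.plus_of_int[of "i mod int N" "i div int N"] by simp
    then show ?thesis by simp
  qed
  have "i mod int N \<in> I" using N by simp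
  then have "\<bar>q i\<bar> \<le> V" using bd pm by metis
  then have "(q i)^2 \<le> V^2" using V0 by (simp add: abs_le_square_iff[symmetric])
  then show ?thesis using V2 by simp
qed

lemma pi_sq: "4 * pi^2 \<le> 40"
proof -
  have "pi \<le> 3.15" using pi_approx by simp
  then have "pi^2 \<le> 3.15^2" by (intro power_mono) auto
  then show ?thesis by (simp add: power2_eq_square)
qed

lemma poincare: "h * (\<Sum>i\<in>I. (q i)^2) \<le> 40 * Q"
proof -
  have "(\<Sum>i\<in>I. (q i)^2) \<le> (\<Sum>i\<in>I. 2 * pi * Q)" by (intro sum_mono poincare_sup)
  then have "h * (\<Sum>i\<in>I. (q i)^2) \<le> h * (\<Sum>i\<in>I. 2 * pi * Q)" using h by (intro mult_left_mono) auto
  also have "\<dots> = (h * real N) * (2 * pi * Q)" by simp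
  also have "\<dots> = 4 * pi^2 * Q" unfolding hN by (simp add: power2_eq_square)
  also have "\<dots> \<le> 40 * Q" using pi_sq Q_nonneg by (rule mult_right_mono)
  finally show ?thesis .
qed

lemma v_diff: "\<bar>v (i + 1) - v i\<bar> \<le> h * kappa"
proof -
  have "v (i + 1) - v i = h * p i" using h by (simp add: slope_def)
  then show ?thesis using p_le[of i] h by (simp add: abs_mult)
qed

text \<open>
  The interpolation inequality for \<open>d = exp v q\<close>. The second difference of the
  angle is \<open>exp v R\<close> plus \<open>q\<close> times a difference quotient of
  \<open>exp v\<close>, and the latter is controlled by the slope bound.
\<close>

lemma q4: "h * (\<Sum>i\<in>I. q i ^ 4) \<le> 144 * kappa^2 * Q / m^2"
proof -
  have "(\<Sum>i\<in>I. d i ^ 4) \<le> 9 * kappa^2 * (\<Sum>i\<in>I. ((d (i + 1) - d i) / h)^2)"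
    by (rule discrete_interpolation[where w=w and h=h, OF h], rule per_w, rule w_le) (simp add: angle_diff_def)
  also have "\<dots> \<le> 9 * kappa^2 * (\<Sum>i\<in>I. 8 * m^2 * (R i)^2 + 8 * m^2 * kappa^2 * (q i)^2)"
  proof (intro mult_left_mono sum_mono)
    fix i
    define e where "e = (exp (v (i + 1)) - exp (v i)) / h"
    have "\<bar>e\<bar> = \<bar>exp (v (i + 1)) - exp (v i)\<bar> / h" using h by (simp add: e_def)
    also have "\<dots> \<le> 2 * m * \<bar>v (i + 1) - v i\<bar> / h" using h by (intro divide_right_mono exp_diff_bound hi) auto
    also have "\<dots> \<le> 2 * m * (h * kappa) / h" using h m v_diff[of i] by (intro divide_right_mono mult_left_mono) auto
    finally have e: "\<bar>e\<bar> \<le> 2 * m * kappa" using h by simp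
    have eq: "(d (i + 1) - d i) / h = exp (v (i + 1)) * R i + q i * e"
      unfolding d_eq R_def e_def using h by (simp add: field_simps)
    have "(a + b)^2 \<le> 2 * a^2 + 2 * b^2" for a b :: real
      using zero_le_power2[of "a - b"] by (simp add: power2_eq_square algebra_simps)
    then have "((d (i + 1) - d i) / h)^2 \<le> 2 * (exp (v (i + 1)) * R i)^2 + 2 * (q i * e)^2"
      unfolding eq by blast
    also have "\<dots> = 2 * ((exp (v (i + 1)))^2 * (R i)^2) + 2 * (e^2 * (q i)^2)" by (simp add: power_mult_distrib)
    also have "\<dots> \<le> 2 * ((2 * m)^2 * (R i)^2) + 2 * ((2 * m * kappa)^2 * (q i)^2)"
    proof -
      have "(exp (v (i + 1)))^2 \<le> (2 * m)^2" using hi by (intro power_mono) auto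
      moreover have "e^2 \<le> (2 * m * kappa)^2" using e m by (intro abs_le_square_iff[THEN iffD1]) auto
      ultimately show ?thesis by (intro add_mono mult_left_mono mult_right_mono) auto
    qed
    finally show "((d (i + 1) - d i) / h)^2 \<le> 8 * m^2 * (R i)^2 + 8 * m^2 * kappa^2 * (q i)^2"
      by (simp add: power_mult_distrib power_divide)
  qed simp
  also have "\<dots> = 9 * kappa^2 * (8 * m^2 * (Q / h) + 8 * m^2 * kappa^2 * (\<Sum>i\<in>I. (q i)^2))"
    by (simp add: sum.distrib sum_Q flip: sum_distrib_left)
  finally have "h * (\<Sum>i\<in>I. d i ^ 4) \<le> h * (9 * kappa^2 * (8 * m^2 * (Q / h) + 8 * m^2 * kappa^2 * (\<Sum>i\<in>I. (q i)^2)))"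
    using h by (intro mult_left_mono) auto
  also have "\<dots> = 72 * kappa^2 * m^2 * (Q + kappa^2 * (h * (\<Sum>i\<in>I. (q i)^2)))"
    using h by (simp add: field_simps)
  also have "\<dots> \<le> 72 * kappa^2 * m^2 * (2 * Q)"
  proof -
    have "kappa^2 * (h * (\<Sum>i\<in>I. (q i)^2)) \<le> kappa^2 * (40 * Q)" using poincare by (rule mult_left_mono) simp
    also have "\<dots> \<le> Q" using Q_nonneg by (simp add: power2_eq_square)
    finally show ?thesis by (intro mult_left_mono) auto
  qed
  finally have d4: "h * (\<Sum>i\<in>I. d i ^ 4) \<le> 144 * kappa^2 * m^2 * Q" by simp
  have "(\<Sum>i\<in>I. m ^ 4 * q i ^ 4) \<le> (\<Sum>i\<in>I. d i ^ 4)"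
  proof (intro sum_mono)
    fix i
    have "m ^ 4 \<le> exp (v i) ^ 4" using lo m by (intro power_mono) auto
    then have "m ^ 4 * q i ^ 4 \<le> exp (v i) ^ 4 * q i ^ 4" by (intro mult_right_mono) auto
    then show "m ^ 4 * q i ^ 4 \<le> d i ^ 4" by (simp add: d_eq power_mult_distrib)
  qed
  then have "h * (m ^ 4 * (\<Sum>i\<in>I. q i ^ 4)) \<le> h * (\<Sum>i\<in>I. d i ^ 4)"
    using h by (intro mult_left_mono) (auto simp: sum_distrib_left)
  then have "m ^ 4 * (h * (\<Sum>i\<in>I. q i ^ 4)) \<le> 144 * kappa^2 * m^2 * Q"
    using d4 by (simp only: mult.left_commute[of h])
  also have "\<dots> = m ^ 4 * (144 * kappa^2 * Q / m^2)"
    using m by (simp add: field_simps power4_eq_xxxx power2_eq_square)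
  finally have "m ^ 4 * (h * (\<Sum>i\<in>I. q i ^ 4)) \<le> m ^ 4 * (144 * kappa^2 * Q / m^2)" .
  then show ?thesis using m by (metis mult_le_cancel_left_pos zero_less_power)
qed

lemma sum_q_R: "h * (\<Sum>i\<in>I. \<bar>R i\<bar> * \<bar>q i\<bar>) \<le> 7 * Q"
proof -
  have "h * (\<Sum>i\<in>I. \<bar>R i\<bar> * \<bar>q i\<bar>) \<le> h * (\<Sum>i\<in>I. (7 * (R i)^2 + (q i)^2 / 7) / 2)"
    using h by (intro mult_left_mono sum_mono young_weighted) auto
  also have "\<dots> = (7 * Q + (h * (\<Sum>i\<in>I. (q i)^2)) / 7) / 2"
    by (simp add: Q_def sum.distrib algebra_simps flip: sum_distrib_left sum_divide_distrib)
  also have "\<dots> \<le> 7 * Q" using poincare Q_nonneg by simp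
  finally show ?thesis .
qed

lemma sum_R_q2:
  assumes g: "\<And>i. g i \<ge> 0" "h * (\<Sum>i\<in>I. (g i)^2) \<le> 144 * kappa^2 * Q / m^2"
  shows "h * (\<Sum>i\<in>I. \<bar>R i\<bar> * g i) \<le> 12 * kappa / m * Q"
proof -
  define t where "t = 12 * kappa / m"
  have t: "t > 0" using m by (simp add: t_def)
  have "h * (\<Sum>i\<in>I. \<bar>R i\<bar> * g i) \<le> h * (\<Sum>i\<in>I. (t * (R i)^2 + (g i)^2 / t) / 2)"
    using h young_weighted[OF t, of "R _" "g _"] g(1) by (intro mult_left_mono sum_mono) auto
  also have "\<dots> = (t * Q + (h * (\<Sum>i\<in>I. (g i)^2)) / t) / 2"
    by (simp add: Q_def sum.distrib algebra_simps flip: sum_distrib_left sum_divide_distrib)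
  also have "\<dots> \<le> (t * Q + (144 * kappa^2 * Q / m^2) / t) / 2"
    using t g(2) by (intro divide_right_mono add_left_mono) auto
  also have "(144 * kappa^2 * Q / m^2) / t = t * Q" using m by (simp add: t_def power2_eq_square)
  finally show ?thesis by (simp add: t_def)
qed

lemma sum_q_q2: "h * (\<Sum>i\<in>I. \<bar>q i\<bar> * (q i)^2) \<le> 84 * kappa / m * Q"
proof -
  define t where "t = 12 * kappa / (7 * m)"
  have t: "t > 0" using m by (simp add: t_def)
  have "h * (\<Sum>i\<in>I. \<bar>q i\<bar> * (q i)^2) \<le> h * (\<Sum>i\<in>I. (t * (q i)^2 + ((q i)^2)^2 / t) / 2)"
    using h young_weighted[OF t, of "q _" "(q _)^2"] by (intro mult_left_mono sum_mono) auto
  also have "\<dots> = (t * (h * (\<Sum>i\<in>I. (q i)^2)) + (h * (\<Sum>i\<in>I. q i ^ 4)) / t) / 2"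
    by (simp add: sum.distrib algebra_simps flip: sum_distrib_left sum_divide_distrib)
  also have "\<dots> \<le> (t * (40 * Q) + (144 * kappa^2 * Q / m^2) / t) / 2"
    using t poincare q4 by (intro divide_right_mono add_mono mult_left_mono) auto
  also have "(144 * kappa^2 * Q / m^2) / t = 84 * kappa / m * Q" using m by (simp add: t_def power2_eq_square)
  also have "(t * (40 * Q) + 84 * kappa / m * Q) / 2 \<le> 84 * kappa / m * Q"
    using m Q_nonneg by (simp add: t_def divide_right_mono field_simps)
  finally show ?thesis .
qed

end

context admissible_step
begin

lemma sup_q: "\<bar>q i\<bar> \<le> 2 * kappa / (h * m)"
proof -
  have "\<bar>d i\<bar> \<le> 2 * kappa / h"
  proof -
    have "\<bar>w i - w (i - 1)\<bar> \<le> 2 * kappa" using w_le[of i] w_le[of "i - 1"] by linarith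
    from divide_right_mono[OF this, of h] show ?thesis using h by (simp only: angle_diff_def abs_divide) simp
  qed
  then have "\<bar>d i\<bar> / exp (v i) \<le> (2 * kappa / h) / m"
    using m lo[of i] h by (intro frac_le) auto
  then show ?thesis by (simp add: speed_def abs_divide)
qed

lemma sup_R: "\<bar>R i\<bar> \<le> 4 * kappa / (h^2 * m)"
proof -
  have "\<bar>R i\<bar> \<le> (2 * kappa / (h * m) + 2 * kappa / (h * m)) / h"
  proof -
    have "\<bar>q (i + 1) - q i\<bar> \<le> 2 * kappa / (h * m) + 2 * kappa / (h * m)"
      using sup_q[of i] sup_q[of "i + 1"] by linarith
    from divide_right_mono[OF this, of h] show ?thesis using h by (simp only: R_def abs_divide) simp
  qed
  also have "\<dots> = 4 * kappa / (h^2 * m)" using h m by (simp add: field_simps power2_eq_square)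
  finally show ?thesis .
qed

text \<open>
  The coefficient \<open>u^2 (1 + p^2)\<close> that arises when \<open>w\<^sub>x = u q\<close>
  is inserted into the derivative of the energy.
\<close>

definition weight :: "int => real" where "weight i = (exp (v i))^2 * (1 + (p i)^2)"

lemma per_weight: "weight (i + int N) = weight i"
  unfolding weight_def by (simp add: per per_p)

lemma p2_le: "(p i)^2 \<le> kappa^2"
  using p_le[of i] by (intro abs_le_square_iff[THEN iffD1]) auto

lemma p_diff: "\<bar>p (i + 1) - p i\<bar> \<le> 4 * m * h * \<bar>q (i + 1)\<bar>"
proof -
  obtain c where c: "1/2 \<le> c" "c \<le> 1" "w (i + 1) - w i = c * (p (i + 1) - p i)"
    using arctan_diff_factor[of "p (i + 1)" "p i"] p_le[of i] p_le[of "i + 1"] by (auto simp: angle_def)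
  have "w (i + 1) - w i = h * (exp (v (i + 1)) * q (i + 1))"
    using h unfolding d_eq[symmetric] by (simp add: angle_diff_def)
  then have "c * \<bar>p (i + 1) - p i\<bar> = h * exp (v (i + 1)) * \<bar>q (i + 1)\<bar>"
    using c h by (metis abs_exp_cancel abs_mult abs_of_pos less_le_trans mult.assoc zero_less_divide_1_iff zero_less_numeral)
  also have "\<dots> \<le> h * (2 * m) * \<bar>q (i + 1)\<bar>" using h hi by (intro mult_right_mono mult_left_mono) auto
  finally have "c * \<bar>p (i + 1) - p i\<bar> \<le> h * (2 * m) * \<bar>q (i + 1)\<bar>" .
  moreover have "1/2 * \<bar>p (i + 1) - p i\<bar> \<le> c * \<bar>p (i + 1) - p i\<bar>" using c by (intro mult_right_mono) auto
  ultimately show ?thesis by (simp add: algebra_simps)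
qed

lemma weight_diff: "\<bar>weight (i + 1) - weight i\<bar> / h \<le> 16 * kappa * m^2 + 32 * kappa * m ^ 3 * \<bar>q (i + 1)\<bar>"
proof -
  have e2: "exp (2 * v j) \<le> 4 * m^2" for j
  proof -
    have "(exp (v j))^2 \<le> (2 * m)^2" using hi by (intro power_mono) auto
    then show ?thesis by (simp add: power2_eq_square mult_exp_exp)
  qed
  have sq: "(exp (v j))^2 = exp (2 * v j)" for j by (simp add: power2_eq_square mult_exp_exp)
  have "weight (i + 1) - weight i = (exp (2 * v (i + 1)) - exp (2 * v i)) * (1 + (p (i + 1))^2)
      + exp (2 * v i) * ((p (i + 1) + p i) * (p (i + 1) - p i))"
    unfolding weight_def sq by (simp add: power2_eq_square algebra_simps)
  also have "\<bar>\<dots>\<bar> \<le> \<bar>exp (2 * v (i + 1)) - exp (2 * v i)\<bar> * (1 + (p (i + 1))^2)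
      + exp (2 * v i) * (\<bar>p (i + 1) + p i\<bar> * \<bar>p (i + 1) - p i\<bar>)"
    by (rule order_trans[OF abs_triangle_ineq]) (simp add: abs_mult)
  also have "\<dots> \<le> (4 * m^2 * (2 * (h * kappa))) * 2 + (4 * m^2) * ((2 * kappa) * (4 * m * h * \<bar>q (i + 1)\<bar>))"
  proof (intro add_mono mult_mono)
    have "\<bar>exp (2 * v (i + 1)) - exp (2 * v i)\<bar> \<le> 4 * m^2 * \<bar>2 * v (i + 1) - 2 * v i\<bar>"
      by (intro exp_diff_bound e2)
    also have "\<bar>2 * v (i + 1) - 2 * v i\<bar> = 2 * \<bar>v (i + 1) - v i\<bar>"
      using abs_mult[of 2 "v (i + 1) - v i"] by (simp add: right_diff_distrib)
    also have "4 * m^2 * (2 * \<bar>v (i + 1) - v i\<bar>) \<le> 4 * m^2 * (2 * (h * kappa))"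
      using v_diff[of i] by (intro mult_left_mono) auto
    finally show "\<bar>exp (2 * v (i + 1)) - exp (2 * v i)\<bar> \<le> 4 * m^2 * (2 * (h * kappa))" .
    show "1 + (p (i + 1))^2 \<le> 2" using p2_le[of "i+1"] by (simp add: power2_eq_square)
    show "\<bar>p (i + 1) + p i\<bar> \<le> 2 * kappa" using p_le[of i] p_le[of "i+1"] by linarith
  qed (use p_diff e2 h m in auto)
  finally have "\<bar>weight (i + 1) - weight i\<bar> / h \<le> ((4 * m^2 * (2 * (h * kappa))) * 2 + (4 * m^2) * ((2 * kappa) * (4 * m * h * \<bar>q (i + 1)\<bar>))) / h"
    using h by (intro divide_right_mono) auto
  also have "\<dots> = 16 * kappa * m^2 + 32 * kappa * m ^ 3 * \<bar>q (i + 1)\<bar>"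
    using h by (simp add: field_simps power2_eq_square power3_eq_cube)
  finally show ?thesis .
qed

lemma sum_q2_shift: "h * (\<Sum>i\<in>I. (\<bar>q i\<bar> * \<bar>q (i + 1)\<bar>)^2) \<le> 144 * kappa^2 * Q / m^2"
proof -
  have "(\<Sum>i\<in>I. (\<bar>q i\<bar> * \<bar>q (i + 1)\<bar>)^2) \<le> (\<Sum>i\<in>I. (q i ^ 4 + q (i + 1) ^ 4) / 2)"
  proof (intro sum_mono)
    fix i
    have "(\<bar>q i\<bar> * \<bar>q (i + 1)\<bar>)^2 = (q i)^2 * (q (i + 1))^2" by (simp add: power_mult_distrib)
    also have "\<dots> \<le> (q i ^ 4 + q (i + 1) ^ 4) / 2"
      using zero_le_power2[of "(q i)^2 - (q (i + 1))^2"]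
      by (simp add: power2_eq_square power4_eq_xxxx algebra_simps)
    finally show "(\<bar>q i\<bar> * \<bar>q (i + 1)\<bar>)^2 \<le> (q i ^ 4 + q (i + 1) ^ 4) / 2" .
  qed
  also have "\<dots> = ((\<Sum>i\<in>I. q i ^ 4) + (\<Sum>i\<in>I. q (i + 1) ^ 4)) / 2"
    by (simp only: sum.distrib flip: sum_divide_distrib)
  also have "\<dots> = (\<Sum>i\<in>I. q i ^ 4)"
    using period_sum_shift[of "\<lambda>i. q i ^ 4" N] per_q by simp
  finally have "h * (\<Sum>i\<in>I. (\<bar>q i\<bar> * \<bar>q (i + 1)\<bar>)^2) \<le> h * (\<Sum>i\<in>I. q i ^ 4)"
    using h by (intro mult_left_mono) auto
  then show ?thesis using q4 by linarith
qed

lemma sum_qqR: "h * (\<Sum>i\<in>I. \<bar>R i\<bar> * (\<bar>q i\<bar> * \<bar>q (i + 1)\<bar>)) \<le> 12 * kappa / m * Q"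
  by (rule sum_R_q2[OF _ sum_q2_shift]) simp

lemma sum_qR2: "h * (\<Sum>i\<in>I. \<bar>R i\<bar> * (q i)^2) \<le> 12 * kappa / m * Q"
  by (rule sum_R_q2) (use q4 in simp_all)

text \<open>
  The principal part of the time derivative of the energy. Here \<open>X\<close> is the
  difference quotient of the angle in time, which the mean value theorem writes as a multiple of
  \<open>R\<close>. Summation by parts produces the negative square of \<open>R\<close>, and
  differences of the weight carry a factor \<open>kappa\<close>.
\<close>

lemma dissipation:
  assumes X: "\<And>i. X i = c i * R i" and c: "\<And>i. 1/2 \<le> c i" "\<And>i. c i \<le> 1" and perX: "\<And>i. X (i + int N) = X i"
  shows "h * (\<Sum>i\<in>I. weight i * q i * ((X i - X (i - 1)) / h)) \<le> - (m^2 * Q / 4)"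
proof -
  have "h * (\<Sum>i\<in>I. weight i * q i * ((X i - X (i - 1)) / h)) = (\<Sum>i\<in>I. weight i * q i * (X i - X (i - 1)))"
    unfolding sum_distrib_left using h by (intro sum.cong) auto
  also have "\<dots> = - (\<Sum>i\<in>I. X i * (weight (i + 1) * q (i + 1) - weight i * q i))"
    by (rule summation_by_parts_period) (simp_all add: perX per_weight per_q)
  also have "\<dots> = (\<Sum>i\<in>I. - (X i * (weight (i + 1) * q (i + 1) - weight i * q i)))"
    by (simp add: sum_negf)
  also have "\<dots> \<le> (\<Sum>i\<in>I. h * (- (m^2 / 2) * (R i)^2 + 16 * kappa * m^2 * (\<bar>R i\<bar> * \<bar>q i\<bar>)
      + 32 * kappa * m ^ 3 * (\<bar>R i\<bar> * (\<bar>q i\<bar> * \<bar>q (i + 1)\<bar>))))"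
  proof (intro sum_mono)
    fix i
    define D where "D = (weight (i + 1) - weight i) / h"
    have "- (X i * (weight (i + 1) * q (i + 1) - weight i * q i)) = h * (- (c i * weight (i + 1) * (R i)^2) - c i * R i * q i * D)"
      unfolding X D_def R_def using h by (simp add: field_simps power2_eq_square)
    also have "\<dots> \<le> h * (- (m^2 / 2) * (R i)^2 + \<bar>R i\<bar> * \<bar>q i\<bar> * (16 * kappa * m^2 + 32 * kappa * m ^ 3 * \<bar>q (i + 1)\<bar>))"
    proof (intro mult_left_mono)
      have "m^2 \<le> (exp (v (i + 1)))^2" using lo m by (intro power_mono) auto
      then have "m^2 * 1 \<le> weight (i + 1)" unfolding weight_def using m by (intro mult_mono) auto
      then have "1/2 * m^2 \<le> c i * weight (i + 1)" using c[of i] by (intro mult_mono) auto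
      then have 1: "1/2 * m^2 * (R i)^2 \<le> c i * weight (i + 1) * (R i)^2" by (intro mult_right_mono) auto
      have "- (c i * R i * q i * D) \<le> \<bar>c i * R i * q i * D\<bar>" by linarith
      also have "\<dots> = c i * (\<bar>R i\<bar> * \<bar>q i\<bar> * \<bar>D\<bar>)" using c[of i] by (simp add: abs_mult)
      also have "\<dots> \<le> 1 * (\<bar>R i\<bar> * \<bar>q i\<bar> * \<bar>D\<bar>)" using c by (intro mult_right_mono) auto
      also have "\<dots> \<le> \<bar>R i\<bar> * \<bar>q i\<bar> * (16 * kappa * m^2 + 32 * kappa * m ^ 3 * \<bar>q (i + 1)\<bar>)"
      unfolding mult_1
      proof (rule mult_left_mono)
        show "\<bar>D\<bar> \<le> 16 * kappa * m^2 + 32 * kappa * m ^ 3 * \<bar>q (i + 1)\<bar>"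
          using weight_diff[of i] h by (simp only: D_def abs_divide abs_of_pos)
      qed simp
      finally show "- (c i * weight (i + 1) * (R i)^2) - c i * R i * q i * D
        \<le> - (m^2 / 2) * (R i)^2 + \<bar>R i\<bar> * \<bar>q i\<bar> * (16 * kappa * m^2 + 32 * kappa * m ^ 3 * \<bar>q (i + 1)\<bar>)"
        using 1 by simp
    qed (use h in simp)
    finally show "- (X i * (weight (i + 1) * q (i + 1) - weight i * q i)) \<le> h * (- (m^2 / 2) * (R i)^2 + 16 * kappa * m^2 * (\<bar>R i\<bar> * \<bar>q i\<bar>)
      + 32 * kappa * m ^ 3 * (\<bar>R i\<bar> * (\<bar>q i\<bar> * \<bar>q (i + 1)\<bar>)))" by (simp add: algebra_simps)
  qed
  also have "\<dots> = h * (- (m^2 / 2) * (\<Sum>i\<in>I. (R i)^2) + 16 * kappa * m^2 * (\<Sum>i\<in>I. \<bar>R i\<bar> * \<bar>q i\<bar>)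
      + 32 * kappa * m ^ 3 * (\<Sum>i\<in>I. \<bar>R i\<bar> * (\<bar>q i\<bar> * \<bar>q (i + 1)\<bar>)))"
    by (simp only: sum.distrib flip: sum_distrib_left)
  also have "\<dots> = - (m^2 / 2) * Q + 16 * kappa * m^2 * (h * (\<Sum>i\<in>I. \<bar>R i\<bar> * \<bar>q i\<bar>))
      + 32 * kappa * m ^ 3 * (h * (\<Sum>i\<in>I. \<bar>R i\<bar> * (\<bar>q i\<bar> * \<bar>q (i + 1)\<bar>)))"
    unfolding Q_def by (simp add: algebra_simps)
  also have "\<dots> \<le> - (m^2 / 2) * Q + 16 * kappa * m^2 * (7 * Q) + 32 * kappa * m ^ 3 * (12 * kappa / m * Q)"
    using m by (intro add_mono mult_left_mono sum_q_R sum_qqR order_refl) auto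
  also have "\<dots> = m^2 * Q * (- (1/2) + 112 * kappa + 384 * kappa^2)"
    using m by (simp add: field_simps power2_eq_square power3_eq_cube)
  also have "\<dots> \<le> m^2 * Q * (- (1/4))"
    using Q_nonneg by (intro mult_left_mono) (auto simp: power2_eq_square)
  finally show ?thesis by simp
qed

text \<open>
  Let \<open>s\<close> and \<open>s'\<close> be the weights \<open>u (1 + p^2)\<close> before
  and after the step, and \<open>f\<close> the difference quotient of \<open>d\<close> in time.
  The cross term \<open>2 \<tau> s d f\<close> is the dissipation. The change of the weight
  gives terms that are cubic in \<open>q\<close> and \<open>R\<close>, small by
  \<open>q4\<close>. The terms quadratic in \<open>f\<close> are of second order in
  \<open>\<tau>\<close>; as \<open>f\<close> is at most of the size of \<open>R / h\<close>, the
  bound \<open>\<tau> \<le> m h^2 / 100\<close> makes them smaller than the dissipation.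
\<close>

theorem energy_decreases: "energy N h (euler \<tau> h v) \<le> energy N h v"
proof -
  define v' where "v' = euler \<tau> h v"
  have adm': "admissible N h m v'" unfolding v'_def by (rule admissible_euler[OF h m tau adm])
  interpret new: admissible_step N h m \<tau> v' using N h_eq m tau adm' by unfold_locales
  have p': "slope h v' i = p i + \<tau> * R i" for i
    unfolding v'_def R_def by (rule slope_euler) (use h in simp)
  define X where "X i = (angle h v' i - w i) / \<tau>" for i
  have "\<exists>c. 1/2 \<le> c \<and> c \<le> 1 \<and> X i = c * R i" for i
  proof -
    obtain c where c: "1/2 \<le> c" "c \<le> 1" "angle h v' i - w i = c * (slope h v' i - p i)"
      using arctan_diff_factor[of "slope h v' i" "p i"] p_le[of i] new.p_le[of i] by (auto simp: angle_def)
    then have "X i = c * R i" using tau by (simp add: X_def p')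
    then show ?thesis using c by blast
  qed
  then obtain c where c: "\<And>i. 1/2 \<le> c i" "\<And>i. c i \<le> 1" and X: "\<And>i. X i = c i * R i" by metis
  have perX: "X (i + int N) = X i" for i by (simp add: X_def per_w new.per_w)
  define f where "f i = (X i - X (i - 1)) / h" for i
  have d': "angle_diff h v' i = d i + \<tau> * f i" for i
    unfolding f_def X_def angle_diff_def using tau h by (simp add: field_simps)
  define s where "s i = exp (v i) * (1 + (p i)^2)" for i
  define s' where "s' i = exp (v' i) * (1 + (slope h v' i)^2)" for i
  define S where "S = 2 * kappa / (h * m) + kappa * (4 * kappa / (h^2 * m))"
  have sumf: "h * (\<Sum>i\<in>I. (f i)^2) \<le> 4 * Q / h^2"
  proof -
    have "(\<Sum>i\<in>I. (f i)^2) \<le> (\<Sum>i\<in>I. 2 / h^2 * ((R i)^2 + (R (i - 1))^2))"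
    proof (intro sum_mono)
      fix i
      have X2: "(X j)^2 \<le> (R j)^2" for j
      proof -
        have "\<bar>c j\<bar> * \<bar>R j\<bar> \<le> 1 * \<bar>R j\<bar>" using c[of j] by (intro mult_right_mono) auto
        then show ?thesis by (simp add: X abs_le_square_iff[symmetric] abs_mult)
      qed
      have "(f i)^2 = (X i - X (i - 1))^2 / h^2" by (simp add: f_def power_divide)
      also have "\<dots> \<le> (2 * ((X i)^2 + (X (i - 1))^2)) / h^2"
        using zero_le_power2[of "X i + X (i - 1)"] by (intro divide_right_mono) (auto simp: power2_eq_square algebra_simps)
      also have "\<dots> \<le> (2 * ((R i)^2 + (R (i - 1))^2)) / h^2"
        using X2[of i] X2[of "i - 1"] by (intro divide_right_mono) auto
      finally show "(f i)^2 \<le> 2 / h^2 * ((R i)^2 + (R (i - 1))^2)" by simp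
    qed
    also have "\<dots> = 2 / h^2 * ((\<Sum>i\<in>I. (R i)^2) + (\<Sum>i\<in>I. (R (i - 1))^2))"
      by (simp only: sum.distrib flip: sum_distrib_left)
    also have "(\<Sum>i\<in>I. (R (i - 1))^2) = (\<Sum>i\<in>I. (R i)^2)"
      using period_sum_shift_back[of "\<lambda>i. (R i)^2" N] per_R by simp
    finally have "h * (\<Sum>i\<in>I. (f i)^2) \<le> h * (2 / h^2 * ((\<Sum>i\<in>I. (R i)^2) + (\<Sum>i\<in>I. (R i)^2)))"
      using h by (intro mult_left_mono) auto
    then show ?thesis by (simp add: Q_def field_simps)
  qed
  have s_le: "s i \<le> 4 * m" for i
  proof -
    have "s i \<le> (2 * m) * 2" unfolding s_def using hi p2_le[of i] m by (intro mult_mono) (auto simp: power2_eq_square)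
    then show ?thesis by simp
  qed
  have s_diff: "\<bar>s' i - s i\<bar> \<le> 4 * m * \<tau> * (\<bar>q i\<bar> + kappa * \<bar>R i\<bar>)" for i
  proof -
    have "s' i - s i = (exp (v' i) - exp (v i)) * (1 + (slope h v' i)^2) + exp (v i) * ((slope h v' i + p i) * (slope h v' i - p i))"
      by (simp add: s_def s'_def power2_eq_square algebra_simps)
    also have "\<bar>\<dots>\<bar> \<le> \<bar>exp (v' i) - exp (v i)\<bar> * (1 + (slope h v' i)^2) + exp (v i) * (\<bar>slope h v' i + p i\<bar> * \<bar>slope h v' i - p i\<bar>)"
      by (rule order_trans[OF abs_triangle_ineq]) (simp add: abs_mult)
    also have "\<dots> \<le> (2 * m * (\<tau> * \<bar>q i\<bar>)) * 2 + (2 * m) * ((2 * kappa) * (\<tau> * \<bar>R i\<bar>))"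
    proof (intro add_mono mult_mono)
      have "\<bar>exp (v' i) - exp (v i)\<bar> \<le> 2 * m * \<bar>v' i - v i\<bar>" by (intro exp_diff_bound hi new.hi)
      then show "\<bar>exp (v' i) - exp (v i)\<bar> \<le> 2 * m * (\<tau> * \<bar>q i\<bar>)"
        using tau by (simp add: v'_def euler_def abs_mult)
      show "1 + (slope h v' i)^2 \<le> 2" using new.p2_le[of i] by (simp add: power2_eq_square)
      show "\<bar>slope h v' i + p i\<bar> \<le> 2 * kappa" using p_le[of i] new.p_le[of i] by linarith
      show "\<bar>slope h v' i - p i\<bar> \<le> \<tau> * \<bar>R i\<bar>" using tau by (simp add: p' abs_mult)
    qed (use hi m tau in auto)
    finally show ?thesis by (simp add: algebra_simps)
  qed
  have point: "s' i * (d i + \<tau> * f i)^2 - s i * (d i)^2 \<le>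
     32 * m ^ 3 * \<tau> * (\<bar>q i\<bar> * (q i)^2) + 32 * m ^ 3 * \<tau> * kappa * (\<bar>R i\<bar> * (q i)^2) + 8 * m * \<tau> * S * \<tau>^2 * (f i)^2
     + 2 * \<tau> * (weight i * q i * ((X i - X (i - 1)) / h)) + 4 * m * \<tau>^2 * (f i)^2" for i
  proof -
    define a where "a = \<bar>q i\<bar> + kappa * \<bar>R i\<bar>"
    have aS: "0 \<le> a" "a \<le> S" unfolding a_def S_def using sup_q[of i] sup_R[of i]
      by (simp_all add: add_mono)
    have e: "s' i * (d i + \<tau> * f i)^2 - s i * (d i)^2 = (s' i - s i) * (d i + \<tau> * f i)^2 + 2 * \<tau> * (s i * d i * f i) + \<tau>^2 * (s i * (f i)^2)"
      by (simp add: power2_eq_square algebra_simps)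
    have "d i ^ 2 \<le> (2 * m)^2 * (q i)^2"
      unfolding d_eq power_mult_distrib[of "exp (v i)"] using hi by (intro mult_right_mono power_mono) auto
    moreover have "(d i + \<tau> * f i)^2 \<le> 2 * (d i)^2 + 2 * (\<tau>^2 * (f i)^2)"
      using zero_le_power2[of "d i - \<tau> * f i"] by (simp add: power2_eq_square algebra_simps)
    ultimately have sq: "(d i + \<tau> * f i)^2 \<le> 8 * m^2 * (q i)^2 + 2 * (\<tau>^2 * (f i)^2)" by (simp add: power_mult_distrib)
    have "(s' i - s i) * (d i + \<tau> * f i)^2 \<le> \<bar>s' i - s i\<bar> * (d i + \<tau> * f i)^2" by (intro mult_right_mono) auto
    also have "\<dots> \<le> (4 * m * \<tau> * a) * (8 * m^2 * (q i)^2 + 2 * (\<tau>^2 * (f i)^2))"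
      using s_diff[of i] sq aS m tau unfolding a_def[symmetric] by (intro mult_mono) auto
    also have "\<dots> = 32 * m ^ 3 * \<tau> * (a * (q i)^2) + 8 * m * \<tau> * a * (\<tau>^2 * (f i)^2)"
      by (simp add: algebra_simps power2_eq_square power3_eq_cube)
    also have "\<dots> \<le> 32 * m ^ 3 * \<tau> * (a * (q i)^2) + 8 * m * \<tau> * S * (\<tau>^2 * (f i)^2)"
      using aS m tau by (intro add_left_mono mult_right_mono mult_left_mono) auto
    finally have 1: "(s' i - s i) * (d i + \<tau> * f i)^2 \<le> 32 * m ^ 3 * \<tau> * (a * (q i)^2) + 8 * m * \<tau> * S * (\<tau>^2 * (f i)^2)" .
    have 2: "s i * d i * f i = weight i * q i * ((X i - X (i - 1)) / h)"
      unfolding s_def d_eq weight_def f_def by (simp add: power2_eq_square)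
    have 3: "\<tau>^2 * (s i * (f i)^2) \<le> \<tau>^2 * (4 * m * (f i)^2)"
      using s_le by (intro mult_left_mono mult_right_mono) auto
    show ?thesis unfolding e 2 using 1 3 by (simp add: a_def algebra_simps)
  qed
  have Ediff: "energy N h v' - energy N h v = h * (\<Sum>i\<in>I. s' i * (d i + \<tau> * f i)^2 - s i * (d i)^2)"
    by (simp add: energy_def s_def s'_def d' sum_subtractf right_diff_distrib)
  also have "\<dots> \<le> h * (\<Sum>i\<in>I. 32 * m ^ 3 * \<tau> * (\<bar>q i\<bar> * (q i)^2) + 32 * m ^ 3 * \<tau> * kappa * (\<bar>R i\<bar> * (q i)^2) + 8 * m * \<tau> * S * \<tau>^2 * (f i)^2
     + 2 * \<tau> * (weight i * q i * ((X i - X (i - 1)) / h)) + 4 * m * \<tau>^2 * (f i)^2)"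
    using h by (intro mult_left_mono sum_mono point) auto
  also have "\<dots> = 32 * m ^ 3 * \<tau> * (h * (\<Sum>i\<in>I. \<bar>q i\<bar> * (q i)^2)) + 32 * m ^ 3 * \<tau> * kappa * (h * (\<Sum>i\<in>I. \<bar>R i\<bar> * (q i)^2))
     + 8 * m * \<tau> * S * \<tau>^2 * (h * (\<Sum>i\<in>I. (f i)^2))
     + 2 * \<tau> * (h * (\<Sum>i\<in>I. weight i * q i * ((X i - X (i - 1)) / h))) + 4 * m * \<tau>^2 * (h * (\<Sum>i\<in>I. (f i)^2))"
    by (simp only: sum.distrib distrib_left mult.left_commute[of h] flip: sum_distrib_left)
  also have "\<dots> \<le> 32 * m ^ 3 * \<tau> * (84 * kappa / m * Q) + 32 * m ^ 3 * \<tau> * kappa * (12 * kappa / m * Q)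
     + 8 * m * \<tau> * S * \<tau>^2 * (4 * Q / h^2)
     + 2 * \<tau> * (- (m^2 * Q / 4)) + 4 * m * \<tau>^2 * (4 * Q / h^2)"
    using m tau h
    by (intro add_mono mult_left_mono sum_q_q2 sum_qR2 sumf dissipation[OF X c perX])
       (auto simp: S_def intro!: mult_nonneg_nonneg add_nonneg_nonneg)
  \<comment> \<open>All terms are multiples of \<open>m^2 \<tau> Q\<close>: the dissipation gives -1/2, the
    terms of second order in \<open>\<tau>\<close> give 16/100, and the other coefficients
    contain \<open>kappa\<close>.\<close>
  also have "\<dots> \<le> m^2 * \<tau> * Q * (32 * 84 * kappa) + m^2 * \<tau> * Q * (32 * 12 * kappa^2) + m^2 * \<tau> * Q * (32 / 10000 * (14 * kappa + 4 * kappa^2))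
     + m^2 * \<tau> * Q * (- (1/2)) + m^2 * \<tau> * Q * (16 / 100)"
  proof (intro add_mono)
    have hle: "h \<le> 7"
    proof -
      have "h \<le> 2 * pi" using N unfolding h_eq by (simp add: divide_le_eq)
      then show ?thesis using pi_approx by simp
    qed
    have "4 * m * \<tau>^2 * (4 * Q / h^2) = 16 * m * \<tau> * Q / h^2 * \<tau>" by (simp add: power2_eq_square)
    also have "\<dots> \<le> 16 * m * \<tau> * Q / h^2 * (m * h^2 / 100)" using m tau Q_nonneg h by (intro mult_left_mono) auto
    also have "\<dots> = m^2 * \<tau> * Q * (16 / 100)" using h by (simp add: power2_eq_square)
    finally show "4 * m * \<tau>^2 * (4 * Q / h^2) \<le> m^2 * \<tau> * Q * (16 / 100)" .
    have "\<tau>^2 \<le> (m * h^2 / 100)^2" using tau by (intro power_mono) auto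
    then have "8 * m * \<tau> * S * (4 * Q / h^2) * \<tau>^2 \<le> 8 * m * \<tau> * S * (4 * Q / h^2) * (m * h^2 / 100)^2"
      using m tau Q_nonneg h by (intro mult_left_mono) (auto simp: S_def)
    also have "\<dots> = m^2 * \<tau> * Q * (32 / 10000 * (2 * kappa * h + 4 * kappa^2))"
      using m h by (simp add: S_def field_simps power2_eq_square)
    also have "\<dots> \<le> m^2 * \<tau> * Q * (32 / 10000 * (14 * kappa + 4 * kappa^2))"
      using m tau Q_nonneg hle by (intro mult_left_mono add_right_mono) auto
    finally show "8 * m * \<tau> * S * \<tau>^2 * (4 * Q / h^2) \<le> m^2 * \<tau> * Q * (32 / 10000 * (14 * kappa + 4 * kappa^2))"
      by (simp add: mult_ac)
  qed (use m in \<open>auto simp: power2_eq_square power3_eq_cube\<close>)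
  also have "\<dots> = m^2 * \<tau> * Q * (32 * 84 * kappa + 32 * 12 * kappa^2 + 32 / 10000 * (14 * kappa + 4 * kappa^2) - 1/2 + 16/100)"
    by (simp only: distrib_left[symmetric])
       (simp add: algebra_simps)
  also have "\<dots> \<le> 0"
    using m tau Q_nonneg by (intro mult_nonneg_nonpos) (auto simp: power2_eq_square)
  finally show ?thesis by (simp add: v'_def)
qed

end

section \<open>Hoelder continuity of the discrete slopes\<close>

lemma period_sum_window:
  fixes f :: "int => real"
  assumes per: "\<And>i. f (i + int N) = f i"
  shows "(\<Sum>i=a..<a + int N. f i) = (\<Sum>i=0..<int N. f i)"
proof -
  have shift: "(\<Sum>i=a..<a + int N. f i) = (\<Sum>i=0..<int N. f (i + a))" for a
    by (rule sum.reindex_bij_witness[of _ "\<lambda>i. i + a" "\<lambda>i. i - a"]) auto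
  have up: "(\<Sum>i=0..<int N. f (i + (a + 1))) = (\<Sum>i=0..<int N. f (i + a))" for a
  proof -
    have p: "f (i + int N + a) = f (i + a)" for i using per[of "i + a"] by (simp add: algebra_simps)
    show ?thesis using period_sum_shift[of "\<lambda>i. f (i + a)" N, OF p] by (simp add: add.assoc add.commute[of 1])
  qed
  have "(\<Sum>i=0..<int N. f (i + a)) = (\<Sum>i=0..<int N. f i)"
  proof (induction a rule: int_induct[of _ 0])
    case (step1 i) then show ?case using up[of i] by simp
  next
    case (step2 i) then show ?case using up[of "i - 1"] by simp
  qed simp
  then show ?thesis using shift by simp
qed

lemma diff_quotient_mult: "D \<noteq> 0 ==> (A / D - p) * D = A - D * (p :: real)"
  by (simp add: field_simps)

text \<open>
  Symmetric difference quotients around \<open>x\<close> form a Cauchy sequence as the interval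
  shrinks, and every difference quotient over an interval near \<open>x\<close> is compared with
  one of them.
\<close>

lemma slope_oscillation_derivative:
  fixes v :: "real => real"
  assumes C: "C \<ge> 0"
    and osc: "\<And>x x' y' y. x \<le> x' ==> x' < y' ==> y' \<le> y ==> y - x \<le> 2 ==>
      \<bar>(v y' - v x') / (y' - x') - (v y - v x) / (y - x)\<bar> \<le> C * sqrt (y - x)"
  shows "\<exists>P. \<forall>x y. \<bar>y - x\<bar> \<le> 1 \<longrightarrow> \<bar>v y - v x - (y - x) * P x\<bar> \<le> 4 * C * sqrt \<bar>y - x\<bar> * \<bar>y - x\<bar>"
proof -
  have "\<exists>p. \<forall>y. \<bar>y - x\<bar> \<le> 1 \<longrightarrow> \<bar>v y - v x - (y - x) * p\<bar> \<le> 4 * C * sqrt \<bar>y - x\<bar> * \<bar>y - x\<bar>" for x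
  proof -
    define s where "s r = (v (x + r) - v (x - r)) / (2 * r)" for r
    have s: "\<bar>s r - s r'\<bar> \<le> C * sqrt (2 * r')" if "0 < r" "r \<le> r'" "r' \<le> 1" for r r'
      using osc[of "x - r'" "x - r" "x + r" "x + r'"] that by (simp add: s_def)
    have "Cauchy (\<lambda>n. s (1 / real (Suc n)))"
    proof (rule metric_CauchyI)
      fix e :: real assume e: "e > 0"
      have "(\<lambda>n. C * sqrt (2 * (1 / real (Suc n)))) \<longlonglongrightarrow> C * sqrt (2 * 0)"
        by (intro tendsto_intros LIMSEQ_Suc[OF lim_1_over_n])
      then have "\<forall>\<^sub>F n in sequentially. C * sqrt (2 * (1 / real (Suc n))) < e" using e by (intro order_tendstoD(2)) auto
      then obtain M where M: "\<And>n. n \<ge> M ==> C * sqrt (2 * (1 / real (Suc n))) < e"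
        unfolding eventually_sequentially by blast
      have *: "\<bar>s (1 / real (Suc n)) - s (1 / real (Suc m))\<bar> < e" if "M \<le> m" "m \<le> n" for m n
        using s[of "1 / real (Suc n)" "1 / real (Suc m)"] M[of m] that by (auto simp: frac_le)
      show "\<exists>M. \<forall>m\<ge>M. \<forall>n\<ge>M. dist (s (1 / real (Suc m))) (s (1 / real (Suc n))) < e"
      proof (intro exI[of _ M] allI impI)
        fix m n assume "M \<le> m" "M \<le> n"
        then show "dist (s (1 / real (Suc m))) (s (1 / real (Suc n))) < e"
          using *[of m n] *[of n m] by (cases "m \<le> n") (auto simp: dist_real_def abs_minus_commute)
      qed
    qed
    then obtain p where p: "(\<lambda>n. s (1 / real (Suc n))) \<longlonglongrightarrow> p"
      using Cauchy_convergent convergent_def by blast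
    have sp: "\<bar>p - s r\<bar> \<le> C * sqrt (2 * r)" if r: "0 < r" "r \<le> 1" for r
    proof (rule LIMSEQ_le_const2)
      show "(\<lambda>n. \<bar>s (1 / real (Suc n)) - s r\<bar>) \<longlonglongrightarrow> \<bar>p - s r\<bar>" by (intro tendsto_intros p)
      obtain M :: nat where M: "1 / r \<le> real M" using real_arch_simple by blast
      show "\<exists>N. \<forall>n\<ge>N. \<bar>s (1 / real (Suc n)) - s r\<bar> \<le> C * sqrt (2 * r)"
      proof (intro exI[of _ M] allI impI)
        fix n assume "M \<le> n"
        then have "1 / r \<le> real (Suc n)" using M by simp
        then have "1 / real (Suc n) \<le> r" using r by (simp add: field_simps)
        then show "\<bar>s (1 / real (Suc n)) - s r\<bar> \<le> C * sqrt (2 * r)" using s[of "1 / real (Suc n)" r] r by simp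
      qed
    qed
    have "\<bar>v y - v x - (y - x) * p\<bar> \<le> 4 * C * sqrt \<bar>y - x\<bar> * \<bar>y - x\<bar>" if y: "\<bar>y - x\<bar> \<le> 1" for y
    proof (cases "y = x")
      case False
      define r where "r = \<bar>y - x\<bar>"
      have r: "0 < r" "r \<le> 1" using False y by (auto simp: r_def)
      have q: "\<bar>(v y - v x) / (y - x) - s r\<bar> \<le> C * sqrt (2 * r)"
      proof (cases "x < y")
        case True
        then show ?thesis using osc[of "x - r" x y "x + r"] r by (simp add: s_def r_def)
      next
        case f: False
        have "(v x - v y) / (x - y) = (v y - v x) / (y - x)" by (metis minus_diff_eq minus_divide_divide)
        then show ?thesis using osc[of "x - r" y x "x + r"] r f False by (simp add: s_def r_def)
      qed
      have "\<bar>(v y - v x) / (y - x) - p\<bar> \<le> 2 * (C * sqrt (2 * r))" using q sp[OF r] by linarith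
      also have "sqrt (2 * r) \<le> 2 * sqrt r"
        using real_sqrt_le_mono[of 2 4] r by (simp add: real_sqrt_mult mult_right_mono)
      then have "2 * (C * sqrt (2 * r)) \<le> 4 * C * sqrt r" using C mult_left_mono[of "sqrt (2 * r)" "2 * sqrt r" C] by simp
      finally have "\<bar>(v y - v x) / (y - x) - p\<bar> * r \<le> 4 * C * sqrt r * r" using r by (intro mult_right_mono) auto
      moreover have "\<bar>(v y - v x) / (y - x) - p\<bar> * r = \<bar>v y - v x - (y - x) * p\<bar>"
        using False unfolding r_def abs_mult[symmetric] by (subst diff_quotient_mult) auto
      ultimately show ?thesis by (simp add: r_def)
    qed simp
    then show ?thesis by blast
  qed
  then show ?thesis by metis
qed

context admissible_step
begin

lemma sum_d2_energy: "h * (\<Sum>i\<in>I. (d i)^2) \<le> energy N h v / m"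
proof -
  have "m * (h * (\<Sum>i\<in>I. (d i)^2)) = h * (\<Sum>i\<in>I. m * (d i)^2)" by (simp add: sum_distrib_left mult_ac)
  also have "\<dots> \<le> energy N h v" unfolding energy_def
  proof (intro mult_left_mono sum_mono)
    fix i
    have "m * 1 \<le> exp (v i) * (1 + (p i)^2)" using lo m by (intro mult_mono) auto
    then show "m * (d i)^2 \<le> exp (v i) * (1 + (p i)^2) * (d i)^2" by (intro mult_right_mono) auto
  qed (use h in simp)
  finally show ?thesis using m by (simp add: field_simps)
qed

lemma energy_nonneg: "energy N h v \<ge> 0"
  unfolding energy_def using h by (intro mult_nonneg_nonneg sum_nonneg) auto

lemma w_telescope: "a \<le> b ==> w b - w a = h * (\<Sum>l=a + 1..b. d l)"
proof (induction b rule: int_ge_induct)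
  case (step b)
  have "{a + 1..b + 1} = insert (b + 1) {a + 1..b}" using step by auto
  then have "h * (\<Sum>l=a + 1..b + 1. d l) = h * d (b + 1) + h * (\<Sum>l=a + 1..b. d l)" by (simp add: distrib_left)
  also have "h * d (b + 1) = w (b + 1) - w b" using h by (simp add: angle_diff_def)
  finally show ?case using step by simp
qed simp

lemma w_window:
  assumes "a \<le> b"
  shows "(w b - w a)^2 \<le> (h * real_of_int (b - a)) * (h * (\<Sum>l=a + 1..b. (d l)^2))"
proof -
  have "(w b - w a)^2 = h^2 * (\<Sum>l=a + 1..b. 1 * d l)^2" by (simp add: w_telescope[OF assms] power_mult_distrib)
  also have "\<dots> \<le> h^2 * ((\<Sum>l=a + 1..b. 1^2) * (\<Sum>l=a + 1..b. (d l)^2))"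
    by (intro mult_left_mono Cauchy_Schwarz_ineq_sum) auto
  also have "(\<Sum>l=a + 1..b. (1::real)^2) = real_of_int (b - a)" using assms by simp
  finally show ?thesis by (simp add: power2_eq_square mult_ac)
qed

lemma window_le_energy:
  assumes "a \<le> b" "b - a \<le> int N"
  shows "h * (\<Sum>l=a + 1..b. (d l)^2) \<le> energy N h v / m"
proof -
  have "(\<Sum>l=a + 1..b. (d l)^2) \<le> (\<Sum>l=a + 1..<a + 1 + int N. (d l)^2)"
    using assms by (intro sum_mono2) auto
  also have "\<dots> = (\<Sum>l\<in>I. (d l)^2)" by (rule period_sum_window) (simp add: per_d)
  finally have "h * (\<Sum>l=a + 1..b. (d l)^2) \<le> h * (\<Sum>l\<in>I. (d l)^2)" using h by (intro mult_left_mono) auto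
  then show ?thesis using sum_d2_energy by linarith
qed

lemma w_holder:
  assumes "a \<le> b" "b - a \<le> int N" "energy N h v \<le> E"
  shows "\<bar>w b - w a\<bar> \<le> sqrt (E / m) * sqrt (h * real_of_int (b - a))"
proof -
  have "(w b - w a)^2 \<le> (h * real_of_int (b - a)) * (energy N h v / m)"
    by (rule order_trans[OF w_window[OF assms(1)]])
       (rule mult_left_mono[OF window_le_energy[OF assms(1,2)]], use h assms(1) in simp)
  also have "\<dots> \<le> (h * real_of_int (b - a)) * (E / m)"
    using h assms m by (intro mult_left_mono divide_right_mono) auto
  finally have "sqrt ((w b - w a)^2) \<le> sqrt ((h * real_of_int (b - a)) * (E / m))" by (rule real_sqrt_le_mono)
  then show ?thesis by (simp add: real_sqrt_mult[symmetric] mult.commute)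
qed

lemma p_holder:
  assumes "a \<le> b" "b - a \<le> int N" "energy N h v \<le> E"
  shows "\<bar>p b - p a\<bar> \<le> 2 * sqrt (E / m) * sqrt (h * real_of_int (b - a))"
proof -
  obtain c where c: "1/2 \<le> c" "c \<le> 1" "w b - w a = c * (p b - p a)"
    using arctan_diff_factor[of "p b" "p a"] p_le[of a] p_le[of b] by (auto simp: angle_def)
  have "1/2 * \<bar>p b - p a\<bar> \<le> c * \<bar>p b - p a\<bar>" using c by (intro mult_right_mono) auto
  also have "\<dots> = \<bar>w b - w a\<bar>" using c by (simp add: abs_mult)
  finally show ?thesis using w_holder[OF assms] by simp
qed

text \<open>
  The energy bounds the sum of the squares of the angle differences, so slopes are Hoelder
  continuous with exponent 1/2, and a difference quotient of \<open>v\<close> is a mean of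
  slopes.
\<close>

lemma slope_window:
  assumes ab: "a \<le> l" "l < b" "a \<le> a'" "a' < b'" "b' \<le> b" and len: "b - a \<le> int N" and E: "energy N h v \<le> E"
  shows "\<bar>(v b' - v a') / (h * real_of_int (b' - a')) - p l\<bar> \<le> 2 * sqrt (E / m) * sqrt (h * real_of_int (b - a))"
proof -
  define M where "M = 2 * sqrt (E / m) * sqrt (h * real_of_int (b - a))"
  have bd: "\<bar>p j - p l\<bar> \<le> M" if j: "a \<le> j" "j < b" for j
  proof -
    have E0: "sqrt (E / m) \<ge> 0" using energy_nonneg E m by simp
    have *: "2 * sqrt (E / m) * sqrt (h * real_of_int x) \<le> M" if "x \<le> b - a" for x
      unfolding M_def using E0 h that by (intro mult_left_mono real_sqrt_le_mono) auto
    show ?thesis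
    proof (cases "j \<le> l")
      case True
      then show ?thesis using p_holder[of j l E] *[of "l - j"] ab j len E by (simp add: abs_minus_commute)
    next
      case False
      then show ?thesis using p_holder[of l j E] *[of "j - l"] ab j len E by simp
    qed
  qed
  have "\<bar>v j - v a' - h * real_of_int (j - a') * p l\<bar> \<le> h * real_of_int (j - a') * M" if "a' \<le> j" "j \<le> b'" for j
    using that
  proof (induction j rule: int_ge_induct)
    case (step j)
    have 1: "v (j + 1) - v j = h * p j" using h by (simp add: slope_def)
    have "\<bar>h * p j - h * p l\<bar> \<le> h * M"
      using bd[of j] step ab h by (simp add: abs_mult flip: right_diff_distrib)
    then show ?case using step 1 by (simp add: algebra_simps)
  qed simp
  then have le: "\<bar>v b' - v a' - h * real_of_int (b' - a') * p l\<bar> \<le> h * real_of_int (b' - a') * M" using ab by simp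
  define H where "H = h * real_of_int (b' - a')"
  have H: "H > 0" using h ab by (simp add: H_def)
  have "H * \<bar>(v b' - v a') / H - p l\<bar> = \<bar>((v b' - v a') / H - p l) * H\<bar>" using H by (simp add: abs_mult mult.commute)
  also have "\<dots> = \<bar>v b' - v a' - H * p l\<bar>" using H by (subst diff_quotient_mult) auto
  also have "\<dots> \<le> H * M" using le by (simp add: H_def)
  finally have "\<bar>(v b' - v a') / H - p l\<bar> \<le> M" using H by (metis mult_le_cancel_left_pos)
  then show ?thesis by (simp add: M_def H_def)
qed

lemma slope_osc:
  assumes ab: "a \<le> a'" "a' < b'" "b' \<le> b" and len: "b - a \<le> int N" and E: "energy N h v \<le> E"
  shows "\<bar>(v b' - v a') / (h * real_of_int (b' - a')) - (v b - v a) / (h * real_of_int (b - a))\<bar>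
     \<le> 4 * sqrt (E / m) * sqrt (h * real_of_int (b - a))"
  using slope_window[of a a b a' b' E] slope_window[of a a b a b E] assms by auto

end

section \<open>Grid functions of bounded energy and their limits\<close>

lemma admissible_stepI:
  assumes "m > 0" "admissible (2 ^ l) (mesh l) m y"
  shows "admissible_step (2 ^ l) (mesh l) m (m * (mesh l)^2 / 100) y"
  using assms mesh_pos[of l] by unfold_locales (auto simp: mesh_def)

lemma node_diff: "node n b - node n a = mesh n * real_of_int (b - a)"
  by (simp add: node_def algebra_simps)

text \<open>
  By the Cauchy-Schwarz inequality the Dirichlet energy of the angles does not increase when
  only every \<open>r\<close>-th grid point is kept, provided that the weights of the blocks are
  below those of their points.
\<close>

lemma (in admissible_step) block_energy:
  fixes \<sigma> t :: "int => real" and r :: nat and J :: nat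
  assumes N_eq: "N = J * r" and \<sigma>: "\<And>j. \<sigma> j \<ge> 0" and t: "\<And>i. t (i + int N) = t i"
    and le: "\<And>j l. 0 \<le> j ==> j < int J ==> j * int r < l ==> l \<le> (j + 1) * int r ==> \<sigma> j \<le> t l"
  shows "(\<Sum>j=0..<int J. \<sigma> j * ((w ((j + 1) * int r) - w (j * int r))^2 / (h * real r))) \<le> h * (\<Sum>i\<in>I. t i * (d i)^2)"
proof -
  have r: "r > 0" using N N_eq by (cases r) auto
  have "(\<Sum>j=0..<int J. \<sigma> j * ((w ((j + 1) * int r) - w (j * int r))^2 / (h * real r)))
     \<le> (\<Sum>j=0..<int J. \<Sum>l=j * int r + 1..(j + 1) * int r. h * (t l * (d l)^2))"
  proof (rule sum_mono)
    fix j assume j: "j \<in> {0..<int J}"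
    have "(w ((j + 1) * int r) - w (j * int r))^2 \<le> (h * real_of_int ((j + 1) * int r - j * int r)) * (h * (\<Sum>l=j * int r + 1..(j + 1) * int r. (d l)^2))"
      by (rule w_window) (auto simp: mult_right_mono)
    also have "real_of_int ((j + 1) * int r - j * int r) = real r" by (simp add: algebra_simps)
    finally have "(w ((j + 1) * int r) - w (j * int r))^2 / (h * real r) \<le> h * (\<Sum>l=j * int r + 1..(j + 1) * int r. (d l)^2)"
      using h r by (simp add: pos_divide_le_eq mult.commute)
    then have "\<sigma> j * ((w ((j + 1) * int r) - w (j * int r))^2 / (h * real r)) \<le> \<sigma> j * (h * (\<Sum>l=j * int r + 1..(j + 1) * int r. (d l)^2))"
      using \<sigma> by (rule mult_left_mono)
    also have "\<dots> = (\<Sum>l=j * int r + 1..(j + 1) * int r. h * (\<sigma> j * (d l)^2))"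
      by (simp add: sum_distrib_left mult_ac)
    also have "\<dots> \<le> (\<Sum>l=j * int r + 1..(j + 1) * int r. h * (t l * (d l)^2))"
      using le[of j] j h by (intro sum_mono mult_left_mono mult_right_mono) auto
    finally show "\<sigma> j * ((w ((j + 1) * int r) - w (j * int r))^2 / (h * real r)) \<le> (\<Sum>l=j * int r + 1..(j + 1) * int r. h * (t l * (d l)^2))" .
  qed
  also have "\<dots> = (\<Sum>l=1..int J * int r. h * (t l * (d l)^2))"
  proof (induction J)
    case (Suc J)
    have 1: "{0..<int (Suc J)} = insert (int J) {0..<int J}" by auto
    have 2: "{1..int (Suc J) * int r} = {1..int J * int r} \<union> {int J * int r + 1..(int J + 1) * int r}"
      by (auto simp: algebra_simps)
        (smt (verit, best) mult_nonneg_nonneg of_nat_0_le_iff)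
    show ?case unfolding 1 2 using Suc by (subst sum.union_disjoint) auto
  qed simp
  also have "\<dots> = (\<Sum>l=1..<1 + int N. h * (t l * (d l)^2))"
    by (intro sum.cong) (auto simp: N_eq)
  also have "\<dots> = (\<Sum>i\<in>I. h * (t i * (d i)^2))"
    by (rule period_sum_window) (simp add: per_d t)
  finally show ?thesis by (simp add: sum_distrib_left)
qed

text \<open>
  Grid functions at one instant, on grids of mesh tending to zero, that converge uniformly to
  \<open>v\<close>. The bound \<open>B\<close> of the energies gives the regularity of
  \<open>v\<close>, and their limit \<open>E0\<close> the sharp estimate.
\<close>

locale spatial_limit =
  fixes m B E0 :: real and L :: "nat => nat" and y :: "nat => int => real" and e \<eta> :: "nat => real"
    and v :: "real => real"
  assumes m: "m > 0" and adm: "\<And>k. admissible (2 ^ L k) (mesh (L k)) m (y k)"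
    and en: "\<And>k. energy (2 ^ L k) (mesh (L k)) (y k) \<le> e k" and eB: "\<And>k. e k \<le> B" and e: "e \<longlonglongrightarrow> E0"
    and L: "filterlim L at_top sequentially"
    and conv: "\<And>k i. \<bar>y k i - v (node (L k) i)\<bar> \<le> \<eta> k" and eta: "\<eta> \<longlonglongrightarrow> 0"
    and v_cont: "continuous_on UNIV v"
begin

lemma step: "admissible_step (2 ^ L k) (mesh (L k)) m (m * (mesh (L k))^2 / 100) (y k)"
  by (rule admissible_stepI[OF m adm])

lemma enB: "energy (2 ^ L k) (mesh (L k)) (y k) \<le> B" using en eB order_trans by blast

lemma B0: "B \<ge> 0"
  using admissible_step.energy_nonneg[OF step] enB order_trans by blast

lemma L_ge: "\<forall>\<^sub>F k in sequentially. n \<le> L k"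
  using L by (auto simp: filterlim_at_top)

lemma node_L: "(\<lambda>k. node (L k) (cell (L k) x)) \<longlonglongrightarrow> x"
  by (rule filterlim_compose[OF node_cell_tendsto L])

lemma y_tendsto: "(\<lambda>k. y k (cell (L k) x)) \<longlonglongrightarrow> v x"
proof -
  have v1: "(\<lambda>k. v (node (L k) (cell (L k) x))) \<longlonglongrightarrow> v x"
    using continuous_on_tendsto_compose[OF v_cont node_L] by simp
  have "(\<lambda>k. y k (cell (L k) x) - v (node (L k) (cell (L k) x))) \<longlonglongrightarrow> 0"
    by (rule Lim_null_comparison[OF _ eta]) (use conv in simp)
  from tendsto_add[OF this v1] show ?thesis by simp
qed

lemma v_slope_osc:
  assumes x: "x \<le> x'" "x' < z'" "z' \<le> z" "z - x \<le> 2"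
  shows "\<bar>(v z' - v x') / (z' - x') - (v z - v x) / (z - x)\<bar> \<le> 4 * sqrt (B / m) * sqrt (z - x)"
proof -
  define N where "N k a = node (L k) (cell (L k) a)" for k a
  define Y where "Y k a = y k (cell (L k) a)" for k a
  have lim: "(\<lambda>k. N k a) \<longlonglongrightarrow> a" "(\<lambda>k. Y k a) \<longlonglongrightarrow> v a" for a
    unfolding N_def Y_def by (rule node_L, rule y_tendsto)
  have ev1: "\<forall>\<^sub>F k in sequentially. N k z' - N k x' > 0"
    by (rule order_tendstoD(1)[OF tendsto_diff[OF lim(1) lim(1)]]) (use x in simp)
  have ev2: "\<forall>\<^sub>F k in sequentially. N k z - N k x < 2 * pi"
    by (rule order_tendstoD(2)[OF tendsto_diff[OF lim(1) lim(1)]]) (use x pi_gt3 in simp)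
  show ?thesis
  proof (rule tendsto_le[OF sequentially_bot])
    show "(\<lambda>k. \<bar>(Y k z' - Y k x') / (N k z' - N k x') - (Y k z - Y k x) / (N k z - N k x)\<bar>)
       \<longlonglongrightarrow> \<bar>(v z' - v x') / (z' - x') - (v z - v x) / (z - x)\<bar>"
      using x by (intro tendsto_intros lim) auto
    show "(\<lambda>k. 4 * sqrt (B / m) * sqrt (N k z - N k x)) \<longlonglongrightarrow> 4 * sqrt (B / m) * sqrt (z - x)"
      by (intro tendsto_intros lim)
    show "\<forall>\<^sub>F k in sequentially. \<bar>(Y k z' - Y k x') / (N k z' - N k x') - (Y k z - Y k x) / (N k z - N k x)\<bar> \<le> 4 * sqrt (B / m) * sqrt (N k z - N k x)"
      using ev1 ev2
    proof eventually_elim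
      case (elim k)
      interpret admissible_step "2 ^ L k" "mesh (L k)" m "m * (mesh (L k))^2 / 100" "y k" by (rule step)
      have mono: "cell (L k) a \<le> cell (L k) b" if "a \<le> b" for a b
        unfolding cell_def using that mesh_pos[of "L k"] by (intro floor_mono divide_right_mono) auto
      have 1: "cell (L k) x' < cell (L k) z'"
        using elim(1) mesh_pos[of "L k"] unfolding N_def node_diff by (simp add: zero_less_mult_iff)
      have 2: "cell (L k) z - cell (L k) x \<le> int (2 ^ L k)"
      proof -
        have "mesh (L k) * real_of_int (cell (L k) z - cell (L k) x) < mesh (L k) * 2 ^ L k"
          using elim(2) unfolding N_def node_diff by (simp add: mesh_def)
        then have "real_of_int (cell (L k) z - cell (L k) x) < 2 ^ L k" using mesh_pos[of "L k"] by simp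
        then have "real_of_int (cell (L k) z - cell (L k) x) < real_of_int (2 ^ L k)" by simp
        then have "cell (L k) z - cell (L k) x < 2 ^ L k" by (simp only: of_int_less_iff)
        then show ?thesis by simp
      qed
      show ?case
        using slope_osc[OF mono[OF x(1)] 1 mono[OF x(3)] 2 enB] unfolding N_def Y_def node_diff by simp
    qed
  qed
qed

definition D :: real where "D = 16 * sqrt (B / m)"

lemma D0: "D \<ge> 0" using B0 m by (simp add: D_def)

lemma v_taylor: "\<bar>x' - x\<bar> \<le> 1 ==> \<bar>v x' - v x - (x' - x) * deriv v x\<bar> \<le> D * sqrt \<bar>x' - x\<bar> * \<bar>x' - x\<bar>"
  and v_deriv: "(v has_real_derivative deriv v x) (at x)"
proof -
  obtain P where P: "\<And>x x'. \<bar>x' - x\<bar> \<le> 1 ==> \<bar>v x' - v x - (x' - x) * P x\<bar> \<le> D * sqrt \<bar>x' - x\<bar> * \<bar>x' - x\<bar>"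
    using slope_oscillation_derivative[of "4 * sqrt (B / m)" v] v_slope_osc B0 m by (auto simp: D_def)
  have "(v has_real_derivative P x) (at x)" for x
    unfolding has_field_derivative_iff
  proof (rule LIM_zero_cancel, rule Lim_null_comparison)
    show "((\<lambda>z. D * sqrt \<bar>z - x\<bar>) \<longlongrightarrow> 0) (at x)"
    proof -
      have "((\<lambda>z. D * sqrt \<bar>z - x\<bar>) \<longlongrightarrow> D * sqrt \<bar>x - x\<bar>) (at x)" by (intro tendsto_intros)
      then show ?thesis by simp
    qed
    have "\<forall>\<^sub>F z in at x. \<bar>z - x\<bar> < 1 \<and> z \<noteq> x"
      unfolding eventually_at by (intro exI[of _ 1]) (auto simp: dist_real_def)
    then show "\<forall>\<^sub>F z in at x. norm ((v z - v x) / (z - x) - P x) \<le> D * sqrt \<bar>z - x\<bar>"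
    proof eventually_elim
      case (elim z)
      have "\<bar>(v z - v x) / (z - x) - P x\<bar> * \<bar>z - x\<bar> = \<bar>v z - v x - (z - x) * P x\<bar>"
        unfolding abs_mult[symmetric] using elim by (subst diff_quotient_mult) auto
      also have "\<dots> \<le> D * sqrt \<bar>z - x\<bar> * \<bar>z - x\<bar>" using P[of z x] elim by simp
      finally show ?case using elim by simp
    qed
  qed
  then have "deriv v x = P x" for x by (rule DERIV_imp_deriv)
  then show "\<bar>x' - x\<bar> \<le> 1 ==> \<bar>v x' - v x - (x' - x) * deriv v x\<bar> \<le> D * sqrt \<bar>x' - x\<bar> * \<bar>x' - x\<bar>"
    "(v has_real_derivative deriv v x) (at x)" using P \<open>\<And>x. (v has_real_derivative P x) (at x)\<close> by auto
qed

lemma deriv_holder: "\<bar>x' - x\<bar> \<le> 1 ==> \<bar>deriv v x' - deriv v x\<bar> \<le> 2 * D * sqrt \<bar>x' - x\<bar>"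
proof (cases "x' = x")
  case False
  assume le: "\<bar>x' - x\<bar> \<le> 1"
  have a: "\<bar>v x' - v x - (x' - x) * deriv v x\<bar> \<le> D * sqrt \<bar>x' - x\<bar> * \<bar>x' - x\<bar>" by (rule v_taylor[OF le])
  have b: "\<bar>v x - v x' - (x - x') * deriv v x'\<bar> \<le> D * sqrt \<bar>x' - x\<bar> * \<bar>x' - x\<bar>"
    using v_taylor[of x x'] le by (simp add: abs_minus_commute)
  have "\<bar>(x' - x) * (deriv v x' - deriv v x)\<bar> = \<bar>(v x' - v x - (x' - x) * deriv v x) + (v x - v x' - (x - x') * deriv v x')\<bar>"
    by (simp add: algebra_simps)
  also have "\<dots> \<le> (2 * D * sqrt \<bar>x' - x\<bar>) * \<bar>x' - x\<bar>" using a b by linarith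
  finally have "\<bar>deriv v x' - deriv v x\<bar> * \<bar>x' - x\<bar> \<le> (2 * D * sqrt \<bar>x' - x\<bar>) * \<bar>x' - x\<bar>" by (simp add: abs_mult mult.commute)
  then show ?thesis using False by simp
qed simp

lemma deriv_cont: "continuous_on UNIV (deriv v)"
  unfolding continuous_on_eq_continuous_within
proof
  fix x
  have "((\<lambda>z. deriv v z - deriv v x) \<longlongrightarrow> 0) (at x)"
  proof (rule Lim_null_comparison)
    show "((\<lambda>z. 2 * D * sqrt \<bar>z - x\<bar>) \<longlongrightarrow> 0) (at x)"
    proof -
      have "((\<lambda>z. 2 * D * sqrt \<bar>z - x\<bar>) \<longlongrightarrow> 2 * D * sqrt \<bar>x - x\<bar>) (at x)" by (intro tendsto_intros)
      then show ?thesis by simp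
    qed
    have "\<forall>\<^sub>F z in at x. \<bar>z - x\<bar> < 1"
      unfolding eventually_at by (intro exI[of _ 1]) (auto simp: dist_real_def)
    then show "\<forall>\<^sub>F z in at x. norm (deriv v z - deriv v x) \<le> 2 * D * sqrt \<bar>z - x\<bar>"
      by eventually_elim (use deriv_holder in simp)
  qed
  then have "(deriv v \<longlongrightarrow> deriv v x) (at x)" by (rule LIM_zero_cancel)
  then show "continuous (at x) (deriv v)" by (simp add: continuous_at)
qed

text \<open>
  The slope of the grid function and the derivative of \<open>v\<close> are both compared with
  difference quotients over an intermediate length \<open>mesh n\<close>: short enough for the
  Hoelder bounds, but fixed as \<open>k\<close> grows, so that the uniform convergence of the
  grid functions survives the division.
\<close>

lemma slope_error:
  assumes n: "n \<le> L k" "mesh n \<le> 1"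
  shows "\<bar>slope (mesh (L k)) (y k) i - deriv v (node (L k) i)\<bar> \<le> 2 * D * sqrt (mesh n) + 2 * \<eta> k / mesh n"
proof -
  interpret admissible_step "2 ^ L k" "mesh (L k)" m "m * (mesh (L k))^2 / 100" "y k" by (rule step)
  define b where "b = i + 2 ^ (L k - n)"
  have len: "mesh (L k) * real_of_int (b - i) = mesh n"
    using n by (auto simp: b_def mesh_def power_add dest!: le_Suc_ex)
  have le: "b - i \<le> int (2 ^ L k)" by (simp add: b_def)
  have ib: "i < b" by (simp add: b_def)
  define x z where "x = node (L k) i" and "z = node (L k) b"
  have zx: "z - x = mesh n" unfolding x_def z_def node_diff len ..
  have mp: "mesh n > 0" by (rule mesh_pos)
  have 1: "\<bar>(y k b - y k i) / mesh n - slope (mesh (L k)) (y k) i\<bar> \<le> 2 * sqrt (B / m) * sqrt (mesh n)"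
    using slope_window[of i i b i b B] ib le enB unfolding len by simp
  have 2: "\<bar>(v z - v x) / mesh n - deriv v x\<bar> \<le> D * sqrt (mesh n)"
  proof -
    have "\<bar>(v z - v x) / mesh n - deriv v x\<bar> * mesh n = \<bar>((v z - v x) / mesh n - deriv v x) * mesh n\<bar>"
      using mp by (simp add: abs_mult)
    also have "\<dots> = \<bar>v z - v x - (z - x) * deriv v x\<bar>" using mp by (subst diff_quotient_mult) (auto simp: zx)
    also have "\<dots> \<le> D * sqrt (mesh n) * mesh n" using v_taylor[of z x] zx n mp by simp
    finally show ?thesis using mp by simp
  qed
  have 3: "\<bar>(y k b - y k i) / mesh n - (v z - v x) / mesh n\<bar> \<le> 2 * \<eta> k / mesh n"
  proof -
    have "\<bar>(y k b - v z) - (y k i - v x)\<bar> \<le> 2 * \<eta> k"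
      using conv[of k b] conv[of k i] unfolding x_def z_def by linarith
    from divide_right_mono[OF this, of "mesh n"] mp
    have "\<bar>((y k b - v z) - (y k i - v x)) / mesh n\<bar> \<le> 2 * \<eta> k / mesh n" by (simp only: abs_divide abs_of_pos)
    moreover have "(y k b - y k i) / mesh n - (v z - v x) / mesh n = ((y k b - v z) - (y k i - v x)) / mesh n"
      by (simp add: diff_divide_distrib)
    ultimately show ?thesis by (simp only:)
  qed
  have "2 * sqrt (B / m) * sqrt (mesh n) \<le> D * sqrt (mesh n)"
    using B0 m mp by (intro mult_right_mono) (auto simp: D_def)
  then show ?thesis using 1 2 3 unfolding x_def[symmetric] by linarith
qed

lemma slope_uniform:
  assumes "\<epsilon> > 0"
  shows "\<forall>\<^sub>F k in sequentially. \<forall>i. \<bar>slope (mesh (L k)) (y k) i - deriv v (node (L k) i)\<bar> \<le> \<epsilon>"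
proof -
  have "(\<lambda>n. 2 * D * sqrt (mesh n)) \<longlonglongrightarrow> 2 * D * sqrt 0" by (intro tendsto_intros mesh_tendsto)
  then have "\<forall>\<^sub>F n in sequentially. 2 * D * sqrt (mesh n) < \<epsilon> / 2" using assms by (intro order_tendstoD(2)) auto
  moreover have "\<forall>\<^sub>F n in sequentially. mesh n < 1" using order_tendstoD(2)[OF mesh_tendsto] by simp
  ultimately have "\<forall>\<^sub>F n in sequentially. 2 * D * sqrt (mesh n) < \<epsilon> / 2 \<and> mesh n < 1" by eventually_elim simp
  then obtain n where n: "2 * D * sqrt (mesh n) < \<epsilon> / 2" "mesh n < 1"
    using eventually_happens'[OF sequentially_bot] by blast
  have "(\<lambda>k. 2 * \<eta> k / mesh n) \<longlonglongrightarrow> 2 * 0 / mesh n" using mesh_pos[of n] by (intro tendsto_intros eta) auto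
  then have "\<forall>\<^sub>F k in sequentially. 2 * \<eta> k / mesh n < \<epsilon> / 2" using assms by (intro order_tendstoD(2)) auto
  then show ?thesis using L_ge[of n]
  proof eventually_elim
    case (elim k)
    show ?case
    proof
      fix i
      show "\<bar>slope (mesh (L k)) (y k) i - deriv v (node (L k) i)\<bar> \<le> \<epsilon>"
        using slope_error[OF elim(2) less_imp_le[OF n(2)], of i] elim(1) n(1) by linarith
    qed
  qed
qed

lemma deriv_le: "\<bar>deriv v x\<bar> \<le> kappa"
proof (rule field_le_epsilon)
  fix \<epsilon> :: real assume "\<epsilon> > 0"
  have "(\<lambda>k. \<bar>deriv v (node (L k) (cell (L k) x))\<bar>) \<longlonglongrightarrow> \<bar>deriv v x\<bar>"
    using continuous_on_tendsto_compose[OF deriv_cont node_L] by (intro tendsto_intros) auto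
  moreover have "\<forall>\<^sub>F k in sequentially. \<bar>deriv v (node (L k) (cell (L k) x))\<bar> \<le> kappa + \<epsilon>"
    using slope_uniform[OF \<open>\<epsilon> > 0\<close>]
  proof eventually_elim
    case (elim k)
    have "\<bar>slope (mesh (L k)) (y k) (cell (L k) x)\<bar> \<le> kappa" using adm[of k] by (auto simp: admissible_def)
    then show ?case using elim[rule_format, of "cell (L k) x"] by linarith
  qed
  ultimately show "\<bar>deriv v x\<bar> \<le> kappa + \<epsilon>" by (rule tendsto_upperbound) simp
qed

lemma exp_v: "m \<le> exp (v x)" "exp (v x) \<le> 2 * m"
proof -
  have l: "(\<lambda>k. exp (y k (cell (L k) x))) \<longlonglongrightarrow> exp (v x)" by (intro tendsto_intros y_tendsto)
  show "m \<le> exp (v x)" by (rule tendsto_lowerbound[OF l]) (use adm in \<open>auto simp: admissible_def\<close>)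
  show "exp (v x) \<le> 2 * m" by (rule tendsto_upperbound[OF l]) (use adm in \<open>auto simp: admissible_def\<close>)
qed

definition weight_fun :: "real => real" where "weight_fun x = exp (v x) * (1 + (deriv v x)^2)"
definition W :: "real => real" where "W x = arctan (deriv v x)"
definition yw :: "nat => int => real" where "yw k i = exp (y k i) * (1 + (slope (mesh (L k)) (y k) i)^2)"

lemma weight_uniform:
  assumes "\<epsilon> > 0"
  shows "\<forall>\<^sub>F k in sequentially. \<forall>i. \<bar>yw k i - weight_fun (node (L k) i)\<bar> \<le> \<epsilon>"
proof -
  have "(\<lambda>k. 2 * m * \<eta> k * 2) \<longlonglongrightarrow> 2 * m * 0 * 2" by (intro tendsto_intros eta)
  then have "\<forall>\<^sub>F k in sequentially. 2 * m * \<eta> k * 2 < \<epsilon> / 2"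
    by (rule order_tendstoD(2)) (use assms in simp)
  moreover have "\<forall>\<^sub>F k in sequentially. \<forall>i. \<bar>slope (mesh (L k)) (y k) i - deriv v (node (L k) i)\<bar> \<le> \<epsilon> / (4 * m)"
    by (rule slope_uniform) (use assms m in simp)
  ultimately show ?thesis
  proof eventually_elim
    case (elim k)
    show ?case
    proof
      fix i
      let ?p = "slope (mesh (L k)) (y k) i" and ?x = "node (L k) i"
      have a: "exp (y k i) \<le> 2 * m" "\<bar>?p\<bar> \<le> kappa" using adm[of k] by (auto simp: admissible_def)
      have p2: "?p^2 \<le> 1" using a(2) by (simp add: abs_square_le_1)
      have eq: "yw k i - weight_fun ?x = (exp (y k i) - exp (v ?x)) * (1 + ?p^2) + exp (v ?x) * ((?p + deriv v ?x) * (?p - deriv v ?x))"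
        by (simp add: yw_def weight_fun_def power2_eq_square algebra_simps)
      have "\<bar>yw k i - weight_fun ?x\<bar> \<le> \<bar>exp (y k i) - exp (v ?x)\<bar> * (1 + ?p^2) + exp (v ?x) * (\<bar>?p + deriv v ?x\<bar> * \<bar>?p - deriv v ?x\<bar>)"
        unfolding eq by (rule order_trans[OF abs_triangle_ineq]) (simp add: abs_mult)
      also have "\<dots> \<le> (2 * m * \<eta> k) * 2 + (2 * m) * (1 * (\<epsilon> / (4 * m)))"
      proof -
        have h1: "\<bar>exp (y k i) - exp (v ?x)\<bar> \<le> 2 * m * \<eta> k"
          by (rule order_trans[OF exp_diff_bound[OF a(1) exp_v(2)] mult_left_mono[OF conv]]) (use m in simp)
        have h2: "\<bar>?p + deriv v ?x\<bar> \<le> 1" using a(2) deriv_le[of ?x] by linarith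
        have h3: "\<bar>?p - deriv v ?x\<bar> \<le> \<epsilon> / (4 * m)" by (rule elim(2)[rule_format])
        have h4: "0 \<le> 2 * m * \<eta> k" by (rule order_trans[OF abs_ge_zero h1])
        have h5: "\<bar>exp (y k i) - exp (v ?x)\<bar> * (1 + ?p^2) \<le> (2 * m * \<eta> k) * 2"
          by (rule mult_mono[OF h1 _ h4]) (use p2 in simp_all)
        have h6: "\<bar>?p + deriv v ?x\<bar> * \<bar>?p - deriv v ?x\<bar> \<le> 1 * (\<epsilon> / (4 * m))"
          by (rule mult_mono[OF h2 h3]) simp_all
        have h7: "exp (v ?x) * (\<bar>?p + deriv v ?x\<bar> * \<bar>?p - deriv v ?x\<bar>) \<le> (2 * m) * (1 * (\<epsilon> / (4 * m)))"
          by (rule mult_mono[OF exp_v(2) h6]) (use m in simp_all)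
        show ?thesis by (rule add_mono[OF h5 h7])
      qed
      also have "\<dots> \<le> \<epsilon>" using elim(1) m by simp
      finally show "\<bar>yw k i - weight_fun ?x\<bar> \<le> \<epsilon>" .
    qed
  qed
qed

lemma W_cont: "continuous_on UNIV W" and weight_cont: "continuous_on S weight_fun"
  unfolding W_def weight_fun_def
  by (intro continuous_intros deriv_cont continuous_on_subset[OF deriv_cont] continuous_on_subset[OF v_cont]; simp)+

lemma angle_tendsto: "(\<lambda>k. angle (mesh (L k)) (y k) (j * 2 ^ (L k - n))) \<longlonglongrightarrow> W (node n j)"
proof -
  have "(\<lambda>k. slope (mesh (L k)) (y k) (j * 2 ^ (L k - n)) - deriv v (node n j)) \<longlonglongrightarrow> 0"
  proof (rule tendstoI)
    fix \<epsilon> :: real assume "\<epsilon> > 0"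
    then have "\<forall>\<^sub>F k in sequentially. \<forall>i. \<bar>slope (mesh (L k)) (y k) i - deriv v (node (L k) i)\<bar> \<le> \<epsilon> / 2" by (intro slope_uniform) simp
    then show "\<forall>\<^sub>F k in sequentially. dist (slope (mesh (L k)) (y k) (j * 2 ^ (L k - n)) - deriv v (node n j)) 0 < \<epsilon>"
      using L_ge[of n]
    proof eventually_elim
      case (elim k)
      show ?case using elim(1)[rule_format, of "j * 2 ^ (L k - n)"] node_refine[OF elim(2), of j] \<open>\<epsilon> > 0\<close> by (simp add: dist_real_def)
    qed
  qed
  then have "(\<lambda>k. slope (mesh (L k)) (y k) (j * 2 ^ (L k - n))) \<longlonglongrightarrow> deriv v (node n j)" by (rule LIM_zero_cancel)
  then show ?thesis unfolding angle_def W_def by (intro tendsto_intros)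
qed

lemma block_limit:
  fixes \<sigma> :: "int => real"
  assumes \<sigma>: "\<And>j. \<sigma> j \<ge> 0" and t: "\<And>k i. t k (i + 2 ^ L k) = t k i"
   and le: "\<forall>\<^sub>F k in sequentially. \<forall>j l. 0 \<le> j \<longrightarrow> j < 2 ^ n \<longrightarrow> node n j \<le> node (L k) l \<longrightarrow> node (L k) l \<le> node n (j + 1) \<longrightarrow> \<sigma> j \<le> t k l"
   and en': "\<forall>\<^sub>F k in sequentially. mesh (L k) * (\<Sum>i=0..<int (2 ^ L k). t k i * (angle_diff (mesh (L k)) (y k) i)^2) \<le> C k"
   and C: "C \<longlonglongrightarrow> C0"
  shows "(\<Sum>j=0..<2 ^ n. \<sigma> j * ((W (node n (j + 1)) - W (node n j))^2 / mesh n)) \<le> C0"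
proof (rule tendsto_le[OF sequentially_bot C])
  show "(\<lambda>k. \<Sum>j=0..<2 ^ n. \<sigma> j * ((angle (mesh (L k)) (y k) ((j + 1) * 2 ^ (L k - n)) - angle (mesh (L k)) (y k) (j * 2 ^ (L k - n)))^2 / mesh n))
     \<longlonglongrightarrow> (\<Sum>j=0..<2 ^ n. \<sigma> j * ((W (node n (j + 1)) - W (node n j))^2 / mesh n))"
    using mesh_pos[of n] by (intro tendsto_intros angle_tendsto) auto
  show "\<forall>\<^sub>F k in sequentially. (\<Sum>j=0..<2 ^ n. \<sigma> j * ((angle (mesh (L k)) (y k) ((j + 1) * 2 ^ (L k - n)) - angle (mesh (L k)) (y k) (j * 2 ^ (L k - n)))^2 / mesh n)) \<le> C k"
    using le en' L_ge[of n]
  proof eventually_elim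
    case (elim k)
    interpret admissible_step "2 ^ L k" "mesh (L k)" m "m * (mesh (L k))^2 / 100" "y k" by (rule step)
    have "(\<Sum>j=0..<int (2 ^ n). \<sigma> j * ((w ((j + 1) * int (2 ^ (L k - n))) - w (j * int (2 ^ (L k - n))))^2 / (mesh (L k) * real (2 ^ (L k - n)))))
      \<le> mesh (L k) * (\<Sum>i\<in>I. t k i * (d i)^2)"
    proof (rule block_energy[OF _ \<sigma>])
      show "(2::nat) ^ L k = 2 ^ n * 2 ^ (L k - n)" using elim(3) by (simp flip: power_add)
      show "t k (i + int (2 ^ L k)) = t k i" for i using t[of k i] by simp
      fix j l assume j: "0 \<le> j" "j < int (2 ^ n)" "j * int (2 ^ (L k - n)) < l" "l \<le> (j + 1) * int (2 ^ (L k - n))"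
      show "\<sigma> j \<le> t k l"
        using elim(1)[rule_format, of j l] j node_refine[OF elim(3), of j] node_refine[OF elim(3), of "j + 1"]
          node_mono[of "j * int (2 ^ (L k - n))" l "L k"] node_mono[of l "(j + 1) * int (2 ^ (L k - n))" "L k"] by simp
    qed
    moreover have "mesh (L k) * real (2 ^ (L k - n)) = mesh n"
      using elim(3) by (auto simp: mesh_def power_add dest!: le_Suc_ex)
    ultimately show ?case using elim(2) by simp
  qed
qed

lemma per_y: "y k (i + 2 ^ L k) = y k i" "slope (mesh (L k)) (y k) (i + 2 ^ L k) = slope (mesh (L k)) (y k) i"
proof -
  interpret admissible_step "2 ^ L k" "mesh (L k)" m "m * (mesh (L k))^2 / 100" "y k" by (rule step)
  show "y k (i + 2 ^ L k) = y k i" "slope (mesh (L k)) (y k) (i + 2 ^ L k) = slope (mesh (L k)) (y k) i"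
    using per[of i] per_p[of i] by simp_all
qed

lemma W_energy: "dyadic_energy W n \<le> B / m"
proof -
  have "(\<Sum>j=0..<2 ^ n. 1 * ((W (node n (j + 1)) - W (node n j))^2 / mesh n)) \<le> B / m"
  proof (rule block_limit[where t="\<lambda>_ _. 1" and C="\<lambda>_. B / m"])
    show "\<forall>\<^sub>F k in sequentially. mesh (L k) * (\<Sum>i=0..<int (2 ^ L k). 1 * (angle_diff (mesh (L k)) (y k) i)^2) \<le> B / m"
    proof (intro always_eventually allI)
      fix k
      interpret admissible_step "2 ^ L k" "mesh (L k)" m "m * (mesh (L k))^2 / 100" "y k" by (rule step)
      have "energy (2 ^ L k) (mesh (L k)) (y k) / m \<le> B / m" using enB m by (intro divide_right_mono) auto
      then show "mesh (L k) * (\<Sum>i=0..<int (2 ^ L k). 1 * (angle_diff (mesh (L k)) (y k) i)^2) \<le> B / m"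
        using sum_d2_energy by simp
    qed
  qed auto
  then show ?thesis by (simp add: dyadic_energy_def)
qed

text \<open>
  On the cells of a fine enough grid the continuous weight is constant up to
  \<open>\<delta>\<close>, and the discrete weights converge uniformly to it. So the weights may
  be exchanged at the expense of a multiple of \<open>\<delta>\<close> times the unweighted
  energy, which is at most \<open>B / m\<close>.
\<close>

lemma W_weighted_energy:
  assumes \<epsilon>: "\<epsilon> > 0"
  shows "\<forall>\<^sub>F n in sequentially. (\<Sum>j=0..<2 ^ n. weight_fun (node n j) * ((W (node n (j + 1)) - W (node n j))^2 / mesh n)) \<le> E0 + \<epsilon>"
proof -
  define c where "c = B / m + 1"
  have c: "c > 0" using B0 m by (simp add: c_def add_nonneg_pos)
  define \<delta> where "\<delta> = \<epsilon> / (2 * c)"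
  have \<delta>: "\<delta> > 0" using \<epsilon> c by (simp add: \<delta>_def)
  have "uniformly_continuous_on {-pi..pi} weight_fun"
    by (rule compact_uniformly_continuous[OF weight_cont compact_Icc])
  then obtain \<rho> where \<rho>: "\<rho> > 0" "\<And>a b. a \<in> {-pi..pi} ==> b \<in> {-pi..pi} ==> \<bar>b - a\<bar> < \<rho> ==> \<bar>weight_fun b - weight_fun a\<bar> < \<delta>"
    unfolding uniformly_continuous_on_def dist_real_def using \<delta> by metis
  have "\<forall>\<^sub>F n in sequentially. mesh n < \<rho>" using order_tendstoD(2)[OF mesh_tendsto \<rho>(1)] .
  then show ?thesis
  proof eventually_elim
    case (elim n)
    have "(\<Sum>j=0..<2 ^ n. weight_fun (node n j) * ((W (node n (j + 1)) - W (node n j))^2 / mesh n)) \<le> E0 + 2 * \<delta> * (B / m)"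
    proof (rule block_limit[where t="\<lambda>k i. yw k i + 2 * \<delta>" and C="\<lambda>k. e k + 2 * \<delta> * (B / m)"])
      show "weight_fun (node n j) \<ge> 0" for j by (simp add: weight_fun_def)
      show "yw k (i + 2 ^ L k) + 2 * \<delta> = yw k i + 2 * \<delta>" for k i by (simp add: yw_def per_y)
      show "(\<lambda>k. e k + 2 * \<delta> * (B / m)) \<longlonglongrightarrow> E0 + 2 * \<delta> * (B / m)" by (intro tendsto_intros e)
      show "\<forall>\<^sub>F k in sequentially. mesh (L k) * (\<Sum>i=0..<int (2 ^ L k). (yw k i + 2 * \<delta>) * (angle_diff (mesh (L k)) (y k) i)^2) \<le> e k + 2 * \<delta> * (B / m)"
      proof (intro always_eventually allI)
        fix k
        interpret admissible_step "2 ^ L k" "mesh (L k)" m "m * (mesh (L k))^2 / 100" "y k" by (rule step)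
        have 1: "mesh (L k) * (\<Sum>i\<in>I. (d i)^2) \<le> B / m"
          using sum_d2_energy divide_right_mono[OF enB, of m k] m by simp
        have "mesh (L k) * (\<Sum>i\<in>I. (yw k i + 2 * \<delta>) * (d i)^2) = energy (2 ^ L k) (mesh (L k)) (y k) + 2 * \<delta> * (mesh (L k) * (\<Sum>i\<in>I. (d i)^2))"
          by (simp add: energy_def yw_def distrib_right sum.distrib distrib_left flip: sum_distrib_left)
        also have "\<dots> \<le> e k + 2 * \<delta> * (B / m)" using en[of k] 1 \<delta> by (intro add_mono mult_left_mono) auto
        finally show "mesh (L k) * (\<Sum>i=0..<int (2 ^ L k). (yw k i + 2 * \<delta>) * (d i)^2) \<le> e k + 2 * \<delta> * (B / m)" .
      qed
      show "\<forall>\<^sub>F k in sequentially. \<forall>j l. 0 \<le> j \<longrightarrow> j < 2 ^ n \<longrightarrow> node n j \<le> node (L k) l \<longrightarrow> node (L k) l \<le> node n (j + 1) \<longrightarrow> weight_fun (node n j) \<le> yw k l + 2 * \<delta>"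
        using weight_uniform[OF \<delta>]
      proof eventually_elim
        case el: (elim k)
        show ?case
        proof (intro allI impI)
          fix j l assume j: "0 \<le> j" "j < 2 ^ n" "node n j \<le> node (L k) l" "node (L k) l \<le> node n (j + 1)"
          have "-pi \<le> node n j" "node n (j + 1) \<le> pi"
            using node_mono[of 0 j n] node_mono[of "j + 1" "2 ^ n" n] j by auto
          then have "\<bar>weight_fun (node (L k) l) - weight_fun (node n j)\<bar> < \<delta>"
            using j elim node_Suc[of n j] by (intro \<rho>(2)) auto
          then show "weight_fun (node n j) \<le> yw k l + 2 * \<delta>" using el[rule_format, of l] by linarith
        qed
      qed
    qed
    also have "2 * \<delta> * (B / m) \<le> \<epsilon>"
    proof -
      have "2 * \<delta> * (B / m) \<le> 2 * \<delta> * c" using \<delta> by (intro mult_left_mono) (auto simp: c_def)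
      also have "\<dots> = \<epsilon>" using c by (simp add: \<delta>_def)
      finally show ?thesis .
    qed
    finally show ?case by simp
  qed
qed

text \<open>
  Lower semicontinuity of the energy at a fixed time: the discrete energies dominate the dyadic
  energies of the limit angle.
\<close>

theorem limit_regularity:
  obtains \<omega> where "L2_torus \<omega>" "primitive_on (-pi) pi (\<lambda>x. arctan (deriv v x)) \<omega>"
    "(LINT x|torus. exp (v x) * (1 + (deriv v x)^2) * (\<omega> x)^2) \<le> E0"
proof (rule dyadic_limit[of W pi "B / m" weight_fun E0])
  show "\<bar>W x\<bar> \<le> pi" for x using arctan_bounded[of "deriv v x"] pi_gt_zero by (auto simp: W_def)
  show "weight_fun x \<ge> 0" for x by (simp add: weight_fun_def)
qed (use W_cont weight_cont W_energy W_weighted_energy that in \<open>auto simp: W_def[abs_def] weight_fun_def[abs_def]\<close>)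

end

section \<open>Compactness in space and time\<close>

context admissible_step
begin

lemma node_lipschitz: "\<bar>v i - v j\<bar> \<le> kappa * (h * \<bar>real_of_int (i - j)\<bar>)"
proof -
  have *: "\<bar>v b - v a\<bar> \<le> kappa * (h * real_of_int (b - a))" if "a \<le> b" for a b
    using that
  proof (induction b rule: int_ge_induct)
    case (step b)
    have "\<bar>v (b + 1) - v a\<bar> \<le> \<bar>v (b + 1) - v b\<bar> + \<bar>v b - v a\<bar>" by linarith
    also have "\<dots> \<le> h * kappa + kappa * (h * real_of_int (b - a))" by (intro add_mono v_diff step.IH)
    finally show ?case by (simp add: field_simps)
  qed simp
  show ?thesis
  proof (cases "j \<le> i")
    case True then show ?thesis using *[of j i] by simp
  next
    case False then show ?thesis using *[of i j] by (simp add: abs_minus_commute)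
  qed
qed

lemma sum_q2_energy: "h * (\<Sum>i\<in>I. (q i)^2) \<le> energy N h v / m ^ 3"
proof -
  have "m^2 * (h * (\<Sum>i\<in>I. (q i)^2)) = h * (\<Sum>i\<in>I. m^2 * (q i)^2)" by (simp add: sum_distrib_left mult_ac)
  also have "\<dots> \<le> h * (\<Sum>i\<in>I. (d i)^2)"
  proof (intro mult_left_mono sum_mono)
    fix i
    have "m^2 \<le> (exp (v i))^2" using lo m by (intro power_mono) auto
    then show "m^2 * (q i)^2 \<le> (d i)^2" unfolding d_eq power_mult_distrib by (intro mult_right_mono) auto
  qed (use h in simp)
  also have "\<dots> \<le> energy N h v / m" by (rule sum_d2_energy)
  finally show ?thesis using m by (simp add: field_simps power2_eq_square power3_eq_cube)
qed

end

text \<open>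
  The square of \<open>f\<close> is small somewhere, and its variation over a period is bounded
  by a multiple of the Lipschitz constant times the mean of \<open>\<bar>f\<bar>\<close>.
  Applied to differences of \<open>v\<close> at two times, this turns mean square bounds for the
  increments in time into uniform ones.
\<close>

lemma discrete_agmon:
  fixes f :: "int => real"
  assumes N: "N > 0" and h: "h > 0" "h * real N = 2 * pi" and per: "\<And>i. f (i + int N) = f i"
    and lip: "\<And>i. \<bar>f (i + 1) - f i\<bar> \<le> 2 * kappa * h" and one: "\<And>i. \<bar>f i\<bar> \<le> 1"
    and S: "h * (\<Sum>i=0..<int N. (f i)^2) \<le> X^2" and X: "X \<ge> 0"
  shows "(f i)^2 \<le> X"
proof -
  have main: "(f i)^2 \<le> X" if i: "i \<in> {0..<int N}" for i
  proof (cases "X \<le> 1")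
    case False
    have "(f i)^2 \<le> 1" using one[of i] by (simp add: abs_square_le_1)
    then show ?thesis using False by simp
  next
    case True
    have "\<exists>j\<in>{0..<int N}. (f j)^2 \<le> X^2 / (2 * pi)"
    proof (rule ccontr)
      assume "\<not> ?thesis"
      then have "(\<Sum>j=0..<int N. X^2 / (2 * pi)) < (\<Sum>j=0..<int N. (f j)^2)"
        using N by (intro sum_strict_mono) (auto simp: not_le)
      then have "real N * (X^2 / (2 * pi)) < (\<Sum>j=0..<int N. (f j)^2)" by simp
      then have "h * (real N * (X^2 / (2 * pi))) < h * (\<Sum>j=0..<int N. (f j)^2)"
        using h(1) by (rule mult_strict_left_mono)
      then have "h * real N * (X^2 / (2 * pi)) < X^2" using S by (simp add: mult.assoc)
      then show False unfolding h by simp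
    qed
    then obtain j where j: "j \<in> {0..<int N}" "(f j)^2 \<le> X^2 / (2 * pi)" by blast
    have "\<bar>(f i)^2 - (f j)^2\<bar> \<le> (\<Sum>l=0..<int N. \<bar>(f (l + 1))^2 - (f l)^2\<bar>)"
      by (rule telescope_period[OF j(1) i])
    also have "\<dots> \<le> (\<Sum>l=0..<int N. 2 * kappa * h * (\<bar>f (l + 1)\<bar> + \<bar>f l\<bar>))"
    proof (intro sum_mono)
      fix l
      have "\<bar>(f (l + 1))^2 - (f l)^2\<bar> = \<bar>f (l + 1) - f l\<bar> * \<bar>f (l + 1) + f l\<bar>"
        unfolding abs_mult[symmetric] by (simp add: power2_eq_square algebra_simps)
      also have "\<dots> \<le> 2 * kappa * h * (\<bar>f (l + 1)\<bar> + \<bar>f l\<bar>)" using lip[of l] h by (intro mult_mono) auto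
      finally show "\<bar>(f (l + 1))^2 - (f l)^2\<bar> \<le> 2 * kappa * h * (\<bar>f (l + 1)\<bar> + \<bar>f l\<bar>)" .
    qed
    also have "\<dots> = 2 * kappa * h * ((\<Sum>l=0..<int N. \<bar>f (l + 1)\<bar>) + (\<Sum>l=0..<int N. \<bar>f l\<bar>))"
      by (simp only: sum.distrib flip: sum_distrib_left)
    also have "(\<Sum>l=0..<int N. \<bar>f (l + 1)\<bar>) = (\<Sum>l=0..<int N. \<bar>f l\<bar>)"
      using period_sum_shift[of "\<lambda>l. \<bar>f l\<bar>" N] per by simp
    finally have 1: "\<bar>(f i)^2 - (f j)^2\<bar> \<le> 4 * kappa * (h * (\<Sum>l=0..<int N. \<bar>f l\<bar>))" by simp
    have "(h * (\<Sum>l=0..<int N. \<bar>f l\<bar>))^2 = h^2 * (\<Sum>l=0..<int N. 1 * \<bar>f l\<bar>)^2" by (simp add: power_mult_distrib)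
    also have "\<dots> \<le> h^2 * ((\<Sum>l=0..<int N. 1^2) * (\<Sum>l=0..<int N. \<bar>f l\<bar>^2))"
      by (intro mult_left_mono Cauchy_Schwarz_ineq_sum) auto
    also have "\<dots> = (h * real N) * (h * (\<Sum>l=0..<int N. (f l)^2))" by (simp add: power2_eq_square)
    also have "\<dots> \<le> 2 * pi * X^2" unfolding h using S by (intro mult_left_mono) auto
    also have "\<dots> \<le> 3^2 * X^2" using pi_less_4 by (intro mult_right_mono) auto
    finally have "(h * (\<Sum>l=0..<int N. \<bar>f l\<bar>))^2 \<le> (3 * X)^2" by (simp add: power_mult_distrib)
    then have 2: "h * (\<Sum>l=0..<int N. \<bar>f l\<bar>) \<le> 3 * X" by (rule power2_le_imp_le) (use X in simp)
    have "X^2 / (2 * pi) \<le> X / (2 * pi)" using True X by (intro divide_right_mono) (auto simp: power2_eq_square mult_left_le)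
    also have "\<dots> \<le> X / 6" using X pi_gt3 by (intro divide_left_mono) auto
    finally have 3: "X^2 / (2 * pi) \<le> X / 6" .
    show ?thesis using 1 2 3 j(2) X by linarith
  qed
  interpret pf: periodic_fun_simple f "int N" by standard (rule per)
  have "f (i mod int N + (i div int N) * int N) = f (i mod int N)" using pf.plus_of_int[of "i mod int N" "i div int N"] by simp
  then have "f i = f (i mod int N)" by simp
  then show ?thesis using main[of "i mod int N"] N by simp
qed

text \<open>
  The scheme on all dyadic grids, from initial values \<open>v0 n\<close> whose energies are at
  most \<open>e n\<close>.
\<close>

locale scheme =
  fixes m B E0 :: real and v0 :: "nat => int => real" and e :: "nat => real"
  assumes m: "m > 0" and adm0: "\<And>n. admissible (2 ^ n) (mesh n) m (v0 n)"
    and en0: "\<And>n. energy (2 ^ n) (mesh n) (v0 n) \<le> e n" and eB: "\<And>n. e n \<le> B" and e: "e \<longlonglongrightarrow> E0"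
begin

definition dt :: "nat => real" where "dt n = m * (mesh n)^2 / 100"

definition approx :: "nat => nat => int => real" where
  "approx n k = ((euler (dt n) (mesh n)) ^^ k) (v0 n)"

lemma approx_0: "approx n 0 = v0 n" and approx_Suc: "approx n (Suc k) = euler (dt n) (mesh n) (approx n k)"
  by (simp_all add: approx_def)

lemma dt_pos: "dt n > 0" using m mesh_pos[of n] by (simp add: dt_def)

lemma dt_tendsto: "dt \<longlonglongrightarrow> 0"
proof -
  have "(\<lambda>n. m * (mesh n)^2 / 100) \<longlonglongrightarrow> m * 0^2 / 100" by (intro tendsto_intros mesh_tendsto) auto
  then show ?thesis by (simp add: dt_def[abs_def])
qed

lemma adm: "admissible (2 ^ n) (mesh n) m (approx n k)"
proof (induction k)
  case 0 show ?case using adm0 by (simp add: approx_0)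
next
  case (Suc k) then show ?case unfolding approx_Suc
    by (intro admissible_euler) (use mesh_pos m dt_pos in \<open>auto simp: dt_def\<close>)
qed

lemma step: "admissible_step (2 ^ n) (mesh n) m (dt n) (approx n k)"
  unfolding dt_def by (rule admissible_stepI[OF m adm])

lemma energy_le: "energy (2 ^ n) (mesh n) (approx n k) \<le> e n"
proof (induction k)
  case 0 show ?case using en0 by (simp add: approx_0)
next
  case (Suc k)
  have "energy (2 ^ n) (mesh n) (approx n (Suc k)) \<le> energy (2 ^ n) (mesh n) (approx n k)"
    unfolding approx_Suc by (rule admissible_step.energy_decreases[OF step])
  then show ?case using Suc by linarith
qed

lemma energy_B: "energy (2 ^ n) (mesh n) (approx n k) \<le> B" using energy_le eB order_trans by blast

lemma B0: "B \<ge> 0" using admissible_step.energy_nonneg[OF step] energy_B order_trans by blast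

lemma approx_per: "approx n k (i + 2 ^ n) = approx n k i"
  using admissible_step.per[OF step[of n k], of i] by simp

lemma approx_bounds: "ln m \<le> approx n k i" "approx n k i \<le> ln (2 * m)"
  using admissible_step.lo[OF step[of n k], of i] admissible_step.hi[OF step[of n k], of i] m
    ln_ge_iff[of "2 * m" "approx n k i"] ln_le_cancel_iff[of m "exp (approx n k i)"] by auto

lemma approx_node_lipschitz: "\<bar>approx n k i - approx n k j\<bar> \<le> kappa * \<bar>node n i - node n j\<bar>"
  using admissible_step.node_lipschitz[OF step[of n k], of i j] mesh_pos[of n]
  by (simp add: node_diff abs_mult)

text \<open>
  A bound for the mean square norm of the speed, from \<open>sum_q2_energy\<close>.
\<close>

definition G :: real where "G = sqrt (B / m ^ 3)"

lemma G0: "G \<ge> 0" using B0 m by (simp add: G_def)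

lemma approx_time_l2:
  assumes "k \<le> l"
  shows "mesh n * (\<Sum>i=0..<int (2 ^ n). (approx n l i - approx n k i)^2) \<le> (G * (real (l - k) * dt n))^2"
proof -
  let ?I = "{0..<int (2 ^ n)}"
  define Q where "Q j i = speed (mesh n) (approx n j) i" for j i
  have tel: "approx n l i - approx n k i = dt n * (\<Sum>j=k..<l. 1 * Q j i)" for i
    using assms
  proof (induction l rule: dec_induct)
    case (step l)
    then show ?case by (simp add: approx_Suc euler_def Q_def distrib_left)
  qed simp
  have "mesh n * (\<Sum>i\<in>?I. (approx n l i - approx n k i)^2) \<le> mesh n * (\<Sum>i\<in>?I. (dt n)^2 * (real (l - k) * (\<Sum>j=k..<l. (Q j i)^2)))"
  proof (intro mult_left_mono sum_mono)
    fix i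
    have "(approx n l i - approx n k i)^2 = (dt n)^2 * (\<Sum>j=k..<l. 1 * Q j i)^2" unfolding tel by (simp add: power_mult_distrib)
    also have "\<dots> \<le> (dt n)^2 * ((\<Sum>j=k..<l. 1^2) * (\<Sum>j=k..<l. (Q j i)^2))"
      by (intro mult_left_mono Cauchy_Schwarz_ineq_sum) auto
    finally show "(approx n l i - approx n k i)^2 \<le> (dt n)^2 * (real (l - k) * (\<Sum>j=k..<l. (Q j i)^2))" by simp
  qed (use mesh_pos[of n] in simp)
  also have "\<dots> = (dt n)^2 * real (l - k) * (\<Sum>j=k..<l. mesh n * (\<Sum>i\<in>?I. (Q j i)^2))"
    unfolding sum_distrib_left by (subst sum.swap) (simp add: mult_ac)
  also have "\<dots> \<le> (dt n)^2 * real (l - k) * (\<Sum>j=k..<l. B / m ^ 3)"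
  proof (intro mult_left_mono sum_mono)
    fix j
    have "mesh n * (\<Sum>i\<in>?I. (Q j i)^2) \<le> energy (2 ^ n) (mesh n) (approx n j) / m ^ 3"
      using admissible_step.sum_q2_energy[OF step[of n j]] by (simp add: Q_def)
    also have "\<dots> \<le> B / m ^ 3" using energy_B m by (intro divide_right_mono) auto
    finally show "mesh n * (\<Sum>i\<in>?I. (Q j i)^2) \<le> B / m ^ 3" .
  qed auto
  also have "\<dots> = (G * (real (l - k) * dt n))^2"
  proof -
    have "G^2 = B / m ^ 3" using B0 m by (simp add: G_def)
    then show ?thesis unfolding power_mult_distrib by (simp add: power2_eq_square)
  qed
  finally show ?thesis .
qed

lemma approx_time: "\<bar>approx n l i - approx n k i\<bar> \<le> sqrt G * sqrt \<bar>real l * dt n - real k * dt n\<bar>"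
proof -
  have *: "\<bar>approx n l i - approx n k i\<bar> \<le> sqrt G * sqrt (real (l - k) * dt n)" if "k \<le> l" for k l
  proof -
    have "(approx n l i - approx n k i)^2 \<le> G * (real (l - k) * dt n)"
    proof (rule discrete_agmon[where N="2 ^ n" and h="mesh n" and f="\<lambda>i. approx n l i - approx n k i"])
      show "mesh n * real (2 ^ n) = 2 * pi" by (simp add: mesh_def)
      show "approx n l (i + int (2 ^ n)) - approx n k (i + int (2 ^ n)) = approx n l i - approx n k i" for i using approx_per by simp
      show "\<bar>approx n l (i + 1) - approx n k (i + 1) - (approx n l i - approx n k i)\<bar> \<le> 2 * kappa * mesh n" for i
        using admissible_step.v_diff[OF step[of n l], of i] admissible_step.v_diff[OF step[of n k], of i] by linarith
      show "\<bar>approx n l i - approx n k i\<bar> \<le> 1" for i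
      proof -
        have "ln (2 * m) = ln 2 + ln m" using m by (simp add: ln_mult)
        then show ?thesis using approx_bounds[of n l i] approx_bounds[of n k i] ln_2_less_1 by linarith
      qed
    qed (use mesh_pos approx_time_l2[OF that] G0 dt_pos[of n] in auto)
    then have "sqrt ((approx n l i - approx n k i)^2) \<le> sqrt (G * (real (l - k) * dt n))" by (rule real_sqrt_le_mono)
    then show ?thesis by (simp add: real_sqrt_mult)
  qed
  show ?thesis
  proof (cases "k \<le> l")
    case True
    then have "\<bar>real l * dt n - real k * dt n\<bar> = real (l - k) * dt n"
      using dt_pos[of n] by (simp add: of_nat_diff left_diff_distrib[symmetric] abs_mult)
    then show ?thesis using *[OF True] by simp
  next
    case False
    then have "\<bar>real l * dt n - real k * dt n\<bar> = real (k - l) * dt n"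
      using dt_pos[of n] by (simp add: of_nat_diff left_diff_distrib[symmetric] abs_mult)
    then show ?thesis using *[of l k] False by (simp add: abs_minus_commute)
  qed
qed

definition modulus :: "real => real => real" where
  "modulus s x = kappa * \<bar>x\<bar> + sqrt G * sqrt \<bar>s\<bar>"

lemma modulus_triangle: "modulus (s + s') (x + x') \<le> modulus s x + modulus s' x'"
proof -
  have "sqrt \<bar>s + s'\<bar> \<le> sqrt (\<bar>s\<bar> + \<bar>s'\<bar>)" by simp
  also have "\<dots> \<le> sqrt \<bar>s\<bar> + sqrt \<bar>s'\<bar>" by (intro sqrt_add_le_add_sqrt) auto
  finally have "sqrt G * sqrt \<bar>s + s'\<bar> \<le> sqrt G * (sqrt \<bar>s\<bar> + sqrt \<bar>s'\<bar>)" using G0 by (intro mult_left_mono) auto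
  moreover have "kappa * \<bar>x + x'\<bar> \<le> kappa * (\<bar>x\<bar> + \<bar>x'\<bar>)" by simp
  ultimately show ?thesis unfolding modulus_def distrib_left by linarith
qed

lemma modulus_nonneg: "modulus s x \<ge> 0" using G0 by (simp add: modulus_def)

lemma modulus_minus: "modulus (- s) (- x) = modulus s x" by (simp add: modulus_def)

text \<open>
  McShane's extension: the largest function on the whole plane that has the modulus of
  continuity of the grid function and does not exceed it on the grid, where the two therefore
  agree.
\<close>

definition extended :: "nat => real => real => real" where
  "extended n t x = (INF (k, i) \<in> UNIV. approx n k i + modulus (t - real k * dt n) (x - node n i))"

lemma extended_bdd: "bdd_below ((\<lambda>(k, i). approx n k i + modulus (t - real k * dt n) (x - node n i)) ` UNIV)"
  by (rule bdd_belowI2[of _ "ln m"]) (auto intro!: add_increasing2 approx_bounds modulus_nonneg)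

lemma extended_le: "extended n t x \<le> approx n k i + modulus (t - real k * dt n) (x - node n i)"
  unfolding extended_def by (rule cINF_lower2[OF extended_bdd, of "(k, i)"]) auto

lemma extended_ge:
  assumes "\<And>k i. c \<le> approx n k i + modulus (t - real k * dt n) (x - node n i)"
  shows "c \<le> extended n t x"
  unfolding extended_def by (rule cINF_greatest) (use assms in auto)

lemma extended_modulus: "\<bar>extended n t x - extended n t' x'\<bar> \<le> modulus (t - t') (x - x')"
proof -
  have *: "extended n t x - modulus (t - t') (x - x') \<le> extended n t' x'" for t t' x x'
  proof (rule extended_ge)
    fix k i
    have "modulus ((t - t') + (t' - real k * dt n)) ((x - x') + (x' - node n i)) \<le> modulus (t - t') (x - x') + modulus (t' - real k * dt n) (x' - node n i)"
      by (rule modulus_triangle)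
    then show "extended n t x - modulus (t - t') (x - x') \<le> approx n k i + modulus (t' - real k * dt n) (x' - node n i)"
      using extended_le[of n t x k i] by simp
  qed
  show ?thesis using *[of t x t' x'] *[of t' x' t x] modulus_minus[of "t - t'" "x - x'"] by simp
qed

lemma extended_grid: "extended n (real k * dt n) (node n i) = approx n k i"
proof (rule antisym)
  show "extended n (real k * dt n) (node n i) \<le> approx n k i"
    using extended_le[of n "real k * dt n" "node n i" k i] by (simp add: modulus_def)
  show "approx n k i \<le> extended n (real k * dt n) (node n i)"
  proof (rule extended_ge)
    fix l j
    show "approx n k i \<le> approx n l j + modulus (real k * dt n - real l * dt n) (node n i - node n j)"
      using approx_time[of n k i l] approx_node_lipschitz[of n l i j] unfolding modulus_def by linarith
  qed
qed

lemma extended_period: "extended n t (x + 2 * pi) = extended n t x"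
proof (rule antisym)
  have nd: "node n (i + 2 ^ n) = node n i + 2 * pi" for i by (simp add: node_def mesh_def field_simps)
  show "extended n t (x + 2 * pi) \<le> extended n t x"
  proof (rule extended_ge)
    fix k i
    show "extended n t (x + 2 * pi) \<le> approx n k i + modulus (t - real k * dt n) (x - node n i)"
      using extended_le[of n t "x + 2 * pi" k "i + 2 ^ n"] by (simp add: nd approx_per)
  qed
  show "extended n t x \<le> extended n t (x + 2 * pi)"
  proof (rule extended_ge)
    fix k i
    show "extended n t x \<le> approx n k i + modulus (t - real k * dt n) (x + 2 * pi - node n i)"
      using extended_le[of n t x k "i - 2 ^ n"] nd[of "i - 2 ^ n"] approx_per[of n k "i - 2 ^ n"] by (simp add: algebra_simps)
  qed
qed

lemma extended_range: "ln m \<le> extended n t x" "extended n t x \<le> ln (2 * m) + sqrt G * sqrt \<bar>t\<bar> + kappa * 7"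
proof -
  show "ln m \<le> extended n t x"
    by (rule extended_ge) (intro add_increasing2 approx_bounds modulus_nonneg)
  have "\<bar>x - node n (cell n x)\<bar> \<le> 7"
  proof -
    have "mesh n \<le> 2 * pi / 1" unfolding mesh_def by (intro divide_left_mono) auto
    then have "mesh n \<le> 7" using pi_approx by simp
    then show ?thesis using node_cell(1)[of n x] node_cell(2)[of x n] by linarith
  qed
  then have "kappa * \<bar>x - node n (cell n x)\<bar> \<le> kappa * 7" by (intro mult_left_mono) auto
  then show "extended n t x \<le> ln (2 * m) + sqrt G * sqrt \<bar>t\<bar> + kappa * 7"
    using extended_le[of n t x 0 "cell n x"] approx_bounds(2)[of n 0 "cell n x"] by (simp add: modulus_def)
qed

text \<open>
  Arzela-Ascoli on one period; periodicity spreads the uniform convergence over the line.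
\<close>

lemma compactness:
  assumes T: "T \<ge> 0"
  obtains r v \<eta> where "strict_mono r" "\<eta> \<longlonglongrightarrow> 0" "\<And>k t x. t \<in> {0..T} ==> \<bar>extended (r k) t x - v t x\<bar> \<le> \<eta> k"
proof -
  define S where "S = {0..T} \<times> {-pi..pi}"
  define M where "M = \<bar>ln m\<bar> + \<bar>ln (2 * m) + sqrt G * sqrt T + kappa * 7\<bar>"
  have bnd: "\<bar>extended n t x\<bar> \<le> M" if "t \<in> {0..T}" for n t x
  proof -
    have "sqrt G * sqrt \<bar>t\<bar> \<le> sqrt G * sqrt T" using that G0 by (intro mult_left_mono) auto
    then show ?thesis using extended_range[of n t x] unfolding M_def by linarith
  qed
  obtain g r where r: "strict_mono (r :: nat => nat)"
    and g: "\<And>e. 0 < e ==> \<exists>N. \<forall>n z. N \<le> n \<and> z \<in> S \<longrightarrow> norm ((\<lambda>(t, x). extended (r n) t x) z - g z) < e"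
  proof (rule Arzela_Ascoli[of S "\<lambda>n (t, x). extended n t x" M])
    show "compact S" unfolding S_def by (intro compact_Times compact_Icc)
    show "norm (case z of (t, x) => extended n t x) \<le> M" if "z \<in> S" for n z
      using that bnd by (auto simp: S_def)
    fix z :: "real \<times> real" and e :: real assume z: "z \<in> S" and e: "0 < e"
    obtain t x where tx: "z = (t, x)" by (cases z)
    have "((\<lambda>d. kappa * d + sqrt G * sqrt d) \<longlongrightarrow> kappa * 0 + sqrt G * sqrt 0) (at_right 0)" by (intro tendsto_intros)
    then have "((\<lambda>d. kappa * d + sqrt G * sqrt d) \<longlongrightarrow> 0) (at_right 0)" by simp
    then have "\<forall>\<^sub>F d in at_right 0. kappa * d + sqrt G * sqrt d < e" by (rule order_tendstoD(2)) (fact e)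
    moreover have "\<forall>\<^sub>F d in at_right (0::real). 0 < d" by (rule eventually_at_right_less)
    ultimately have "\<forall>\<^sub>F d in at_right 0. 0 < d \<and> kappa * d + sqrt G * sqrt d < e" by eventually_elim simp
    then obtain d where d: "0 < d" "kappa * d + sqrt G * sqrt d < e"
      using eventually_happens'[OF trivial_limit_at_right_real] by blast
    show "\<exists>d>0. \<forall>n y. y \<in> S \<and> norm (z - y) < d \<longrightarrow> norm ((case z of (t, x) => extended n t x) - (case y of (t, x) => extended n t x)) < e"
    proof (intro exI[of _ d] conjI allI impI d(1))
      fix n and y :: "real \<times> real" assume y: "y \<in> S \<and> norm (z - y) < d"
      obtain s x' where sy: "y = (s, x')" by (cases y)
      have "\<bar>t - s\<bar> < d" "\<bar>x - x'\<bar> < d"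
        using y norm_fst_le[of "t - s" "x - x'"] norm_snd_le[of "x - x'" "t - s"] by (auto simp: tx sy)
      then have "modulus (t - s) (x - x') \<le> kappa * d + sqrt G * sqrt d"
        unfolding modulus_def using G0 by (intro add_mono mult_left_mono) auto
      then show "norm ((case z of (t, x) => extended n t x) - (case y of (t, x) => extended n t x)) < e"
        using extended_modulus[of n t x s x'] d by (simp add: tx sy)
    qed
  next
    fix g and k :: "nat => nat"
    assume "strict_mono k" "\<And>e. 0 < e ==> \<exists>N. \<forall>n x. N \<le> n \<and> x \<in> S \<longrightarrow> norm ((case x of (t, x) => extended (k n) t x) - g x) < e"
    then show thesis by (rule that)
  qed
  define red where "red x = x - 2 * pi * of_int \<lfloor>(x + pi) / (2 * pi)\<rfloor>" for x :: real
  have red: "red x \<in> {-pi..pi}" for x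
  proof -
    define k where "k = \<lfloor>(x + pi) / (2 * pi)\<rfloor>"
    have "real_of_int k \<le> (x + pi) / (2 * pi)" "(x + pi) / (2 * pi) < real_of_int k + 1"
      unfolding k_def by linarith+
    then have "real_of_int k * (2 * pi) \<le> x + pi" "x + pi < (real_of_int k + 1) * (2 * pi)"
      by (simp_all only: pos_le_divide_eq pos_divide_less_eq pi_gt_zero mult_pos_pos zero_less_numeral)
    moreover have "red x = x - 2 * pi * real_of_int k" by (simp only: red_def k_def)
    ultimately show ?thesis by (simp add: algebra_simps)
  qed
  have VVred: "extended n t (red x) = extended n t x" for n t x
  proof -
    interpret pf: periodic_fun_simple "extended n t" "2 * pi" by standard (rule extended_period)
    show ?thesis using pf.minus_of_int[of x "\<lfloor>(x + pi) / (2 * pi)\<rfloor>"] by (simp add: red_def mult.commute)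
  qed
  define v where "v t x = g (t, red x)" for t x
  define \<eta> where "\<eta> k = (SUP z\<in>S. \<bar>(\<lambda>(t, x). extended (r k) t x) z - g z\<bar>)" for k
  obtain N1 where N1: "\<And>n z. N1 \<le> n ==> z \<in> S ==> norm ((\<lambda>(t, x). extended (r n) t x) z - g z) < 1" using g[of 1] by auto
  have gb: "\<bar>g z\<bar> \<le> M + 1" if "z \<in> S" for z
    using N1[OF order_refl that] bnd[of "fst z" "r N1" "snd z"] that by (auto simp: S_def case_prod_beta)
  have bdd: "bdd_above ((\<lambda>z. \<bar>(\<lambda>(t, x). extended (r k) t x) z - g z\<bar>) ` S)" for k
  proof (rule bdd_aboveI2[of _ _ "2 * M + 1"])
    fix z assume z: "z \<in> S"
    show "\<bar>(\<lambda>(t, x). extended (r k) t x) z - g z\<bar> \<le> 2 * M + 1"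
      using gb[OF z] bnd[of "fst z" "r k" "snd z"] z by (auto simp: S_def case_prod_beta)
  qed
  have Sne: "S \<noteq> {}" using T by (auto simp: S_def)
  have "\<eta> \<longlonglongrightarrow> 0"
  proof (rule LIMSEQ_I)
    fix \<epsilon> :: real assume "\<epsilon> > 0"
    then obtain N where N: "\<And>n z. N \<le> n ==> z \<in> S ==> norm ((\<lambda>(t, x). extended (r n) t x) z - g z) < \<epsilon> / 2" using g[of "\<epsilon> / 2"] by auto
    show "\<exists>no. \<forall>n\<ge>no. norm (\<eta> n - 0) < \<epsilon>"
    proof (intro exI allI impI)
      fix n assume n: "N \<le> n"
      have "\<eta> n \<le> \<epsilon> / 2" unfolding \<eta>_def by (rule cSUP_least[OF Sne]) (use N[OF n] in \<open>auto intro: less_imp_le\<close>)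
      moreover obtain z where z: "z \<in> S" using Sne by blast
      have "0 \<le> \<eta> n" unfolding \<eta>_def by (rule cSUP_upper2[OF bdd z]) simp
      ultimately show "norm (\<eta> n - 0) < \<epsilon>" using \<open>\<epsilon> > 0\<close> by simp
    qed
  qed
  moreover have "\<bar>extended (r k) t x - v t x\<bar> \<le> \<eta> k" if "t \<in> {0..T}" for k t x
  proof -
    have "(t, red x) \<in> S" using that red by (simp add: S_def)
    then have "\<bar>(\<lambda>(t, x). extended (r k) t x) (t, red x) - g (t, red x)\<bar> \<le> \<eta> k" unfolding \<eta>_def by (rule cSUP_upper[OF _ bdd])
    then show ?thesis by (simp add: v_def VVred)
  qed
  ultimately show ?thesis using that r by blast
qed

end

section \<open>Riemann sums and the weak form of one step\<close>

lemma riemann_sum: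
  fixes g :: "real => real" and A :: "nat => real"
  assumes g: "integrable (lebesgue_on {a..a + real K * \<delta>}) g" and \<delta>: "\<delta> \<ge> 0"
    and le: "\<And>j s. j < K ==> a + real j * \<delta> \<le> s ==> s \<le> a + (real j + 1) * \<delta> ==> \<bar>A j - g s\<bar> \<le> \<epsilon>"
  shows "\<bar>(\<Sum>j<K. \<delta> * A j) - (LINT s|lebesgue_on {a..a + real K * \<delta>}. g s)\<bar> \<le> real K * \<delta> * \<epsilon>"
  using g le
proof (induction K)
  case 0
  have "AE x in lebesgue. x \<notin> {a}"
    by (rule AE_not_in) (simp flip: negligible_iff_null_sets)
  then have "AE x in lebesgue. x \<in> {a..a} \<longrightarrow> g x = 0"
    by eventually_elim auto
  then have "AE x in lebesgue_on {a..a}. g x = 0"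
    by (subst AE_restrict_space_iff) auto
  then have "(LINT s|lebesgue_on {a..a}. g s) = (LINT s|lebesgue_on {a..a}. 0)"
    using 0 by (intro Bochner_Integration.integral_cong_AE) auto
  then show ?case by simp
next
  case (Suc K)
  let ?b = "a + real K * \<delta>" and ?c = "a + real (Suc K) * \<delta>"
  have bc: "a \<le> ?b" "?b \<le> ?c" using \<delta> by (auto simp: mult_right_mono)
  have i1: "integrable (lebesgue_on {a..?b}) g" by (rule integrable_subinterval[OF Suc.prems(1)]) (use bc in auto)
  have i2: "integrable (lebesgue_on {?b..?c}) g" by (rule integrable_subinterval[OF Suc.prems(1)]) (use bc in auto)
  have len: "measure (lebesgue_on {?b..?c}) {?b..?c} = \<delta>"
    using bc by (simp add: measure_restrict_space algebra_simps)
  have cint: "integrable (lebesgue_on {?b..?c}) (\<lambda>_. z :: real)" for z by (rule integrable_on_interval_continuous) simp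
  have "\<bar>(LINT s|lebesgue_on {?b..?c}. A K) - (LINT s|lebesgue_on {?b..?c}. g s)\<bar> \<le> (LINT s|lebesgue_on {?b..?c}. \<epsilon>)"
    by (rule lint_diff_bound[OF cint i2 cint]) (use Suc.prems(2)[of K] in \<open>auto simp: algebra_simps\<close>)
  then have "\<bar>\<delta> * A K - (LINT s|lebesgue_on {?b..?c}. g s)\<bar> \<le> \<delta> * \<epsilon>"
    by (simp add: len del: of_nat_Suc)
  moreover have "\<bar>(\<Sum>j<K. \<delta> * A j) - (LINT s|lebesgue_on {a..?b}. g s)\<bar> \<le> real K * \<delta> * \<epsilon>"
    by (rule Suc.IH[OF i1]) (use Suc.prems(2) in auto)
  moreover have "(LINT s|lebesgue_on {a..?c}. g s) = (LINT s|lebesgue_on {a..?b}. g s) + (LINT s|lebesgue_on {?b..?c}. g s)"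
    by (rule integral_combine[OF Suc.prems(1) bc])
  moreover have "real (Suc K) * \<delta> * \<epsilon> = real K * \<delta> * \<epsilon> + \<delta> * \<epsilon>" by (simp add: algebra_simps)
  ultimately show ?case by simp
qed

lemma sum_int_nat: "(\<Sum>i=0..<int N. f i) = (\<Sum>j<N. f (int j))"
  by (rule sum.reindex_bij_witness[of _ int nat]) auto

lemma riemann_sum_torus:
  fixes g :: "real => real" and A :: "int => real"
  assumes g: "continuous_on {-pi..pi} g"
    and le: "\<And>i x. x \<in> {-pi..pi} ==> node n i \<in> {-pi..pi} ==> node n (i + 1) \<in> {-pi..pi} ==> node n i \<le> x ==> x \<le> node n i + mesh n ==> \<bar>A i - g x\<bar> \<le> \<epsilon>"
  shows "\<bar>mesh n * (\<Sum>i=0..<int (2 ^ n). A i) - (LINT x|torus. g x)\<bar> \<le> 2 * pi * \<epsilon>"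
proof -
  have len: "real (2 ^ n) * mesh n = 2 * pi" by (simp add: mesh_def)
  have e: "-pi + real (2 ^ n) * mesh n = pi" unfolding len by simp
  have "\<bar>(\<Sum>j<2 ^ n. mesh n * A (int j)) - (LINT s|lebesgue_on {-pi..-pi + real (2 ^ n) * mesh n}. g s)\<bar> \<le> real (2 ^ n) * mesh n * \<epsilon>"
  proof (rule riemann_sum)
    show "integrable (lebesgue_on {- pi..- pi + real (2 ^ n) * mesh n}) g" unfolding e by (rule integrable_torus_continuous[OF g])
    fix j :: nat and s assume j: "j < 2 ^ n" "- pi + real j * mesh n \<le> s" "s \<le> - pi + (real j + 1) * mesh n"
    have nd: "node n (int j) = -pi + real j * mesh n" "node n (int j + 1) = -pi + (real j + 1) * mesh n" by (simp_all add: node_def)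
    have j': "int j + 1 \<le> 2 ^ n" using j(1) by (metis of_nat_less_iff of_nat_numeral of_nat_power zless_imp_add1_zle)
    have b: "-pi \<le> node n (int j)" "node n (int j) \<le> node n (int j + 1)" "node n (int j + 1) \<le> pi"
      using node_mono[of 0 "int j" n] node_mono[of "int j" "int j + 1" n] node_mono[OF j', of n] by auto
    show "\<bar>A (int j) - g s\<bar> \<le> \<epsilon>"
    proof (rule le)
      show "node n (int j) \<le> s" "s \<le> node n (int j) + mesh n" using j nd node_Suc[of n "int j"] by linarith+
      show "s \<in> {-pi..pi}" using j nd b by (simp only: atLeastAtMost_iff) linarith
      show "node n (int j) \<in> {-pi..pi}" "node n (int j + 1) \<in> {-pi..pi}" using b by auto
    qed
  qed (use mesh_pos[of n] in simp)
  moreover have "mesh n * (\<Sum>i=0..<int (2 ^ n). A i) = (\<Sum>j<2 ^ n. mesh n * A (int j))"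
    by (simp only: sum_int_nat sum_distrib_left)
  moreover have "- pi + 2 * pi = pi" by simp
  ultimately show ?thesis unfolding len by (simp only:)
qed

lemma continuous_param_integral:
  fixes F :: "real => real => real"
  assumes F: "continuous_on ({a..b} \<times> {-pi..pi}) (\<lambda>(s, x). F s x)"
  shows "continuous_on {a..b} (\<lambda>s. LINT x|torus. F s x)"
  unfolding continuous_on_iff
proof (intro ballI allI impI)
  fix s e :: real assume s: "s \<in> {a..b}" and e: "0 < e"
  have uc: "uniformly_continuous_on ({a..b} \<times> {-pi..pi}) (\<lambda>(s, x). F s x)"
    by (rule compact_uniformly_continuous[OF F]) (intro compact_Times compact_Icc)
  have c: "continuous_on {-pi..pi} (F s)" if "s \<in> {a..b}" for s
  proof -
    have "continuous_on {-pi..pi} (\<lambda>x. (\<lambda>(s, x). F s x) (s, x))"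
      by (rule continuous_on_compose2[OF F]) (use that in \<open>auto intro!: continuous_intros\<close>)
    then show ?thesis by simp
  qed
  have "0 < e / (4 * pi)" using e by simp
  from uc[unfolded uniformly_continuous_on_def, rule_format, OF this]
  obtain d where d: "d > 0" "\<forall>z\<in>{a..b} \<times> {-pi..pi}. \<forall>z'\<in>{a..b} \<times> {-pi..pi}. dist z' z < d \<longrightarrow>
      dist ((\<lambda>(s, x). F s x) z') ((\<lambda>(s, x). F s x) z) < e / (4 * pi)" by blast
  show "\<exists>d>0. \<forall>s'\<in>{a..b}. dist s' s < d \<longrightarrow> dist (LINT x|torus. F s' x) (LINT x|torus. F s x) < e"
  proof (intro exI[of _ d] conjI ballI impI d(1))
    fix s' assume s': "s' \<in> {a..b}" "dist s' s < d"
    have "\<bar>(LINT x|torus. F s' x) - (LINT x|torus. F s x)\<bar> \<le> (LINT x|torus. e / (4 * pi))"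
    proof (rule lint_diff_bound)
      fix x :: real assume "x \<in> {-pi..pi}"
      then show "\<bar>F s' x - F s x\<bar> \<le> e / (4 * pi)"
        using d(2)[rule_format, of "(s, x)" "(s', x)"] s s' by (auto simp: dist_Pair_Pair dist_real_def)
    qed (auto intro!: integrable_torus_continuous c s s')
    then show "dist (LINT x|torus. F s' x) (LINT x|torus. F s x) < e" using e by (simp add: dist_real_def)
  qed
qed

lemma exp_taylor_bound: "\<bar>z\<bar> \<le> 1 ==> \<bar>exp z - 1 - z\<bar> \<le> z^2" for z :: real
proof (cases "z \<ge> 0")
  case True
  assume "\<bar>z\<bar> \<le> 1"
  then have "exp z \<le> 1 + z + z^2" using exp_bound[of z] True by simp
  moreover have "1 + z \<le> exp z" by (rule exp_ge_add_one_self)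
  ultimately show ?thesis using zero_le_power2[of z] by linarith
next
  case False
  assume le: "\<bar>z\<bar> \<le> 1"
  have 1: "1 + z \<le> exp z" by (rule exp_ge_add_one_self)
  have pos: "1 - z > 0" using False by simp
  have "1 - z \<le> exp (- z)" using exp_ge_add_one_self[of "-z"] by simp
  then have "exp z * (1 - z) \<le> exp z * exp (- z)" by (intro mult_left_mono) auto
  then have "exp z * (1 - z) \<le> 1" by (simp add: mult_exp_exp)
  moreover have "1 \<le> (1 + z + z^2) * (1 - z)"
    using False mult_nonneg_nonpos[of "z^2" z] by (simp add: power2_eq_square algebra_simps)
  ultimately have "exp z * (1 - z) \<le> (1 + z + z^2) * (1 - z)" by linarith
  then have "exp z \<le> 1 + z + z^2" using pos by (rule mult_right_le_imp_le)
  then show ?thesis using 1 zero_le_power2[of z] by linarith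
qed

text \<open>
  The scheme takes an Euler step for \<open>v = ln u\<close>, whereas the equation is in
  divergence form for \<open>u\<close>. The discrepancy is the second order Taylor remainder of
  the exponential, quadratic in \<open>\<tau> q\<close>, and the energy bounds the sum of the
  squares of \<open>q\<close>.
\<close>

lemma (in admissible_step) euler_weak_error:
  assumes M: "\<And>i. \<bar>\<phi> i\<bar> \<le> M" and per: "\<And>i. \<phi> (i + int N) = \<phi> i"
  shows "\<bar>h * (\<Sum>i\<in>I. exp (euler \<tau> h v i) * \<phi> i) - h * (\<Sum>i\<in>I. exp (v i) * \<phi> i)
      + \<tau> * (h * (\<Sum>i\<in>I. w i * ((\<phi> (i + 1) - \<phi> i) / h)))\<bar> \<le> \<tau>^2 * (2 * M * energy N h v / m^2)"
proof -
  have M0: "M \<ge> 0" using M[of 0] by linarith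
  have parts: "h * (\<Sum>i\<in>I. w i * ((\<phi> (i + 1) - \<phi> i) / h)) = - (h * (\<Sum>i\<in>I. d i * \<phi> i))"
  proof -
    have "(\<Sum>i\<in>I. \<phi> i * (w i - w (i - 1))) = - (\<Sum>i\<in>I. w i * (\<phi> (i + 1) - \<phi> i))"
      by (rule summation_by_parts_period) (simp_all only: per_w per)
    moreover have "h * (\<Sum>i\<in>I. d i * \<phi> i) = (\<Sum>i\<in>I. \<phi> i * (w i - w (i - 1)))"
      unfolding sum_distrib_left angle_diff_def using h by (intro sum.cong) auto
    moreover have "h * (\<Sum>i\<in>I. w i * ((\<phi> (i + 1) - \<phi> i) / h)) = (\<Sum>i\<in>I. w i * (\<phi> (i + 1) - \<phi> i))"
      unfolding sum_distrib_left using h by (intro sum.cong) auto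
    ultimately show ?thesis by simp
  qed
  have small: "\<bar>\<tau> * q i\<bar> \<le> 1" for i
  proof -
    have "\<bar>\<tau> * q i\<bar> \<le> (m * h^2 / 100) * (2 * kappa / (h * m))"
      unfolding abs_mult using tau m h sup_q[of i] by (intro mult_mono) auto
    also have "\<dots> = h * (2 * kappa / 100)" using h m by (simp add: power2_eq_square)
    also have "\<dots> \<le> 7 * (2 * kappa / 100)"
    proof (intro mult_right_mono)
      have "h \<le> 2 * pi" using N unfolding h_eq by (simp add: divide_le_eq)
      then show "h \<le> 7" using pi_approx by simp
    qed simp
    finally show ?thesis by simp
  qed
  define Z where "Z i = (exp (v i) * (exp (\<tau> * q i) - 1 - \<tau> * q i)) * \<phi> i" for i
  have Z: "exp (euler \<tau> h v i) * \<phi> i - exp (v i) * \<phi> i - \<tau> * (d i * \<phi> i) = Z i" for i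
    by (simp add: Z_def euler_def exp_add d_eq algebra_simps)
  have "(\<Sum>i\<in>I. Z i) = (\<Sum>i\<in>I. exp (euler \<tau> h v i) * \<phi> i) - (\<Sum>i\<in>I. exp (v i) * \<phi> i) - \<tau> * (\<Sum>i\<in>I. d i * \<phi> i)"
    unfolding Z[symmetric] by (simp only: sum_subtractf sum_distrib_left)
  then have eq: "h * (\<Sum>i\<in>I. exp (euler \<tau> h v i) * \<phi> i) - h * (\<Sum>i\<in>I. exp (v i) * \<phi> i) + \<tau> * (h * (\<Sum>i\<in>I. w i * ((\<phi> (i + 1) - \<phi> i) / h)))
     = h * (\<Sum>i\<in>I. Z i)"
    unfolding parts by (simp only:) (simp add: algebra_simps)
  have "\<bar>h * (\<Sum>i\<in>I. Z i)\<bar> = h * \<bar>\<Sum>i\<in>I. Z i\<bar>" using h by (simp add: abs_mult)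
  also have "\<dots> \<le> h * (\<Sum>i\<in>I. \<bar>Z i\<bar>)" using h by (intro mult_left_mono sum_abs) auto
  also have "\<dots> \<le> h * (\<Sum>i\<in>I. 2 * m * M * \<tau>^2 * (q i)^2)"
  proof (intro mult_left_mono sum_mono)
    fix i
    have "\<bar>exp (\<tau> * q i) - 1 - \<tau> * q i\<bar> \<le> (\<tau> * q i)^2" by (rule exp_taylor_bound[OF small])
    then have "exp (v i) * \<bar>exp (\<tau> * q i) - 1 - \<tau> * q i\<bar> * \<bar>\<phi> i\<bar> \<le> (2 * m) * (\<tau> * q i)^2 * M"
      using hi M M0 m by (intro mult_mono) auto
    then show "\<bar>Z i\<bar> \<le> 2 * m * M * \<tau>^2 * (q i)^2"
      by (simp add: Z_def abs_mult power_mult_distrib mult_ac)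
  qed (use h in simp)
  also have "\<dots> = 2 * m * M * \<tau>^2 * (h * (\<Sum>i\<in>I. (q i)^2))" by (simp add: sum_distrib_left mult_ac)
  also have "\<dots> \<le> 2 * m * M * \<tau>^2 * (energy N h v / m ^ 3)"
    using sum_q2_energy M0 m by (intro mult_left_mono) auto
  also have "\<dots> = \<tau>^2 * (2 * M * energy N h v / m^2)" using m by (simp add: power2_eq_square power3_eq_cube)
  finally show ?thesis unfolding eq .
qed

section \<open>The limit of the scheme\<close>

text \<open>
  A uniform limit \<open>v\<close> of the extended grid functions along a subsequence
  \<open>r\<close>.
\<close>

locale scheme_limit = scheme +
  fixes T :: real and r :: "nat => nat" and v :: "real => real => real" and \<eta> :: "nat => real" and V0 :: "real => real"
  assumes T: "T > 0" and r: "strict_mono r" and eta: "\<eta> \<longlonglongrightarrow> 0"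
    and conv: "\<And>k t x. t \<in> {0..T} ==> \<bar>extended (r k) t x - v t x\<bar> \<le> \<eta> k"
    and ini: "\<And>x. (\<lambda>n. v0 n (cell n x)) \<longlonglongrightarrow> V0 x"
begin

lemma extended_tendsto: "t \<in> {0..T} ==> (\<lambda>k. extended (r k) t x) \<longlonglongrightarrow> v t x"
proof -
  assume "t \<in> {0..T}"
  then have "(\<lambda>k. extended (r k) t x - v t x) \<longlonglongrightarrow> 0"
    by (intro Lim_null_comparison[OF _ eta]) (use conv in simp)
  then show ?thesis by (rule LIM_zero_cancel)
qed

lemma v_modulus: "t \<in> {0..T} ==> t' \<in> {0..T} ==> \<bar>v t x - v t' x'\<bar> \<le> modulus (t - t') (x - x')"
  by (rule LIMSEQ_le_const2[where X="\<lambda>k. \<bar>extended (r k) t x - extended (r k) t' x'\<bar>"])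
     (auto intro!: tendsto_intros extended_tendsto extended_modulus)

lemma v_period: "t \<in> {0..T} ==> v t (x + 2 * pi) = v t x"
  using extended_tendsto[of t "x + 2 * pi"] extended_tendsto[of t x] by (simp add: extended_period LIMSEQ_unique)

lemma v_continuous: "continuous_on ({0..T} \<times> UNIV) (\<lambda>(t, x). v t x)"
  unfolding continuous_on_def
proof
  fix z :: "real \<times> real" assume z: "z \<in> {0..T} \<times> UNIV"
  obtain t x where tx: "z = (t, x)" by (cases z)
  have "((\<lambda>y. (\<lambda>(t, x). v t x) y - v t x) \<longlongrightarrow> 0) (at z within {0..T} \<times> UNIV)"
  proof (rule Lim_null_comparison)
    show "\<forall>\<^sub>F y in at z within {0..T} \<times> UNIV. norm ((\<lambda>(t, x). v t x) y - v t x) \<le> modulus (fst y - t) (snd y - x)"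
      unfolding eventually_at_filter using v_modulus z by (auto simp: tx intro!: always_eventually)
    have "((\<lambda>y. modulus (fst y - t) (snd y - x)) \<longlongrightarrow> kappa * \<bar>snd z - x\<bar> + sqrt G * sqrt \<bar>fst z - t\<bar>) (at z within {0..T} \<times> UNIV)"
      unfolding modulus_def by (intro tendsto_intros)
    then show "((\<lambda>y. modulus (fst y - t) (snd y - x)) \<longlongrightarrow> 0) (at z within {0..T} \<times> UNIV)" by (simp add: tx)
  qed
  then show "((\<lambda>(t, x). v t x) \<longlongrightarrow> (\<lambda>(t, x). v t x) z) (at z within {0..T} \<times> UNIV)"
    unfolding tx by (simp add: LIM_zero_cancel)
qed

lemma v_continuous_x: "t \<in> {0..T} ==> continuous_on S (v t)"
proof -
  assume t: "t \<in> {0..T}"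
  have "continuous_on S (\<lambda>x. (\<lambda>(t, x). v t x) (t, x))"
    by (rule continuous_on_compose2[OF v_continuous]) (use t in \<open>auto intro!: continuous_intros\<close>)
  then show ?thesis by simp
qed

definition index :: "real => nat => nat" where "index t k = nat \<lfloor>t / dt (r k)\<rfloor>"

lemma index_bounds: "t \<ge> 0 ==> real (index t k) * dt (r k) \<le> t" "t \<ge> 0 ==> t < real (index t k) * dt (r k) + dt (r k)"
proof -
  assume t: "t \<ge> 0"
  have "real (index t k) = real_of_int \<lfloor>t / dt (r k)\<rfloor>" unfolding index_def using t dt_pos[of "r k"] by simp
  then have "real (index t k) \<le> t / dt (r k)" "t / dt (r k) < real (index t k) + 1" by linarith+
  then show "real (index t k) * dt (r k) \<le> t" "t < real (index t k) * dt (r k) + dt (r k)"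
    using dt_pos[of "r k"] by (auto simp: field_simps)
qed

lemma index_grid: "index (real j * dt (r k)) k = j"
  using dt_pos[of "r k"] by (simp add: index_def)

lemma dt_r: "(\<lambda>k. dt (r k)) \<longlonglongrightarrow> 0"
  using LIMSEQ_subseq_LIMSEQ[OF dt_tendsto r] by (simp add: o_def)

definition \<eta>' :: "nat => real" where "\<eta>' k = \<eta> k + sqrt G * sqrt (dt (r k))"

lemma eta': "\<eta>' \<longlonglongrightarrow> 0"
proof -
  have "(\<lambda>k. \<eta> k + sqrt G * sqrt (dt (r k))) \<longlonglongrightarrow> 0 + sqrt G * sqrt 0" by (intro tendsto_intros eta dt_r)
  then show ?thesis by (simp add: \<eta>'_def[abs_def])
qed

lemma approx_conv: "t \<in> {0..T} ==> \<bar>approx (r k) (index t k) i - v t (node (r k) i)\<bar> \<le> \<eta>' k"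
proof -
  assume t: "t \<in> {0..T}"
  have "\<bar>extended (r k) (real (index t k) * dt (r k)) (node (r k) i) - extended (r k) t (node (r k) i)\<bar> \<le> modulus (real (index t k) * dt (r k) - t) (node (r k) i - node (r k) i)"
    by (rule extended_modulus)
  also have "\<dots> \<le> sqrt G * sqrt (dt (r k))"
  proof -
    have "\<bar>real (index t k) * dt (r k) - t\<bar> \<le> dt (r k)" using index_bounds[of t k] t by auto
    then show ?thesis unfolding modulus_def using G0 by (auto intro!: mult_left_mono)
  qed
  finally show ?thesis using conv[OF t, of k "node (r k) i"] unfolding extended_grid \<eta>'_def by linarith
qed

lemma at_time:
  assumes t: "t \<in> {0..T}"
  shows "spatial_limit m B E0 r (\<lambda>k. approx (r k) (index t k)) (\<lambda>k. e (r k)) \<eta>' (v t)"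
proof
  show "(\<lambda>k. e (r k)) \<longlonglongrightarrow> E0" using LIMSEQ_subseq_LIMSEQ[OF e r] by (simp add: o_def)
  show "filterlim r at_top sequentially" by (rule filterlim_subseq[OF r])
qed (use m adm energy_le eB approx_conv[OF t] eta' v_continuous_x[OF t] in auto)

abbreviation P :: "real => real => real" where "P t \<equiv> deriv (v t)"

text \<open>
  The difference quotients of \<open>v\<close> in \<open>x\<close> are continuous in both
  variables and converge to \<open>P\<close> uniformly, as the constant in the Taylor estimate
  does not depend on time.
\<close>

lemma P_continuous: "continuous_on ({0..T} \<times> UNIV) (\<lambda>(t, x). P t x)"
proof (rule uniform_limit_theorem)
  define D where "D = spatial_limit.D m B"
  have D0: "D \<ge> 0" unfolding D_def by (rule spatial_limit.D0[OF at_time[of 0]]) (use T in simp)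
  define \<epsilon> where "\<epsilon> n = 1 / real (Suc n)" for n
  have eps: "\<epsilon> n > 0" "\<epsilon> n \<le> 1" for n by (auto simp: \<epsilon>_def)
  show "\<forall>\<^sub>F n in sequentially. continuous_on ({0..T} \<times> UNIV) (\<lambda>z. ((\<lambda>(t, x). v t x) (fst z, snd z + \<epsilon> n) - (\<lambda>(t, x). v t x) z) / \<epsilon> n)"
  proof (intro always_eventually allI)
    fix n
    have "continuous_on ({0..T} \<times> UNIV) (\<lambda>z. (\<lambda>(t, x). v t x) (fst z, snd z + \<epsilon> n))"
      by (rule continuous_on_compose2[OF v_continuous]) (auto intro!: continuous_intros)
    then show "continuous_on ({0..T} \<times> UNIV) (\<lambda>z. ((\<lambda>(t, x). v t x) (fst z, snd z + \<epsilon> n) - (\<lambda>(t, x). v t x) z) / \<epsilon> n)"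
      using eps[of n] by (intro continuous_intros v_continuous) auto
  qed
  show "uniform_limit ({0..T} \<times> UNIV) (\<lambda>n z. ((\<lambda>(t, x). v t x) (fst z, snd z + \<epsilon> n) - (\<lambda>(t, x). v t x) z) / \<epsilon> n) (\<lambda>(t, x). P t x) sequentially"
  proof (rule uniform_limitI)
    fix \<delta> :: real assume "\<delta> > 0"
    have "(\<lambda>n. D * sqrt (\<epsilon> n)) \<longlonglongrightarrow> D * sqrt 0" unfolding \<epsilon>_def by (intro tendsto_intros LIMSEQ_Suc[OF lim_1_over_n])
    then have "\<forall>\<^sub>F n in sequentially. D * sqrt (\<epsilon> n) < \<delta>" by (rule order_tendstoD(2)) (use \<open>\<delta> > 0\<close> in simp)
    then show "\<forall>\<^sub>F n in sequentially. \<forall>z\<in>{0..T} \<times> UNIV. dist (((\<lambda>(t, x). v t x) (fst z, snd z + \<epsilon> n) - (\<lambda>(t, x). v t x) z) / \<epsilon> n) ((\<lambda>(t, x). P t x) z) < \<delta>"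
    proof eventually_elim
      case (elim n)
      have "\<bar>(v t (x + \<epsilon> n) - v t x) / \<epsilon> n - P t x\<bar> < \<delta>" if t: "t \<in> {0..T}" for t x
      proof -
        have "\<bar>v t (x + \<epsilon> n) - v t x - (x + \<epsilon> n - x) * P t x\<bar> \<le> D * sqrt \<bar>x + \<epsilon> n - x\<bar> * \<bar>x + \<epsilon> n - x\<bar>"
          unfolding D_def by (rule spatial_limit.v_taylor[OF at_time[OF t]]) (use eps[of n] in simp)
        then have le: "\<bar>v t (x + \<epsilon> n) - v t x - \<epsilon> n * P t x\<bar> \<le> D * sqrt (\<epsilon> n) * \<epsilon> n" using eps[of n] by simp
        have "\<bar>(v t (x + \<epsilon> n) - v t x) / \<epsilon> n - P t x\<bar> * \<epsilon> n = \<bar>((v t (x + \<epsilon> n) - v t x) / \<epsilon> n - P t x) * \<epsilon> n\<bar>"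
          using eps[of n] by (simp add: abs_mult)
        also have "((v t (x + \<epsilon> n) - v t x) / \<epsilon> n - P t x) * \<epsilon> n = v t (x + \<epsilon> n) - v t x - \<epsilon> n * P t x"
          by (rule diff_quotient_mult) (use eps[of n] in simp)
        finally have "\<bar>(v t (x + \<epsilon> n) - v t x) / \<epsilon> n - P t x\<bar> * \<epsilon> n \<le> D * sqrt (\<epsilon> n) * \<epsilon> n" using le by simp
        then have "\<bar>(v t (x + \<epsilon> n) - v t x) / \<epsilon> n - P t x\<bar> \<le> D * sqrt (\<epsilon> n)" using eps(1)[of n] by (rule mult_right_le_imp_le)
        then show ?thesis using elim by linarith
      qed
      then show ?case by (auto simp: dist_real_def)
    qed
  qed
qed simp

lemma P_le: "t \<in> {0..T} ==> \<bar>P t x\<bar> \<le> kappa"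
  using spatial_limit.deriv_le[OF at_time] .

lemma exp_v: "t \<in> {0..T} ==> m \<le> exp (v t x)" "t \<in> {0..T} ==> exp (v t x) \<le> 2 * m"
  using spatial_limit.exp_v[OF at_time] by auto

lemma v_deriv: "t \<in> {0..T} ==> (v t has_real_derivative P t x) (at x)"
  using spatial_limit.v_deriv[OF at_time] .

lemma P_period: "t \<in> {0..T} ==> P t (x + 2 * pi) = P t x"
proof -
  assume t: "t \<in> {0..T}"
  have "((\<lambda>y. v t (y + 2 * pi)) has_real_derivative P t (x + 2 * pi)) (at x)"
    using v_deriv[OF t, of "x + 2 * pi"] DERIV_shift[of "v t" _ x "2 * pi"] by simp
  then have "(v t has_real_derivative P t (x + 2 * pi)) (at x)"
    by (simp add: v_period[OF t])
  then show ?thesis by (metis DERIV_imp_deriv)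
qed

lemma r_ge: "\<forall>\<^sub>F k in sequentially. n \<le> r k"
  using eventually_ge_at_top[of n]
  by eventually_elim (meson order_trans seq_suble[OF r])

lemma slope_uniform_grid:
  assumes "\<epsilon> > 0"
  shows "\<forall>\<^sub>F k in sequentially. \<forall>j i. real j * dt (r k) \<le> T \<longrightarrow> \<bar>slope (mesh (r k)) (approx (r k) j) i - P (real j * dt (r k)) (node (r k) i)\<bar> \<le> \<epsilon>"
proof -
  define D where "D = spatial_limit.D m B"
  have "(\<lambda>n. 2 * D * sqrt (mesh n)) \<longlonglongrightarrow> 2 * D * sqrt 0" by (intro tendsto_intros mesh_tendsto)
  then have "\<forall>\<^sub>F n in sequentially. 2 * D * sqrt (mesh n) < \<epsilon> / 2" using assms by (intro order_tendstoD(2)) auto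
  moreover have "\<forall>\<^sub>F n in sequentially. mesh n < 1" using order_tendstoD(2)[OF mesh_tendsto] by simp
  ultimately have "\<forall>\<^sub>F n in sequentially. 2 * D * sqrt (mesh n) < \<epsilon> / 2 \<and> mesh n < 1" by eventually_elim simp
  then obtain n where n: "2 * D * sqrt (mesh n) < \<epsilon> / 2" "mesh n < 1"
    using eventually_happens'[OF sequentially_bot] by blast
  have "(\<lambda>k. 2 * \<eta>' k / mesh n) \<longlonglongrightarrow> 2 * 0 / mesh n" using mesh_pos[of n] by (intro tendsto_intros eta') auto
  then have "\<forall>\<^sub>F k in sequentially. 2 * \<eta>' k / mesh n < \<epsilon> / 2" using assms by (intro order_tendstoD(2)) auto
  then show ?thesis using r_ge[of n]
  proof eventually_elim
    case (elim k)
    show ?case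
    proof (intro allI impI)
      fix j i assume j: "real j * dt (r k) \<le> T"
      have t: "real j * dt (r k) \<in> {0..T}" using j dt_pos[of "r k"] by simp
      have "\<bar>slope (mesh (r k)) (approx (r k) (index (real j * dt (r k)) k)) i - P (real j * dt (r k)) (node (r k) i)\<bar> \<le> 2 * D * sqrt (mesh n) + 2 * \<eta>' k / mesh n"
        unfolding D_def by (rule spatial_limit.slope_error[OF at_time[OF t] elim(2)]) (use n in simp)
      then show "\<bar>slope (mesh (r k)) (approx (r k) j) i - P (real j * dt (r k)) (node (r k) i)\<bar> \<le> \<epsilon>"
        unfolding index_grid using n elim by linarith
    qed
  qed
qed

lemma v_initial: "v 0 x = V0 x"
proof -
  have "(\<lambda>k. approx (r k) (index 0 k) (cell (r k) x)) \<longlonglongrightarrow> v 0 x"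
    by (rule spatial_limit.y_tendsto[OF at_time]) (use T in simp)
  then have "(\<lambda>k. v0 (r k) (cell (r k) x)) \<longlonglongrightarrow> v 0 x" by (simp add: index_def approx_0)
  moreover have "(\<lambda>k. v0 (r k) (cell (r k) x)) \<longlonglongrightarrow> V0 x"
    using LIMSEQ_subseq_LIMSEQ[OF ini r] by (simp add: o_def)
  ultimately show ?thesis by (rule LIMSEQ_unique)
qed

context
  fixes \<phi> :: "real => real"
  assumes test: "test_fun \<phi>"
begin

lemma phi_bounds:
  obtains M where "M \<ge> 0" "\<And>x. \<bar>\<phi> x\<bar> \<le> M" "\<And>x. \<bar>deriv \<phi> x\<bar> \<le> M"
proof -
  have bd: "\<exists>M\<ge>0. \<forall>x. \<bar>f x\<bar> \<le> M" if f: "test_fun f" for f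
  proof -
    obtain M where M: "M \<ge> 0" "\<And>x. x \<in> {-pi..pi} ==> \<bar>f x\<bar> \<le> M"
      using bounded_on_Icc[OF test_fun_continuous[OF f]] by blast
    interpret pf: periodic_fun_simple f "2 * pi" by standard (rule test_fun_periodic[OF f])
    have "\<bar>f x\<bar> \<le> M" for x
    proof -
      define k where "k = \<lfloor>(x + pi) / (2 * pi)\<rfloor>"
      have "real_of_int k \<le> (x + pi) / (2 * pi)" "(x + pi) / (2 * pi) < real_of_int k + 1"
        unfolding k_def by linarith+
      then have "real_of_int k * (2 * pi) \<le> x + pi" "x + pi < (real_of_int k + 1) * (2 * pi)"
        by (simp_all only: pos_le_divide_eq pos_divide_less_eq pi_gt_zero mult_pos_pos zero_less_numeral)
      then have "x - real_of_int k * (2 * pi) \<in> {-pi..pi}" by (simp add: algebra_simps)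
      then show ?thesis using M(2) pf.minus_of_int[of x k] by metis
    qed
    then show ?thesis using M(1) by blast
  qed
  obtain M1 where M1: "M1 \<ge> 0" "\<And>x. \<bar>\<phi> x\<bar> \<le> M1" using bd[OF test] by blast
  obtain M2 where M2: "M2 \<ge> 0" "\<And>x. \<bar>deriv \<phi> x\<bar> \<le> M2" using bd[OF test_fun_deriv[OF test]] by blast
  show ?thesis by (rule that[of "max M1 M2"]) (use M1 M2 in \<open>auto intro: max.coboundedI1 max.coboundedI2\<close>)
qed

lemma phi_node_per: "\<phi> (node n (i + int (2 ^ n))) = \<phi> (node n i)"
proof -
  have "node n (i + int (2 ^ n)) = node n i + 2 * pi" by (simp add: node_def mesh_def field_simps)
  then show ?thesis by (simp add: test_fun_periodic[OF test])
qed

lemma mass_tendsto: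
  assumes t: "t \<in> {0..T}"
  shows "(\<lambda>k. mesh (r k) * (\<Sum>i=0..<int (2 ^ r k). exp (approx (r k) (index t k) i) * \<phi> (node (r k) i)))
     \<longlonglongrightarrow> (LINT x|torus. exp (v t x) * \<phi> x)"
proof (rule LIMSEQ_I)
  fix \<epsilon> :: real assume \<epsilon>: "\<epsilon> > 0"
  obtain M where M: "M \<ge> 0" "\<And>x. \<bar>\<phi> x\<bar> \<le> M" using phi_bounds by metis
  define H where "H x = exp (v t x) * \<phi> x" for x
  have Hc: "continuous_on {-pi..pi} H" unfolding H_def
    by (intro continuous_intros v_continuous_x[OF t] test_fun_continuous[OF test])
  define \<delta> where "\<delta> = \<epsilon> / (8 * pi)"
  have \<delta>: "\<delta> > 0" using \<epsilon> by (simp add: \<delta>_def)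
  obtain \<rho> where \<rho>: "\<rho> > 0" "\<And>a b. a \<in> {-pi..pi} ==> b \<in> {-pi..pi} ==> \<bar>b - a\<bar> < \<rho> ==> \<bar>H b - H a\<bar> < \<delta>"
    using compact_uniformly_continuous[OF Hc compact_Icc] \<delta>
    unfolding uniformly_continuous_on_def dist_real_def by metis
  have "(\<lambda>k. 2 * m * \<eta>' k * M) \<longlonglongrightarrow> 2 * m * 0 * M" by (intro tendsto_intros eta')
  then have "\<forall>\<^sub>F k in sequentially. 2 * m * \<eta>' k * M < \<delta>" by (rule order_tendstoD(2)) (use \<delta> in simp)
  moreover have "\<forall>\<^sub>F k in sequentially. mesh (r k) < \<rho>"
    using order_tendstoD(2)[OF LIMSEQ_subseq_LIMSEQ[OF mesh_tendsto r] \<rho>(1)] by (simp add: o_def)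
  ultimately have "\<forall>\<^sub>F k in sequentially. norm (mesh (r k) * (\<Sum>i=0..<int (2 ^ r k). exp (approx (r k) (index t k) i) * \<phi> (node (r k) i)) - (LINT x|torus. H x)) < \<epsilon>"
  proof eventually_elim
    case (elim k)
    have "\<bar>mesh (r k) * (\<Sum>i=0..<int (2 ^ r k). exp (approx (r k) (index t k) i) * \<phi> (node (r k) i)) - (LINT x|torus. H x)\<bar> \<le> 2 * pi * (2 * \<delta>)"
    proof (rule riemann_sum_torus[OF Hc])
      fix i x assume x: "x \<in> {-pi..pi}" "node (r k) i \<in> {-pi..pi}" "node (r k) i \<le> x" "x \<le> node (r k) i + mesh (r k)"
      let ?n = "node (r k) i"
      have "\<bar>exp (approx (r k) (index t k) i) - exp (v t ?n)\<bar> \<le> 2 * m * \<bar>approx (r k) (index t k) i - v t ?n\<bar>"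
        by (rule exp_diff_bound) (use admissible_step.hi[OF step] exp_v[OF t] in auto)
      also have "\<dots> \<le> 2 * m * \<eta>' k" using approx_conv[OF t] m by (intro mult_left_mono) auto
      finally have "\<bar>exp (approx (r k) (index t k) i) - exp (v t ?n)\<bar> * \<bar>\<phi> ?n\<bar> \<le> 2 * m * \<eta>' k * M"
        using M by (intro mult_mono) auto
      then have 1: "\<bar>exp (approx (r k) (index t k) i) * \<phi> ?n - H ?n\<bar> < \<delta>"
        using elim(1) by (simp add: H_def abs_mult flip: left_diff_distrib)
      have "\<bar>H x - H ?n\<bar> < \<delta>" by (rule \<rho>(2)) (use x elim in auto)
      then show "\<bar>exp (approx (r k) (index t k) i) * \<phi> ?n - H x\<bar> \<le> 2 * \<delta>" using 1 by linarith
    qed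
    also have "2 * pi * (2 * \<delta>) < \<epsilon>" using \<epsilon> by (simp add: \<delta>_def)
    finally show ?case by simp
  qed
  then show "\<exists>no. \<forall>k\<ge>no. norm (mesh (r k) * (\<Sum>i=0..<int (2 ^ r k). exp (approx (r k) (index t k) i) * \<phi> (node (r k) i)) - (LINT x|torus. exp (v t x) * \<phi> x)) < \<epsilon>"
    unfolding eventually_sequentially H_def .
qed

definition flux :: "real => real => real" where "flux s x = arctan (P s x) * deriv \<phi> x"

lemma flux_continuous: "continuous_on ({0..T} \<times> {-pi..pi}) (\<lambda>(s, x). flux s x)"
proof -
  have "continuous_on ({0..T} \<times> {-pi..pi}) (\<lambda>z. arctan ((\<lambda>(t, x). P t x) z) * deriv \<phi> (snd z))"
    by (intro continuous_intros continuous_on_subset[OF P_continuous] continuous_on_compose2[OF test_fun_continuous[OF test_fun_deriv[OF test], of UNIV]]) auto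
  then show ?thesis by (simp add: flux_def case_prod_unfold)
qed

lemma flux_continuous_x: "s \<in> {0..T} ==> continuous_on {-pi..pi} (flux s)"
proof -
  assume s: "s \<in> {0..T}"
  have "continuous_on {-pi..pi} (\<lambda>x. (\<lambda>(s, x). flux s x) (s, x))"
    by (rule continuous_on_compose2[OF flux_continuous]) (use s in \<open>auto intro!: continuous_intros\<close>)
  then show ?thesis by simp
qed

definition dsum :: "nat => nat => real" where
  "dsum k j = mesh (r k) * (\<Sum>i=0..<int (2 ^ r k). angle (mesh (r k)) (approx (r k) j) i * ((\<phi> (node (r k) (i + 1)) - \<phi> (node (r k) i)) / mesh (r k)))"

lemma dsum_close:
  assumes "\<epsilon> > 0"
  shows "\<forall>\<^sub>F k in sequentially. \<forall>j s. real j * dt (r k) \<le> s \<longrightarrow> s \<le> (real j + 1) * dt (r k) \<longrightarrow> (real j + 1) * dt (r k) \<le> T \<longrightarrow>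
      \<bar>dsum k j - (LINT x|torus. flux s x)\<bar> \<le> \<epsilon>"
proof -
  obtain M where M: "M \<ge> 0" "\<And>x. \<bar>deriv \<phi> x\<bar> \<le> M" using phi_bounds by metis
  define \<delta> where "\<delta> = \<epsilon> / (2 * pi * (2 * M + 1))"
  have \<delta>: "\<delta> > 0" using assms M by (simp add: \<delta>_def)
  define g where "g = (\<lambda>z. (arctan ((\<lambda>(t, x). P t x) z)))"
  have gc: "continuous_on ({0..T} \<times> {-pi..pi}) g" unfolding g_def
    by (intro continuous_intros continuous_on_subset[OF P_continuous]) auto
  have "uniformly_continuous_on ({0..T} \<times> {-pi..pi}) g"
    by (rule compact_uniformly_continuous[OF gc]) (intro compact_Times compact_Icc)
  from this[unfolded uniformly_continuous_on_def, rule_format, OF \<delta>]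
  obtain \<rho>1 where \<rho>1: "\<rho>1 > 0" "\<forall>a\<in>{0..T} \<times> {-pi..pi}. \<forall>b\<in>{0..T} \<times> {-pi..pi}. dist b a < \<rho>1 \<longrightarrow> dist (g b) (g a) < \<delta>"
    by blast
  obtain \<rho>2 where \<rho>2: "\<rho>2 > 0" "\<And>a b. a \<in> {-pi..pi} ==> b \<in> {-pi..pi} ==> \<bar>b - a\<bar> < \<rho>2 ==> \<bar>deriv \<phi> b - deriv \<phi> a\<bar> < \<delta>"
    using compact_uniformly_continuous[OF test_fun_continuous[OF test_fun_deriv[OF test]] compact_Icc[of "-pi" pi]] \<delta>
    unfolding uniformly_continuous_on_def dist_real_def by metis
  have "\<forall>\<^sub>F k in sequentially. mesh (r k) < min \<rho>2 (\<rho>1 / 2)"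
    using order_tendstoD(2)[OF LIMSEQ_subseq_LIMSEQ[OF mesh_tendsto r], of "min \<rho>2 (\<rho>1 / 2)"] \<rho>1 \<rho>2 by (simp add: o_def)
  moreover have "\<forall>\<^sub>F k in sequentially. dt (r k) < \<rho>1 / 2"
    by (rule order_tendstoD(2)[OF dt_r]) (use \<rho>1(1) in simp)
  moreover note slope_uniform_grid[OF \<delta>]
  ultimately show ?thesis
  proof eventually_elim
    case (elim k)
    show ?case
    proof (intro allI impI)
      fix j s assume s: "real j * dt (r k) \<le> s" "s \<le> (real j + 1) * dt (r k)" "(real j + 1) * dt (r k) \<le> T"
      have j0: "0 \<le> real j * dt (r k)" using dt_pos[of "r k"] by simp
      have jT: "real j * dt (r k) \<le> T" using s by linarith
      have sT: "s \<in> {0..T}" using s j0 by auto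
      have sj: "\<bar>real j * dt (r k) - s\<bar> < \<rho>1 / 2" using s elim(2) by (auto simp: algebra_simps)
      have "\<bar>dsum k j - (LINT x|torus. flux s x)\<bar> \<le> 2 * pi * (\<delta> * (2 * M + 1))"
        unfolding dsum_def
      proof (rule riemann_sum_torus[OF flux_continuous_x[OF sT]])
        fix i x assume x: "x \<in> {-pi..pi}" "node (r k) i \<in> {-pi..pi}" "node (r k) (i + 1) \<in> {-pi..pi}" "node (r k) i \<le> x" "x \<le> node (r k) i + mesh (r k)"
        let ?n = "node (r k) i" and ?h = "mesh (r k)"
        have h: "?h > 0" by (rule mesh_pos)
        obtain \<xi> where \<xi>: "?n < \<xi>" "\<xi> < node (r k) (i + 1)" "\<phi> (node (r k) (i + 1)) - \<phi> ?n = (node (r k) (i + 1) - ?n) * deriv \<phi> \<xi>"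
          using MVT2[of ?n "node (r k) (i + 1)" \<phi> "deriv \<phi>"] h node_Suc[of "r k" i] test_fun_has_derivative[OF test] by auto
        have D: "(\<phi> (node (r k) (i + 1)) - \<phi> ?n) / ?h = deriv \<phi> \<xi>" using \<xi>(3) h node_Suc[of "r k" i] by simp
        let ?w = "angle ?h (approx (r k) j) i"
        have a1: "\<bar>?w - arctan (P (real j * dt (r k)) ?n)\<bar> \<le> \<delta>"
          unfolding angle_def using arctan_1_lipschitz elim(3) jT order_trans by blast
        have a2: "\<bar>arctan (P (real j * dt (r k)) ?n) - arctan (P s x)\<bar> < \<delta>"
        proof -
          have "dist (real j * dt (r k), ?n) (s, x) \<le> \<bar>real j * dt (r k) - s\<bar> + \<bar>?n - x\<bar>"
            using norm_Pair_le[of "real j * dt (r k) - s" "?n - x"] by (simp add: dist_norm)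
          also have "\<dots> < \<rho>1" using sj x elim(1) by linarith
          finally have "dist (g (real j * dt (r k), ?n)) (g (s, x)) < \<delta>"
            using j0 jT sT x by (intro \<rho>1(2)[rule_format]) auto
          then show ?thesis by (simp add: g_def dist_real_def)
        qed
        have a3: "\<bar>deriv \<phi> \<xi> - deriv \<phi> x\<bar> < \<delta>"
          by (rule \<rho>2(2)) (use \<xi> x elim(1) node_Suc[of "r k" i] in auto)
        have a4: "\<bar>arctan (P s x)\<bar> \<le> 1" using arctan_1_lipschitz[of "P s x" 0] P_le[OF sT, of x] by simp
        have "?w * deriv \<phi> \<xi> - flux s x = (?w - arctan (P s x)) * deriv \<phi> \<xi> + arctan (P s x) * (deriv \<phi> \<xi> - deriv \<phi> x)"
          by (simp add: flux_def algebra_simps)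
        moreover have "\<bar>(?w - arctan (P s x)) * deriv \<phi> \<xi>\<bar> \<le> (2 * \<delta>) * M"
          unfolding abs_mult by (rule mult_mono) (use a1 a2 M \<delta> in auto)
        moreover have "\<bar>arctan (P s x) * (deriv \<phi> \<xi> - deriv \<phi> x)\<bar> \<le> 1 * \<delta>"
          unfolding abs_mult by (rule mult_mono) (use a3 a4 in auto)
        ultimately have "\<bar>?w * deriv \<phi> \<xi> - flux s x\<bar> \<le> (2 * \<delta>) * M + \<delta>" by linarith
        then show "\<bar>?w * ((\<phi> (node (r k) (i + 1)) - \<phi> ?n) / ?h) - flux s x\<bar> \<le> \<delta> * (2 * M + 1)"
          unfolding D by (simp add: algebra_simps)
      qed
      also have "\<dots> = \<epsilon>" using M by (simp add: \<delta>_def)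
      finally show "\<bar>dsum k j - (LINT x|torus. flux s x)\<bar> \<le> \<epsilon>" .
    qed
  qed
qed

lemma flux_integral_continuous: "continuous_on {0..T} (\<lambda>s. LINT x|torus. flux s x)"
  by (rule continuous_param_integral[OF flux_continuous])

lemma time_sum_tendsto:
  assumes t: "t \<in> {0..T}"
  shows "(\<lambda>k. \<Sum>j<index t k. dt (r k) * dsum k j) \<longlonglongrightarrow> (LINT s|lebesgue_on {0..t}. LINT x|torus. flux s x)"
proof -
  let ?F = "\<lambda>s. LINT x|torus. flux s x"
  define tk where "tk k = real (index t k) * dt (r k)" for k
  have tk: "0 \<le> tk k" "tk k \<le> t" "t < tk k + dt (r k)" for k
    using index_bounds[of t k] t dt_pos[of "r k"] by (auto simp: tk_def)
  have iF: "integrable (lebesgue_on {0..T}) ?F" by (rule integrable_on_interval_continuous[OF flux_integral_continuous])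
  have "tk \<longlonglongrightarrow> t"
  proof (rule tendsto_sandwich[where f="\<lambda>k. t - dt (r k)" and h="\<lambda>_. t"])
    show "(\<lambda>k. t - dt (r k)) \<longlonglongrightarrow> t" using tendsto_diff[OF tendsto_const[of t] dt_r] by simp
  qed (use tk in \<open>auto intro!: always_eventually simp: algebra_simps less_imp_le\<close>)
  then have 1: "(\<lambda>k. LINT s|lebesgue_on {0..tk k}. ?F s) \<longlonglongrightarrow> (LINT s|lebesgue_on {0..t}. ?F s)"
    by (intro continuous_on_tendsto_compose[OF indefinite_integral_continuous_real[OF iF]])
       (use tk t in \<open>auto intro!: always_eventually intro: order_trans\<close>)
  have 2: "(\<lambda>k. (\<Sum>j<index t k. dt (r k) * dsum k j) - (LINT s|lebesgue_on {0..tk k}. ?F s)) \<longlonglongrightarrow> 0"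
  proof (rule LIMSEQ_I)
    fix \<epsilon> :: real assume \<epsilon>: "\<epsilon> > 0"
    define \<delta> where "\<delta> = \<epsilon> / (2 * T)"
    have \<delta>: "\<delta> > 0" using \<epsilon> T by (simp add: \<delta>_def)
    have "\<forall>\<^sub>F k in sequentially. norm ((\<Sum>j<index t k. dt (r k) * dsum k j) - (LINT s|lebesgue_on {0..tk k}. ?F s) - 0) < \<epsilon>"
      using dsum_close[OF \<delta>]
    proof eventually_elim
      case (elim k)
      have i: "integrable (lebesgue_on {0..0 + real (index t k) * dt (r k)}) ?F"
        by (rule integrable_subinterval[OF iF]) (use tk[of k] t in \<open>auto simp: tk_def\<close>)
      have "\<bar>(\<Sum>j<index t k. dt (r k) * dsum k j) - (LINT s|lebesgue_on {0..0 + real (index t k) * dt (r k)}. ?F s)\<bar> \<le> real (index t k) * dt (r k) * \<delta>"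
      proof (rule riemann_sum[OF i])
        fix j s assume j: "j < index t k" "0 + real j * dt (r k) \<le> s" "s \<le> 0 + (real j + 1) * dt (r k)"
        have "(real j + 1) * dt (r k) \<le> tk k" unfolding tk_def
          using j dt_pos[of "r k"] by (intro mult_right_mono) auto
        then show "\<bar>dsum k j - ?F s\<bar> \<le> \<delta>" using elim j tk[of k] t by auto
      qed (use dt_pos[of "r k"] in simp)
      also have "\<dots> \<le> T * \<delta>" using tk[of k] t \<delta> by (intro mult_right_mono) (auto simp: tk_def)
      also have "\<dots> < \<epsilon>" using \<epsilon> T by (simp add: \<delta>_def)
      finally show ?case by (simp add: tk_def)
    qed
    then show "\<exists>no. \<forall>k\<ge>no. norm ((\<Sum>j<index t k. dt (r k) * dsum k j) - (LINT s|lebesgue_on {0..tk k}. ?F s) - 0) < \<epsilon>"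
      unfolding eventually_sequentially .
  qed
  show ?thesis using tendsto_add[OF 2 1] by simp
qed

lemma discrete_weak:
  assumes M: "\<And>x. \<bar>\<phi> x\<bar> \<le> M"
  shows "\<bar>mesh (r k) * (\<Sum>i=0..<int (2 ^ r k). exp (approx (r k) K i) * \<phi> (node (r k) i))
    - mesh (r k) * (\<Sum>i=0..<int (2 ^ r k). exp (approx (r k) 0 i) * \<phi> (node (r k) i))
    + (\<Sum>j<K. dt (r k) * dsum k j)\<bar> \<le> real K * ((dt (r k))^2 * (2 * M * B / m^2))"
proof (induction K)
  case (Suc K)
  interpret admissible_step "2 ^ r k" "mesh (r k)" m "dt (r k)" "approx (r k) K" by (rule step)
  have M0: "M \<ge> 0" using M[of 0] by linarith
  have "\<bar>mesh (r k) * (\<Sum>i=0..<int (2 ^ r k). exp (euler (dt (r k)) (mesh (r k)) (approx (r k) K) i) * \<phi> (node (r k) i))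
    - mesh (r k) * (\<Sum>i=0..<int (2 ^ r k). exp (approx (r k) K i) * \<phi> (node (r k) i))
    + dt (r k) * dsum k K\<bar> \<le> (dt (r k))^2 * (2 * M * energy (2 ^ r k) (mesh (r k)) (approx (r k) K) / m^2)"
    unfolding dsum_def by (rule euler_weak_error[where \<phi>="\<lambda>i. \<phi> (node (r k) i)"]) (auto simp only: M phi_node_per)
  also have "\<dots> \<le> (dt (r k))^2 * (2 * M * B / m^2)"
    using M0 energy_B by (intro mult_left_mono divide_right_mono) auto
  finally have A: "\<bar>mesh (r k) * (\<Sum>i=0..<int (2 ^ r k). exp (euler (dt (r k)) (mesh (r k)) (approx (r k) K) i) * \<phi> (node (r k) i))
    - mesh (r k) * (\<Sum>i=0..<int (2 ^ r k). exp (approx (r k) K i) * \<phi> (node (r k) i))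
    + dt (r k) * dsum k K\<bar> \<le> (dt (r k))^2 * (2 * M * B / m^2)" .
  have 1: "(\<Sum>j<Suc K. dt (r k) * dsum k j) = (\<Sum>j<K. dt (r k) * dsum k j) + dt (r k) * dsum k K" by simp
  have 2: "real (Suc K) * c = real K * c + c" for c by (simp add: distrib_right)
  show ?case unfolding 1 2 approx_Suc using Suc A by linarith
qed simp

text \<open>
  The one-step identities are summed over the steps up to time \<open>t\<close>. Their errors
  are of order \<open>\<tau>^2\<close> and there are \<open>t / \<tau>\<close> of them; the sums
  converge to the integrals because the slopes converge uniformly.
\<close>

theorem weak_equation:
  assumes t: "t \<in> {0..T}"
  shows "(LINT x|torus. exp (v t x) * \<phi> x) - (LINT x|torus. exp (V0 x) * \<phi> x)
     = - (LINT s|lebesgue_on {0..t}. LINT x|torus. arctan (P s x) * deriv \<phi> x)"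
proof -
  obtain M where M: "M \<ge> 0" "\<And>x. \<bar>\<phi> x\<bar> \<le> M" using phi_bounds by metis
  define Er where "Er k = mesh (r k) * (\<Sum>i=0..<int (2 ^ r k). exp (approx (r k) (index t k) i) * \<phi> (node (r k) i))
    - mesh (r k) * (\<Sum>i=0..<int (2 ^ r k). exp (approx (r k) 0 i) * \<phi> (node (r k) i))
    + (\<Sum>j<index t k. dt (r k) * dsum k j)" for k
  have i0: "index 0 k = 0" for k by (simp add: index_def)
  have "Er \<longlonglongrightarrow> (LINT x|torus. exp (v t x) * \<phi> x) - (LINT x|torus. exp (v 0 x) * \<phi> x) + (LINT s|lebesgue_on {0..t}. LINT x|torus. flux s x)"
    unfolding Er_def using mass_tendsto[of 0] T by (intro tendsto_intros mass_tendsto[OF t] time_sum_tendsto[OF t]) (simp add: i0)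
  moreover have "Er \<longlonglongrightarrow> 0"
  proof (rule Lim_null_comparison)
    show "\<forall>\<^sub>F k in sequentially. norm (Er k) \<le> T * (dt (r k) * (2 * M * B / m^2))"
    proof (intro always_eventually allI)
      fix k
      have "norm (Er k) \<le> real (index t k) * ((dt (r k))^2 * (2 * M * B / m^2))" unfolding Er_def real_norm_def by (rule discrete_weak[OF M(2)])
      also have "\<dots> = (real (index t k) * dt (r k)) * (dt (r k) * (2 * M * B / m^2))" by (simp add: power2_eq_square)
      also have "\<dots> \<le> T * (dt (r k) * (2 * M * B / m^2))"
        using index_bounds(1)[of t k] t dt_pos[of "r k"] M B0 by (intro mult_right_mono) auto
      finally show "norm (Er k) \<le> T * (dt (r k) * (2 * M * B / m^2))" .
    qed
    have "(\<lambda>k. T * (dt (r k) * (2 * M * B / m^2))) \<longlonglongrightarrow> T * (0 * (2 * M * B / m^2))" by (intro tendsto_intros dt_r)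
    then show "(\<lambda>k. T * (dt (r k) * (2 * M * B / m^2))) \<longlonglongrightarrow> 0" by simp
  qed
  ultimately have "(LINT x|torus. exp (v t x) * \<phi> x) - (LINT x|torus. exp (v 0 x) * \<phi> x) + (LINT s|lebesgue_on {0..t}. LINT x|torus. flux s x) = 0"
    by (rule LIMSEQ_unique)
  then show ?thesis by (simp add: v_initial flux_def)
qed

end

end

section \<open>Discretisation of the initial datum\<close>

lemma primitive_on_subinterval:
  assumes "primitive_on a b f g" "a \<le> c" "d \<le> b"
  shows "primitive_on c d f g"
  using assms integrable_subinterval[of a b g c d] unfolding primitive_on_def by auto

lemma taylor_left:
  assumes v: "primitive_on a b v P" and P: "primitive_on a b P P2" and ab: "a \<le> b"
  shows "v b - v a - (b - a) * P a = (LINT y|lebesgue_on {a..b}. (b - y) * P2 y)"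
proof -
  have l: "primitive_on a b (\<lambda>y. b - y) (\<lambda>_. -1)"
    by (rule primitive_on_C1) (auto intro!: derivative_eq_intros)
  have i: "integrable (lebesgue_on {a..b}) P" "integrable (lebesgue_on {a..b}) (\<lambda>y. (b - y) * P2 y)"
    by (rule primitive_on_integrable[OF v],
        rule integrable_continuous_mult[OF primitive_on_integrable[OF P]]) (intro continuous_intros)
  have "(b - b) * P b - (b - a) * P a = (LINT y|lebesgue_on {a..b}. P y * -1 + (b - y) * P2 y)"
    using primitive_onD[OF primitive_on_mult[OF l P], of a b] ab by simp
  also have "\<dots> = - (LINT y|lebesgue_on {a..b}. P y) + (LINT y|lebesgue_on {a..b}. (b - y) * P2 y)"
    using i by simp
  finally show ?thesis using primitive_onD[OF v, of a b] ab by simp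
qed

lemma taylor_right:
  assumes v: "primitive_on a b v P" and P: "primitive_on a b P P2" and ab: "a \<le> b"
  shows "(b - a) * P b - (v b - v a) = (LINT y|lebesgue_on {a..b}. (y - a) * P2 y)"
proof -
  have l: "primitive_on a b (\<lambda>y. y - a) (\<lambda>_. 1)"
    by (rule primitive_on_C1) (auto intro!: derivative_eq_intros)
  have i: "integrable (lebesgue_on {a..b}) P" "integrable (lebesgue_on {a..b}) (\<lambda>y. (y - a) * P2 y)"
    by (rule primitive_on_integrable[OF v],
        rule integrable_continuous_mult[OF primitive_on_integrable[OF P]]) (intro continuous_intros)
  have "(b - a) * P b - (a - a) * P a = (LINT y|lebesgue_on {a..b}. P y * 1 + (y - a) * P2 y)"
    using primitive_onD[OF primitive_on_mult[OF l P], of a b] ab by simp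
  also have "\<dots> = (LINT y|lebesgue_on {a..b}. P y) + (LINT y|lebesgue_on {a..b}. (y - a) * P2 y)"
    using i by simp
  finally show ?thesis using primitive_onD[OF v, of a b] ab by simp
qed

lemma kernel_Cauchy_Schwarz:
  fixes g \<kappa> :: "real => real"
  assumes g: "integrable (lebesgue_on {a..b}) g" and g2: "integrable (lebesgue_on {a..b}) (\<lambda>y. (g y)^2)"
   and k: "continuous_on {a..b} \<kappa>" "\<And>y. y \<in> {a..b} ==> \<kappa> y \<ge> 0"
  shows "(LINT y|lebesgue_on {a..b}. \<kappa> y * g y)^2 \<le> (LINT y|lebesgue_on {a..b}. \<kappa> y) * (LINT y|lebesgue_on {a..b}. \<kappa> y * (g y)^2)"
proof -
  have sq: "(sqrt (\<kappa> y))^2 = \<kappa> y" "sqrt (\<kappa> y) * (sqrt (\<kappa> y) * z) = \<kappa> y * z" if "y \<in> {a..b}" for y z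
    using k(2)[OF that] by (simp_all flip: mult.assoc)
  have c1: "(LINT y|lebesgue_on {a..b}. (sqrt (\<kappa> y))^2) = (LINT y|lebesgue_on {a..b}. \<kappa> y)"
    and c2: "(LINT y|lebesgue_on {a..b}. (sqrt (\<kappa> y) * g y)^2) = (LINT y|lebesgue_on {a..b}. \<kappa> y * (g y)^2)"
    and c3: "(LINT y|lebesgue_on {a..b}. sqrt (\<kappa> y) * (sqrt (\<kappa> y) * g y)) = (LINT y|lebesgue_on {a..b}. \<kappa> y * g y)"
    by (intro Bochner_Integration.integral_cong refl; simp add: power_mult_distrib sq)+
  have i1: "integrable (lebesgue_on {a..b}) (\<lambda>y. (sqrt (\<kappa> y))^2)"
    by (intro integrable_on_interval_continuous continuous_intros k)
  have i2: "integrable (lebesgue_on {a..b}) (\<lambda>y. (sqrt (\<kappa> y) * g y)^2)"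
  proof -
    have "continuous_on {a..b} (\<lambda>y. (sqrt (\<kappa> y))^2)" by (intro continuous_intros k)
    from integrable_continuous_mult[OF g2 this] show ?thesis by (simp only: power_mult_distrib)
  qed
  have i3: "integrable (lebesgue_on {a..b}) (\<lambda>y. sqrt (\<kappa> y) * (sqrt (\<kappa> y) * g y))"
  proof -
    have "continuous_on {a..b} (\<lambda>y. sqrt (\<kappa> y) * sqrt (\<kappa> y))" by (intro continuous_intros k)
    from integrable_continuous_mult[OF g this] show ?thesis by (simp only: mult.assoc)
  qed
  show ?thesis using lint_Cauchy_Schwarz[OF i1 i2 i3] unfolding c1 c2 c3 .
qed

lemma lint_linear_kernels:
  fixes a b :: real
  assumes "a \<le> b"
  shows "(LINT y|lebesgue_on {a..b}. b - y) = (b - a)^2 / 2" "(LINT y|lebesgue_on {a..b}. y - a) = (b - a)^2 / 2"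
proof -
  have "primitive_on a b (\<lambda>y. - ((b - y)^2) / 2) (\<lambda>y. b - y)"
    by (rule primitive_on_C1) (auto intro!: derivative_eq_intros continuous_intros simp: field_simps)
  from primitive_onD[OF this order_refl assms order_refl] show "(LINT y|lebesgue_on {a..b}. b - y) = (b - a)^2 / 2" by simp
  have "primitive_on a b (\<lambda>y. (y - a)^2 / 2) (\<lambda>y. y - a)"
    by (rule primitive_on_C1) (auto intro!: derivative_eq_intros continuous_intros simp: field_simps)
  from primitive_onD[OF this order_refl assms order_refl] show "(LINT y|lebesgue_on {a..b}. y - a) = (b - a)^2 / 2" by simp
qed

lemma weight_perturbation:
  fixes p x Q \<delta> :: real
  assumes "\<bar>p\<bar> \<le> 1/2" "\<bar>x\<bar> \<le> 1/2" "\<bar>Q\<bar> \<le> 1/2" "\<bar>p - x\<bar> \<le> \<delta>" "\<bar>Q - x\<bar> \<le> \<delta>"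
  shows "(1 + p^2) / (1 + x^2)^2 \<le> 1 / (1 + Q^2) + 4 * \<delta>"
proof -
  have sq: "z^2 \<le> 1" if "\<bar>z\<bar> \<le> 1/2" for z :: real using that by (simp add: abs_square_le_1)
  have d: "\<bar>y^2 - x^2\<bar> \<le> \<delta>" if "\<bar>y\<bar> \<le> 1/2" "\<bar>y - x\<bar> \<le> \<delta>" for y
  proof -
    have "\<bar>y^2 - x^2\<bar> = \<bar>y + x\<bar> * \<bar>y - x\<bar>" unfolding abs_mult[symmetric] by (simp add: power2_eq_square algebra_simps)
    also have "\<dots> \<le> 1 * \<delta>" using that assms(2) by (intro mult_mono) auto
    finally show ?thesis by simp
  qed
  have \<delta>0: "\<delta> \<ge> 0" using assms(4) by linarith
  have den: "1 \<le> (1 + x^2)^2 * (1 + Q^2)" by (intro mult_ge1_I) (auto simp: one_le_power)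
  have "(1 + p^2) * (1 + Q^2) - (1 + x^2)^2 = (p^2 - x^2) * (1 + Q^2) + (1 + x^2) * (Q^2 - x^2)"
    by (simp add: power2_eq_square algebra_simps)
  also have "\<dots> \<le> \<delta> * 2 + 2 * \<delta>"
  proof (rule add_mono)
    have "(p^2 - x^2) * (1 + Q^2) \<le> \<delta> * (1 + Q^2)" using d[of p] assms by (intro mult_right_mono) auto
    also have "\<dots> \<le> \<delta> * 2" using sq[of Q] assms \<delta>0 by (intro mult_left_mono) auto
    finally show "(p^2 - x^2) * (1 + Q^2) \<le> \<delta> * 2" .
    have "(1 + x^2) * (Q^2 - x^2) \<le> (1 + x^2) * \<delta>" using d[of Q] assms by (intro mult_left_mono) auto
    also have "\<dots> \<le> 2 * \<delta>" using sq[of x] assms \<delta>0 by (intro mult_right_mono) auto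
    finally show "(1 + x^2) * (Q^2 - x^2) \<le> 2 * \<delta>" .
  qed
  finally have num: "(1 + p^2) * (1 + Q^2) \<le> (1 + x^2)^2 + 4 * \<delta>" by simp
  also have "\<dots> \<le> (1 + x^2)^2 + 4 * \<delta> * ((1 + x^2)^2 * (1 + Q^2))"
    using den \<delta>0 mult_left_mono[OF den, of "4 * \<delta>"] by simp
  finally have *: "(1 + p^2) * (1 + Q^2) \<le> (1 + x^2)^2 + 4 * \<delta> * ((1 + x^2)^2 * (1 + Q^2))" .
  have "1 + x^2 > 0" and pos2: "1 + Q^2 > 0" by (simp_all add: add_pos_nonneg)
  then have pos: "(1 + x^2)^2 > 0" "1 + Q^2 > 0" using zero_less_power by blast+
  define X Y where "X = (1 + x^2)^2" "Y = 1 + Q^2"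
  have XY: "X > 0" "Y > 0" using pos by (auto simp: X_Y_def)
  have "(1 + p^2) * Y \<le> X + 4 * \<delta> * (X * Y)" using * by (simp add: X_Y_def)
  then have "(1 + p^2) / X \<le> 1 / Y + 4 * \<delta>"
    using XY by (simp add: field_simps)
  then show ?thesis by (simp add: X_Y_def)
qed

text \<open>
  The logarithm \<open>v\<close> of the initial datum, with its continuous first derivative
  \<open>P\<close> and its second derivative \<open>P2\<close> in \<open>L\<^sup>2\<close>.
\<close>

locale initial_data =
  fixes v P P2 :: "real => real" and m :: real
  assumes v: "primitive_on (-pi) pi v P" and P: "primitive_on (-pi) pi P P2" and P2: "L2_torus P2"
   and v_per: "\<And>x. v (x + 2 * pi) = v x" and P_per: "\<And>x. P (x + 2 * pi) = P x" and P_cont: "continuous_on UNIV P"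
   and P_le: "\<And>x. \<bar>P x\<bar> \<le> kappa" and m: "m > 0" and v_range: "\<And>x. m \<le> exp (v x)" "\<And>x. exp (v x) \<le> 2 * m"
begin

definition y :: "nat => int => real" where "y n i = v (node n i)"

lemma node_per: "node n (i + 2 ^ n) = node n i + 2 * pi"
  by (simp add: node_def mesh_def field_simps)

lemma y_per: "y n (i + 2 ^ n) = y n i" by (simp add: y_def node_per v_per)

lemma cell_in:
  assumes "i \<in> {0..<2 ^ n}"
  shows "-pi \<le> node n i" "node n i \<le> node n (i + 1)" "node n (i + 1) \<le> pi"
  using node_mono[of 0 i n] node_mono[of i "i + 1" n] node_mono[of "i + 1" "2 ^ n" n] assms by auto

lemma int_mod_cell: "i mod 2 ^ n \<in> {0..<2 ^ n}" for i :: int by simp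

lemma periodic_mod:
  fixes f :: "int => real"
  assumes "\<And>i. f (i + 2 ^ n) = f i"
  shows "f (i mod 2 ^ n) = f i"
proof -
  interpret pf: periodic_fun_simple f "2 ^ n" by standard (rule assms)
  have "f (i mod 2 ^ n + (i div 2 ^ n) * 2 ^ n) = f (i mod 2 ^ n)" using pf.plus_of_int[of "i mod 2 ^ n" "i div 2 ^ n"] by simp
  then show ?thesis by (simp only: mod_div_mult_eq)
qed

lemma slope_per: "slope (mesh n) (y n) (i + 2 ^ n) = slope (mesh n) (y n) i"
  using y_per[of n i] y_per[of n "i + 1"] by (simp add: slope_def algebra_simps)

lemma slope_mean:
  assumes i: "i \<in> {0..<2 ^ n}" and c: "\<And>x. node n i \<le> x ==> x \<le> node n (i + 1) ==> \<bar>P x - c\<bar> \<le> \<delta>"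
  shows "\<bar>slope (mesh n) (y n) i - c\<bar> \<le> \<delta>"
proof -
  have p: "primitive_on (node n i) (node n (i + 1)) v P"
    by (rule primitive_on_subinterval[OF v]) (use cell_in[OF i] in auto)
  have "\<bar>v (node n (i + 1)) - v (node n i) - (node n (i + 1) - node n i) * c\<bar> \<le> (node n (i + 1) - node n i) * \<delta>"
    by (rule primitive_on_bound[OF p]) (use c cell_in[OF i] in auto)
  then have "\<bar>v (node n (i + 1)) - v (node n i) - c * mesh n\<bar> \<le> \<delta> * mesh n" by (simp add: node_Suc mult.commute)
  moreover have "slope (mesh n) (y n) i - c = (v (node n (i + 1)) - v (node n i) - c * mesh n) / mesh n"
    using mesh_pos[of n] by (simp add: slope_def y_def field_simps)
  ultimately show ?thesis using mesh_pos[of n] by (simp add: abs_divide pos_divide_le_eq)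
qed

lemma slope_mean':
  assumes c: "\<And>x. node n i \<le> x ==> x \<le> node n (i + 1) ==> \<bar>P x - c\<bar> \<le> \<delta>"
  shows "\<bar>slope (mesh n) (y n) i - c\<bar> \<le> \<delta>"
proof -
  have "\<bar>slope (mesh n) (y n) (i mod 2 ^ n) - c\<bar> \<le> \<delta>"
  proof (rule slope_mean[OF int_mod_cell])
    fix x assume x: "node n (i mod 2 ^ n) \<le> x" "x \<le> node n (i mod 2 ^ n + 1)"
    define k where "k = i div 2 ^ n"
    have i: "i = i mod 2 ^ n + k * 2 ^ n" unfolding k_def by (rule mod_div_mult_eq[symmetric])
    have nd: "node n (j + k * 2 ^ n) = node n j + of_int k * (2 * pi)" for j
      by (simp add: node_def mesh_def field_simps)
    interpret pf: periodic_fun_simple P "2 * pi" by standard (rule P_per)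
    have "P (x + of_int k * (2 * pi)) = P x" by (rule pf.plus_of_int)
    moreover have "\<bar>P (x + of_int k * (2 * pi)) - c\<bar> \<le> \<delta>"
    proof (rule c)
      show "node n i \<le> x + of_int k * (2 * pi)" using x(1) nd[of "i mod 2 ^ n"] i by simp
      have "node n (i + 1) = node n (i mod 2 ^ n + 1) + of_int k * (2 * pi)"
        using nd[of "i mod 2 ^ n + 1"] i by (metis add.assoc add.commute)
      then show "x + of_int k * (2 * pi) \<le> node n (i + 1)" using x(2) by simp
    qed
    ultimately show "\<bar>P x - c\<bar> \<le> \<delta>" by simp
  qed
  then show ?thesis using periodic_mod[of "slope (mesh n) (y n)" n i, OF slope_per] by simp
qed

lemma slope_le: "\<bar>slope (mesh n) (y n) i\<bar> \<le> kappa"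
  using slope_mean'[of n i 0 kappa] P_le by simp

lemma y_admissible: "admissible (2 ^ n) (mesh n) m (y n)"
  unfolding admissible_def using y_per slope_le v_range by (auto simp: y_def)

definition data_energy :: real where
  "data_energy = (LINT x|torus. exp (v x) / (1 + (P x)^2) * (P2 x)^2)"

text \<open>
  Taylor remainders of \<open>v\<close> over a cell, expanded at its left and at its right end.
  They are the integrals of \<open>P2\<close> against the two linear kernels on the cell, and
  the second differences of \<open>v\<close> are sums of two of them
  (\<open>slope_diff\<close>).
\<close>

definition A :: "nat => int => real" where "A n i = v (node n (i + 1)) - v (node n i) - mesh n * P (node n i)"
definition B :: "nat => int => real" where "B n i = mesh n * P (node n (i + 1)) - (v (node n (i + 1)) - v (node n i))"

lemma slope_diff: "slope (mesh n) (y n) i - slope (mesh n) (y n) (i - 1) = (A n i + B n (i - 1)) / mesh n"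
  using mesh_pos[of n] by (simp add: slope_def y_def A_def B_def field_simps)

lemma AB_per: "A n (i + 2 ^ n) = A n i" "B n (i + 2 ^ n) = B n i"
proof -
  have "i + 2 ^ n + 1 = i + 1 + 2 ^ n" by simp
  then show "A n (i + 2 ^ n) = A n i" "B n (i + 2 ^ n) = B n i" by (simp_all only: A_def B_def node_per v_per P_per)
qed

lemma P2_sub:
  assumes i: "i \<in> {0..<2 ^ n}"
  shows "integrable (lebesgue_on {node n i..node n (i + 1)}) P2" "integrable (lebesgue_on {node n i..node n (i + 1)}) (\<lambda>x. (P2 x)^2)"
  using L2_torus_integrable[OF P2] P2 cell_in[OF i]
  by (auto intro!: integrable_subinterval[of "-pi" pi] simp: L2_torus_def)

lemma A_sq: "i \<in> {0..<2 ^ n} ==> 2 * (A n i)^2 \<le> (mesh n)^2 * (LINT x|lebesgue_on {node n i..node n (i + 1)}. (node n (i + 1) - x) * (P2 x)^2)"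
  and B_sq: "i \<in> {0..<2 ^ n} ==> 2 * (B n i)^2 \<le> (mesh n)^2 * (LINT x|lebesgue_on {node n i..node n (i + 1)}. (x - node n i) * (P2 x)^2)"
proof -
  assume i: "i \<in> {0..<2 ^ n}"
  note c = cell_in[OF i]
  have pv: "primitive_on (node n i) (node n (i + 1)) v P" and pP: "primitive_on (node n i) (node n (i + 1)) P P2"
    by (rule primitive_on_subinterval[OF v] primitive_on_subinterval[OF P]; use c in simp)+
  have len: "node n (i + 1) - node n i = mesh n" by (simp add: node_Suc)
  have "A n i = (LINT x|lebesgue_on {node n i..node n (i + 1)}. (node n (i + 1) - x) * P2 x)"
    using taylor_left[OF pv pP c(2)] unfolding len A_def .
  then have "(A n i)^2 \<le> (LINT x|lebesgue_on {node n i..node n (i + 1)}. node n (i + 1) - x) * (LINT x|lebesgue_on {node n i..node n (i + 1)}. (node n (i + 1) - x) * (P2 x)^2)"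
    using kernel_Cauchy_Schwarz[OF P2_sub[OF i], of "\<lambda>x. node n (i + 1) - x"] by (simp add: continuous_intros)
  then show "2 * (A n i)^2 \<le> (mesh n)^2 * (LINT x|lebesgue_on {node n i..node n (i + 1)}. (node n (i + 1) - x) * (P2 x)^2)"
    unfolding lint_linear_kernels[OF c(2)] len by simp
  have "B n i = (LINT x|lebesgue_on {node n i..node n (i + 1)}. (x - node n i) * P2 x)"
    using taylor_right[OF pv pP c(2)] unfolding len B_def .
  then have "(B n i)^2 \<le> (LINT x|lebesgue_on {node n i..node n (i + 1)}. x - node n i) * (LINT x|lebesgue_on {node n i..node n (i + 1)}. (x - node n i) * (P2 x)^2)"
    using kernel_Cauchy_Schwarz[OF P2_sub[OF i], of "\<lambda>x. x - node n i"] by (simp add: continuous_intros)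
  then show "2 * (B n i)^2 \<le> (mesh n)^2 * (LINT x|lebesgue_on {node n i..node n (i + 1)}. (x - node n i) * (P2 x)^2)"
    unfolding lint_linear_kernels[OF c(2)] len by simp
qed

text \<open>
  The ratio of the weighted squares of the angle differences in the energy to the squares of the
  slope differences, with its limiting value where the latter vanish; the mean value theorem for
  the arctangent puts it close to \<open>exp v / (1 + P^2)\<close>.
\<close>

definition \<sigma> :: "nat => int => real" where
  "\<sigma> n i = exp (y n i) * (1 + (slope (mesh n) (y n) i)^2) *
     (if slope (mesh n) (y n) i = slope (mesh n) (y n) (i - 1) then 1 / (1 + (slope (mesh n) (y n) i)^2)
      else (angle (mesh n) (y n) i - angle (mesh n) (y n) (i - 1)) / (slope (mesh n) (y n) i - slope (mesh n) (y n) (i - 1)))^2"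

lemma sigma_per: "\<sigma> n (i + 2 ^ n) = \<sigma> n i"
  using slope_per[of n i] slope_per[of n "i - 1"] y_per[of n i]
  by (simp add: \<sigma>_def angle_def algebra_simps)

lemma sigma_nonneg: "\<sigma> n i \<ge> 0" by (simp add: \<sigma>_def)

lemma energy_term: "exp (y n i) * (1 + (slope (mesh n) (y n) i)^2) * (angle_diff (mesh n) (y n) i)^2 = \<sigma> n i * ((A n i + B n (i - 1)) / (mesh n)^2)^2"
proof -
  have e: "(A n i + B n (i - 1)) / (mesh n)^2 = (slope (mesh n) (y n) i - slope (mesh n) (y n) (i - 1)) / mesh n"
    unfolding slope_diff by (simp add: power2_eq_square)
  show ?thesis unfolding e angle_diff_def \<sigma>_def
    by (auto simp: angle_def power_divide power_mult_distrib)
qed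

lemma sigma_le:
  assumes "\<bar>slope (mesh n) (y n) i - Q\<bar> \<le> \<delta>" "\<bar>slope (mesh n) (y n) (i - 1) - Q\<bar> \<le> \<delta>" "\<bar>Q\<bar> \<le> kappa" "\<bar>y n i - z\<bar> \<le> \<delta>" "exp z \<le> 2 * m"
  shows "\<sigma> n i \<le> exp z / (1 + Q^2) + 20 * m * \<delta>"
proof -
  let ?p = "slope (mesh n) (y n) i" and ?p' = "slope (mesh n) (y n) (i - 1)"
  obtain \<xi> where \<xi>: "min ?p ?p' \<le> \<xi>" "\<xi> \<le> max ?p ?p'" "arctan ?p - arctan ?p' = (?p - ?p') / (1 + \<xi>^2)"
    by (rule arctan_mvt)
  have \<xi>': "\<bar>\<xi>\<bar> \<le> kappa" "\<bar>Q - \<xi>\<bar> \<le> \<delta>" "\<bar>?p - \<xi>\<bar> \<le> 2 * \<delta>"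
    using \<xi> assms slope_le[of n i] slope_le[of n "i - 1"] by (auto simp: min_def max_def abs_le_iff split: if_splits)
  have \<delta>0: "\<delta> \<ge> 0" using assms(1) by linarith
  have c: "(if ?p = ?p' then 1 / (1 + ?p^2) else (angle (mesh n) (y n) i - angle (mesh n) (y n) (i - 1)) / (?p - ?p')) = 1 / (1 + \<xi>^2)"
    using \<xi> by (auto simp: angle_def)
  have s: "\<sigma> n i = exp (y n i) * ((1 + ?p^2) / (1 + \<xi>^2)^2)"
    unfolding \<sigma>_def c by (simp add: power_divide)
  have w: "(1 + ?p^2) / (1 + \<xi>^2)^2 \<le> 1 / (1 + Q^2) + 4 * (2 * \<delta>)"
    by (rule weight_perturbation) (use \<xi>' assms slope_le[of n i] \<delta>0 in auto)
  have ey: "exp (y n i) \<le> 2 * m" by (simp add: y_def v_range)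
  have "exp (y n i) * ((1 + ?p^2) / (1 + \<xi>^2)^2) \<le> exp (y n i) * (1 / (1 + Q^2) + 4 * (2 * \<delta>))"
    using w by (intro mult_left_mono) auto
  also have "\<dots> = exp (y n i) * (1 / (1 + Q^2)) + exp (y n i) * (8 * \<delta>)" by (simp add: algebra_simps)
  also have "\<dots> \<le> (exp z + 2 * m * \<delta>) * (1 / (1 + Q^2)) + 2 * m * (8 * \<delta>)"
  proof (intro add_mono mult_right_mono)
    have "\<bar>exp (y n i) - exp z\<bar> \<le> 2 * m * \<bar>y n i - z\<bar>" by (rule exp_diff_bound[OF ey assms(5)])
    also have "\<dots> \<le> 2 * m * \<delta>" using assms m by (intro mult_left_mono) auto
    finally show "exp (y n i) \<le> exp z + 2 * m * \<delta>" by linarith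
  qed (use ey \<delta>0 in auto)
  also have "\<dots> \<le> exp z / (1 + Q^2) + 2 * m * \<delta> * 1 + 2 * m * (8 * \<delta>)"
  proof -
    have "1 / (1 + Q^2) \<le> 1" by (simp add: add_pos_nonneg)
    then have "2 * m * \<delta> * (1 / (1 + Q^2)) \<le> 2 * m * \<delta> * 1" using m \<delta>0 by (intro mult_left_mono) auto
    then show ?thesis by (simp add: distrib_right add_divide_distrib mult_ac)
  qed
  also have "\<dots> \<le> exp z / (1 + Q^2) + 20 * m * \<delta>" using m \<delta>0 by simp
  finally show ?thesis unfolding s .
qed

text \<open>
  The discrete energy is a weighted sum of squares of second differences \<open>A n i + B n (i -
  1)\<close>. After \<open>(a + b)^2 \<le> 2 a^2 + 2 b^2\<close> and the Cauchy-Schwarz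
  inequalities \<open>A_sq\<close> and \<open>B_sq\<close> the two linear kernels on each cell
  add up to the constant mesh, so no factor is lost, and the weight is within \<open>20 m
  \<delta>\<close> of its limit.
\<close>

theorem energy_limsup:
  assumes \<epsilon>: "\<epsilon> > 0"
  shows "\<forall>\<^sub>F n in sequentially. energy (2 ^ n) (mesh n) (y n) \<le> data_energy + \<epsilon>"
proof -
  define S where "S = (LINT x|torus. (P2 x)^2)"
  have S0: "S \<ge> 0" unfolding S_def by (intro Bochner_Integration.integral_nonneg) auto
  define \<delta> where "\<delta> = \<epsilon> / (20 * m * (S + 1))"
  have \<delta>: "\<delta> > 0" using \<epsilon> m S0 by (simp add: \<delta>_def)
  have vc: "continuous_on {-pi..pi} v" by (rule primitive_on_continuous[OF v])
  obtain \<rho> where \<rho>: "\<rho> > 0" "\<And>a b. a \<in> {-4*pi..4*pi} ==> b \<in> {-4*pi..4*pi} ==> \<bar>b - a\<bar> < \<rho> ==> \<bar>P b - P a\<bar> < \<delta>"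
    using compact_uniformly_continuous[OF continuous_on_subset[OF P_cont] compact_Icc[of "-4*pi" "4*pi"]] \<delta>
    unfolding uniformly_continuous_on_def dist_real_def by (metis subset_UNIV)
  obtain \<rho>' where \<rho>': "\<rho>' > 0" "\<And>a b. a \<in> {-pi..pi} ==> b \<in> {-pi..pi} ==> \<bar>b - a\<bar> < \<rho>' ==> \<bar>v b - v a\<bar> < \<delta>"
    using compact_uniformly_continuous[OF vc compact_Icc] \<delta>
    unfolding uniformly_continuous_on_def dist_real_def by metis
  have "\<forall>\<^sub>F n in sequentially. mesh n < min (\<rho> / 2) \<rho>'"
    by (rule order_tendstoD(2)[OF mesh_tendsto]) (use \<rho> \<rho>' in simp)
  then show ?thesis
  proof eventually_elim
    case (elim n)
    let ?h = "mesh n" and ?I = "{0..<2 ^ n} :: int set"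
    have h: "?h > 0" by (rule mesh_pos)
    have hpi: "?h \<le> 2 * pi"
    proof -
      have "mesh n \<le> 2 * pi / 1" unfolding mesh_def by (intro divide_left_mono) auto
      then show ?thesis by simp
    qed
    define a where "a x = exp (v x) / (1 + (P x)^2)" for x
    define b where "b x = a x + 20 * m * \<delta>" for x
    have bc: "continuous_on {-pi..pi} b" unfolding b_def[abs_def] a_def
      by (intro continuous_intros vc continuous_on_subset[OF P_cont]) (auto simp: add_nonneg_eq_0_iff)
    have key: "\<sigma> n j \<le> b x" if i: "i \<in> ?I" and x: "node n i \<le> x" "x \<le> node n (i + 1)" and j: "j = i \<or> j = i + 1" for i j x
      unfolding a_def b_def
    proof (rule sigma_le)
      note c = cell_in[OF i]
      have P: "\<bar>P z - P x\<bar> \<le> \<delta>" if "node n (i - 1) \<le> z" "z \<le> node n (i + 2)" for z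
      proof (rule less_imp_le, rule \<rho>(2))
        have "node n (i - 1) = node n i - ?h" "node n (i + 2) = node n (i + 1) + ?h" "node n (i + 1) = node n i + ?h"
          by (simp_all add: node_def algebra_simps)
        then show "x \<in> {-4*pi..4*pi}" "z \<in> {-4*pi..4*pi}" "\<bar>z - x\<bar> < \<rho>"
          using c x that hpi elim h by (auto simp: abs_less_iff)
      qed
      have s: "\<bar>slope ?h (y n) l - P x\<bar> \<le> \<delta>" if "i - 1 \<le> l" "l \<le> i + 1" for l
      proof (rule slope_mean')
        fix z assume z: "node n l \<le> z" "z \<le> node n (l + 1)"
        show "\<bar>P z - P x\<bar> \<le> \<delta>"
          by (rule P) (use z node_mono[of "i - 1" l n] node_mono[of "l + 1" "i + 2" n] that in linarith)+
      qed
      show "\<bar>slope ?h (y n) j - P x\<bar> \<le> \<delta>" "\<bar>slope ?h (y n) (j - 1) - P x\<bar> \<le> \<delta>" using s j by auto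
      show "\<bar>y n j - v x\<bar> \<le> \<delta>" unfolding y_def
        by (rule less_imp_le, rule \<rho>'(2)) (use c x j elim node_Suc[of n i] in auto)
    qed (use P_le v_range in auto)
    have "energy (2 ^ n) ?h (y n) = ?h * (\<Sum>i\<in>?I. \<sigma> n i * ((A n i + B n (i - 1)) / ?h^2)^2)"
      by (simp add: energy_def energy_term)
    also have "\<dots> \<le> ?h * (\<Sum>i\<in>?I. \<sigma> n i * (2 * (A n i)^2) / ?h ^ 4 + \<sigma> n i * (2 * (B n (i - 1))^2) / ?h ^ 4)"
    proof (intro mult_left_mono sum_mono)
      fix i
      have "((A n i + B n (i - 1)) / ?h^2)^2 = (A n i + B n (i - 1))^2 / ?h ^ 4" by (simp add: power_divide flip: power_mult)
      also have "\<dots> \<le> (2 * (A n i)^2 + 2 * (B n (i - 1))^2) / ?h ^ 4"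
        using zero_le_power2[of "A n i - B n (i - 1)"] by (intro divide_right_mono) (auto simp: power2_eq_square algebra_simps)
      finally have "\<sigma> n i * ((A n i + B n (i - 1)) / ?h^2)^2 \<le> \<sigma> n i * ((2 * (A n i)^2 + 2 * (B n (i - 1))^2) / ?h ^ 4)"
        by (rule mult_left_mono[OF _ sigma_nonneg])
      then show "\<sigma> n i * ((A n i + B n (i - 1)) / ?h^2)^2 \<le> \<sigma> n i * (2 * (A n i)^2) / ?h ^ 4 + \<sigma> n i * (2 * (B n (i - 1))^2) / ?h ^ 4"
        by (simp add: add_divide_distrib distrib_left)
    qed (use h in simp)
    also have "\<dots> = ?h * ((\<Sum>i\<in>?I. \<sigma> n i * (2 * (A n i)^2) / ?h ^ 4) + (\<Sum>i\<in>?I. \<sigma> n i * (2 * (B n (i - 1))^2) / ?h ^ 4))"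
      by (simp only: sum.distrib)
    also have "(\<Sum>i\<in>?I. \<sigma> n i * (2 * (B n (i - 1))^2) / ?h ^ 4) = (\<Sum>i\<in>?I. \<sigma> n (i + 1) * (2 * (B n i)^2) / ?h ^ 4)"
    proof -
      have "\<sigma> n (i + 2 ^ n + 1) = \<sigma> n (i + 1)" for i using sigma_per[of n "i + 1"] by (simp add: algebra_simps)
      then show ?thesis
        using period_sum_shift_back[of "\<lambda>i. \<sigma> n (i + 1) * (2 * (B n i)^2) / ?h ^ 4" "2 ^ n"] AB_per by simp
    qed
    also have "?h * ((\<Sum>i\<in>?I. \<sigma> n i * (2 * (A n i)^2) / ?h ^ 4) + (\<Sum>i\<in>?I. \<sigma> n (i + 1) * (2 * (B n i)^2) / ?h ^ 4))
       = (\<Sum>i\<in>?I. (\<sigma> n i * (2 * (A n i)^2) + \<sigma> n (i + 1) * (2 * (B n i)^2)) / ?h ^ 3)"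
      unfolding sum.distrib[symmetric] sum_distrib_left
      using h by (intro sum.cong) (auto simp: power4_eq_xxxx power3_eq_cube field_simps)
    also have "\<dots> \<le> (\<Sum>i\<in>?I. LINT x|lebesgue_on {node n i..node n (i + 1)}. b x * (P2 x)^2)"
    proof (rule sum_mono)
      fix i assume i: "i \<in> ?I"
      let ?C = "lebesgue_on {node n i..node n (i + 1)}"
      note c = cell_in[OF i]
      have I: "integrable ?C (\<lambda>x. k x * b x * (P2 x)^2)" "integrable ?C (\<lambda>x. k x * (P2 x)^2)"
        if "continuous_on {node n i..node n (i + 1)} k" for k
        using c by (intro integrable_continuous_mult[OF P2_sub(2)[OF i]] continuous_on_mult that continuous_on_subset[OF bc]; auto)+
      have t: "s * (2 * X) \<le> ?h^2 * (LINT x|?C. k x * b x * (P2 x)^2)"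
        if X: "2 * X \<le> ?h^2 * (LINT x|?C. k x * (P2 x)^2)" and s: "0 \<le> s" and k: "continuous_on {node n i..node n (i + 1)} k"
          and le: "\<And>x. node n i \<le> x ==> x \<le> node n (i + 1) ==> 0 \<le> k x \<and> s \<le> b x" for s X k
      proof -
        have "s * (2 * X) \<le> s * (?h^2 * (LINT x|?C. k x * (P2 x)^2))" by (rule mult_left_mono[OF X s])
        also have "\<dots> = ?h^2 * (LINT x|?C. s * (k x * (P2 x)^2))" by simp
        also have "\<dots> \<le> ?h^2 * (LINT x|?C. k x * b x * (P2 x)^2)"
        proof (rule mult_left_mono, rule integral_mono)
          fix x assume "x \<in> space ?C"
          then have "s * (k x * (P2 x)^2) \<le> b x * (k x * (P2 x)^2)" using le[of x] by (intro mult_right_mono) auto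
          then show "s * (k x * (P2 x)^2) \<le> k x * b x * (P2 x)^2" by (simp add: mult_ac)
        qed (use I[OF k] in auto)
        finally show ?thesis .
      qed
      have k1: "continuous_on {node n i..node n (i + 1)} (\<lambda>x. node n (i + 1) - x)"
        and k2: "continuous_on {node n i..node n (i + 1)} (\<lambda>x. x - node n i)"
        by (intro continuous_intros)+
      note I1 = I(1)[OF k1] and I2 = I(1)[OF k2]
      have t1: "\<sigma> n i * (2 * (A n i)^2) \<le> ?h^2 * (LINT x|?C. (node n (i + 1) - x) * b x * (P2 x)^2)"
        by (rule t[OF A_sq[OF i] sigma_nonneg k1]) (use key[OF i, of _ i] in auto)
      have t2: "\<sigma> n (i + 1) * (2 * (B n i)^2) \<le> ?h^2 * (LINT x|?C. (x - node n i) * b x * (P2 x)^2)"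
        by (rule t[OF B_sq[OF i] sigma_nonneg k2]) (use key[OF i, of _ "i + 1"] in auto)
      have "(LINT x|?C. (node n (i + 1) - x) * b x * (P2 x)^2) + (LINT x|?C. (x - node n i) * b x * (P2 x)^2)
         = (LINT x|?C. ?h * (b x * (P2 x)^2))"
        unfolding Bochner_Integration.integral_add[OF I1 I2, symmetric]
      proof (intro Bochner_Integration.integral_cong refl)
        fix x
        have "(node n (i + 1) - x) + (x - node n i) = ?h" by (simp only: node_Suc)
        then show "(node n (i + 1) - x) * b x * (P2 x)^2 + (x - node n i) * b x * (P2 x)^2
            = ?h * (b x * (P2 x)^2)"
          by (simp only: mult.assoc distrib_right[symmetric])
      qed
      also have "\<dots> = ?h * (LINT x|?C. b x * (P2 x)^2)" by simp
      finally have "\<sigma> n i * (2 * (A n i)^2) + \<sigma> n (i + 1) * (2 * (B n i)^2) \<le> ?h^2 * (?h * (LINT x|?C. b x * (P2 x)^2))"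
        using add_mono[OF t1 t2] by (simp only: distrib_left[symmetric])
      then show "(\<sigma> n i * (2 * (A n i)^2) + \<sigma> n (i + 1) * (2 * (B n i)^2)) / ?h ^ 3 \<le> (LINT x|?C. b x * (P2 x)^2)"
        using h by (simp add: pos_divide_le_eq power2_eq_square power3_eq_cube mult_ac)
    qed
    also have "\<dots> = (LINT x|torus. b x * (P2 x)^2)"
    proof -
      from integrable_continuous_mult[OF _ bc, of "\<lambda>x. (P2 x)^2"] P2
      have "integrable torus (\<lambda>x. b x * (P2 x)^2)" by (simp add: L2_torus_def)
      then show ?thesis using lint_split_nodes[of n 0 "2 ^ n" "\<lambda>x. b x * (P2 x)^2"] by simp
    qed
    also have "\<dots> = data_energy + 20 * m * \<delta> * S"
    proof -
      have ac: "continuous_on {-pi..pi} a" unfolding a_def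
        by (intro continuous_intros vc continuous_on_subset[OF P_cont]) (auto simp: add_nonneg_eq_0_iff)
      have i2: "integrable torus (\<lambda>x. (P2 x)^2)" using P2 by (simp add: L2_torus_def)
      have i1: "integrable torus (\<lambda>x. a x * (P2 x)^2)" by (rule integrable_continuous_mult[OF i2 ac])
      have "(LINT x|torus. b x * (P2 x)^2) = (LINT x|torus. a x * (P2 x)^2 + 20 * m * \<delta> * (P2 x)^2)"
        by (simp add: b_def distrib_right)
      also have "\<dots> = data_energy + 20 * m * \<delta> * S" using i1 i2 by (simp add: data_energy_def a_def S_def)
      finally show ?thesis .
    qed
    also have "\<dots> \<le> data_energy + \<epsilon>"
    proof -
      have "20 * m * \<delta> * S \<le> 20 * m * \<delta> * (S + 1)" using m \<delta> by (intro mult_left_mono) auto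
      also have "\<dots> = \<epsilon>" using m S0 by (simp add: \<delta>_def)
      finally show ?thesis by simp
    qed
    finally show ?case .
  qed
qed

end

section \<open>The energy inequality for weak evolutions\<close>

lemma gronwall_zero:
  fixes y :: "real => real"
  assumes y: "continuous_on {0..T} y" and nonneg: "\<And>t. t \<in> {0..T} ==> 0 \<le> y t"
    and le: "\<And>t. t \<in> {0..T} ==> y t \<le> C * (LINT s|lebesgue_on {0..t}. y s)" and C: "C \<ge> 0" and t: "t \<in> {0..T}"
  shows "y t = 0"
proof -
  define Y where "Y = (\<lambda>t. 0 + (LINT s|lebesgue_on {0..t}. y s))"
  have pY: "primitive_on 0 T Y y" unfolding Y_def
    by (intro primitive_on_indefinite integrable_on_interval_continuous y)
  have pE: "primitive_on 0 T (\<lambda>t. exp (- C * t)) (\<lambda>t. - C * exp (- C * t))"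
    by (rule primitive_on_C1) (auto intro!: derivative_eq_intros continuous_intros)
  note pF = primitive_on_mult[OF pE pY]
  have "exp (- C * t) * Y t - exp (- C * 0) * Y 0 = (LINT s|lebesgue_on {0..t}. Y s * (- C * exp (- C * s)) + exp (- C * s) * y s)"
    by (rule primitive_onD[OF pF]) (use t in auto)
  also have "\<dots> \<le> (LINT s|lebesgue_on {0..t}. 0)"
  proof (rule integral_mono)
    show "integrable (lebesgue_on {0..t}) (\<lambda>s. Y s * (- C * exp (- C * s)) + exp (- C * s) * y s)"
      by (rule integrable_subinterval[OF primitive_on_integrable[OF pF]]) (use t in auto)
    fix s assume "s \<in> space (lebesgue_on {0..t})"
    then have "s \<in> {0..T}" using t by auto
    then have "y s \<le> C * Y s" using le[of s] by (simp add: Y_def)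
    then have "exp (- C * s) * y s \<le> exp (- C * s) * (C * Y s)" by (intro mult_left_mono) auto
    then show "Y s * (- C * exp (- C * s)) + exp (- C * s) * y s \<le> 0" by (simp add: mult_ac)
  qed simp
  finally have "exp (- C * t) * Y t \<le> exp (- C * 0) * Y 0" by simp
  moreover have "Y 0 = 0"
  proof -
    have "Y 0 - Y 0 = (LINT s|lebesgue_on {0..0}. y s)" by (rule primitive_onD[OF pY]) (use t in auto)
    then show ?thesis by (simp add: Y_def)
  qed
  ultimately have "Y t \<le> 0" by (simp add: mult_le_0_iff)
  then have "C * Y t \<le> 0" using C by (simp add: mult_nonneg_nonpos)
  then show ?thesis using le[OF t] nonneg[OF t] by (simp add: Y_def)
qed

lemma lint_mult_fourier_sum_tendsto:
  assumes f: "L2_torus f" and g: "L2_torus g"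
  shows "(\<lambda>n. LINT x|torus. f x * fourier_sum n g x) \<longlonglongrightarrow> (LINT x|torus. f x * g x)"
proof -
  have Lf: "L2_torus (fourier_sum n g)" for n unfolding fourier_sum_def by (rule L2_torus_trig_sum)
  have "(\<lambda>n. (LINT x|torus. f x * fourier_sum n g x) - (LINT x|torus. f x * g x)) \<longlonglongrightarrow> 0"
  proof (rule Lim_null_comparison)
    show "\<forall>\<^sub>F n in sequentially. norm ((LINT x|torus. f x * fourier_sum n g x) - (LINT x|torus. f x * g x))
       \<le> sqrt ((LINT x|torus. (f x)^2) * (LINT x|torus. (g x - fourier_sum n g x)^2))"
    proof (intro always_eventually allI)
      fix n
      have Ld: "L2_torus (\<lambda>x. g x - fourier_sum n g x)" by (rule L2_torus_diff[OF g Lf])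
      have "(LINT x|torus. f x * (g x - fourier_sum n g x)) = (LINT x|torus. f x * g x) - (LINT x|torus. f x * fourier_sum n g x)"
        using L2_torus_mult[OF f g] L2_torus_mult[OF f Lf] by (simp add: right_diff_distrib)
      moreover have "(LINT x|torus. f x * (g x - fourier_sum n g x))^2 \<le> (LINT x|torus. (f x)^2) * (LINT x|torus. (g x - fourier_sum n g x)^2)"
        using f Ld L2_torus_mult[OF f Ld] by (intro lint_Cauchy_Schwarz) (auto simp: L2_torus_def)
      then have "\<bar>LINT x|torus. f x * (g x - fourier_sum n g x)\<bar> \<le> sqrt ((LINT x|torus. (f x)^2) * (LINT x|torus. (g x - fourier_sum n g x)^2))"
        by (rule real_le_rsqrt[of "\<bar>_\<bar>", simplified])
      ultimately show "norm ((LINT x|torus. f x * fourier_sum n g x) - (LINT x|torus. f x * g x))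
       \<le> sqrt ((LINT x|torus. (f x)^2) * (LINT x|torus. (g x - fourier_sum n g x)^2))" by (simp add: abs_minus_commute)
    qed
    have "(\<lambda>n. sqrt ((LINT x|torus. (f x)^2) * (LINT x|torus. (g x - fourier_sum n g x)^2))) \<longlonglongrightarrow> sqrt ((LINT x|torus. (f x)^2) * 0)"
      by (intro tendsto_intros fourier_sum_tendsto g)
    then show "(\<lambda>n. sqrt ((LINT x|torus. (f x)^2) * (LINT x|torus. (g x - fourier_sum n g x)^2))) \<longlonglongrightarrow> 0" by simp
  qed
  then show ?thesis by (rule LIM_zero_cancel)
qed

lemma continuous_slice:
  assumes "continuous_on ({0..T} \<times> S) (\<lambda>(t, x). f t x)" "t \<in> {0..T}"
  shows "continuous_on S (f t)"
proof -
  have "continuous_on S (\<lambda>x. (\<lambda>(t, x). f t x) (t, x))"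
    by (rule continuous_on_compose2[OF assms(1)]) (use assms(2) in \<open>auto intro!: continuous_intros\<close>)
  then show ?thesis by simp
qed

text \<open>
  The equation \<open>z\<^sub>t = \<gamma>\<^sub>x\<close> in the sense of distributions, for a
  bounded flux \<open>\<gamma>\<close> and for \<open>z\<close> with a weak space derivative
  \<open>zx\<close>, square integrable in space and time.
\<close>

locale weak_evolution =
  fixes T C :: real and z zx \<gamma> :: "real => real => real" and \<omega> :: "real => real"
  assumes T: "T > 0" and z: "continuous_on ({0..T} \<times> {-pi..pi}) (\<lambda>(t, x). z t x)"
    and zx: "AE s in lebesgue_on {0..T}. L2_torus (zx s) \<and> has_weak_deriv 1 (z s) (zx s) \<and> (LINT x|torus. (zx s x)^2) \<le> \<omega> s"
    and \<omega>: "integrable (lebesgue_on {0..T}) \<omega>"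
    and \<gamma>: "AE s in lebesgue_on {0..T}. \<gamma> s \<in> borel_measurable torus" and \<gamma>_le: "\<And>s x. \<bar>\<gamma> s x\<bar> \<le> C"
    and \<gamma>_meas: "\<And>\<phi>. test_fun \<phi> ==> (\<lambda>s. LINT x|torus. \<gamma> s x * \<phi> x) \<in> borel_measurable (lebesgue_on {0..T})"
    and weak: "\<And>t \<phi>. t \<in> {0..T} ==> test_fun \<phi> ==> (LINT x|torus. z t x * \<phi> x) - (LINT x|torus. z 0 x * \<phi> x)
          = - (LINT s|lebesgue_on {0..t}. LINT x|torus. \<gamma> s x * deriv \<phi> x)"
begin

lemma z_slice: "t \<in> {0..T} ==> continuous_on {-pi..pi} (z t)"
  by (rule continuous_slice[OF z])

lemma z_L2: "t \<in> {0..T} ==> L2_torus (z t)"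
  by (rule L2_torus_continuous[OF z_slice])

lemma pairing_integrable:
  assumes "test_fun \<phi>"
  shows "integrable (lebesgue_on {0..T}) (\<lambda>s. LINT x|torus. \<gamma> s x * \<phi> x)"
proof -
  obtain M where M: "M \<ge> 0" "\<And>x. x \<in> {-pi..pi} ==> \<bar>\<phi> x\<bar> \<le> M"
    using bounded_on_Icc[OF test_fun_continuous[OF assms]] by blast
  have C0: "C \<ge> 0" using \<gamma>_le[of 0 0] by linarith
  have "\<bar>LINT x|torus. \<gamma> s x * \<phi> x\<bar> \<le> 2 * pi * (C * M)" for s
    by (rule abs_lint_torus_le) (unfold abs_mult, intro mult_mono \<gamma>_le M abs_ge_zero C0)
  then have "integrable (lebesgue_on {0..T}) (\<lambda>s. (LINT x|torus. \<gamma> s x * \<phi> x) * 1)"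
    by (intro integrable_bounded_mult[OF integrable_on_interval_continuous \<gamma>_meas[OF assms], where B="2 * pi * (C * M)"]) auto
  then show ?thesis by simp
qed

lemma pairing_primitive:
  assumes "test_fun \<phi>"
  shows "primitive_on 0 T (\<lambda>t. LINT x|torus. z t x * \<phi> x) (\<lambda>s. - (LINT x|torus. \<gamma> s x * deriv \<phi> x))"
proof -
  have i: "integrable (lebesgue_on {0..T}) (\<lambda>s. - (LINT x|torus. \<gamma> s x * deriv \<phi> x))"
    using pairing_integrable[OF test_fun_deriv[OF assms]] by simp
  show ?thesis
    by (rule primitive_on_cong[OF primitive_on_indefinite[OF i, of "LINT x|torus. z 0 x * \<phi> x"]])
       (use weak[OF _ assms] in \<open>simp add: algebra_simps\<close>)
qed

definition a where "a k t = fourier_cos (z t) k"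
definition b where "b k t = fourier_sin (z t) k"
definition a' where "a' k s = real k * fourier_sin (\<gamma> s) k"
definition b' where "b' k s = - real k * fourier_cos (\<gamma> s) k"

lemma a_primitive: "primitive_on 0 T (a k) (a' k)" and b_primitive: "primitive_on 0 T (b k) (b' k)"
proof -
  have 1: "(\<lambda>s. - (LINT x|torus. \<gamma> s x * deriv (\<lambda>x. cos (real k * x)) x)) = a' k"
  proof
    fix s
    have "(\<lambda>x. \<gamma> s x * (- real k * sin (real k * x))) = (\<lambda>x. - real k * (\<gamma> s x * sin (real k * x)))" by auto
    then show "- (LINT x|torus. \<gamma> s x * deriv (\<lambda>x. cos (real k * x)) x) = a' k s"
      by (simp add: deriv_cos_mult a'_def fourier_sin_def)
  qed
  have 2: "(\<lambda>s. - (LINT x|torus. \<gamma> s x * deriv (\<lambda>x. sin (real k * x)) x)) = b' k"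
  proof
    fix s
    have "(\<lambda>x. \<gamma> s x * (real k * cos (real k * x))) = (\<lambda>x. real k * (\<gamma> s x * cos (real k * x)))" by auto
    then show "- (LINT x|torus. \<gamma> s x * deriv (\<lambda>x. sin (real k * x)) x) = b' k s"
      by (simp add: deriv_sin_mult b'_def fourier_cos_def)
  qed
  show "primitive_on 0 T (a k) (a' k)" using pairing_primitive[OF test_fun_cos[of k]] unfolding 1 by (simp add: a_def[abs_def] fourier_cos_def)
  show "primitive_on 0 T (b k) (b' k)" using pairing_primitive[OF test_fun_sin[of k]] unfolding 2 by (simp add: b_def[abs_def] fourier_sin_def)
qed

definition rate :: "nat => real => real" where
  "rate n s = (\<Sum>k\<le>n. (2 * (a k s * a' k s) + 2 * (b k s * b' k s)) / fourier_weight k)"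

lemma rate_integrable: "integrable (lebesgue_on {0..T}) (rate n)"
proof -
  have "integrable (lebesgue_on {0..T}) (\<lambda>s. a k s * a' k s)" "integrable (lebesgue_on {0..T}) (\<lambda>s. b k s * b' k s)" for k
    using integrable_continuous_mult[OF primitive_on_integrable[OF a_primitive] primitive_on_continuous[OF a_primitive]]
      integrable_continuous_mult[OF primitive_on_integrable[OF b_primitive] primitive_on_continuous[OF b_primitive]] by blast+
  then show ?thesis unfolding rate_def
    by (intro Bochner_Integration.integrable_sum Bochner_Integration.integrable_divide Bochner_Integration.integrable_add) auto
qed

lemma energy_primitive:
  assumes t: "t \<in> {0..T}"
  shows "fourier_energy n (z t) - fourier_energy n (z 0) = (LINT s|lebesgue_on {0..t}. rate n s)"
proof -
  have sub: "integrable (lebesgue_on {0..t}) f" if "integrable (lebesgue_on {0..T}) f" for f :: "real => real"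
    by (rule integrable_subinterval[OF that]) (use t in auto)
  have sq: "(f t)^2 - (f 0)^2 = (LINT s|lebesgue_on {0..t}. 2 * (f s * f' s))" if p: "primitive_on 0 T f f'" for f f'
  proof -
    have "f t * f t - f 0 * f 0 = (LINT s|lebesgue_on {0..t}. f s * f' s + f s * f' s)"
      by (rule primitive_onD[OF primitive_on_mult[OF p p]]) (use t in auto)
    also have "\<dots> = (LINT s|lebesgue_on {0..t}. 2 * (f s * f' s))"
      by (intro Bochner_Integration.integral_cong) auto
    finally show ?thesis by (simp only: power2_eq_square)
  qed
  have i: "integrable (lebesgue_on {0..t}) (\<lambda>s. a k s * a' k s)" "integrable (lebesgue_on {0..t}) (\<lambda>s. b k s * b' k s)" for k
    using sub[OF integrable_continuous_mult[OF primitive_on_integrable[OF a_primitive] primitive_on_continuous[OF a_primitive]]]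
      sub[OF integrable_continuous_mult[OF primitive_on_integrable[OF b_primitive] primitive_on_continuous[OF b_primitive]]] by blast+
  have "fourier_energy n (z t) - fourier_energy n (z 0) = (\<Sum>k\<le>n. (((a k t)^2 - (a k 0)^2) + ((b k t)^2 - (b k 0)^2)) / fourier_weight k)"
    by (simp add: fourier_energy_def a_def b_def diff_divide_distrib add_divide_distrib sum_subtractf sum.distrib)
  also have "\<dots> = (\<Sum>k\<le>n. LINT s|lebesgue_on {0..t}. (2 * (a k s * a' k s) + 2 * (b k s * b' k s)) / fourier_weight k)"
    unfolding sq[OF a_primitive] sq[OF b_primitive] using i by simp
  also have "\<dots> = (LINT s|lebesgue_on {0..t}. rate n s)" unfolding rate_def
    using i by (intro Bochner_Integration.integral_sum[symmetric] Bochner_Integration.integrable_divide Bochner_Integration.integrable_add) auto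
  finally show ?thesis .
qed

lemma rate_eq:
  assumes "L2_torus (zx s)" "has_weak_deriv 1 (z s) (zx s)" "L2_torus (\<gamma> s)"
  shows "rate n s = - 2 * (LINT x|torus. \<gamma> s x * fourier_sum n (zx s) x)"
proof -
  have "(LINT x|torus. \<gamma> s x * fourier_sum n (zx s) x) = (\<Sum>k\<le>n. fourier_cos (zx s) k / fourier_weight k * fourier_cos (\<gamma> s) k + fourier_sin (zx s) k / fourier_weight k * fourier_sin (\<gamma> s) k)"
    unfolding fourier_sum_def by (rule lint_mult_trig_sum[OF assms(3)])
  also have "- 2 * \<dots> = rate n s"
    unfolding rate_def sum_distrib_left
    by (intro sum.cong refl)
       (simp add: fourier_cos_weak_deriv[OF assms(2)] fourier_sin_weak_deriv[OF assms(2)] a_def b_def a'_def b'_def diff_divide_distrib add_divide_distrib algebra_simps)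
  finally show ?thesis by simp
qed

lemma rate_bound:
  assumes "L2_torus (zx s)" "has_weak_deriv 1 (z s) (zx s)" "L2_torus (\<gamma> s)" "(LINT x|torus. (zx s x)^2) \<le> \<omega> s"
  shows "\<bar>rate n s\<bar> \<le> \<omega> s + 2 * pi * C^2"
proof -
  let ?A = "fourier_cos (zx s)" and ?B = "fourier_sin (zx s)" and ?A' = "fourier_cos (\<gamma> s)" and ?B' = "fourier_sin (\<gamma> s)"
  have "\<bar>rate n s\<bar> \<le> (\<Sum>k\<le>n. \<bar>(2 * (a k s * a' k s) + 2 * (b k s * b' k s)) / fourier_weight k\<bar>)"
    unfolding rate_def by (rule sum_abs)
  also have "\<dots> \<le> (\<Sum>k\<le>n. ((?A k)^2 + (?B k)^2) / fourier_weight k + ((?A' k)^2 + (?B' k)^2) / fourier_weight k)"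
  proof (rule sum_mono)
    fix k
    have w: "fourier_weight k > 0" by (rule fourier_weight_pos)
    have e: "2 * (a k s * a' k s) + 2 * (b k s * b' k s) = - 2 * (?B k * ?B' k + ?A k * ?A' k)"
      by (simp add: fourier_cos_weak_deriv[OF assms(2)] fourier_sin_weak_deriv[OF assms(2)] a_def b_def a'_def b'_def algebra_simps)
    have y: "\<bar>2 * (x * y)\<bar> \<le> x^2 + y^2" for x y :: real
      using zero_le_power2[of "x - y"] zero_le_power2[of "x + y"] by (simp add: power2_eq_square algebra_simps abs_le_iff)
    have "\<bar>2 * (a k s * a' k s) + 2 * (b k s * b' k s)\<bar> \<le> ((?A k)^2 + (?B k)^2) + ((?A' k)^2 + (?B' k)^2)"
      unfolding e using y[of "?A k" "?A' k"] y[of "?B k" "?B' k"] by (simp add: abs_le_iff algebra_simps)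
    then show "\<bar>(2 * (a k s * a' k s) + 2 * (b k s * b' k s)) / fourier_weight k\<bar> \<le> ((?A k)^2 + (?B k)^2) / fourier_weight k + ((?A' k)^2 + (?B' k)^2) / fourier_weight k"
      using w by (simp add: abs_divide divide_right_mono flip: add_divide_distrib)
  qed
  also have "\<dots> = fourier_energy n (zx s) + fourier_energy n (\<gamma> s)"
    by (simp add: fourier_energy_def sum.distrib)
  also have "\<dots> \<le> (LINT x|torus. (zx s x)^2) + (LINT x|torus. (\<gamma> s x)^2)"
    by (intro add_mono fourier_energy_le assms)
  also have "(LINT x|torus. (\<gamma> s x)^2) \<le> (LINT x|torus. C^2)"
  proof (rule integral_mono)
    fix x show "(\<gamma> s x)^2 \<le> C^2" using \<gamma>_le[of s x] by (intro abs_le_square_iff[THEN iffD1]) linarith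
  qed (use assms(3) in \<open>auto simp: L2_torus_def\<close>)
  finally show ?thesis using assms(4) by simp
qed

text \<open>
  Formally this is the equation tested with \<open>2 z\<close>. The Fourier coefficients of
  \<open>z\<close> are absolutely continuous in time, so the identity holds for the Fourier
  sums; there the flux is paired with the Fourier sum of \<open>zx\<close>, which converges for
  almost every time, with an integrable bound.
\<close>

theorem energy_inequality:
  assumes le: "AE s in lebesgue_on {0..T}. - 2 * (LINT x|torus. \<gamma> s x * zx s x) \<le> K * (LINT x|torus. (z s x)^2)" and t: "t \<in> {0..T}"
  shows "(LINT x|torus. (z t x)^2) - (LINT x|torus. (z 0 x)^2) \<le> K * (LINT s|lebesgue_on {0..t}. LINT x|torus. (z s x)^2)"
proof -
  have sub: "integrable (lebesgue_on {0..t}) f" if "integrable (lebesgue_on {0..T}) f" for f :: "real => real"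
    by (rule integrable_subinterval[OF that]) (use t in auto)
  have AEsub: "AE s in lebesgue_on {0..t}. Q s" if "AE s in lebesgue_on {0..T}. Q s" for Q
  proof -
    have "AE s in lebesgue. s \<in> {0..T} \<longrightarrow> Q s" using that by (subst (asm) AE_restrict_space_iff) auto
    then have "AE s in lebesgue. s \<in> {0..t} \<longrightarrow> Q s" by eventually_elim (use t in auto)
    then show ?thesis by (subst AE_restrict_space_iff) auto
  qed
  define L where "L s = lim (\<lambda>n. rate n s)" for s
  have good: "AE s in lebesgue_on {0..t}. L2_torus (zx s) \<and> has_weak_deriv 1 (z s) (zx s) \<and> (LINT x|torus. (zx s x)^2) \<le> \<omega> s \<and> L2_torus (\<gamma> s)"
    using AEsub[OF zx] AEsub[OF \<gamma>] by eventually_elim (auto intro: L2_torus_bounded[of _ C] \<gamma>_le)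
  have conv: "AE s in lebesgue_on {0..t}. (\<lambda>n. rate n s) \<longlonglongrightarrow> - 2 * (LINT x|torus. \<gamma> s x * zx s x)"
    using good
  proof eventually_elim
    case (elim s)
    then have "rate n s = - 2 * (LINT x|torus. \<gamma> s x * fourier_sum n (zx s) x)" for n by (intro rate_eq) auto
    then show ?case using elim by (auto intro!: tendsto_intros lint_mult_fourier_sum_tendsto)
  qed
  have Leq: "AE s in lebesgue_on {0..t}. L s = - 2 * (LINT x|torus. \<gamma> s x * zx s x) \<and> (\<lambda>n. rate n s) \<longlonglongrightarrow> L s"
    using conv
  proof eventually_elim
    case (elim s)
    have "L s = - 2 * (LINT x|torus. \<gamma> s x * zx s x)" unfolding L_def by (rule limI[OF elim])
    then show ?case using elim by (simp only: simp_thms)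
  qed
  have rm: "rate n \<in> borel_measurable (lebesgue_on {0..t})" for n using sub[OF rate_integrable] by auto
  have Lm: "L \<in> borel_measurable (lebesgue_on {0..t})" unfolding L_def by (rule borel_measurable_lim_metric) (rule rm)
  have W: "integrable (lebesgue_on {0..t}) (\<lambda>s. \<omega> s + 2 * pi * C^2)"
    by (intro Bochner_Integration.integrable_add sub[OF \<omega>] integrable_on_interval_continuous) auto
  have L_lim: "AE s in lebesgue_on {0..t}. (\<lambda>n. rate n s) \<longlonglongrightarrow> L s" using Leq by eventually_elim (rule conjunct2)
  have bnd: "AE s in lebesgue_on {0..t}. norm (rate n s) \<le> \<omega> s + 2 * pi * C^2" for n
    using good by eventually_elim (auto intro: rate_bound)
  have "(\<lambda>n. LINT s|lebesgue_on {0..t}. rate n s) \<longlonglongrightarrow> (LINT s|lebesgue_on {0..t}. L s)"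
    by (rule integral_dominated_convergence[OF Lm rm W L_lim bnd])
  moreover have "(\<lambda>n. LINT s|lebesgue_on {0..t}. rate n s) \<longlonglongrightarrow> (LINT x|torus. (z t x)^2) - (LINT x|torus. (z 0 x)^2)"
    unfolding energy_primitive[OF t, symmetric] using T
    by (intro tendsto_intros fourier_energy_tendsto z_L2 t) auto
  ultimately have eq: "(LINT x|torus. (z t x)^2) - (LINT x|torus. (z 0 x)^2) = (LINT s|lebesgue_on {0..t}. L s)"
    using LIMSEQ_unique by blast
  have Li: "integrable (lebesgue_on {0..t}) L"
    by (rule integrable_dominated_convergence[OF Lm rm W L_lim bnd])
  have zi: "integrable (lebesgue_on {0..t}) (\<lambda>s. LINT x|torus. (z s x)^2)"
  proof (intro sub integrable_on_interval_continuous continuous_param_integral)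
    have "continuous_on ({0..T} \<times> {-pi..pi}) (\<lambda>y. ((\<lambda>(t, x). z t x) y)^2)" by (intro continuous_intros z)
    then show "continuous_on ({0..T} \<times> {-pi..pi}) (\<lambda>(s, x). (z s x)^2)" by (simp add: case_prod_unfold)
  qed
  have "(LINT s|lebesgue_on {0..t}. L s) \<le> (LINT s|lebesgue_on {0..t}. K * (LINT x|torus. (z s x)^2))"
  proof (rule integral_mono_AE[OF Li])
    show "AE s in lebesgue_on {0..t}. L s \<le> K * (LINT x|torus. (z s x)^2)"
      using Leq AEsub[OF le] by eventually_elim auto
  qed (use zi in simp)
  then show ?thesis unfolding eq by simp
qed

end

text \<open>
  With \<open>u A - w B = u (A - B) + (u - w) B\<close> the first part has the sign of
  \<open>arctan A - arctan B\<close>. It dominates the second unless \<open>u \<bar>A -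
  B\<bar>\<close> is at most \<open>\<bar>(u - w) B\<bar>\<close>, and then the Lipschitz bound
  for the arctangent suffices.
\<close>

lemma arctan_monotone_estimate:
  fixes A B u w :: real
  assumes u: "u > 0"
  shows "- ((arctan A - arctan B) * (u * A - w * B)) \<le> (u - w)^2 * B^2 / u"
proof -
  define \<theta> where "\<theta> = arctan A - arctan B"
  have sgn: "0 \<le> \<theta> * (A - B)"
    unfolding \<theta>_def by (cases "A \<le> B") (auto simp: mult_nonpos_nonpos arctan_le_iff)
  have le: "\<bar>\<theta>\<bar> \<le> \<bar>A - B\<bar>" unfolding \<theta>_def by (rule arctan_1_lipschitz)
  have abs: "\<theta> * (A - B) = \<bar>\<theta>\<bar> * \<bar>A - B\<bar>" using sgn by (metis abs_mult abs_of_nonneg)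
  have "u * A - w * B = u * (A - B) + (u - w) * B" by (simp add: algebra_simps)
  then have e: "\<theta> * (u * A - w * B) = u * (\<bar>\<theta>\<bar> * \<bar>A - B\<bar>) + \<theta> * ((u - w) * B)"
    using abs by (simp add: distrib_left mult.left_commute)
  have "- (\<theta> * ((u - w) * B)) \<le> \<bar>\<theta>\<bar> * \<bar>(u - w) * B\<bar>" by (metis abs_ge_minus_self abs_mult)
  then have 1: "- (\<theta> * (u * A - w * B)) \<le> \<bar>\<theta>\<bar> * (\<bar>(u - w) * B\<bar> - u * \<bar>A - B\<bar>)" unfolding e by (simp add: algebra_simps)
  show ?thesis unfolding \<theta>_def[symmetric]
  proof (cases "\<bar>(u - w) * B\<bar> \<le> u * \<bar>A - B\<bar>")
    case True
    then have "\<bar>\<theta>\<bar> * (\<bar>(u - w) * B\<bar> - u * \<bar>A - B\<bar>) \<le> 0" by (intro mult_nonneg_nonpos) auto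
    moreover have "0 \<le> (u - w)^2 * B^2 / u" using u by simp
    ultimately show "- (\<theta> * (u * A - w * B)) \<le> (u - w)^2 * B^2 / u" using 1 by linarith
  next
    case False
    have "\<bar>\<theta>\<bar> \<le> \<bar>(u - w) * B\<bar> / u" using le False u by (simp add: pos_le_divide_eq mult.commute) (smt (verit, best) mult_left_mono)
    then have "\<bar>\<theta>\<bar> * (\<bar>(u - w) * B\<bar> - u * \<bar>A - B\<bar>) \<le> (\<bar>(u - w) * B\<bar> / u) * (\<bar>(u - w) * B\<bar> - 0)"
      using False u by (intro mult_mono) auto
    also have "\<dots> = (u - w)^2 * B^2 / u" by (simp add: power2_eq_square abs_mult[symmetric])
    finally show "- (\<theta> * (u * A - w * B)) \<le> (u - w)^2 * B^2 / u" using 1 by linarith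
  qed
qed

section \<open>The limit as a solution with values in H2\<close>

lemma borel_measurable_AE_on:
  fixes f g :: "real => real"
  assumes f: "f \<in> borel_measurable (lebesgue_on S)" and ae: "AE x in lebesgue_on S. f x = g x" and S: "S \<in> sets lebesgue"
  shows "g \<in> borel_measurable (lebesgue_on S)"
proof -
  have 1: "(\<lambda>x. if x \<in> S then f x else 0) \<in> borel_measurable lebesgue"
    using f borel_measurable_if[OF S, of f] by simp
  have "AE x in lebesgue. x \<in> S \<longrightarrow> f x = g x" using ae S by (subst (asm) AE_restrict_space_iff) auto
  then have "AE x in lebesgue. (if x \<in> S then f x else 0) = (if x \<in> S then g x else 0)"
    by eventually_elim auto
  from borel_measurable_AE[OF 1 this] show ?thesis using borel_measurable_if[OF S, of g] by simp
qed

lemma borel_measurable_AE_limit: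
  fixes f :: "nat => real => real"
  assumes f: "\<And>n. f n \<in> borel_measurable (lebesgue_on S)" and S: "S \<in> sets lebesgue"
   and lim: "AE x in lebesgue_on S. (\<lambda>n. f n x) \<longlonglongrightarrow> g x"
  shows "g \<in> borel_measurable (lebesgue_on S)"
proof (rule borel_measurable_AE_on[OF _ _ S])
  show "(\<lambda>x. lim (\<lambda>n. f n x)) \<in> borel_measurable (lebesgue_on S)" by (rule borel_measurable_lim_metric) (rule f)
  show "AE x in lebesgue_on S. lim (\<lambda>n. f n x) = g x" using lim by eventually_elim (rule limI)
qed

lemma continuous_on_pair_of_slice:
  fixes f :: "real => real"
  assumes "continuous_on {-pi..pi} f"
  shows "continuous_on ({0..T::real} \<times> {-pi..pi}) (\<lambda>z. f (snd z))"
  by (rule continuous_on_compose2[OF assms]) (auto intro!: continuous_intros)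

lemma continuous_on_uncurry:
  "continuous_on A (\<lambda>(t, x). f t x) \<longleftrightarrow> continuous_on A (\<lambda>z. f (fst z) (snd z))"
  by (simp add: case_prod_unfold)

lemma fourier_coefficients_continuous:
  fixes T :: real
  assumes "continuous_on ({0..T} \<times> {-pi..pi}) (\<lambda>(t, x). f t x)"
  shows "continuous_on {0..T} (\<lambda>t. fourier_cos (f t) k)" "continuous_on {0..T} (\<lambda>t. fourier_sin (f t) k)"
proof -
  have f: "continuous_on ({0..T} \<times> {-pi..pi}) (\<lambda>z. f (fst z) (snd z))" using assms unfolding continuous_on_uncurry .
  have "continuous_on ({0..T} \<times> {-pi..pi}) (\<lambda>(t, x). f t x * cos (real k * x))"
    "continuous_on ({0..T} \<times> {-pi..pi}) (\<lambda>(t, x). f t x * sin (real k * x))"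
    unfolding case_prod_unfold by (auto intro!: continuous_intros f)
  from this[THEN continuous_param_integral]
  show "continuous_on {0..T} (\<lambda>t. fourier_cos (f t) k)" "continuous_on {0..T} (\<lambda>t. fourier_sin (f t) k)"
    unfolding fourier_cos_def fourier_sin_def .
qed

lemma continuous_imp_time_measurable:
  assumes "continuous_on ({0..T} \<times> {-pi..pi}) (\<lambda>(t, x). f t x)"
  shows "time_measurable T f"
  unfolding time_measurable_def
proof (intro allI impI)
  fix \<phi> assume t: "test_fun \<phi>"
  have "continuous_on ({0..T} \<times> {-pi..pi}) (\<lambda>(s, x). f s x * \<phi> x)"
    using assms continuous_on_pair_of_slice[OF test_fun_continuous[OF t], of T] unfolding continuous_on_uncurry
    by (intro continuous_intros)
  then show "(\<lambda>s. LINT x|torus. f s x * \<phi> x) \<in> borel_measurable (lebesgue_on {0..T})"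
    by (intro continuous_imp_measurable_on_sets_lebesgue continuous_param_integral) auto
qed

text \<open>
  The Fourier sums of the weak derivative have coefficients that depend continuously on time,
  being, up to a factor, coefficients of the continuous function \<open>u\<close>. So the
  pairing is almost everywhere a limit of continuous functions of time.
\<close>

lemma flux_pairing_measurable:
  fixes u ux :: "real => real => real" and \<phi> :: "real => real"
  assumes u: "continuous_on ({0..T} \<times> {-pi..pi}) (\<lambda>(t, x). u t x)" and pos: "\<And>t x. t \<in> {0..T} ==> x \<in> {-pi..pi} ==> \<mu> \<le> u t x" and \<mu>: "\<mu> > 0"
    and ux: "AE s in lebesgue_on {0..T}. L2_torus (ux s) \<and> has_weak_deriv 1 (u s) (ux s)"
    and \<phi>: "continuous_on {-pi..pi} \<phi>"
  shows "(\<lambda>s. LINT x|torus. arctan (ux s x / u s x) * \<phi> x) \<in> borel_measurable (lebesgue_on {0..T})"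
proof -
  define D where "D n s = trig_sum n (\<lambda>k. real k * fourier_sin (u s) k / fourier_weight k) (\<lambda>k. - real k * fourier_cos (u s) k / fourier_weight k)" for n s
  have nz: "u (fst z) (snd z) \<noteq> 0" if "z \<in> {0..T} \<times> {-pi..pi}" for z
    using pos[of "fst z" "snd z"] \<mu> that by auto
  have Dc: "continuous_on ({0..T} \<times> {-pi..pi}) (\<lambda>z. D n (fst z) (snd z))" for n
  proof -
    have a: "continuous_on ({0..T} \<times> {-pi..pi}) (\<lambda>z. fourier_sin (u (fst z)) k)" "continuous_on ({0..T} \<times> {-pi..pi}) (\<lambda>z. fourier_cos (u (fst z)) k)" for k
      by (rule continuous_on_compose2[OF fourier_coefficients_continuous(2)[OF u]] continuous_on_compose2[OF fourier_coefficients_continuous(1)[OF u]], auto intro!: continuous_intros)+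
    show ?thesis unfolding D_def trig_sum_def using fourier_weight_pos
      by (intro continuous_intros a) (auto simp: less_imp_neq[symmetric] dest: less_imp_neq)
  qed
  define F where "F n s = (LINT x|torus. arctan (D n s x / u s x) * \<phi> x)" for n s
  have Fc: "continuous_on {0..T} (F n)" for n
  proof -
    have "continuous_on ({0..T} \<times> {-pi..pi}) (\<lambda>z. u (fst z) (snd z))" using u unfolding continuous_on_uncurry .
    then have "continuous_on ({0..T} \<times> {-pi..pi}) (\<lambda>(s, x). arctan (D n s x / u s x) * \<phi> x)"
      unfolding case_prod_unfold using nz Dc continuous_on_pair_of_slice[OF \<phi>, of T]
      by (intro continuous_on_mult continuous_on_arctan continuous_on_divide ballI) blast+
    from continuous_param_integral[OF this] show ?thesis unfolding F_def[abs_def] .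
  qed
  show ?thesis
  proof (rule borel_measurable_AE_limit[where f=F])
    show "F n \<in> borel_measurable (lebesgue_on {0..T})" for n
      by (rule continuous_imp_measurable_on_sets_lebesgue[OF Fc]) simp
    obtain M where M: "M \<ge> 0" "\<And>x. x \<in> {-pi..pi} ==> \<bar>\<phi> x\<bar> \<le> M" using bounded_on_Icc[OF \<phi>] by blast
    have \<phi>m: "\<phi> \<in> borel_measurable torus" by (rule continuous_imp_measurable_on_sets_lebesgue[OF \<phi>]) simp
    show "AE s in lebesgue_on {0..T}. (\<lambda>n. F n s) \<longlonglongrightarrow> (LINT x|torus. arctan (ux s x / u s x) * \<phi> x)"
      using ux AE_space
    proof eventually_elim
      case (elim s)
      then have s: "s \<in> {0..T}" and L: "L2_torus (ux s)" and w: "has_weak_deriv 1 (u s) (ux s)" by auto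
      have uc: "continuous_on {-pi..pi} (u s)" by (rule continuous_slice[OF u s])
      have um: "u s \<in> borel_measurable torus" by (rule continuous_imp_measurable_on_sets_lebesgue[OF uc]) simp
      have De: "D n s = fourier_sum n (ux s)" for n
        unfolding D_def fourier_sum_def fourier_cos_weak_deriv[OF w] fourier_sin_weak_deriv[OF w] ..
      have LD: "L2_torus (D n s)" for n unfolding De fourier_sum_def by (rule L2_torus_trig_sum)
      have Ld: "L2_torus (\<lambda>x. ux s x - D n s x)" for n by (rule L2_torus_diff[OF L LD])
      have Lb: "L2_torus (\<lambda>x. arctan (h x / u s x) * \<phi> x)" if "h \<in> borel_measurable torus" for h
      proof (rule L2_torus_bounded[where B="pi * M"])
        fix x assume x: "x \<in> {-pi..pi}"
        have "\<bar>arctan (h x / u s x)\<bar> \<le> pi" using arctan_bounded[of "h x / u s x"] pi_gt_zero by (simp add: abs_le_iff)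
        then show "\<bar>arctan (h x / u s x) * \<phi> x\<bar> \<le> pi * M" unfolding abs_mult using M(2)[OF x] by (intro mult_mono) auto
      qed (use that um \<phi>m in measurable)
      have i1: "integrable torus (\<lambda>x. arctan (D n s x / u s x) * \<phi> x)" for n
        by (rule L2_torus_integrable[OF Lb]) (use LD in \<open>auto simp: L2_torus_def\<close>)
      have i2: "integrable torus (\<lambda>x. arctan (ux s x / u s x) * \<phi> x)"
        by (rule L2_torus_integrable[OF Lb]) (use L in \<open>auto simp: L2_torus_def\<close>)
      have "(\<lambda>n. F n s - (LINT x|torus. arctan (ux s x / u s x) * \<phi> x)) \<longlonglongrightarrow> 0"
      proof (rule Lim_null_comparison)
        show "\<forall>\<^sub>F n in sequentially. norm (F n s - (LINT x|torus. arctan (ux s x / u s x) * \<phi> x)) \<le> M / \<mu> * sqrt (2 * pi * (LINT x|torus. (ux s x - fourier_sum n (ux s) x)^2))"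
        proof (intro always_eventually allI)
          fix n
          have "\<bar>F n s - (LINT x|torus. arctan (ux s x / u s x) * \<phi> x)\<bar> \<le> (LINT x|torus. M / \<mu> * \<bar>ux s x - D n s x\<bar>)"
            unfolding F_def
          proof (rule lint_diff_bound[OF i1 i2])
            show "integrable torus (\<lambda>x. M / \<mu> * \<bar>ux s x - D n s x\<bar>)" using L2_torus_integrable[OF Ld] by auto
            fix x assume x: "x \<in> {-pi..pi}"
            have ug: "\<mu> \<le> u s x" by (rule pos[OF s x])
            have "\<bar>arctan (D n s x / u s x) - arctan (ux s x / u s x)\<bar> \<le> \<bar>D n s x / u s x - ux s x / u s x\<bar>" by (rule arctan_1_lipschitz)
            also have "\<dots> = \<bar>ux s x - D n s x\<bar> / u s x" using ug \<mu> by (simp add: abs_divide abs_minus_commute flip: diff_divide_distrib)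
            also have "\<dots> \<le> \<bar>ux s x - D n s x\<bar> / \<mu>" using ug \<mu> by (intro divide_left_mono) auto
            finally have "\<bar>arctan (D n s x / u s x) - arctan (ux s x / u s x)\<bar> * \<bar>\<phi> x\<bar> \<le> \<bar>ux s x - D n s x\<bar> / \<mu> * M"
              using M(2)[OF x] \<mu> by (intro mult_mono) auto
            then show "\<bar>arctan (D n s x / u s x) * \<phi> x - arctan (ux s x / u s x) * \<phi> x\<bar> \<le> M / \<mu> * \<bar>ux s x - D n s x\<bar>"
              unfolding left_diff_distrib[symmetric] abs_mult by (simp add: mult.commute)
          qed simp
          also have "\<dots> = M / \<mu> * (LINT x|torus. \<bar>ux s x - D n s x\<bar>)" by simp
          also have "\<dots> \<le> M / \<mu> * sqrt (2 * pi * (LINT x|torus. (ux s x - D n s x)^2))"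
          proof (intro mult_left_mono real_le_rsqrt)
            have "(LINT x|torus. \<bar>ux s x - D n s x\<bar> * 1)^2 \<le> (LINT x|torus. \<bar>ux s x - D n s x\<bar>^2) * (LINT x|torus. 1^2)"
              by (rule lint_Cauchy_Schwarz) (use Ld[of n] L2_torus_integrable[OF Ld[of n]] in \<open>auto simp: L2_torus_def\<close>)
            then show "(LINT x|torus. \<bar>ux s x - D n s x\<bar>)^2 \<le> 2 * pi * (LINT x|torus. (ux s x - D n s x)^2)" by (simp add: mult.commute)
          qed (use M \<mu> in auto)
          finally show "norm (F n s - (LINT x|torus. arctan (ux s x / u s x) * \<phi> x)) \<le> M / \<mu> * sqrt (2 * pi * (LINT x|torus. (ux s x - fourier_sum n (ux s) x)^2))"
            by (simp add: De)
        qed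
        have "(\<lambda>n. M / \<mu> * sqrt (2 * pi * (LINT x|torus. (ux s x - fourier_sum n (ux s) x)^2))) \<longlonglongrightarrow> M / \<mu> * sqrt (2 * pi * 0)"
          by (intro tendsto_intros fourier_sum_tendsto L)
        then show "(\<lambda>n. M / \<mu> * sqrt (2 * pi * (LINT x|torus. (ux s x - fourier_sum n (ux s) x)^2))) \<longlonglongrightarrow> 0" by simp
      qed
      then show ?case by (rule LIM_zero_cancel)
    qed
  qed simp
qed

lemma primitive_on_cong_integrand:
  assumes p: "primitive_on a b f g" and eq: "\<And>x. x \<in> {a..b} ==> g x = g' x"
  shows "primitive_on a b f g'"
  unfolding primitive_on_def
proof (intro conjI allI impI)
  show "integrable (lebesgue_on {a..b}) g'"
    using primitive_on_integrable[OF p] Bochner_Integration.integrable_cong[of "lebesgue_on {a..b}" "lebesgue_on {a..b}" g g'] eq by auto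
  fix x y assume xy: "a \<le> x \<and> x \<le> y \<and> y \<le> b"
  have "(LINT s|lebesgue_on {x..y}. g s) = (LINT s|lebesgue_on {x..y}. g' s)"
    by (intro Bochner_Integration.integral_cong refl eq) (use xy in auto)
  then show "f y - f x = integral\<^sup>L (lebesgue_on {x..y}) g'" using primitive_onD[OF p, of x y] xy by auto
qed

lemma H_norm_1_sq: "(H_norm 1 f)^2 = (LINT x|torus. (wderiv 0 f x)^2) + (LINT x|torus. (wderiv 1 f x)^2)"
  unfolding H_norm_def by (subst real_sqrt_pow2) (auto intro!: sum_nonneg Bochner_Integration.integral_nonneg)

lemma lint_sq_cong_AE:
  fixes f g :: "real => real"
  assumes "AE x in torus. f x = g x" "f \<in> borel_measurable torus" "g \<in> borel_measurable torus"
  shows "(LINT x|torus. (f x)^2) = (LINT x|torus. (g x)^2)"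
proof (rule Bochner_Integration.integral_cong_AE)
  show "AE x in torus. (f x)^2 = (g x)^2" using assms(1) by eventually_elim simp
qed (use assms(2,3) in \<open>auto intro!: borel_measurable_power\<close>)

context scheme_limit
begin

definition U :: "real => real => real" where "U t x = exp (v t x)"

lemma U_pos: "U t x > 0" by (simp add: U_def)

lemma U_continuous: "continuous_on ({0..T} \<times> UNIV) (\<lambda>(t, x). U t x)"
  using continuous_on_exp[OF v_continuous] by (simp add: U_def case_prod_unfold)

lemma U_continuous': "continuous_on ({0..T} \<times> {-pi..pi}) (\<lambda>(t, x). U t x)"
  by (rule continuous_on_subset[OF U_continuous]) auto

lemma U_period: "t \<in> {0..T} ==> periodic (U t)"
  unfolding periodic_def periodic_fun_simple_def U_def using v_period by simp

lemma P_slice: "t \<in> {0..T} ==> continuous_on S (P t)"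
  using continuous_slice[OF P_continuous] continuous_on_subset by blast

lemma U_slice: "t \<in> {0..T} ==> continuous_on S (U t)"
  using continuous_slice[OF U_continuous] continuous_on_subset by blast

lemma U_primitive: "t \<in> {0..T} ==> primitive_on (-pi) pi (U t) (\<lambda>x. U t x * P t x)"
proof (rule primitive_on_C1)
  fix x assume t: "t \<in> {0..T}"
  have "(U t has_real_derivative U t x * P t x) (at x)"
    unfolding U_def[abs_def] using v_deriv[OF t, of x] by (auto intro!: derivative_eq_intros)
  then show "(U t has_real_derivative U t x * P t x) (at x within {- pi..pi})" by (rule has_field_derivative_at_within)
qed (intro continuous_intros U_slice P_slice)

lemma ends: "t \<in> {0..T} ==> v t pi = v t (-pi)" "t \<in> {0..T} ==> P t pi = P t (-pi)"
  using v_period[of t "-pi"] P_period[of t "-pi"] by simp_all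

lemma U_ends: "t \<in> {0..T} ==> U t pi = U t (-pi)" by (simp add: U_def ends)

lemma U_weak_deriv: "t \<in> {0..T} ==> has_weak_deriv 1 (U t) (\<lambda>x. U t x * P t x)"
  by (rule primitive_has_weak_deriv[OF U_primitive U_ends])

lemma U_L2: "t \<in> {0..T} ==> L2_torus (U t)" "t \<in> {0..T} ==> L2_torus (\<lambda>x. U t x * P t x)"
  by (intro L2_torus_continuous continuous_intros U_slice P_slice; simp)+

lemma U_wderiv: "t \<in> {0..T} ==> AE x in torus. wderiv 1 (U t) x = U t x * P t x"
  by (intro wderiv_AE_eq U_L2 U_weak_deriv)

lemma U_H1: "t \<in> {0..T} ==> H_torus 1 (U t)"
  unfolding H_torus_def
proof (intro conjI allI impI)
  fix j :: nat assume t: "t \<in> {0..T}" and "j \<le> 1"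
  then have "j = 0 \<or> j = 1" by linarith
  then show "\<exists>g. L2_torus g \<and> has_weak_deriv j (U t) g"
    using U_L2[OF t] U_weak_deriv[OF t] has_weak_deriv_0 by blast
qed (rule U_L2)

lemma U_H1_norm: "t \<in> {0..T} ==> (H_norm 1 (U t))^2 = (LINT x|torus. (U t x)^2) + (LINT x|torus. (U t x * P t x)^2)"
proof -
  assume t: "t \<in> {0..T}"
  have "AE x in torus. wderiv 0 (U t) x = U t x" by (rule wderiv_AE_eq[OF U_L2(1)[OF t] has_weak_deriv_0])
  then have "(LINT x|torus. (wderiv 0 (U t) x)^2) = (LINT x|torus. (U t x)^2)"
    by (rule lint_sq_cong_AE) (use H_torus_wderiv(1)[OF U_H1[OF t], of 0] U_L2[OF t] in \<open>auto simp: L2_torus_def\<close>)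
  moreover have "(LINT x|torus. (wderiv 1 (U t) x)^2) = (LINT x|torus. (U t x * P t x)^2)"
    by (rule lint_sq_cong_AE[OF U_wderiv[OF t]]) (use H_torus_wderiv(1)[OF U_H1[OF t], of 1] U_L2[OF t] in \<open>auto simp: L2_torus_def\<close>)
  ultimately show ?thesis unfolding H_norm_1_sq by (simp only:)
qed

lemma P_continuous': "continuous_on ({0..T} \<times> {-pi..pi}) (\<lambda>z. P (fst z) (snd z))"
  using continuous_on_subset[OF P_continuous, of "{0..T} \<times> {-pi..pi}"] by (simp add: case_prod_unfold subset_iff)

lemma U_L2_time: "L2_time_H T 1 U"
  unfolding L2_time_H_def
proof (intro conjI)
  show "time_measurable T U" by (rule continuous_imp_time_measurable[OF U_continuous'])
  show "AE t in lebesgue_on {0..T}. H_torus 1 (U t)" by (rule AE_I2) (use U_H1 in simp)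
  have c1: "continuous_on {0..T} (\<lambda>t. LINT x|torus. (U t x)^2)" "continuous_on {0..T} (\<lambda>t. LINT x|torus. (U t x * P t x)^2)"
  proof -
    have f: "continuous_on ({0..T} \<times> {-pi..pi}) (\<lambda>z. U (fst z) (snd z))" using U_continuous' unfolding continuous_on_uncurry .
    have "continuous_on ({0..T} \<times> {-pi..pi}) (\<lambda>(t, x). (U t x)^2)"
      "continuous_on ({0..T} \<times> {-pi..pi}) (\<lambda>(t, x). (U t x * P t x)^2)"
      unfolding case_prod_unfold by (auto intro!: continuous_intros f P_continuous')
    from this[THEN continuous_param_integral]
    show "continuous_on {0..T} (\<lambda>t. LINT x|torus. (U t x)^2)" "continuous_on {0..T} (\<lambda>t. LINT x|torus. (U t x * P t x)^2)" .
  qed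
  have "integrable (lebesgue_on {0..T}) (\<lambda>t. (LINT x|torus. (U t x)^2) + (LINT x|torus. (U t x * P t x)^2))"
    by (intro integrable_on_interval_continuous continuous_intros c1)
  then show "integrable (lebesgue_on {0..T}) (\<lambda>t. (H_norm 1 (U t))^2)"
    by (rule Bochner_Integration.integrable_cong[THEN iffD1, rotated 2]) (use U_H1_norm in auto)
qed

lemma U_slope: "t \<in> {0..T} ==> AE x in torus. wderiv 1 (U t) x / U t x = P t x"
proof -
  assume t: "t \<in> {0..T}"
  show ?thesis using U_wderiv[OF t]
  proof eventually_elim
    case (elim x) then show ?case using U_pos[of t x] by simp
  qed
qed

lemma U_flux: "t \<in> {0..T} ==> continuous_on {-pi..pi} \<psi> ==> (LINT x|torus. arctan (wderiv 1 (U t) x / U t x) * \<psi> x) = (LINT x|torus. arctan (P t x) * \<psi> x)"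
proof (rule Bochner_Integration.integral_cong_AE)
  assume t: "t \<in> {0..T}" and \<psi>: "continuous_on {-pi..pi} \<psi>"
  have m: "U t \<in> borel_measurable torus" "wderiv 1 (U t) \<in> borel_measurable torus" "\<psi> \<in> borel_measurable torus" "P t \<in> borel_measurable torus"
    using U_L2[OF t] H_torus_wderiv(1)[OF U_H1[OF t], of 1]
      continuous_imp_measurable_on_sets_lebesgue[OF \<psi>] continuous_imp_measurable_on_sets_lebesgue[OF P_slice[OF t]]
    by (auto simp: L2_torus_def)
  show "(\<lambda>x. arctan (wderiv 1 (U t) x / U t x) * \<psi> x) \<in> borel_measurable torus" "(\<lambda>x. arctan (P t x) * \<psi> x) \<in> borel_measurable torus"
    using m by measurable
  show "AE x in torus. arctan (wderiv 1 (U t) x / U t x) * \<psi> x = arctan (P t x) * \<psi> x"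
    using U_slope[OF t] by eventually_elim simp
qed

theorem U_solution: "solution T (\<lambda>x. exp (V0 x)) U"
  unfolding solution_def
proof (intro conjI ballI allI impI)
  show "continuous_on ({0..T} \<times> UNIV) (\<lambda>(t, x). U t x)" by (rule U_continuous)
  show "L2_time_H T 1 U" by (rule U_L2_time)
  show "U 0 x = exp (V0 x)" for x by (simp add: U_def v_initial)
  fix t assume t: "t \<in> {0..T}"
  show "periodic (U t)" by (rule U_period[OF t])
  show "0 < U t x" for x by (rule U_pos)
  fix \<phi> assume \<phi>: "test_fun \<phi>"
  have "(LINT s|lebesgue_on {0..t}. LINT x|torus. arctan (wderiv 1 (U s) x / U s x) * deriv \<phi> x) = (LINT s|lebesgue_on {0..t}. LINT x|torus. arctan (P s x) * deriv \<phi> x)"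
    by (intro Bochner_Integration.integral_cong refl U_flux test_fun_continuous test_fun_deriv \<phi>) (use t in auto)
  then show "(LINT x|torus. U t x * \<phi> x) - (LINT x|torus. exp (V0 x) * \<phi> x) = - (LINT s|lebesgue_on {0..t}. LINT x|torus. arctan (wderiv 1 (U s) x / U s x) * deriv \<phi> x)"
    using weak_equation[OF \<phi> t] by (simp add: U_def)
qed

text \<open>
  The derivative of the angle yields the second derivative of \<open>U\<close> by the chain rule
  for the tangent, and in terms of it both functionals simplify.
\<close>

lemma U_regular:
  assumes t: "t \<in> {0..T}"
  obtains \<omega> where "L2_torus \<omega>" "primitive_on (-pi) pi (\<lambda>x. arctan (P t x)) \<omega>"
    "H2_chain (U t) (\<lambda>x. U t x * P t x) (\<lambda>x. U t x * ((P t x)^2 + (1 + (P t x)^2) * \<omega> x))"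
    "lyapunov (U t) \<le> E0" "growth_rate (U t) = (LINT x|torus. (\<omega> x)^2)" "(LINT x|torus. (\<omega> x)^2) \<le> E0 / m"
proof -
  obtain \<omega> where \<omega>: "L2_torus \<omega>" "primitive_on (-pi) pi (\<lambda>x. arctan (P t x)) \<omega>"
    "(LINT x|torus. exp (v t x) * (1 + (P t x)^2) * (\<omega> x)^2) \<le> E0"
    using spatial_limit.limit_regularity[OF at_time[OF t]] by blast
  have Pp: "primitive_on (-pi) pi (P t) (\<lambda>x. (1 + (P t x)^2) * \<omega> x)"
  proof -
    have "primitive_on (-pi) pi (\<lambda>x. tan (arctan (P t x))) (\<lambda>x. (1 + (tan (arctan (P t x)))^2) * \<omega> x)"
    proof (rule primitive_on_compose[OF \<omega>(2)])
      fix z assume "z \<in> (\<lambda>x. arctan (P t x)) ` {- pi..pi}"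
      then have c: "cos z \<noteq> 0" by (auto simp: cos_arctan_not_zero)
      show "(tan has_real_derivative 1 + (tan z)^2) (at z)"
        using DERIV_tan[OF c] c tan_sec[OF c] by (simp add: power_inverse)
    next
      show "continuous_on ((\<lambda>x. arctan (P t x)) ` {- pi..pi}) (\<lambda>z. 1 + (tan z)^2)"
        by (intro continuous_intros) (auto simp: cos_arctan_not_zero)
    qed
    then show ?thesis by (simp only: tan_arctan)
  qed
  have chain: "H2_chain (U t) (\<lambda>x. U t x * P t x) (\<lambda>x. U t x * ((P t x)^2 + (1 + (P t x)^2) * \<omega> x))"
    unfolding H2_chain_def
  proof (intro conjI)
    show "primitive_on (-pi) pi (U t) (\<lambda>x. U t x * P t x)" by (rule U_primitive[OF t])
    show "primitive_on (-pi) pi (\<lambda>x. U t x * P t x) (\<lambda>x. U t x * ((P t x)^2 + (1 + (P t x)^2) * \<omega> x))"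
      by (rule primitive_on_cong_integrand[OF primitive_on_mult[OF U_primitive[OF t] Pp]]) (simp add: power2_eq_square algebra_simps)
    show "U t pi = U t (-pi)" "U t pi * P t pi = U t (-pi) * P t (-pi)" by (simp_all add: U_ends[OF t] ends[OF t])
    have "L2_torus (\<lambda>x. U t x * (P t x)^2 + (U t x * (1 + (P t x)^2)) * \<omega> x)"
      by (intro L2_torus_add L2_torus_mult_continuous \<omega>(1) L2_torus_continuous continuous_intros U_slice[OF t] P_slice[OF t])
    then show "L2_torus (\<lambda>x. U t x * ((P t x)^2 + (1 + (P t x)^2) * \<omega> x))" by (simp add: algebra_simps)
  qed
  have num: "U t x * (U t x * ((P t x)^2 + (1 + (P t x)^2) * \<omega> x)) - (U t x * P t x)^2 = (U t x)^2 * (1 + (P t x)^2) * \<omega> x" for x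
    by (simp add: power2_eq_square algebra_simps)
  have den: "(U t x)^2 + (U t x * P t x)^2 = (U t x)^2 * (1 + (P t x)^2)" for x
    by (simp add: power2_eq_square algebra_simps)
  have nz: "U t x \<noteq> 0" "1 + (P t x)^2 \<noteq> 0" for x
    using U_pos[of t x] add_pos_nonneg[of 1 "(P t x)^2"] by auto
  have f1: "((U t x)^2 * (1 + (P t x)^2) * \<omega> x)^2 / (U t x * ((U t x)^2 * (1 + (P t x)^2))) = exp (v t x) * (1 + (P t x)^2) * (\<omega> x)^2" for x
  proof -
    define a c where "a = U t x" "c = 1 + (P t x)^2"
    have "a \<noteq> 0" "c \<noteq> 0" using nz[of x] by (auto simp: a_c_def)
    then have "(a^2 * c * \<omega> x)^2 / (a * (a^2 * c)) = a * c * (\<omega> x)^2" by (simp add: power2_eq_square field_simps)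
    then show ?thesis by (simp add: a_c_def U_def)
  qed
  have f2: "((U t x)^2 * (1 + (P t x)^2) * \<omega> x)^2 / ((U t x)^2 * (1 + (P t x)^2))^2 = (\<omega> x)^2" for x
  proof -
    define a c where "a = U t x" "c = 1 + (P t x)^2"
    have "a \<noteq> 0" "c \<noteq> 0" using nz[of x] by (auto simp: a_c_def)
    then have "(a^2 * c * \<omega> x)^2 / (a^2 * c)^2 = (\<omega> x)^2" by (simp add: power_mult_distrib)
    then show ?thesis by (simp add: a_c_def)
  qed
  have ly: "lyapunov (U t) \<le> E0" "growth_rate (U t) = (LINT x|torus. (\<omega> x)^2)"
    using lyapunov_chain[OF chain U_pos] \<omega>(3) unfolding num den f1 f2 by auto
  have i2: "integrable torus (\<lambda>x. (\<omega> x)^2)" using \<omega>(1) by (simp add: L2_torus_def)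
  have "m * (LINT x|torus. (\<omega> x)^2) = (LINT x|torus. m * (\<omega> x)^2)" by simp
  also have "\<dots> \<le> (LINT x|torus. exp (v t x) * (1 + (P t x)^2) * (\<omega> x)^2)"
  proof (rule integral_mono)
    show "integrable torus (\<lambda>x. exp (v t x) * (1 + (P t x)^2) * (\<omega> x)^2)"
      by (rule integrable_continuous_mult[OF i2]) (intro continuous_intros v_continuous_x[OF t] P_slice[OF t])
    fix x
    have "m * 1 \<le> exp (v t x) * (1 + (P t x)^2)" using exp_v(1)[OF t, of x] m by (intro mult_mono) auto
    then show "m * (\<omega> x)^2 \<le> exp (v t x) * (1 + (P t x)^2) * (\<omega> x)^2" by (intro mult_right_mono) auto
  qed (use i2 in simp)
  also have "\<dots> \<le> E0" by (rule \<omega>(3))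
  finally have "(LINT x|torus. (\<omega> x)^2) \<le> E0 / m" using m by (simp add: field_simps)
  then show ?thesis using that \<omega>(1,2) chain ly by blast
qed

text \<open>
  By Parseval's identity the growth rate is a limit of functions that are continuous in time.
\<close>

lemma growth_integrable: "integrable (lebesgue_on {0..T}) (\<lambda>t. growth_rate (U t))"
proof -
  define W where "W t x = arctan (P t x)" for t x
  have Wc: "continuous_on ({0..T} \<times> {-pi..pi}) (\<lambda>(t, x). W t x)"
    unfolding continuous_on_uncurry W_def by (intro continuous_intros P_continuous')
  define F where "F n t = (\<Sum>k\<le>n. ((real k * fourier_sin (W t) k)^2 + (- real k * fourier_cos (W t) k)^2) / fourier_weight k)" for n t
  have Fc: "continuous_on {0..T} (F n)" for n unfolding F_def
    using fourier_weight_pos by (intro continuous_intros fourier_coefficients_continuous Wc) (auto simp: less_imp_neq[symmetric] dest: less_imp_neq)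
  have conv: "(\<lambda>n. F n t) \<longlonglongrightarrow> growth_rate (U t)" and bd: "\<bar>growth_rate (U t)\<bar> \<le> E0 / m" if t: "t \<in> {0..T}" for t
  proof -
    obtain \<omega> where \<omega>: "L2_torus \<omega>" "primitive_on (-pi) pi (\<lambda>x. arctan (P t x)) \<omega>" "growth_rate (U t) = (LINT x|torus. (\<omega> x)^2)" "(LINT x|torus. (\<omega> x)^2) \<le> E0 / m"
      using U_regular[OF t] by metis
    have w: "has_weak_deriv 1 (W t) \<omega>" unfolding W_def by (rule primitive_has_weak_deriv[OF \<omega>(2)]) (simp add: ends[OF t])
    have "F n t = fourier_energy n \<omega>" for n
      unfolding F_def fourier_energy_def fourier_cos_weak_deriv[OF w] fourier_sin_weak_deriv[OF w] ..
    then show "(\<lambda>n. F n t) \<longlonglongrightarrow> growth_rate (U t)" using fourier_energy_tendsto[OF \<omega>(1)] \<omega>(3) by simp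
    have "0 \<le> (LINT x|torus. (\<omega> x)^2)" by (intro Bochner_Integration.integral_nonneg) auto
    then show "\<bar>growth_rate (U t)\<bar> \<le> E0 / m" using \<omega>(3,4) by simp
  qed
  have "(\<lambda>t. growth_rate (U t)) \<in> borel_measurable (lebesgue_on {0..T})"
    by (rule borel_measurable_AE_limit[where f=F])
       (use conv in \<open>auto intro!: continuous_imp_measurable_on_sets_lebesgue[OF Fc] AE_I2\<close>)
  then have "integrable (lebesgue_on {0..T}) (\<lambda>t. growth_rate (U t) * 1)"
    by (intro integrable_bounded_mult[OF integrable_on_interval_continuous, where B="E0 / m"]) (use bd in auto)
  then show ?thesis by simp
qed

lemma U_H2_bound:
  obtains M where "\<And>t. t \<in> {0..T} ==> H_torus 2 (U t) \<and> H_norm 2 (U t) \<le> M"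
proof (rule that[of "sqrt (2 * pi * (2 * m)^2 + 2 * pi * (2 * m)^2 + (2 * m)^2 * (4 * pi + 8 * (E0 / m)))"])
  fix t assume t: "t \<in> {0..T}"
  obtain \<omega> where \<omega>: "L2_torus \<omega>" "primitive_on (-pi) pi (\<lambda>x. arctan (P t x)) \<omega>"
    "H2_chain (U t) (\<lambda>x. U t x * P t x) (\<lambda>x. U t x * ((P t x)^2 + (1 + (P t x)^2) * \<omega> x))"
    "lyapunov (U t) \<le> E0" "growth_rate (U t) = (LINT x|torus. (\<omega> x)^2)" "(LINT x|torus. (\<omega> x)^2) \<le> E0 / m"
    by (rule U_regular[OF t])
  note H = H2_chain_weak[OF \<omega>(3)]
  have Ub: "0 < U t x" "U t x \<le> 2 * m" for x using exp_v[OF t, of x] by (auto simp: U_def)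
  have Pb: "\<bar>P t x\<bar> \<le> 1" for x using P_le[OF t, of x] by simp
  have P2: "(P t x)^2 \<le> 1" for x using Pb[of x] by (simp add: abs_square_le_1)
  have c2: "(LINT x|torus. (f x)^2) \<le> 2 * pi * (2 * m)^2" if "L2_torus f" "\<And>x. \<bar>f x\<bar> \<le> 2 * m" for f
  proof -
    have "(LINT x|torus. (f x)^2) \<le> (LINT x|torus. (2 * m)^2)"
    proof (rule integral_mono)
      fix x show "(f x)^2 \<le> (2 * m)^2" using that(2)[of x] by (intro abs_le_square_iff[THEN iffD1]) linarith
    qed (use that(1) in \<open>auto simp: L2_torus_def\<close>)
    then show ?thesis by simp
  qed
  have n0: "(LINT x|torus. (wderiv 0 (U t) x)^2) \<le> 2 * pi * (2 * m)^2"
  proof -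
    have "(LINT x|torus. (wderiv 0 (U t) x)^2) = (LINT x|torus. (U t x)^2)"
      by (rule lint_sq_cong_AE[OF H(2)]) (use H_torus_wderiv(1)[OF H(1), of 0] U_L2[OF t] in \<open>auto simp: L2_torus_def\<close>)
    then show ?thesis using c2[OF U_L2(1)[OF t]] Ub by (simp add: abs_of_pos)
  qed
  have n1: "(LINT x|torus. (wderiv 1 (U t) x)^2) \<le> 2 * pi * (2 * m)^2"
  proof -
    have "(LINT x|torus. (wderiv 1 (U t) x)^2) = (LINT x|torus. (U t x * P t x)^2)"
      by (rule lint_sq_cong_AE[OF H(3)]) (use H_torus_wderiv(1)[OF H(1), of 1] U_L2[OF t] in \<open>auto simp: L2_torus_def\<close>)
    moreover have "\<bar>U t x * P t x\<bar> \<le> 2 * m" for x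
    proof -
      have "\<bar>U t x\<bar> * \<bar>P t x\<bar> \<le> (2 * m) * 1" using Ub[of x] Pb[of x] by (intro mult_mono) auto
      then show ?thesis by (simp add: abs_mult)
    qed
    ultimately show ?thesis using c2[OF U_L2(2)[OF t]] by simp
  qed
  define f2 where "f2 x = U t x * ((P t x)^2 + (1 + (P t x)^2) * \<omega> x)" for x
  have Lf2: "L2_torus f2" using \<omega>(3) by (simp add: H2_chain_def f2_def[abs_def])
  have n2: "(LINT x|torus. (wderiv 2 (U t) x)^2) \<le> (2 * m)^2 * (4 * pi + 8 * (E0 / m))"
  proof -
    have "(LINT x|torus. (wderiv 2 (U t) x)^2) = (LINT x|torus. (f2 x)^2)"
      by (rule lint_sq_cong_AE[OF H(4)[folded f2_def]]) (use H_torus_wderiv(1)[OF H(1), of 2] Lf2 in \<open>auto simp: L2_torus_def\<close>)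
    also have "\<dots> \<le> (LINT x|torus. (2 * m)^2 * (2 + 8 * (\<omega> x)^2))"
    proof (rule integral_mono)
      fix x
      have q: "((P t x)^2 + (1 + (P t x)^2) * \<omega> x)^2 \<le> 2 + 8 * (\<omega> x)^2"
      proof -
        have "((P t x)^2 + (1 + (P t x)^2) * \<omega> x)^2 \<le> 2 * ((P t x)^2)^2 + 2 * ((1 + (P t x)^2) * \<omega> x)^2"
          using zero_le_power2[of "(P t x)^2 - (1 + (P t x)^2) * \<omega> x"] by (simp add: power2_diff power2_sum)
        moreover have "((P t x)^2)^2 \<le> 1" by (rule power_le_one[OF _ P2]) simp
        moreover have "((1 + (P t x)^2) * \<omega> x)^2 \<le> 2^2 * (\<omega> x)^2"
          unfolding power_mult_distrib using P2[of x] by (intro mult_right_mono power_mono) auto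
        ultimately show ?thesis by simp
      qed
      have "(f2 x)^2 = (U t x)^2 * ((P t x)^2 + (1 + (P t x)^2) * \<omega> x)^2" by (simp add: f2_def power_mult_distrib)
      also have "\<dots> \<le> (2 * m)^2 * (2 + 8 * (\<omega> x)^2)" using q Ub[of x] by (intro mult_mono power_mono) auto
      finally show "(f2 x)^2 \<le> (2 * m)^2 * (2 + 8 * (\<omega> x)^2)" .
    qed (use Lf2 \<omega>(1) in \<open>auto simp: L2_torus_def\<close>)
    also have "\<dots> = (2 * m)^2 * (4 * pi + 8 * (LINT x|torus. (\<omega> x)^2))"
      using \<omega>(1) by (simp add: L2_torus_def)
    also have "\<dots> \<le> (2 * m)^2 * (4 * pi + 8 * (E0 / m))" using \<omega>(6) by (intro mult_left_mono add_left_mono) auto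
    finally show ?thesis .
  qed
  have s: "{..2::nat} = {0, 1, 2}" by auto
  have "H_norm 2 (U t) \<le> sqrt (2 * pi * (2 * m)^2 + 2 * pi * (2 * m)^2 + (2 * m)^2 * (4 * pi + 8 * (E0 / m)))"
    unfolding H_norm_def s using n0 n1 n2 by (intro real_sqrt_le_mono) simp
  then show "H_torus 2 (U t) \<and> H_norm 2 (U t) \<le> sqrt (2 * pi * (2 * m)^2 + 2 * pi * (2 * m)^2 + (2 * m)^2 * (4 * pi + 8 * (E0 / m)))"
    using H(1) by simp
qed

end

section \<open>From data of small slope to the scheme\<close>

lemma torus_representative: "x - of_int \<lfloor>(x + pi) / (2 * pi)\<rfloor> * (2 * pi) \<in> {-pi..pi}"
  using floor_divide_lower[of "2 * pi" "x + pi"] floor_divide_upper[of "2 * pi" "x + pi"] by (simp add: algebra_simps)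

lemma periodic_continuous_UNIV:
  fixes g :: "real => real"
  assumes per: "\<And>x. g (x + 2 * pi) = g x" and c: "continuous_on {-pi..pi} g"
  shows "continuous_on UNIV g"
proof -
  interpret pg: periodic_fun_simple g "2 * pi" by standard (rule per)
  have "continuous_on {pi..3 * pi} (\<lambda>x. g (x - 2 * pi))"
    by (rule continuous_on_compose2[OF c]) (auto intro!: continuous_intros)
  then have "continuous_on {pi..3 * pi} g" by (simp add: pg.minus_1)
  then have "continuous_on ({-pi..pi} \<union> {pi..3 * pi}) g" by (intro continuous_on_closed_Un c) auto
  then have c2: "continuous_on {-pi<..<3 * pi} g" by (rule continuous_on_subset) auto
  have "isCont g x" for x
  proof -
    define k where "k = \<lfloor>x / (2 * pi)\<rfloor>"
    define z where "z = x + of_int (- k) * (2 * pi)"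
    have "z \<in> {-pi<..<3 * pi}"
      using floor_divide_lower[of "2 * pi" x] floor_divide_upper[of "2 * pi" x]
      unfolding z_def k_def by (simp add: algebra_simps)
    then have "isCont g z" using c2 by (simp add: continuous_on_eq_continuous_at)
    then have "isCont (\<lambda>y. g (y + of_int (- k) * (2 * pi))) x"
      unfolding z_def by (intro isCont_o2[where f="\<lambda>y. y + of_int (- k) * (2 * pi)" and g=g]) (auto intro!: continuous_intros)
    then show ?thesis unfolding pg.plus_of_int .
  qed
  then show ?thesis by (simp add: continuous_at_imp_continuous_on)
qed

lemma continuous_AE_le:
  fixes f :: "real => real"
  assumes f: "continuous_on {-pi..pi} f" and le: "AE x in torus. f x \<le> K" and x: "x \<in> {-pi..pi}"
  shows "f x \<le> K"
proof -
  have "max (f x) K = K"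
  proof (rule AE_torus_eq_continuous[OF _ _ _ x])
    show "continuous_on {-pi..pi} (\<lambda>x. max (f x) K)" by (intro continuous_intros f)
    show "AE x in torus. max (f x) K = K" using le by eventually_elim simp
  qed simp
  then show ?thesis by simp
qed

text \<open>
  The essential bound for the angle becomes a pointwise bound for the continuous representative
  of \<open>u0' / u0\<close>, so \<open>ln u0\<close> varies by at most 1/1000 over a period;
  this gives the two-sided bound with \<open>m\<close> and \<open>2 m\<close>.
\<close>

lemma initial_data_exists:
  assumes per: "periodic u0" and cont: "continuous_on UNIV u0" and H: "H_torus 2 u0" and pos: "\<And>x. u0 x > 0"
    and small: "esssup torus (\<lambda>x. ereal \<bar>arctan (wderiv 1 u0 x / u0 x)\<bar>) \<le> ereal (arctan kappa)"
  obtains P P2 m where "initial_data (\<lambda>x. ln (u0 x)) P P2 m"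
    "initial_data.data_energy (\<lambda>x. ln (u0 x)) P P2 = lyapunov u0"
proof -
  interpret pu: periodic_fun_simple u0 "2 * pi" using per unfolding periodic_def .
  obtain f' f'' where chain: "H2_chain u0 f' f''"
    using H2_chain_exists[OF H continuous_on_subset[OF cont subset_UNIV]] .
  then have p1: "primitive_on (-pi) pi u0 f'" and p2: "primitive_on (-pi) pi f' f''" and ends: "f' pi = f' (-pi)" and L: "L2_torus f''"
    by (auto simp: H2_chain_def)
  have uc: "continuous_on {-pi..pi} u0" by (rule continuous_on_subset[OF cont subset_UNIV])
  have fc: "continuous_on {-pi..pi} f'" by (rule primitive_on_continuous[OF p2])
  have nz: "u0 x \<noteq> 0" for x using pos[of x] by simp
  define Q where "Q x = f' x / u0 x" for x
  have Qc: "continuous_on {-pi..pi} Q" unfolding Q_def by (intro continuous_intros uc fc) (simp add: nz)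
  have "AE x in torus. \<bar>Q x\<bar> \<le> kappa"
    using esssup_AE[of "\<lambda>x. ereal \<bar>arctan (wderiv 1 u0 x / u0 x)\<bar>" torus] H2_chain_weak(3)[OF chain]
  proof eventually_elim
    case (elim x)
    have "ereal \<bar>arctan (wderiv 1 u0 x / u0 x)\<bar> \<le> ereal (arctan kappa)" using elim(1) small by (rule order_trans)
    then have "\<bar>arctan (Q x)\<bar> \<le> arctan kappa" using elim(2) by (simp add: Q_def)
    then have "arctan (Q x) \<le> arctan kappa" "arctan (- Q x) \<le> arctan kappa" by (simp_all add: arctan_minus abs_le_iff)
    then show ?case unfolding arctan_le_iff by (simp add: abs_le_iff)
  qed
  then have Q_le: "\<bar>Q x\<bar> \<le> kappa" if "x \<in> {-pi..pi}" for x
    using continuous_AE_le[OF continuous_on_rabs[OF Qc] _ that] by blast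
  define red where "red x = x - of_int \<lfloor>(x + pi) / (2 * pi)\<rfloor> * (2 * pi)" for x :: real
  have red_in: "red x \<in> {-pi..pi}" for x unfolding red_def by (rule torus_representative)
  have red_per: "red (x + 2 * pi) = red x" for x
  proof -
    have "(x + 2 * pi + pi) / (2 * pi) = (x + pi) / (2 * pi) + 1" by (simp add: field_simps)
    then show ?thesis unfolding red_def by (simp add: algebra_simps)
  qed
  have u_red: "u0 (red x) = u0 x" for x
    using pu.plus_of_int[of x "- \<lfloor>(x + pi) / (2 * pi)\<rfloor>"] by (simp add: red_def)
  define P where "P x = Q (red x)" for x
  have PQ: "P x = Q x" if x: "x \<in> {-pi..pi}" for x
  proof (cases "x = pi")
    case True
    have "red pi = -pi" by (simp add: red_def)
    then show ?thesis using True ends pu.plus_1[of "-pi"] by (simp add: P_def Q_def)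
  next
    case False
    then have "0 \<le> (x + pi) / (2 * pi)" "(x + pi) / (2 * pi) < 1" using x by (auto simp: pos_divide_less_eq)
    then have "\<lfloor>(x + pi) / (2 * pi)\<rfloor> = 0" by (simp add: floor_eq_iff)
    then show ?thesis by (simp add: P_def red_def)
  qed
  have P_per: "P (x + 2 * pi) = P x" for x by (simp add: P_def red_per)
  have P_cont: "continuous_on UNIV P"
  proof (rule periodic_continuous_UNIV, rule P_per)
    show "continuous_on {-pi..pi} P" using Qc by (simp add: PQ cong: continuous_on_cong_simp)
  qed
  define P2 where "P2 x = f'' x * (1 / u0 x) - (Q x)^2" for x
  have v: "primitive_on (-pi) pi (\<lambda>x. ln (u0 x)) P"
  proof (rule primitive_on_cong_integrand)
    show "primitive_on (-pi) pi (\<lambda>x. ln (u0 x)) (\<lambda>x. 1 / u0 x * f' x)"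
      by (rule primitive_on_compose[OF p1, of ln "\<lambda>z. 1 / z"]) (use pos nz in \<open>auto intro!: derivative_eq_intros continuous_intros\<close>)
  qed (simp add: PQ Q_def)
  have inv: "primitive_on (-pi) pi (\<lambda>x. 1 / u0 x) (\<lambda>x. - 1 / (u0 x)^2 * f' x)"
    by (rule primitive_on_compose[OF p1, of "\<lambda>z. 1 / z" "\<lambda>z. - 1 / z^2"])
       (use nz in \<open>auto intro!: derivative_eq_intros continuous_intros simp: power2_eq_square\<close>)
  have P: "primitive_on (-pi) pi P P2"
  proof (rule primitive_on_cong)
    show "primitive_on (-pi) pi (\<lambda>x. f' x * (1 / u0 x)) P2"
      by (rule primitive_on_cong_integrand[OF primitive_on_mult[OF p2 inv]])
         (simp add: P2_def Q_def power_divide power2_eq_square)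
  qed (simp add: PQ Q_def)
  have P2: "L2_torus P2" unfolding P2_def[abs_def]
  proof (rule L2_torus_diff)
    show "L2_torus (\<lambda>x. f'' x * (1 / u0 x))"
      using L2_torus_mult_continuous[OF L, of "\<lambda>x. 1 / u0 x"] uc nz by (simp add: continuous_on_divide mult.commute)
    show "L2_torus (\<lambda>x. (Q x)^2)" by (intro L2_torus_continuous continuous_intros Qc)
  qed
  define m where "m = u0 (-pi) * exp (- (1 / 1000))"
  have m: "m > 0" using pos by (simp add: m_def)
  have range': "m \<le> u0 x \<and> u0 x \<le> 2 * m" if x: "x \<in> {-pi..pi}" for x
  proof -
    have "\<bar>ln (u0 x) - ln (u0 (-pi))\<bar> \<le> (x - (-pi)) * kappa"
    proof -
      have "\<bar>P z - 0\<bar> \<le> kappa" if "z \<in> {-pi..pi}" for z using Q_le[OF that] by (simp only: PQ[OF that] diff_0_right)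
      from primitive_on_bound[OF v this x] show ?thesis by simp
    qed
    also have "\<dots> \<le> 7 * kappa" using x pi_approx by (intro mult_right_mono) auto
    also have "\<dots> \<le> 1 / 1000" by simp
    finally have b: "- (1 / 1000) \<le> ln (u0 x) - ln (u0 (-pi))" "ln (u0 x) - ln (u0 (-pi)) \<le> 1 / 1000" by linarith+
    have e: "u0 x = u0 (-pi) * exp (ln (u0 x) - ln (u0 (-pi)))" using pos[of x] pos[of "-pi"] by (simp add: exp_diff)
    have 1: "m \<le> u0 x" unfolding m_def using b(1) pos[of "-pi"] by (subst e) (intro mult_left_mono, auto)
    have "exp (2 / 1000 :: real) \<le> 2" using exp_bound[of "2 / 1000"] by (simp add: power2_eq_square)
    then have "exp (1 / 1000 :: real) \<le> 2 * exp (- (1 / 1000))"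
      using mult_right_mono[of "exp (2 / 1000 :: real)" 2 "exp (- (1 / 1000))"] by (simp flip: exp_add)
    then have "exp (ln (u0 x) - ln (u0 (-pi))) \<le> 2 * exp (- (1 / 1000))" using b(2) by (meson exp_le_cancel_iff order_trans)
    then have "u0 (-pi) * exp (ln (u0 x) - ln (u0 (-pi))) \<le> u0 (-pi) * (2 * exp (- (1 / 1000)))"
      using pos[of "-pi"] by (intro mult_left_mono) auto
    then have "u0 x \<le> 2 * m" using e by (simp add: m_def)
    with 1 show ?thesis by blast
  qed
  have data: "initial_data (\<lambda>x. ln (u0 x)) P P2 m"
  proof
    show "ln (u0 (x + 2 * pi)) = ln (u0 x)" for x by (simp add: pu.plus_1)
    show "\<bar>P x\<bar> \<le> kappa" for x unfolding P_def by (rule Q_le[OF red_in])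
    show "m \<le> exp (ln (u0 x))" "exp (ln (u0 x)) \<le> 2 * m" for x
      using range'[OF red_in, of x] pos[of x] by (simp_all add: u_red)
  qed (fact v P P2 P_per P_cont m)+
  have "initial_data.data_energy (\<lambda>x. ln (u0 x)) P P2 = (LINT x|torus. exp (ln (u0 x)) / (1 + (P x)^2) * (P2 x)^2)"
    by (rule initial_data.data_energy_def[OF data])
  also have "\<dots> = (LINT x|torus. (u0 x * f'' x - (f' x)^2)^2 / (u0 x * ((u0 x)^2 + (f' x)^2)))"
  proof (intro Bochner_Integration.integral_cong refl)
    fix x assume "x \<in> space torus"
    then have x: "P x = f' x / u0 x" using PQ[of x] by (simp add: Q_def)
    define a b c where "a = u0 x" "b = f' x" "c = f'' x"
    have a: "a > 0" using pos[of x] by (simp add: a_b_c_def)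
    then have n: "a^2 + b^2 > 0" by (simp add: add_pos_nonneg)
    have 1: "1 + (b / a)^2 = (a^2 + b^2) / a^2" using a by (simp add: power_divide field_simps)
    have 2: "c * (1 / a) - (b / a)^2 = (a * c - b^2) / a^2" using a by (simp add: power2_eq_square field_simps)
    have "a / (1 + (b / a)^2) * (c * (1 / a) - (b / a)^2)^2 = (a * c - b^2)^2 / (a * (a^2 + b^2))"
    proof -
      have "a / (n' / a^2) * (d / a^2)^2 = d^2 / (a * n')" if "n' > 0" for d n' :: real
        using a that by (simp add: power2_eq_square field_simps)
      from this[OF n] show ?thesis unfolding 1 2 .
    qed
    then show "exp (ln (u0 x)) / (1 + (P x)^2) * (P2 x)^2 = (u0 x * f'' x - (f' x)^2)^2 / (u0 x * ((u0 x)^2 + (f' x)^2))"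
      using pos[of x] by (simp add: x P2_def Q_def a_b_c_def)
  qed
  also have "\<dots> = lyapunov u0" by (rule lyapunov_chain(1)[OF chain, symmetric]) (rule pos)
  finally show ?thesis using that data by blast
qed

text \<open>
  The maximum with the energy of the datum turns the bound for the upper limit of the discrete
  energies into convergence.
\<close>

lemma (in initial_data) scheme_exists: obtains B e where "scheme m B data_energy y e"
proof -
  define e where "e n = max (energy (2 ^ n) (mesh n) (y n)) data_energy" for n
  have lim: "e \<longlonglongrightarrow> data_energy"
  proof (rule LIMSEQ_I)
    fix \<epsilon> :: real assume \<epsilon>: "\<epsilon> > 0"
    have "\<forall>\<^sub>F n in sequentially. energy (2 ^ n) (mesh n) (y n) \<le> data_energy + \<epsilon> / 2" by (rule energy_limsup) (use \<epsilon> in simp)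
    then have "\<forall>\<^sub>F n in sequentially. norm (e n - data_energy) < \<epsilon>"
      by eventually_elim (use \<epsilon> in \<open>auto simp: e_def max_def\<close>)
    then show "\<exists>no. \<forall>n\<ge>no. norm (e n - data_energy) < \<epsilon>" by (simp add: eventually_sequentially)
  qed
  then obtain B where "\<And>n. norm (e n) \<le> B"
    using convergent_imp_Bseq[OF convergentI] by (metis BseqE)
  then have "scheme m B data_energy y e"
    using m y_admissible lim by unfold_locales (auto simp: e_def abs_le_iff)
  then show ?thesis by (rule that)
qed

lemma (in initial_data) scheme_limit_exists:
  assumes T: "T > 0"
  obtains B e r w \<eta> where "scheme_limit m B data_energy y e T r w \<eta> v"
proof -
  obtain B e where s: "scheme m B data_energy y e" using scheme_exists .
  obtain r w \<eta> where c: "strict_mono r" "\<eta> \<longlonglongrightarrow> 0" "\<And>k t x. t \<in> {0..T} ==> \<bar>scheme.extended m B y (r k) t x - w t x\<bar> \<le> \<eta> k"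
    by (rule scheme.compactness[OF s less_imp_le[OF T]]) (rule that)
  have "continuous_on UNIV v"
    by (rule periodic_continuous_UNIV[OF v_per primitive_on_continuous[OF v]])
  then have "(\<lambda>n. y n (cell n x)) \<longlonglongrightarrow> v x" for x unfolding y_def
    by (intro isCont_tendsto_compose[OF _ node_cell_tendsto]) (simp add: continuous_on_eq_continuous_at)
  with s c T have "scheme_limit m B data_energy y e T r w \<eta> v"
    by (intro scheme_limit.intro scheme_limit_axioms.intro)
  then show ?thesis by (rule that)
qed

lemma lyapunov_nonneg:
  assumes "\<And>x. f x > 0"
  shows "0 \<le> lyapunov f"
  unfolding lyapunov_def using assms by (intro Bochner_Integration.integral_nonneg) (simp add: less_imp_le)

lemma growth_rate_nonneg: "0 \<le> growth_rate f"
  unfolding growth_rate_def by (intro Bochner_Integration.integral_nonneg) simp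

section \<open>Uniqueness\<close>

lemma has_weak_deriv_1_diff:
  assumes "L2_torus f" "L2_torus f'" "L2_torus g" "L2_torus g'" "has_weak_deriv 1 f f'" "has_weak_deriv 1 g g'"
  shows "has_weak_deriv 1 (\<lambda>x. f x - g x) (\<lambda>x. f' x - g' x)"
  unfolding has_weak_deriv_1
proof (intro allI impI)
  fix \<phi> assume \<phi>: "test_fun \<phi>"
  have L: "L2_torus \<phi>" "L2_torus (deriv \<phi>)"
    using test_fun_continuous[OF \<phi>] test_fun_continuous[OF test_fun_deriv[OF \<phi>]] by (auto intro: L2_torus_continuous)
  have "(LINT x|torus. (f x - g x) * deriv \<phi> x) = (LINT x|torus. f x * deriv \<phi> x) - (LINT x|torus. g x * deriv \<phi> x)"
    unfolding left_diff_distrib by (intro Bochner_Integration.integral_diff L2_torus_mult assms L)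
  also have "\<dots> = - ((LINT x|torus. f' x * \<phi> x) - (LINT x|torus. g' x * \<phi> x))"
    using assms(5,6)[unfolded has_weak_deriv_1, rule_format, OF \<phi>] by simp
  also have "(LINT x|torus. f' x * \<phi> x) - (LINT x|torus. g' x * \<phi> x) = (LINT x|torus. (f' x - g' x) * \<phi> x)"
    unfolding left_diff_distrib by (intro Bochner_Integration.integral_diff[symmetric] L2_torus_mult assms L)
  finally show "(LINT x|torus. (f x - g x) * deriv \<phi> x) = - (LINT x|torus. (f' x - g' x) * \<phi> x)" .
qed

context scheme_limit
begin

text \<open>
  For \<open>z = u - U\<close> the flux is \<open>\<gamma> = arctan (u\<^sub>x / u) - arctan
  P\<close>, with \<open>P = U\<^sub>x / U\<close> bounded by \<open>kappa\<close>. By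
  \<open>arctan_monotone_estimate\<close>, \<open>- \<gamma> z\<^sub>x \<le> kappa^2 z^2 /
  \<mu>\<close> for the minimum \<open>\<mu>\<close> of \<open>u\<close>, and Gronwall's
  inequality applies.
\<close>

theorem solution_unique:
  assumes sol: "solution T (\<lambda>x. exp (V0 x)) u" and t: "t \<in> {0..T}"
  shows "u t = U t"
proof -
  have uc: "continuous_on ({0..T} \<times> UNIV) (\<lambda>(t, x). u t x)"
    and up: "\<And>t. t \<in> {0..T} ==> periodic (u t)" "\<And>t x. t \<in> {0..T} ==> u t x > 0"
    and uH: "L2_time_H T 1 u" and u0: "\<And>x. u 0 x = exp (V0 x)"
    and uw: "\<And>t \<phi>. t \<in> {0..T} ==> test_fun \<phi> ==> (LINT x|torus. u t x * \<phi> x) - (LINT x|torus. exp (V0 x) * \<phi> x) =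
          - (LINT s|lebesgue_on {0..t}. LINT x|torus. arctan (wderiv 1 (u s) x / u s x) * deriv \<phi> x)"
    using sol unfolding solution_def by blast+
  have uc': "continuous_on ({0..T} \<times> {-pi..pi}) (\<lambda>(t, x). u t x)"
    by (rule continuous_on_subset[OF uc]) auto
  have "\<exists>z\<in>{0..T} \<times> {-pi..pi}. \<forall>z'\<in>{0..T} \<times> {-pi..pi}. (\<lambda>(t, x). u t x) z \<le> (\<lambda>(t, x). u t x) z'"
    by (rule continuous_attains_inf[OF _ _ uc']) (use T in \<open>auto intro!: compact_Times\<close>)
  then obtain t1 x1 where t1: "t1 \<in> {0..T}" and min: "\<forall>t\<in>{0..T}. \<forall>x\<in>{-pi..pi}. u t1 x1 \<le> u t x" by auto
  define \<mu> where "\<mu> = u t1 x1"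
  have \<mu>: "\<mu> > 0" unfolding \<mu>_def by (rule up(2)[OF t1])
  have \<mu>_le: "\<mu> \<le> u t x" if "t \<in> {0..T}" "x \<in> {-pi..pi}" for t x unfolding \<mu>_def using min that by blast
  define ux where "ux s = wderiv 1 (u s)" for s
  have "AE s in lebesgue_on {0..T}. H_torus 1 (u s)" using uH unfolding L2_time_H_def by blast
  then have ux: "AE s in lebesgue_on {0..T}. L2_torus (ux s) \<and> has_weak_deriv 1 (u s) (ux s)"
    unfolding ux_def by eventually_elim (intro conjI H_torus_wderiv[OF _ order_refl])
  have L: "L2_torus (u s)" if "s \<in> {0..T}" for s
    by (rule L2_torus_continuous[OF continuous_slice[OF uc' that]])
  define F where "F s \<phi> = (LINT x|torus. arctan (ux s x / u s x) * \<phi> x)" for s \<phi>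
  define G where "G s \<phi> = (LINT x|torus. arctan (P s x) * \<phi> x)" for s \<phi>
  define \<gamma> where "\<gamma> s x = arctan (ux s x / u s x) - arctan (P s x)" for s x
  have arctan_le: "\<bar>arctan A\<bar> \<le> pi / 2" for A using arctan_bounded[of A] by linarith
  have Fi: "integrable (lebesgue_on {0..T}) (\<lambda>s. F s \<phi>)" if \<phi>: "continuous_on {-pi..pi} \<phi>" for \<phi>
  proof -
    obtain M where M: "M \<ge> 0" "\<And>x. x \<in> {-pi..pi} ==> \<bar>\<phi> x\<bar> \<le> M" using bounded_on_Icc[OF \<phi>] by blast
    have "\<bar>F s \<phi>\<bar> \<le> 2 * pi * (pi / 2 * M)" for s unfolding F_def
    proof (rule abs_lint_torus_le)
      fix x assume "x \<in> {-pi..pi}"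
      then show "\<bar>arctan (ux s x / u s x) * \<phi> x\<bar> \<le> pi / 2 * M" unfolding abs_mult using M arctan_le by (intro mult_mono) auto
    qed
    moreover have "(\<lambda>s. F s \<phi>) \<in> borel_measurable (lebesgue_on {0..T})" unfolding F_def
      by (rule flux_pairing_measurable[OF uc' \<mu>_le \<mu> ux \<phi>])
    ultimately have "integrable (lebesgue_on {0..T}) (\<lambda>s. F s \<phi> * 1)"
      by (intro integrable_bounded_mult[OF integrable_on_interval_continuous, where B="2 * pi * (pi / 2 * M)"]) auto
    then show ?thesis by simp
  qed
  have Gi: "integrable (lebesgue_on {0..T}) (\<lambda>s. G s \<phi>)" if \<phi>: "continuous_on {-pi..pi} \<phi>" for \<phi>
  proof -
    have "continuous_on ({0..T} \<times> {-pi..pi}) (\<lambda>(s, x). arctan (P s x) * \<phi> x)"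
      unfolding case_prod_unfold by (intro continuous_on_mult continuous_on_arctan P_continuous' continuous_on_pair_of_slice[OF \<phi>])
    from integrable_on_interval_continuous[OF continuous_param_integral[OF this]] show ?thesis unfolding G_def .
  qed
  have FG: "AE s in lebesgue_on {0..T}. F s \<phi> - G s \<phi> = (LINT x|torus. \<gamma> s x * \<phi> x)" if \<phi>: "continuous_on {-pi..pi} \<phi>" for \<phi>
    using ux AE_space
  proof eventually_elim
    case (elim s)
    then have s: "s \<in> {0..T}" by simp
    have m: "ux s \<in> borel_measurable torus" "u s \<in> borel_measurable torus" "P s \<in> borel_measurable torus"
      using elim L[OF s] continuous_imp_measurable_on_sets_lebesgue[OF P_slice[OF s]] by (auto simp: L2_torus_def)
    have Lp: "L2_torus \<phi>" by (rule L2_torus_continuous[OF \<phi>])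
    have "L2_torus (\<lambda>x. arctan (ux s x / u s x))" "L2_torus (\<lambda>x. arctan (P s x))"
      using m by (auto intro!: L2_torus_bounded[of _ "pi / 2"] arctan_le)
    from this[THEN L2_torus_mult[OF _ Lp]] show ?case
      unfolding F_def G_def \<gamma>_def left_diff_distrib by (rule Bochner_Integration.integral_diff[symmetric])
  qed
  interpret E: weak_evolution T pi "\<lambda>s x. u s x - U s x" "\<lambda>s x. ux s x - U s x * P s x" \<gamma>
    "\<lambda>s. 2 * (H_norm 1 (u s))^2 + 2 * (H_norm 1 (U s))^2"
  proof
    show "0 < T" by (rule T)
    show "continuous_on ({0..T} \<times> {-pi..pi}) (\<lambda>(t, x). u t x - U t x)"
      using continuous_on_diff[OF uc' U_continuous'] by (simp add: case_prod_unfold)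
    show "integrable (lebesgue_on {0..T}) (\<lambda>s. 2 * (H_norm 1 (u s))^2 + 2 * (H_norm 1 (U s))^2)"
      using uH U_L2_time by (simp add: L2_time_H_def)
    show "AE s in lebesgue_on {0..T}. L2_torus (\<lambda>x. ux s x - U s x * P s x) \<and> has_weak_deriv 1 (\<lambda>x. u s x - U s x) (\<lambda>x. ux s x - U s x * P s x) \<and>
        (LINT x|torus. (ux s x - U s x * P s x)^2) \<le> 2 * (H_norm 1 (u s))^2 + 2 * (H_norm 1 (U s))^2"
      using ux AE_space
    proof eventually_elim
      case (elim s)
      then have s: "s \<in> {0..T}" and w: "L2_torus (ux s)" "has_weak_deriv 1 (u s) (ux s)" by auto
      have nn: "0 \<le> (LINT x|torus. (g x)^2)" for g :: "real => real" by (rule Bochner_Integration.integral_nonneg) auto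
      have "(LINT x|torus. (ux s x)^2) \<le> (H_norm 1 (u s))^2" unfolding H_norm_1_sq ux_def using nn[of "wderiv 0 (u s)"] by linarith
      moreover have "(LINT x|torus. (U s x * P s x)^2) \<le> (H_norm 1 (U s))^2" unfolding U_H1_norm[OF s] using nn[of "U s"] by linarith
      moreover have "(LINT x|torus. (ux s x - U s x * P s x)^2) \<le> 2 * (LINT x|torus. (ux s x)^2) + 2 * (LINT x|torus. (U s x * P s x)^2)"
        using lint_sq_diff_le[OF w(1) L2_torus_continuous[OF continuous_on_const[of _ 0]] U_L2(2)[OF s]] by simp
      ultimately show ?case
        using L2_torus_diff[OF w(1) U_L2(2)[OF s]]
          has_weak_deriv_1_diff[OF L[OF s] w(1) U_L2[OF s] w(2) U_weak_deriv[OF s]] by linarith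
    qed
    show "AE s in lebesgue_on {0..T}. \<gamma> s \<in> borel_measurable torus"
      using ux AE_space
    proof eventually_elim
      case (elim s)
      then have s: "s \<in> {0..T}" by simp
      have "ux s \<in> borel_measurable torus" "u s \<in> borel_measurable torus" "P s \<in> borel_measurable torus"
        using elim L[OF s] continuous_imp_measurable_on_sets_lebesgue[OF P_slice[OF s]] by (auto simp: L2_torus_def)
      then show ?case unfolding \<gamma>_def[abs_def] by measurable
    qed
    show "\<bar>\<gamma> s x\<bar> \<le> pi" for s x
      unfolding \<gamma>_def using arctan_le[of "ux s x / u s x"] arctan_le[of "P s x"] by linarith
    fix \<phi> assume \<phi>: "test_fun \<phi>"
    note c = test_fun_continuous[OF \<phi>, of "{-pi..pi}"] and c' = test_fun_continuous[OF test_fun_deriv[OF \<phi>], of "{-pi..pi}"]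
    have "(\<lambda>s. F s \<phi> - G s \<phi>) \<in> borel_measurable (lebesgue_on {0..T})" using Fi[OF c] Gi[OF c] by auto
    from borel_measurable_AE_on[OF this FG[OF c]]
    show "(\<lambda>s. LINT x|torus. \<gamma> s x * \<phi> x) \<in> borel_measurable (lebesgue_on {0..T})" by simp
    fix t assume t: "t \<in> {0..T}"
    have sub: "integrable (lebesgue_on {0..t}) h" if "integrable (lebesgue_on {0..T}) h" for h :: "real => real"
      by (rule integrable_subinterval[OF that]) (use t in auto)
    have mm: "(\<lambda>s. LINT x|torus. \<gamma> s x * deriv \<phi> x) \<in> borel_measurable (lebesgue_on {0..T})"
      by (rule borel_measurable_AE_on[OF _ FG[OF c']]) (use Fi[OF c'] Gi[OF c'] in auto)
    have Lv: "L2_torus \<phi>" by (rule L2_torus_continuous[OF c])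
    have sp: "(LINT x|torus. (u s x - U s x) * \<phi> x) = (LINT x|torus. u s x * \<phi> x) - (LINT x|torus. U s x * \<phi> x)" if s: "s \<in> {0..T}" for s
      unfolding left_diff_distrib by (intro Bochner_Integration.integral_diff L2_torus_mult L[OF s] U_L2[OF s] Lv)
    have "(LINT x|torus. (u t x - U t x) * \<phi> x) = - (LINT s|lebesgue_on {0..t}. F s (deriv \<phi>)) + (LINT s|lebesgue_on {0..t}. G s (deriv \<phi>))"
      unfolding sp[OF t] F_def G_def using uw[OF t \<phi>] weak_equation[OF \<phi> t] by (simp add: U_def ux_def)
    also have "\<dots> = - (LINT s|lebesgue_on {0..t}. F s (deriv \<phi>) - G s (deriv \<phi>))"
      using sub[OF Fi[OF c']] sub[OF Gi[OF c']] by simp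
    also have "(LINT s|lebesgue_on {0..t}. F s (deriv \<phi>) - G s (deriv \<phi>)) = (LINT s|lebesgue_on {0..t}. LINT x|torus. \<gamma> s x * deriv \<phi> x)"
      by (rule lint_subinterval_cong_AE[OF FG[OF c'] _ _ mm]) (use t Fi[OF c'] Gi[OF c'] in auto)
    finally show "(LINT x|torus. (u t x - U t x) * \<phi> x) - (LINT x|torus. (u 0 x - U 0 x) * \<phi> x)
        = - (LINT s|lebesgue_on {0..t}. LINT x|torus. \<gamma> s x * deriv \<phi> x)"
      by (simp add: u0 U_def v_initial)
  qed
  define K where "K = 2 * (kappa^2 / \<mu>)"
  have K: "K \<ge> 0" using \<mu> by (simp add: K_def)
  have le: "AE s in lebesgue_on {0..T}. - 2 * (LINT x|torus. \<gamma> s x * (ux s x - U s x * P s x)) \<le> K * (LINT x|torus. (u s x - U s x)^2)"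
    using E.zx E.\<gamma> AE_space
  proof eventually_elim
    case (elim s)
    then have s: "s \<in> {0..T}" by simp
    have Lg: "L2_torus (\<gamma> s)" using elim by (intro L2_torus_bounded[of _ pi] E.\<gamma>_le)
    have i: "integrable torus (\<lambda>x. \<gamma> s x * (ux s x - U s x * P s x))" using elim by (intro L2_torus_mult Lg) auto
    have "(LINT x|torus. - (\<gamma> s x * (ux s x - U s x * P s x))) \<le> (LINT x|torus. kappa^2 / \<mu> * (u s x - U s x)^2)"
    proof (rule integral_mono)
      fix x assume "x \<in> space torus"
      then have x: "x \<in> {-pi..pi}" by simp
      have e: "u s x * (ux s x / u s x) = ux s x" using up(2)[OF s, of x] by simp
      have "- (\<gamma> s x * (ux s x - U s x * P s x)) \<le> (u s x - U s x)^2 * (P s x)^2 / u s x"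
        using arctan_monotone_estimate[OF up(2)[OF s, of x], of "ux s x / u s x" "P s x" "U s x"] unfolding e \<gamma>_def .
      also have "\<dots> \<le> (u s x - U s x)^2 * kappa^2 / \<mu>"
      proof (intro frac_le mult_left_mono)
        show "(P s x)^2 \<le> kappa^2" using P_le[OF s, of x] by (intro abs_le_square_iff[THEN iffD1]) simp
      qed (use \<mu>_le[OF s x] \<mu> in auto)
      finally show "- (\<gamma> s x * (ux s x - U s x * P s x)) \<le> kappa^2 / \<mu> * (u s x - U s x)^2" by (simp add: mult.commute)
    qed (use i E.z_L2[OF s] in \<open>auto simp: L2_torus_def\<close>)
    then show ?case by (simp add: K_def)
  qed
  define Y where "Y s = (LINT x|torus. (u s x - U s x)^2)" for s
  have "Y 0 = 0" by (simp add: Y_def u0 U_def v_initial)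
  then have ineq: "Y s \<le> K * (LINT r|lebesgue_on {0..s}. Y r)" if "s \<in> {0..T}" for s
    using E.energy_inequality[OF le that] by (simp add: Y_def)
  have Yc: "continuous_on {0..T} Y"
  proof -
    have "continuous_on ({0..T} \<times> {-pi..pi}) (\<lambda>z. ((\<lambda>(t, x). u t x - U t x) z)^2)" by (intro continuous_on_power E.z)
    then have "continuous_on ({0..T} \<times> {-pi..pi}) (\<lambda>(t, x). (u t x - U t x)^2)" by (simp add: case_prod_unfold)
    from continuous_param_integral[OF this] show ?thesis unfolding Y_def[abs_def] .
  qed
  have Yn: "0 \<le> Y s" for s unfolding Y_def by (rule Bochner_Integration.integral_nonneg) auto
  have "Y t = 0" by (rule gronwall_zero[OF Yc Yn ineq K t])
  then have "AE x in torus. (u t x - U t x)^2 = 0"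
    using E.z_L2[OF t] unfolding Y_def L2_torus_def by (subst (asm) integral_nonneg_eq_0_iff_AE) auto
  then have "AE x in torus. u t x = U t x" by eventually_elim simp
  then have eq: "u t x = U t x" if "x \<in> {-pi..pi}" for x
    using AE_torus_eq_continuous[OF continuous_slice[OF uc' t] U_slice[OF t]] that by blast
  interpret pu: periodic_fun_simple "u t" "2 * pi" using up(1)[OF t] unfolding periodic_def .
  interpret pU: periodic_fun_simple "U t" "2 * pi" using U_period[OF t] unfolding periodic_def .
  show "u t = U t"
  proof
    fix x
    have "x + of_int (- \<lfloor>(x + pi) / (2 * pi)\<rfloor>) * (2 * pi) \<in> {-pi..pi}" using torus_representative[of x] by simp
    from eq[OF this] show "u t x = U t x" unfolding pu.plus_of_int pU.plus_of_int .
  qed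
qed

theorem solution_bounds:
  assumes sol: "solution T (\<lambda>x. exp (V0 x)) u"
  shows "\<And>t. t \<in> {0..T} ==> H_torus 2 (u t) \<and> lyapunov (u t) \<le> E0"
    "integrable (lebesgue_on {0..T}) (\<lambda>t. growth_rate (u t))" "Linf_time_H T 2 u"
proof -
  note eq = solution_unique[OF sol]
  obtain M where M: "\<And>t. t \<in> {0..T} ==> H_torus 2 (U t) \<and> H_norm 2 (U t) \<le> M" using U_H2_bound by blast
  show "H_torus 2 (u t) \<and> lyapunov (u t) \<le> E0" if "t \<in> {0..T}" for t
    using M[OF that] U_regular[OF that] eq[OF that] by metis
  show "integrable (lebesgue_on {0..T}) (\<lambda>t. growth_rate (u t))"
    by (rule Bochner_Integration.integrable_cong[THEN iffD1, OF refl _ growth_integrable]) (simp add: eq)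
  show "Linf_time_H T 2 u" unfolding Linf_time_H_def
  proof (intro conjI exI[of _ M] AE_I2)
    show "time_measurable T u" using sol by (simp add: solution_def L2_time_H_def)
  qed (use M eq in simp_all)
qed

end

section \<open>The Lyapunov inequality\<close>

lemma small_slope_scheme_limit:
  assumes "periodic u0" "continuous_on UNIV u0" "H_torus 2 u0" and pos: "\<forall>x. u0 x > 0"
    and "esssup torus (\<lambda>x. ereal \<bar>arctan (wderiv 1 u0 x / u0 x)\<bar>) \<le> ereal (arctan kappa)" and T: "T > 0"
  obtains m B v0 e r w \<eta> where "scheme_limit m B (lyapunov u0) v0 e T r w \<eta> (\<lambda>x. ln (u0 x))"
proof -
  obtain P P2 m where data: "initial_data (\<lambda>x. ln (u0 x)) P P2 m"
    and en: "initial_data.data_energy (\<lambda>x. ln (u0 x)) P P2 = lyapunov u0"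
    by (rule initial_data_exists[OF assms(1-3) _ assms(5)]) (use pos in auto)
  show ?thesis by (rule initial_data.scheme_limit_exists[OF data T]) (rule that, unfold en)
qed

text \<open>
  The energy of a solution never exceeds that of its initial value, and the exponential factor
  is at least one.
\<close>

theorem theorem1p5:
  shows "\<exists>\<delta>>0. \<exists>c>0. \<forall>u0 :: real \<Rightarrow> real.
    periodic u0 \<and> continuous_on UNIV u0 \<and> H_torus 2 u0 \<and> (\<forall>x. u0 x > 0) \<and>
    esssup torus (\<lambda>x. ereal \<bar>arctan (wderiv 1 u0 x / u0 x)\<bar>) \<le> ereal \<delta>
    \<longrightarrow>
    (\<exists>T>0. \<exists>u. solution T u0 u) \<and>
    (\<forall>T>0. \<forall>u. solution T u0 u \<longrightarrow>
       (\<forall>t\<in>{0..T}. H_torus 2 (u t) \<and>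
          lyapunov (u t) \<le>
            lyapunov u0 * exp (c * (LINT s|lebesgue_on {0..t}. growth_rate (u s) + 1))) \<and>
       integrable (lebesgue_on {0..T}) (\<lambda>s. growth_rate (u s)) \<and>
       Linf_time_H T 2 u)"
proof -
  let ?small = "\<lambda>u0. esssup torus (\<lambda>x. ereal \<bar>arctan (wderiv 1 u0 x / u0 x)\<bar>) \<le> ereal (arctan kappa)"
  have existence: "\<exists>u. solution 1 u0 u"
    if "periodic u0" "continuous_on UNIV u0" "H_torus 2 u0" "\<forall>x. u0 x > 0" "?small u0" for u0 :: "real \<Rightarrow> real"
  proof -
    note data = that
    obtain m B v0 e r w \<eta> where L: "scheme_limit m B (lyapunov u0) v0 e 1 r w \<eta> (\<lambda>x. ln (u0 x))"
      by (rule small_slope_scheme_limit[OF data zero_less_one])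
    have "(\<lambda>x. exp (ln (u0 x))) = u0" using data(4) by auto
    then show ?thesis using scheme_limit.U_solution[OF L] by auto
  qed
  have bounds: "(\<forall>t\<in>{0..T}. H_torus 2 (u t) \<and> lyapunov (u t) \<le> lyapunov u0 * exp (1 * (LINT s|lebesgue_on {0..t}. growth_rate (u s) + 1))) \<and>
       integrable (lebesgue_on {0..T}) (\<lambda>s. growth_rate (u s)) \<and> Linf_time_H T 2 u"
    if "periodic u0" "continuous_on UNIV u0" "H_torus 2 u0" "\<forall>x. u0 x > 0" "?small u0" "T > 0" "solution T u0 u" for u0 T u
  proof -
    note data = that
    obtain m B v0 e r w \<eta> where L: "scheme_limit m B (lyapunov u0) v0 e T r w \<eta> (\<lambda>x. ln (u0 x))"
      by (rule small_slope_scheme_limit[OF data(1-6)])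
    have "(\<lambda>x. exp (ln (u0 x))) = u0" using data(4) by auto
    then have "solution T (\<lambda>x. exp (ln (u0 x))) u" using data(7) by simp
    note b = scheme_limit.solution_bounds[OF L this]
    have "lyapunov (u t) \<le> lyapunov u0 * exp (1 * (LINT s|lebesgue_on {0..t}. growth_rate (u s) + 1))" if t: "t \<in> {0..T}" for t
    proof -
      have "0 \<le> (LINT s|lebesgue_on {0..t}. growth_rate (u s) + 1)"
        by (intro Bochner_Integration.integral_nonneg) (simp add: growth_rate_nonneg)
      then have "lyapunov u0 * 1 \<le> lyapunov u0 * exp (1 * (LINT s|lebesgue_on {0..t}. growth_rate (u s) + 1))"
        by (intro mult_left_mono lyapunov_nonneg) (use \<open>\<forall>x. u0 x > 0\<close> in auto)
      then show ?thesis using b(1)[OF t] by linarith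
    qed
    then show ?thesis using b by blast
  qed
  have positive: "arctan kappa > 0" by simp
  show ?thesis
    apply (rule exI[of _ "arctan kappa"], rule conjI[OF positive], rule exI[of _ 1], rule conjI[OF zero_less_one])
    apply (intro allI impI)
    apply (elim conjE)
    apply (rule conjI)
     apply (rule exI[of _ 1], rule conjI[OF zero_less_one], rule existence; assumption)
    apply (intro allI impI, rule bounds; assumption)
    done
qed

end
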